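(* Let $p(\cdot),q(\cdot)\in\mathcal{P}^{\log}(\mathbb{R}^n)$ be such that $1<p^-\le p(\cdot)\le q(\cdot)\le q^+<\infty$, let $K\in\mathfrak{D}$ and $m\in\mathbb{N}\cup\{0\}$. Let $1\le\varrho<\infty$, $a\in T_\infty$ and $b\in\mathcal{L}^\varrho_a$. Let $R,S$ be two constants such that $R>(p')^+/(p')^-$ and $S>q^+/q^-$. Suppose that $(v,w)$ is a couple of weights such that $v\in L^{p(\cdot)}_{\rm loc}(\mathbb{R}^n)$, $w\in L^{Sq(\cdot)}_{\rm loc}(\mathbb{R}^n)$ and, for some positive constant $\kappa$ and for every cube $Q\subset\mathbb{R}^n$, $$a(Q)^{m}\,\widetilde{K}(\ell(Q))\,\frac{\|\chi_Q\|_{L^{q(\cdot)}}}{\|\chi_Q\|_{L^{p(\cdot)}}}\,\frac{\|\chi_Q v^{-1}\|_{L^{Rp'(\cdot)}}}{\|\chi_Q\|_{L^{Rp'(\cdot)}}}\,\frac{\|\chi_Q w\|_{L^{Sq(\cdot)}}}{\|\chi_Q\|_{L^{Sq(\cdot)}}}\le\kappa .$$ Then $T_K^{b,m}$ is bounded from $L^{p(\cdot)}_v(\mathbb{R}^n)$ into $L^{q(\cdot)}_w(\mathbb{R}^n)$. More precisely, there is a constant $C>0$, independent of $f$, $b$, $v$, $w$ and $\kappa$, such that $$\|T_K^{b,m}f\|_{L^{q(\cdot)}_w}\le C\,\kappa\,\|b\|_{\mathcal{L}^1_a}^m\,\|f\|_{L^{p(\cdot)}_v}\qquad\text{for all } f\in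 L^{p(\cdot)}_v(\mathbb{R}^n).$$
   Context: Exponents. For a measurable $p(\cdot):\mathbb{R}^n\to[1,\infty]$ put $p^-=\inf_{\mathbb{R}^n}p$, $p^+=\sup_{\mathbb{R}^n}p$; $p(\cdot)\in\mathcal{P}(\mathbb{R}^n)$ means $1\le p^-\le p^+\le\infty$. The conjugate exponent is $p'(\cdot)=p(\cdot)/(p(\cdot)-1)$. A function $\alpha:\mathbb{R}^n\to\mathbb{R}$ is globally log-Hölder continuous if for some positive constants $C,\alpha_\infty$ one has $|\alpha(x)-\alpha(y)|\le C/\log(e+1/|x-y|)$ and $|\alpha(x)-\alpha_\infty|\le C/\log(e+|x|)$ for all $x,y\in\mathbb{R}^n$. $\mathcal{P}^{\log}(\mathbb{R}^n)$ is the set of $p(\cdot)\in\mathcal{P}(\mathbb{R}^n)$ such that $1/p(\cdot)$ is globally log-Hölder continuous. Spaces. For $p(\cdot)\in\mathcal P(\mathbb R^n)$ let $\varphi_{p(\cdot)}(x,t)=t^{p(x)}$ if $p(x)<\infty$ and $\varphi_{p(\cdot)}(x,t)=\infty\cdot\chi_{(1,\infty)}(t)$ if $p(x)=\infty$ (with $\infty\cdot0=0$). The Luxemburg norm is $\|f\|_{L^{p(\cdot)}}=\inf\{\lambda>0:\int_{\mathbb{R}^n}\varphi_{p(\cdot)}(x,|f(x)|/\lambda)\,dx\le1\}$, and $L^{p(\cdot)}(\mathbb{R}^n)$ is the space of measurable functions for which it is finite. $L^{p(\cdot)}_{\rm loc}(\mathbb{R}^n)$ is the set of $f$ with $f\chi_U\in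 L^{p(\cdot)}(\mathbb{R}^n)$ for every compact $U$. A weight is a locally integrable function on $\mathbb{R}^n$ that is positive almost everywhere. For a weight $w$, $L^{p(\cdot)}_w(\mathbb{R}^n)$ is the set of measurable $f$ with $fw\in L^{p(\cdot)}(\mathbb{R}^n)$, and $\|f\|_{L^{p(\cdot)}_w}=\|fw\|_{L^{p(\cdot)}}$. Cubes. Cubes $Q\subset\mathbb{R}^n$ have sides parallel to the coordinate axes; $\ell(Q)$ is the sidelength; $\mathcal{E}$ is the class of all such cubes; $b_Q=\frac1{|Q|}\int_Q b$. Kernels and operators. $K$ is a non-negative locally integrable function on $\mathbb{R}^n$. $K\in\mathfrak{D}$ means there exist constants $\eta,c>0$ and $0\le\varepsilon<1$ such that for all $k\in\mathbb{Z}$ $$\sup_{2^k<|x|\le2^{k+1}}K(x)\le\frac{c}{2^{kn}}\int_{\eta(1-\varepsilon)2^k<|y|\le2\eta(1+\varepsilon)2^k}K(y)\,dy .$$ $\widetilde{K}(t)=\int_{|z|\le t}K(z)\,dz$. The commutator of order $m$ is $T_K^{b,m}f(x)=\int_{\mathbb{R}^n}(b(x)-b(y))^mK(x-y)f(y)\,dy$, whenever this integral is finite; for $m=0$ it is the potential operator $T_Kf(x)=\int_{\mathbb{R}^n} K(x-y)f(y)\,dy$. Symbols. A functional $a:\mathcal{E}\to[0,\infty)$ satisfies $a\in T_\infty$ if there is a finite constant $t_\infty>0$ with $a(Q')\le t_\infty\,a(Q)$ for all cubes $Q'\subset Q$. For $0<\varrho<\infty$, $\mathcal{L}^\varrho_a$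 is the set of $b\in L^1_{\rm loc}(\mathbb{R}^n)$ for which there is a finite constant $C\geq 0$ with $\left(\frac1{|Q|}\int_Q|b-b_Q|^\varrho\,dx\right)^{1/\varrho}\le C\,a(Q)$ for every cube $Q$; the least such $C$ is denoted $\|b\|_{\mathcal{L}^\varrho_a}$ (i.e. the supremum over $Q$ of the quotient of the two sides). *)

theory Defs
  imports "HOL-Analysis.Analysis"
begin

text \<open>
  Measurability and integration refer to Lebesgue measure; \<open>real ^ 'n\<close> carries the
  Euclidean norm. Variable exponents take values in \<open>[1, \<infinity>]\<close> and are modelled as
  \<open>ennreal\<close>-valued functions.
\<close>

definition exp_inf :: "(real ^ 'n \<Rightarrow> ennreal) \<Rightarrow> ennreal"
  where "exp_inf p = (INF x. p x)"

definition exp_sup :: "(real ^ 'n \<Rightarrow> ennreal) \<Rightarrow> ennreal"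
  where "exp_sup p = (SUP x. p x)"

definition exponents :: "(real ^ 'n \<Rightarrow> ennreal) set"
  where "exponents = {p \<in> borel_measurable lebesgue. \<forall>x. 1 \<le> p x}"

text \<open>The case distinction is needed because \<open>\<infinity> / \<infinity> = 0\<close> in \<open>ennreal\<close>; for \<open>p x = 1\<close>
  the quotient \<open>1 / 0\<close> is \<open>\<infinity>\<close>, as it should be.\<close>

definition conj_exp :: "(real ^ 'n \<Rightarrow> ennreal) \<Rightarrow> real ^ 'n \<Rightarrow> ennreal"
  where "conj_exp p x = (if p x = \<infinity> then 1 else p x / (p x - 1))"

text \<open>For \<open>x = y\<close> the right-hand side of the first inequality evaluates to \<open>C\<close>
  (since \<open>1 / 0 = 0\<close>), while the left-hand side is \<open>0\<close>.\<close>

definition log_holder :: "(real ^ 'n \<Rightarrow> real) \<Rightarrow> bool"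
  where "log_holder \<alpha> \<longleftrightarrow> (\<exists>C \<beta>. 0 < C \<and> 0 < \<beta> \<and>
    (\<forall>x y. \<bar>\<alpha> x - \<alpha> y\<bar> \<le> C / ln (exp 1 + 1 / norm (x - y))) \<and>
    (\<forall>x. \<bar>\<alpha> x - \<beta>\<bar> \<le> C / ln (exp 1 + norm x)))"

definition log_exponents :: "(real ^ 'n \<Rightarrow> ennreal) set"
  where "log_exponents = {p \<in> exponents. log_holder (\<lambda>x. enn2real (1 / p x))}"

definition varphi :: "ennreal \<Rightarrow> real \<Rightarrow> ennreal"
  where "varphi r t =
    (if r = \<infinity> then (if 1 < t then \<infinity> else 0) else ennreal (t powr enn2real r))"

text \<open>The Luxemburg norm; the infimum of the empty set is \<open>\<infinity>\<close>.\<close>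

definition lux_norm :: "(real ^ 'n \<Rightarrow> ennreal) \<Rightarrow> (real ^ 'n \<Rightarrow> real) \<Rightarrow> ennreal"
  where "lux_norm p f =
    (INF s\<in>{s::real. 0 < s \<and> (\<integral>\<^sup>+x. varphi (p x) (\<bar>f x\<bar> / s) \<partial>lebesgue) \<le> 1}. ennreal s)"

definition Lvar :: "(real ^ 'n \<Rightarrow> ennreal) \<Rightarrow> (real ^ 'n \<Rightarrow> real) set"
  where "Lvar p = {f \<in> borel_measurable lebesgue. lux_norm p f < \<infinity>}"

definition Lvar_loc :: "(real ^ 'n \<Rightarrow> ennreal) \<Rightarrow> (real ^ 'n \<Rightarrow> real) set"
  where "Lvar_loc p = {f. \<forall>U. compact U \<longrightarrow> (\<lambda>x. f x * indicator U x) \<in> Lvar p}"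

definition locally_integrable :: "(real ^ 'n \<Rightarrow> real) \<Rightarrow> bool"
  where "locally_integrable f \<longleftrightarrow> (\<forall>U. compact U \<longrightarrow> f absolutely_integrable_on U)"

definition weight :: "(real ^ 'n \<Rightarrow> real) \<Rightarrow> bool"
  where "weight w \<longleftrightarrow> locally_integrable w \<and> (AE x in lebesgue. 0 < w x)"

definition wnorm :: "(real ^ 'n \<Rightarrow> ennreal) \<Rightarrow> (real ^ 'n \<Rightarrow> real) \<Rightarrow> (real ^ 'n \<Rightarrow> real) \<Rightarrow> ennreal"
  where "wnorm p w f = lux_norm p (\<lambda>x. f x * w x)"

definition Lvar_weighted ::
    "(real ^ 'n \<Rightarrow> ennreal) \<Rightarrow> (real ^ 'n \<Rightarrow> real) \<Rightarrow> (real ^ 'n \<Rightarrow> real) set"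
  where "Lvar_weighted p w =
    {f \<in> borel_measurable lebesgue. (\<lambda>x. f x * w x) \<in> Lvar p}"

definition cube :: "real ^ 'n \<Rightarrow> real \<Rightarrow> (real ^ 'n) set"
  where "cube z l = cbox z (\<chi> i. z $ i + l)"

definition cubes :: "(real ^ 'n) set set"
  where "cubes = {cube z l | z l. 0 < l}"

definition avg :: "(real ^ 'n \<Rightarrow> real) \<Rightarrow> (real ^ 'n) set \<Rightarrow> real"
  where "avg b Q = (LINT x:Q|lebesgue. b x) / measure lebesgue Q"

definition kernel_class :: "(real ^ 'n \<Rightarrow> real) set"
  where "kernel_class = {K. (\<forall>x. 0 \<le> K x) \<and> locally_integrable K \<and>
    (\<exists>\<eta> c \<epsilon>. 0 < \<eta> \<and> 0 < c \<and> 0 \<le> \<epsilon> \<and> \<epsilon> < 1 \<and>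
      (\<forall>k::int.
        (SUP x\<in>{x. 2 powi k < norm x \<and> norm x \<le> 2 powi (k + 1)}. ennreal (K x)) \<le>
        ennreal (c / (2 powi k) ^ CARD('n) *
          (LINT y:{y. \<eta> * (1 - \<epsilon>) * 2 powi k < norm y \<and>
                      norm y \<le> 2 * \<eta> * (1 + \<epsilon>) * 2 powi k}|lebesgue. K y))))}"

definition Ktilde :: "(real ^ 'n \<Rightarrow> real) \<Rightarrow> real \<Rightarrow> real"
  where "Ktilde K t = (LINT z:{z. norm z \<le> t}|lebesgue. K z)"

definition comm_integrand ::
    "(real ^ 'n \<Rightarrow> real) \<Rightarrow> (real ^ 'n \<Rightarrow> real) \<Rightarrow> nat \<Rightarrow> (real ^ 'n \<Rightarrow> real) \<Rightarrow> real ^ 'n \<Rightarrow> real ^ 'n \<Rightarrow> real"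
  where "comm_integrand K b m f x y = (b x - b y) ^ m * K (x - y) * f y"

text \<open>At points \<open>x\<close> where the integrand is not integrable the commutator is undefined;
  here it takes the dummy value \<open>0\<close> there, so statements about it must be accompanied by
  integrability almost everywhere.\<close>

definition commutator ::
    "(real ^ 'n \<Rightarrow> real) \<Rightarrow> (real ^ 'n \<Rightarrow> real) \<Rightarrow> nat \<Rightarrow> (real ^ 'n \<Rightarrow> real) \<Rightarrow> real ^ 'n \<Rightarrow> real"
  where "commutator K b m f x = (LINT y|lebesgue. comm_integrand K b m f x y)"

text \<open>Functionals on cubes are functions on sets, of which only the values on \<open>cubes\<close> matter.\<close>

definition T_infty :: "((real ^ 'n) set \<Rightarrow> real) set"
  where "T_infty = {a. (\<forall>Q\<in>cubes. 0 \<le> a Q) \<and>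
    (\<exists>t>0. \<forall>Q\<in>cubes. \<forall>Q'\<in>cubes. Q' \<subseteq> Q \<longrightarrow> a Q' \<le> t * a Q)}"

text \<open>The integrability conjunct says that the mean oscillation is finite; without it the
  Bochner integral would silently be \<open>0\<close>.\<close>

definition osc_bound ::
    "real \<Rightarrow> ((real ^ 'n) set \<Rightarrow> real) \<Rightarrow> (real ^ 'n \<Rightarrow> real) \<Rightarrow> real \<Rightarrow> bool"
  where "osc_bound \<rho> a b C \<longleftrightarrow> (\<forall>Q\<in>cubes.
    (\<lambda>x. \<bar>b x - avg b Q\<bar> powr \<rho>) absolutely_integrable_on Q \<and>
    (avg (\<lambda>x. \<bar>b x - avg b Q\<bar> powr \<rho>) Q) powr (1 / \<rho>) \<le> C * a Q)"

definition L_osc :: "real \<Rightarrow> ((real ^ 'n) set \<Rightarrow> real) \<Rightarrow> (real ^ 'n \<Rightarrow> real) set"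
  where "L_osc \<rho> a = {b. locally_integrable b \<and> (\<exists>C\<ge>0. osc_bound \<rho> a b C)}"

definition osc_norm :: "real \<Rightarrow> ((real ^ 'n) set \<Rightarrow> real) \<Rightarrow> (real ^ 'n \<Rightarrow> real) \<Rightarrow> real"
  where "osc_norm \<rho> a b = Inf {C. 0 \<le> C \<and> osc_bound \<rho> a b C}"

end

theory Submission imports Defs begin

text \<open>
  The commutator is estimated by duality. Write \<open>\<alpha>p = 1 / p\<close>,
  \<open>\<alpha>q = 1 / q\<close>, \<open>u = 1 / v\<close> and \<open>f = u h\<close>. It
  suffices to bound the form \<open>\<integral> w |T f| g\<close> by a multiple of
  \<open>\<kappa> N ^ m\<close>, where \<open>N\<close> is the norm of the symbol, for all
  nonnegative \<open>h\<close> and \<open>g\<close> whose modulars, with exponents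
  \<open>p\<close> and \<open>q'\<close>, are at most \<open>1\<close>
  (\<open>modular_by_duality\<close>, \<open>commutator_norm_le\<close>).

  Discretisation. A kernel in the class is, on a dyadic annulus of radius
  \<open>\<rho>\<close>, at most a constant times \<open>\<rho> ^ (- n)\<close> times its
  integral over a comparable annulus. These annuli overlap boundedly, so the integrals
  \<open>I i\<close> at the scales \<open>2 ^ i\<close> satisfy \<open>\<Sum>i\<le>j. I i
  \<le> C * Ktilde K (C * 2 ^ j)\<close> (\<open>annuli_sum\<close>). Among finitely many
  shifted dyadic grids there is always one in which two given points at distance about
  \<open>2 ^ i\<close> share a cell of side \<open>2 ^ i\<close>
  (\<open>common_dcell\<close>). Hence the form is at most a finite sum, over the grids, of
  \<open>\<Sum>i. I i / |Q| * \<integral>\<integral> w(x) g(x) |b(x) - b(y)| ^ m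
  f(y)\<close> with \<open>x\<close>, \<open>y\<close> in the same cell \<open>Q\<close> of
  generation \<open>i\<close> (\<open>kernel_grid_bound\<close>).

  Oscillation. By John and Nirenberg's inequality all moments of \<open>b -
  b\<^sub>Q\<close> over \<open>Q\<close> are controlled by \<open>N * a(2Q)\<close>
  (\<open>oscillation_moments\<close>). By Hoelder's inequality the double integral is then
  at most a multiple of \<open>(N * a(2Q)) ^ m * |Q|\<^sup>2 * F(Q) * G(Q)\<close>, where
  \<open>F\<close> and \<open>G\<close> are the \<open>L\<^sup>\<theta>\<close> means of
  \<open>f\<close> and \<open>w g\<close> for some \<open>\<theta> > 1\<close>.

  Summation over the scales. Since \<open>F\<close> and \<open>G\<close> are only controlled
  one cell at a time, the scales cannot be summed term by term. A stopping argument at the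
  cells where \<open>F\<close> has grown by a fixed factor (\<open>sparse_bound\<close>)
  shows that it is enough to find an integrable function that majorises \<open>Ktilde K l *
  a(Q) ^ m * F(Q) * G(Q)\<close> on every cell \<open>Q\<close> of side \<open>l\<close>,
  where \<open>l\<close> and the cube in \<open>a(Q)\<close> may be enlarged by a constant
  factor.

  The majorant. Since \<open>R > (p')\<^sup>+ / (p')\<^sup>-\<close> and \<open>S >
  q\<^sup>+ / q\<^sup>-\<close>, there are constants \<open>r > (p')\<^sup>+\<close> and
  \<open>t > q\<^sup>+\<close> such that the means \<open>U\<close> and \<open>W\<close> of
  \<open>u\<close> in \<open>L\<^sup>r\<close> and of \<open>w\<close> in
  \<open>L\<^sup>t\<close> are bounded by the normalised norms in the weight condition. As
  log-Hoelder continuity makes \<open>\<parallel>\<chi>\<^sub>Q\<parallel>\<close>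
  comparable with \<open>|Q| ^ A\<close> for every effective reciprocal exponent
  \<open>A\<close> of \<open>Q\<close>, the weight condition becomes \<open>Ktilde K l *
  a(Q) ^ m * |Q| ^ (Aq - Ap) * U * W \<le> C * \<kappa>\<close>
  (\<open>weight_condition\<close>). By Hoelder's inequality \<open>F(Q)\<close> is at most
  \<open>U\<close> times a mean \<open>H\<close> of \<open>h\<close>, and
  \<open>G(Q)\<close> at most \<open>W\<close> times a mean \<open>H'\<close> of
  \<open>g\<close>, of exponents that are still below \<open>p\<^sup>-\<close> and
  \<open>(q')\<^sup>-\<close>. There remains \<open>|Q| ^ (Ap - Aq) * H * H'\<close>, which
  by Young's inequality and \<open>p \<le> q\<close> is at most a multiple of \<open>H ^ (1
  / Ap) + H' ^ (1 / (1 - Aq))\<close> (\<open>exponent_pair_bound\<close>). The two summands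
  are controlled, uniformly in \<open>Q\<close>, by an integrable maximal function
  (\<open>maximal_control\<close>), which rests on Doob's inequality and on the log-Hoelder
  condition.
\<close>

section \<open>Stopping arguments on a tree of cells\<close>

lemma ennreal_cancel_le:
  fixes A B :: ennreal and c d c' d' :: real
  assumes "A + ennreal c \<le> B + ennreal d" "c' + d \<le> d' + c"
    and "0 \<le> c" "0 \<le> d" "0 \<le> c'" "0 \<le> d'"
  shows "A + ennreal c' \<le> B + ennreal d'"
proof (cases "B = \<infinity>")
  case False
  then obtain b where b: "B = ennreal b" "0 \<le> b" by (cases B) auto
  have "A + ennreal c < \<infinity>"
    using assms(1) b by (metis ennreal_less_top ennreal_plus assms(4) infinity_ennreal_def le_less_trans)
  then obtain a where a: "A = ennreal a" "0 \<le> a" by (cases A) auto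
  have "a + c \<le> b + d"
    using assms(1) unfolding a b using a b assms by (simp flip: ennreal_plus)
  then have "a + c' \<le> b + d'" using assms by linarith
  then show ?thesis unfolding a b using a b assms by (simp flip: ennreal_plus)
qed simp

lemma Young_Doob:
  fixes x y p :: real
  assumes "1 < p" "0 \<le> x" "0 \<le> y"
  shows "p * y powr (p - 1) * x \<le> x powr p + (p - 1) * y powr p"
proof -
  have "x * y powr (p - 1) \<le> x powr p / p + (y powr (p-1)) powr (p / (p-1)) / (p / (p-1))"
    by (rule Youngs_inequality) (use assms in \<open>auto simp: field_simps\<close>)
  also have "(y powr (p-1)) powr (p / (p-1)) = y powr p" using assms by (simp add: powr_powr)
  finally show ?thesis using assms by (simp add: field_simps)
qed

lemma add_right_comm_mono:
  fixes x y u v c :: ennreal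
  assumes "x \<le> y" "u + v = c"
  shows "u + x + v \<le> c + y"
proof -
  have "u + x + v = (u + v) + x" by (simp add: ac_simps)
  also have "\<dots> \<le> c + y" unfolding assms(2) by (intro add_left_mono assms(1))
  finally show ?thesis .
qed

text \<open>
  The mean is a real number so that powers of it can be formed; it is meaningful where the
  integral is finite, and is \<open>0\<close> otherwise.
\<close>

definition ave :: "'a measure \<Rightarrow> ('a \<Rightarrow> real) \<Rightarrow> 'a set \<Rightarrow> real"
  where "ave M f Q = enn2real (\<integral>\<^sup>+x\<in>Q. ennreal (f x) \<partial>M) / measure M Q"

lemma ave_nonneg: "0 \<le> ave M f Q"
  by (simp add: ave_def)

text \<open>
  An abstract dyadic grid: \<open>cell j x\<close> is the cell of generation
  \<open>j\<close> that contains \<open>x\<close>. Cells grow with \<open>j\<close>, so that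
  all arguments are inductions from the finest generation \<open>0\<close> upwards: an
  integral inequality holds on a cell as soon as it holds on its finitely many children
  (\<open>children_mono\<close> below). The maximal functions are thereby finite maxima.
\<close>

locale cell_tree =
  fixes M :: "'a measure" and cell :: "nat \<Rightarrow> 'a \<Rightarrow> 'a set"
  assumes cell_self: "x \<in> cell j x"
    and cell_eq: "y \<in> cell j x \<Longrightarrow> cell j y = cell j x"
    and cell_Suc: "cell j x \<subseteq> cell (Suc j) x"
    and cell_sets: "cell j x \<in> sets M"
    and cell_pos: "0 < measure M (cell j x)"
    and cell_fin: "emeasure M (cell j x) < \<infinity>"
    and cell_children: "finite (cell j ` cell (Suc j) x)"
    and cell_countable: "countable (range (cell j))"
    and space_UNIV: "space M = UNIV"
begin

lemmas [measurable] = cell_sets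

lemma emeasure_cell: "emeasure M (cell j x) = ennreal (measure M (cell j x))"
  using cell_fin[of j x] by (simp add: emeasure_eq_ennreal_measure less_top)

lemma cell_mono: "i \<le> j \<Longrightarrow> cell i x \<subseteq> cell j x"
  by (induction j rule: dec_induct) (use cell_Suc in blast)+

lemma cell_eq': "y \<in> cell i x \<Longrightarrow> i \<le> j \<Longrightarrow> cell j y = cell j x"
  using cell_mono cell_eq by blast

lemma measurable_cell [measurable]: "(\<lambda>x. \<phi> (cell j x)) \<in> borel_measurable M"
proof -
  have "cell j \<in> measurable M (count_space (range (cell j)))"
  proof (rule measurableI)
    fix A assume A: "A \<in> sets (count_space (range (cell j)))"
    have "countable A" using A cell_countable by (simp add: countable_subset[where B = "range (cell j)"])
    have "cell j -` A \<inter> space M = (\<Union>Q\<in>A. Q)"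
    proof (intro set_eqI iffI)
      fix y assume "y \<in> (\<Union>Q\<in>A. Q)"
      then obtain Q x where "Q \<in> A" "y \<in> Q" "Q = cell j x" using A by auto
      then show "y \<in> cell j -` A \<inter> space M" using cell_eq space_UNIV by auto
    qed (use cell_self in auto)
    also have "\<dots> \<in> sets M"
      by (rule sets.countable_UN'[OF \<open>countable A\<close>]) (use A cell_sets in auto)
    finally show "cell j -` A \<inter> space M \<in> sets M" .
  qed auto
  then show ?thesis
    by (rule measurable_compose[where f = "cell j" and g = \<phi>]) auto
qed

lemma nn_integral_cell_const:
  "0 \<le> c \<Longrightarrow> (\<integral>\<^sup>+y\<in>cell j x. ennreal c \<partial>M) = ennreal (c * measure M (cell j x))"
  by (simp add: nn_integral_cmult_indicator emeasure_cell ennreal_mult)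

lemma integral_children:
  assumes [measurable]: "\<phi> \<in> borel_measurable M"
  shows "(\<integral>\<^sup>+y\<in>cell (Suc j) x. \<phi> y \<partial>M) = (\<Sum>R\<in>cell j ` cell (Suc j) x. \<integral>\<^sup>+y\<in>R. \<phi> y \<partial>M)"
proof -
  let ?K = "cell j ` cell (Suc j) x"
  have m: "R \<in> sets M" if "R \<in> ?K" for R using that cell_sets by auto
  have ind: "indicator (cell (Suc j) x) y = (\<Sum>R\<in>?K. indicator R y :: ennreal)" for y
  proof (cases "y \<in> cell (Suc j) x")
    case True
    have "(\<Sum>R\<in>?K. indicator R y :: ennreal) = (\<Sum>R\<in>{cell j y}. indicator R y)"
      by (rule sum.mono_neutral_right) (use cell_children True cell_eq in \<open>auto simp: indicator_def\<close>)
    then show ?thesis using True cell_self by simp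
  next
    case False
    have "y \<notin> R" if R: "R \<in> ?K" for R
    proof
      assume y: "y \<in> R"
      from R obtain z where z: "z \<in> cell (Suc j) x" "R = cell j z" by auto
      have "y \<in> cell (Suc j) z" using y z(2) cell_Suc by blast
      then show False using False cell_eq[OF z(1)] by simp
    qed
    then have "(\<Sum>R\<in>?K. indicator R y :: ennreal) = 0" by (simp add: indicator_def)
    then show ?thesis using False by simp
  qed
  have "(\<integral>\<^sup>+y\<in>cell (Suc j) x. \<phi> y \<partial>M) = (\<integral>\<^sup>+y. (\<Sum>R\<in>?K. \<phi> y * indicator R y) \<partial>M)"
    unfolding ind by (simp add: sum_distrib_left)
  also have "\<dots> = (\<Sum>R\<in>?K. \<integral>\<^sup>+y\<in>R. \<phi> y \<partial>M)"
    by (rule nn_integral_sum) (use m in auto)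
  finally show ?thesis .
qed

lemma children_mono:
  assumes "\<phi> \<in> borel_measurable M" "\<psi> \<in> borel_measurable M"
    and "\<And>y. y \<in> cell (Suc j) x \<Longrightarrow> (\<integral>\<^sup>+z\<in>cell j y. \<phi> z \<partial>M) \<le> (\<integral>\<^sup>+z\<in>cell j y. \<psi> z \<partial>M)"
  shows "(\<integral>\<^sup>+y\<in>cell (Suc j) x. \<phi> y \<partial>M) \<le> (\<integral>\<^sup>+y\<in>cell (Suc j) x. \<psi> y \<partial>M)"
  unfolding integral_children[OF assms(1)] integral_children[OF assms(2)]
  by (rule sum_mono) (use assms(3) in auto)

lemma descendants_mono:
  assumes "\<phi> \<in> borel_measurable M" "\<psi> \<in> borel_measurable M" "j \<le> k"
    and "\<And>y. y \<in> cell k x \<Longrightarrow> (\<integral>\<^sup>+z\<in>cell j y. \<phi> z \<partial>M) \<le> (\<integral>\<^sup>+z\<in>cell j y. \<psi> z \<partial>M)"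
  shows "(\<integral>\<^sup>+y\<in>cell k x. \<phi> y \<partial>M) \<le> (\<integral>\<^sup>+y\<in>cell k x. \<psi> y \<partial>M)"
  using assms(3,4)
proof (induction k arbitrary: x rule: dec_induct)
  case base
  then show ?case using cell_self by blast
next
  case (step k)
  show ?case
  proof (rule children_mono[OF assms(1,2)])
    fix y assume "y \<in> cell (Suc k) x"
    then have "cell k y \<subseteq> cell (Suc k) x" using cell_eq cell_Suc by blast
    then show "(\<integral>\<^sup>+z\<in>cell k y. \<phi> z \<partial>M) \<le> (\<integral>\<^sup>+z\<in>cell k y. \<psi> z \<partial>M)"
      using step by blast
  qed
qed

lemma cell_integral_cong:
  assumes "\<And>y. y \<in> cell k x \<Longrightarrow> \<phi> y = (\<psi> y :: ennreal)"
  shows "(\<integral>\<^sup>+y\<in>cell k x. \<phi> y \<partial>M) = (\<integral>\<^sup>+y\<in>cell k x. \<psi> y \<partial>M)"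
  by (rule nn_integral_cong) (use assms in \<open>auto simp: indicator_def\<close>)

lemma cell_integral_mono:
  assumes "\<And>y. y \<in> cell k x \<Longrightarrow> \<phi> y \<le> (\<psi> y :: ennreal)"
  shows "(\<integral>\<^sup>+y\<in>cell k x. \<phi> y \<partial>M) \<le> (\<integral>\<^sup>+y\<in>cell k x. \<psi> y \<partial>M)"
  by (rule nn_integral_mono) (use assms in \<open>auto simp: indicator_def\<close>)

lemma cell_integral_add:
  assumes [measurable]: "\<phi> \<in> borel_measurable M" "\<psi> \<in> borel_measurable M"
  shows "(\<integral>\<^sup>+y\<in>cell k x. \<phi> y + \<psi> y \<partial>M) = (\<integral>\<^sup>+y\<in>cell k x. \<phi> y \<partial>M) + (\<integral>\<^sup>+y\<in>cell k x. \<psi> y \<partial>M)"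
  by (simp add: distrib_right nn_integral_add)

lemma cell_integral_cmult:
  assumes [measurable]: "\<phi> \<in> borel_measurable M"
  shows "(\<integral>\<^sup>+y\<in>cell k x. c * \<phi> y \<partial>M) = c * (\<integral>\<^sup>+y\<in>cell k x. \<phi> y \<partial>M)"
  by (simp add: mult.assoc nn_integral_cmult)

lemma cell_integral_ave:
  assumes "(\<integral>\<^sup>+y\<in>cell k x. ennreal (f y) \<partial>M) < \<infinity>"
  shows "(\<integral>\<^sup>+y\<in>cell k x. ennreal (f y) \<partial>M) = ennreal (ave M f (cell k x) * measure M (cell k x))"
  using assms cell_pos[of k x] by (auto simp: ave_def)

text \<open>
  The dyadic maximal function, restricted to the generations up to \<open>k\<close>.
\<close>

primrec mx :: "('a \<Rightarrow> real) \<Rightarrow> nat \<Rightarrow> 'a \<Rightarrow> real" where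
  "mx G 0 y = ave M G (cell 0 y)"
| "mx G (Suc k) y = max (ave M G (cell (Suc k) y)) (mx G k y)"

lemma mx_measurable [measurable]: "mx G k \<in> borel_measurable M"
proof (induction k)
  case 0 then show ?case by (simp cong: measurable_cong)
next
  case (Suc k)
  have "mx G (Suc k) = (\<lambda>y. max (ave M G (cell (Suc k) y)) (mx G k y))" by auto
  then show ?case using Suc by simp
qed

lemma mx_ge: "j \<le> k \<Longrightarrow> ave M G (cell j y) \<le> mx G k y"
  by (induction k) (auto simp: le_Suc_eq)

text \<open>
  Inside a cell, the larger cells enter the maximal function only through their largest
  average \<open>L\<close>. The correction \<open>e * L powr (p - 1) * G\<close> makes the
  estimate inductive. A child whose average \<open>x'\<close> exceeds \<open>L\<close> uses
  the induction hypothesis with \<open>x'\<close> in place of \<open>L\<close>; going back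
  to \<open>L\<close> costs nothing because \<open>e * L powr (p - 1) * x' + p * x' powr p
  \<le> p * L powr p + e * x' powr p\<close>, which for this \<open>e\<close> is Young's
  inequality multiplied by \<open>p / (p - 1)\<close>.
\<close>

lemma Doob_Bellman:
  fixes p e :: real
  assumes p: "1 < p" and e: "e = p * p / (p - 1)" and [measurable]: "G \<in> borel_measurable M" and G: "\<And>y. 0 \<le> G y"
    and fin: "\<And>j x. j \<le> k \<Longrightarrow> (\<integral>\<^sup>+y\<in>cell j x. ennreal (G y) \<partial>M) < \<infinity>"
    and lam: "ave M G (cell k x) \<le> L"
  shows "(\<integral>\<^sup>+y\<in>cell k x. ennreal ((max L (mx G k y)) powr p) + ennreal (e * L powr (p-1) * G y) \<partial>M)
     \<le> (\<integral>\<^sup>+y\<in>cell k x. ennreal ((p/(p-1)) powr p * G y powr p) + ennreal (p * L powr p) \<partial>M)"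
  using fin lam
proof (induction k arbitrary: x L)
  case 0
  have e0: "0 \<le> e" using p by (simp add: e)
  have l0: "0 \<le> L" using 0 ave_nonneg order_trans by blast
  show ?case
  proof (rule cell_integral_mono)
    fix y assume "y \<in> cell 0 x"
    then have "max L (mx G 0 y) = L" using 0 cell_eq by auto
    moreover have "L powr p + e * L powr (p-1) * G y \<le> (p/(p-1)) powr p * G y powr p + p * L powr p"
    proof -
      have "e * L powr (p-1) * G y = p * L powr (p-1) * (p/(p-1) * G y)"
        by (simp add: e)
      also have "\<dots> \<le> (p/(p-1) * G y) powr p + (p - 1) * L powr p"
        by (rule Young_Doob) (use p G[of y] l0 in auto)
      also have "(p/(p-1) * G y) powr p = (p/(p-1)) powr p * G y powr p"
        by (rule powr_mult)
      finally show ?thesis by (simp add: algebra_simps)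
    qed
    ultimately show "ennreal ((max L (mx G 0 y)) powr p) + ennreal (e * L powr (p-1) * G y)
        \<le> ennreal ((p/(p-1)) powr p * G y powr p) + ennreal (p * L powr p)"
      using p e0 G[of y] by (simp flip: ennreal_plus)
  qed
next
  case (Suc k)
  have e0: "0 \<le> e" using p by (simp add: e)
  have l0: "0 \<le> L" using Suc.prems ave_nonneg order_trans by blast
  have "(\<integral>\<^sup>+y\<in>cell (Suc k) x. ennreal ((max L (mx G (Suc k) y)) powr p) + ennreal (e * L powr (p-1) * G y) \<partial>M)
     = (\<integral>\<^sup>+y\<in>cell (Suc k) x. ennreal ((max L (mx G k y)) powr p) + ennreal (e * L powr (p-1) * G y) \<partial>M)"
  proof (rule cell_integral_cong)
    fix y assume "y \<in> cell (Suc k) x"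
    then have "max L (mx G (Suc k) y) = max L (mx G k y)" using Suc.prems(2) cell_eq by auto
    then show "ennreal ((max L (mx G (Suc k) y)) powr p) + ennreal (e * L powr (p-1) * G y)
      = ennreal ((max L (mx G k y)) powr p) + ennreal (e * L powr (p-1) * G y)" by metis
  qed
  also have "\<dots> \<le> (\<integral>\<^sup>+y\<in>cell (Suc k) x. ennreal ((p/(p-1)) powr p * G y powr p) + ennreal (p * L powr p) \<partial>M)"
  proof (rule children_mono)
    fix y
    let ?m = "measure M (cell k y)"
    define x' where "x' = ave M G (cell k y)"
    have x'0: "0 \<le> x'" by (simp add: x'_def ave_nonneg)
    have IH: "(\<integral>\<^sup>+z\<in>cell k y. ennreal ((max \<mu> (mx G k z)) powr p) + ennreal (e * \<mu> powr (p-1) * G z) \<partial>M)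
     \<le> (\<integral>\<^sup>+z\<in>cell k y. ennreal ((p/(p-1)) powr p * G z powr p) + ennreal (p * \<mu> powr p) \<partial>M)" if "x' \<le> \<mu>" for \<mu>
      by (rule Suc.IH) (use Suc.prems that x'_def in auto)
    show "(\<integral>\<^sup>+z\<in>cell k y. ennreal ((max L (mx G k z)) powr p) + ennreal (e * L powr (p-1) * G z) \<partial>M)
     \<le> (\<integral>\<^sup>+z\<in>cell k y. ennreal ((p/(p-1)) powr p * G z powr p) + ennreal (p * L powr p) \<partial>M)"
    proof (cases "x' \<le> L")
      case True then show ?thesis by (rule IH)
    next
      case False
      have Gint: "(\<integral>\<^sup>+z\<in>cell k y. ennreal (G z) \<partial>M) = ennreal (x' * ?m)"
        unfolding x'_def by (rule cell_integral_ave) (use Suc.prems in auto)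
      define U where "U = (\<integral>\<^sup>+z\<in>cell k y. ennreal ((max x' (mx G k z)) powr p) \<partial>M)"
      define B where "B = (\<integral>\<^sup>+z\<in>cell k y. ennreal ((p/(p-1)) powr p * G z powr p) \<partial>M)"
      have lin: "(\<integral>\<^sup>+z\<in>cell k y. ennreal (c * G z) \<partial>M) = ennreal (c * x' * ?m)" if "0 \<le> c" for c
        using that G x'0 cell_integral_cmult[of "\<lambda>z. ennreal (G z)" "ennreal c" k y] by (simp add: ennreal_mult Gint mult.assoc)
      have U': "(\<integral>\<^sup>+z\<in>cell k y. ennreal ((max L (mx G k z)) powr p) \<partial>M) = U"
        unfolding U_def
      proof (rule cell_integral_cong)
        fix z assume "z \<in> cell k y"
        then have "x' \<le> mx G k z" using mx_ge[of k k G z] cell_eq x'_def by auto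
        then show "ennreal ((max L (mx G k z)) powr p) = ennreal ((max x' (mx G k z)) powr p)"
          using False by (simp add: max_def)
      qed
      have "U + ennreal (e * x' powr (p-1) * x' * ?m) \<le> B + ennreal (p * x' powr p * ?m)"
        using IH[of x'] p e0 by (simp add: cell_integral_add lin nn_integral_cell_const U_def B_def)
      then have "U + ennreal (e * L powr (p-1) * x' * ?m) \<le> B + ennreal (p * L powr p * ?m)"
      proof (rule ennreal_cancel_le)
        have xp: "x' powr (p-1) * x' = x' powr p"
          using False l0 p by (simp add: powr_diff)
        have "p * L powr (p - 1) * x' \<le> x' powr p + (p - 1) * L powr p"
          by (rule Young_Doob[OF p x'0 l0])
        then have "p/(p-1) * (p * L powr (p - 1) * x') \<le> p/(p-1) * (x' powr p + (p - 1) * L powr p)"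
          using p by (intro mult_left_mono) auto
        also have "\<dots> = p/(p-1) * x' powr p + p * L powr p" using p by (simp add: field_simps)
        also have "p/(p-1) * x' powr p = e * x' powr p - p * x' powr p"
          using p by (simp add: field_simps e)
        finally have "e * L powr (p-1) * x' + p * x' powr p \<le> p * L powr p + e * x' powr (p-1) * x'"
          by (simp add: e mult.assoc xp)
        then have "(e * L powr (p-1) * x' + p * x' powr p) * ?m \<le> (p * L powr p + e * x' powr (p-1) * x') * ?m"
          by (rule mult_right_mono) simp
        then show "e * L powr (p-1) * x' * ?m + p * x' powr p * ?m \<le> p * L powr p * ?m + e * x' powr (p-1) * x' * ?m"
          by (simp add: distrib_right)
      qed (use p x'0 e0 in auto)
      then show ?thesis using p e0 by (simp add: cell_integral_add lin nn_integral_cell_const U' B_def)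
    qed
  qed measurable
  finally show ?case .
qed

lemma Doob_maximal:
  fixes p :: real
  assumes p: "1 < p" and [measurable]: "G \<in> borel_measurable M" and G: "\<And>y. 0 \<le> G y"
    and fin: "\<And>j x. j \<le> k \<Longrightarrow> (\<integral>\<^sup>+y\<in>cell j x. ennreal (G y) \<partial>M) < \<infinity>"
  shows "(\<integral>\<^sup>+y\<in>cell k x. ennreal (mx G k y powr p) \<partial>M)
     \<le> ennreal ((p/(p-1)) powr p) * (\<integral>\<^sup>+y\<in>cell k x. ennreal (G y powr p) \<partial>M)"
proof -
  let ?m = "measure M (cell k x)"
  define l where "l = ave M G (cell k x)"
  have l0: "0 \<le> l" by (simp add: l_def ave_nonneg)
  define e where "e = p * p / (p - 1)"
  have e0: "0 \<le> e" using p by (simp add: e_def)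
  define U where "U = (\<integral>\<^sup>+z\<in>cell k x. ennreal (mx G k z powr p) \<partial>M)"
  define B where "B = (\<integral>\<^sup>+z\<in>cell k x. ennreal ((p/(p-1)) powr p * G z powr p) \<partial>M)"
  have Gint: "(\<integral>\<^sup>+z\<in>cell k x. ennreal (G z) \<partial>M) = ennreal (l * ?m)"
    unfolding l_def by (rule cell_integral_ave) (use fin in auto)
  have lin: "(\<integral>\<^sup>+z\<in>cell k x. ennreal (c * G z) \<partial>M) = ennreal (c * l * ?m)" if "0 \<le> c" for c
    using that G l0 cell_integral_cmult[of "\<lambda>z. ennreal (G z)" "ennreal c" k x] by (simp add: ennreal_mult Gint mult.assoc)
  have U': "(\<integral>\<^sup>+z\<in>cell k x. ennreal ((max l (mx G k z)) powr p) \<partial>M) = U"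
    unfolding U_def
  proof (rule cell_integral_cong)
    fix z assume "z \<in> cell k x"
    then have "l \<le> mx G k z" using mx_ge[of k k G z] cell_eq l_def by auto
    then show "ennreal ((max l (mx G k z)) powr p) = ennreal (mx G k z powr p)" by (simp add: max_def)
  qed
  have "U + ennreal (e * l powr (p-1) * l * ?m) \<le> B + ennreal (p * l powr p * ?m)"
  proof -
    have "ave M G (cell k x) \<le> l" by (simp add: l_def)
    note Doob_Bellman[OF p e_def assms(2) G fin this]
    also have "(\<integral>\<^sup>+y\<in>cell k x. ennreal ((p/(p-1)) powr p * G y powr p) + ennreal (p * l powr p) \<partial>M) = B + ennreal (p * l powr p * ?m)"
      using p by (simp add: cell_integral_add nn_integral_cell_const B_def)
    also have "(\<integral>\<^sup>+y\<in>cell k x. ennreal ((max l (mx G k y)) powr p) + ennreal (e * l powr (p-1) * G y) \<partial>M) = U + ennreal (e * l powr (p-1) * l * ?m)"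
      using e0 by (simp only: U'[symmetric], subst cell_integral_add) (simp_all add: lin)
    finally show ?thesis .
  qed
  then have "U + ennreal 0 \<le> B + ennreal 0"
  proof (rule ennreal_cancel_le)
    have lp: "l powr (p-1) * l = l powr p"
      using l0 p by (cases "l = 0") (auto simp: powr_diff)
    have "p \<le> e" using p by (simp add: field_simps e_def)
    then have "p * l powr p \<le> e * l powr p" by (intro mult_right_mono) auto
    then have "p * l powr p * ?m \<le> e * l powr p * ?m" by (rule mult_right_mono) auto
    then show "0 + p * l powr p * ?m \<le> 0 + e * l powr (p-1) * l * ?m"
      using lp by (simp add: mult.assoc)
  qed (use p l0 e0 in auto)
  moreover have "B = ennreal ((p/(p-1)) powr p) * (\<integral>\<^sup>+y\<in>cell k x. ennreal (G y powr p) \<partial>M)"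
    unfolding B_def by (simp add: ennreal_mult cell_integral_cmult)
  ultimately show ?thesis by (simp add: U_def)
qed

lemma ave_zero_descendant:
  assumes fin: "(\<integral>\<^sup>+y\<in>cell k x. ennreal (f y) \<partial>M) < \<infinity>"
    and z: "ave M f (cell k x) = 0" and y: "y \<in> cell k x" and "i \<le> k"
  shows "ave M f (cell i y) = 0"
proof -
  have "cell i y \<subseteq> cell k x" using cell_mono[OF \<open>i \<le> k\<close>] cell_eq[OF y] by metis
  then have "(\<integral>\<^sup>+z\<in>cell i y. ennreal (f z) \<partial>M) \<le> (\<integral>\<^sup>+z\<in>cell k x. ennreal (f z) \<partial>M)"
    by (intro nn_integral_mono) (auto simp: indicator_def)
  also have "\<dots> = 0" unfolding cell_integral_ave[OF fin] z by simp
  finally show ?thesis by (simp add: ave_def)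
qed

text \<open>
  Taking averages over the cells of generation \<open>i\<close> preserves the integral over
  the larger cell, so Jensen's inequality for the concave power \<open>1 / \<theta>\<close>
  follows by integrating its tangent at the average over the larger cell.
\<close>

lemma Jensen_descendants:
  fixes \<theta> :: real
  assumes \<theta>: "1 < \<theta>" and [measurable]: "g \<in> borel_measurable M" and "i \<le> k"
    and fin: "\<And>j x. j \<le> k \<Longrightarrow> (\<integral>\<^sup>+y\<in>cell j x. ennreal (g y) \<partial>M) < \<infinity>"
  shows "(\<integral>\<^sup>+y\<in>cell k x. ennreal (ave M g (cell i y) powr (1/\<theta>)) \<partial>M)
     \<le> ennreal (ave M g (cell k x) powr (1/\<theta>) * measure M (cell k x))"
proof (cases "ave M g (cell k x) = 0")
  case True
  have "(\<integral>\<^sup>+y\<in>cell k x. ennreal (ave M g (cell i y) powr (1/\<theta>)) \<partial>M) = (\<integral>\<^sup>+y\<in>cell k x. 0 \<partial>M)"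
  proof (rule cell_integral_cong)
    fix y assume "y \<in> cell k x"
    then show "ennreal (ave M g (cell i y) powr (1/\<theta>)) = 0"
      using ave_zero_descendant[OF fin True _ \<open>i \<le> k\<close>] by simp
  qed
  then show ?thesis by simp
next
  case False
  define c where "c = ave M g (cell k x)"
  define d where "d = c powr (1/\<theta>)"
  have c: "0 < c" "0 < d" using False ave_nonneg[of M g "cell k x"] by (auto simp: c_def d_def)
  have tangent: "u powr (1/\<theta>) \<le> d / (c * \<theta>) * u + d * (1 - 1/\<theta>)" if "0 \<le> u" for u
  proof -
    have "\<theta> * (u/c) powr (1/\<theta>) \<le> u/c + (\<theta> - 1)"
      using Young_Doob[OF \<theta>, of "(u/c) powr (1/\<theta>)" 1] that c \<theta> by (simp add: powr_powr)
    moreover have "(u/c) powr (1/\<theta>) = u powr (1/\<theta>) / d"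
      using that c by (simp add: powr_divide d_def)
    ultimately show ?thesis using c \<theta> by (simp add: field_simps)
  qed
  have sub: "(\<integral>\<^sup>+y\<in>cell k x. ennreal (ave M g (cell i y)) \<partial>M) \<le> ennreal (c * measure M (cell k x))"
  proof -
    have "(\<integral>\<^sup>+y\<in>cell k x. ennreal (ave M g (cell i y)) \<partial>M) \<le> (\<integral>\<^sup>+y\<in>cell k x. ennreal (g y) \<partial>M)"
    proof (rule descendants_mono[OF _ _ \<open>i \<le> k\<close>])
      fix y
      have "(\<integral>\<^sup>+z\<in>cell i y. ennreal (ave M g (cell i z)) \<partial>M) = (\<integral>\<^sup>+z\<in>cell i y. ennreal (ave M g (cell i y)) \<partial>M)"
        by (rule cell_integral_cong) (use cell_eq in auto)
      also have "\<dots> = (\<integral>\<^sup>+z\<in>cell i y. ennreal (g z) \<partial>M)"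
        using cell_integral_ave[OF fin[OF \<open>i \<le> k\<close>], of y] by (simp add: nn_integral_cell_const ave_nonneg)
      finally show "(\<integral>\<^sup>+z\<in>cell i y. ennreal (ave M g (cell i z)) \<partial>M) \<le> (\<integral>\<^sup>+z\<in>cell i y. ennreal (g z) \<partial>M)" by simp
    qed auto
    then show ?thesis using fin[of k x] by (simp add: cell_integral_ave c_def)
  qed
  have "(\<integral>\<^sup>+y\<in>cell k x. ennreal (ave M g (cell i y) powr (1/\<theta>)) \<partial>M)
     \<le> (\<integral>\<^sup>+y\<in>cell k x. ennreal (d / (c * \<theta>)) * ennreal (ave M g (cell i y)) + ennreal (d * (1 - 1/\<theta>)) \<partial>M)"
  proof (rule cell_integral_mono)
    fix y
    show "ennreal (ave M g (cell i y) powr (1/\<theta>)) \<le> ennreal (d / (c * \<theta>)) * ennreal (ave M g (cell i y)) + ennreal (d * (1 - 1/\<theta>))"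
      using tangent[OF ave_nonneg, of M g "cell i y"] c \<theta> ave_nonneg[of M g "cell i y"]
      by (simp flip: ennreal_mult ennreal_plus)
  qed
  also have "\<dots> = ennreal (d / (c * \<theta>)) * (\<integral>\<^sup>+y\<in>cell k x. ennreal (ave M g (cell i y)) \<partial>M) + ennreal (d * (1 - 1/\<theta>) * measure M (cell k x))"
    using c \<theta> by (simp add: cell_integral_add cell_integral_cmult nn_integral_cell_const)
  also have "\<dots> \<le> ennreal (d / (c * \<theta>)) * ennreal (c * measure M (cell k x)) + ennreal (d * (1 - 1/\<theta>) * measure M (cell k x))"
    by (intro add_mono mult_left_mono sub) auto
  also have "\<dots> = ennreal (d * measure M (cell k x))"
    using c \<theta> by (simp flip: ennreal_mult ennreal_plus) (simp add: field_simps)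
  finally show ?thesis by (simp add: d_def c_def)
qed

text \<open>
  The largest cells on which the average exceeds the level cover the set and are disjoint;
  the induction stops as soon as it meets one of them.
\<close>

lemma weak_type:
  fixes \<theta> L :: real
  assumes \<theta>: "0 < \<theta>" and [measurable]: "f \<in> borel_measurable M"
    and fin: "\<And>j x. j \<le> k \<Longrightarrow> (\<integral>\<^sup>+y\<in>cell j x. ennreal (f y) \<partial>M) < \<infinity>" and L: "0 \<le> L"
  shows "(\<integral>\<^sup>+y\<in>cell k x. ennreal (L powr \<theta>) * indicator {y. \<exists>j\<le>k. L < ave M f (cell j y) powr (1/\<theta>)} y \<partial>M)
     \<le> (\<integral>\<^sup>+y\<in>cell k x. ennreal (f y) \<partial>M)"
  using fin
proof (induction k arbitrary: x)
  have sel: "(\<integral>\<^sup>+y\<in>cell k x. ennreal (L powr \<theta>) * indicator A y \<partial>M) \<le> (\<integral>\<^sup>+y\<in>cell k x. ennreal (f y) \<partial>M)"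
    if A: "L < ave M f (cell k x) powr (1/\<theta>)" and fin: "(\<integral>\<^sup>+y\<in>cell k x. ennreal (f y) \<partial>M) < \<infinity>"  for k x A
  proof -
    have "L powr \<theta> \<le> (ave M f (cell k x) powr (1/\<theta>)) powr \<theta>"
      using A L \<theta> by (intro powr_mono2) auto
    also have "\<dots> = ave M f (cell k x)" using \<theta> ave_nonneg[of M f "cell k x"] by (simp add: powr_powr)
    finally have le: "L powr \<theta> \<le> ave M f (cell k x)" .
    have "(\<integral>\<^sup>+y\<in>cell k x. ennreal (L powr \<theta>) * indicator A y \<partial>M) \<le> (\<integral>\<^sup>+y\<in>cell k x. ennreal (ave M f (cell k x)) \<partial>M)"
      by (rule cell_integral_mono) (use le in \<open>auto simp: indicator_def ennreal_leI\<close>)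
    also have "\<dots> = (\<integral>\<^sup>+y\<in>cell k x. ennreal (f y) \<partial>M)"
      using fin by (simp add: nn_integral_cell_const ave_nonneg cell_integral_ave)
    finally show ?thesis .
  qed
  {
    case 0
    show ?case
    proof (cases "L < ave M f (cell 0 x) powr (1/\<theta>)")
      case True then show ?thesis by (rule sel) (use 0 in auto)
    next
      case False
      have "(\<integral>\<^sup>+y\<in>cell 0 x. ennreal (L powr \<theta>) * indicator {y. \<exists>j\<le>0. L < ave M f (cell j y) powr (1/\<theta>)} y \<partial>M)
        = (\<integral>\<^sup>+y\<in>cell 0 x. 0 \<partial>M)"
        by (rule cell_integral_cong) (use False cell_eq in \<open>auto simp: indicator_def\<close>)
      then show ?thesis by simp
    qed
  next
    case (Suc k)
    show ?case
    proof (cases "L < ave M f (cell (Suc k) x) powr (1/\<theta>)")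
      case True then show ?thesis by (rule sel) (use Suc in auto)
    next
      case False
      have "(\<integral>\<^sup>+y\<in>cell (Suc k) x. ennreal (L powr \<theta>) * indicator {y. \<exists>j\<le>Suc k. L < ave M f (cell j y) powr (1/\<theta>)} y \<partial>M)
        = (\<integral>\<^sup>+y\<in>cell (Suc k) x. ennreal (L powr \<theta>) * indicator {y. \<exists>j\<le>k. L < ave M f (cell j y) powr (1/\<theta>)} y \<partial>M)"
      proof (rule cell_integral_cong)
        fix y assume "y \<in> cell (Suc k) x"
        then have "(\<exists>j\<le>Suc k. L < ave M f (cell j y) powr (1/\<theta>)) = (\<exists>j\<le>k. L < ave M f (cell j y) powr (1/\<theta>))"
          using False cell_eq by (auto simp: le_Suc_eq)
        then show "ennreal (L powr \<theta>) * indicator {y. \<exists>j\<le>Suc k. L < ave M f (cell j y) powr (1/\<theta>)} y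
          = ennreal (L powr \<theta>) * indicator {y. \<exists>j\<le>k. L < ave M f (cell j y) powr (1/\<theta>)} y"
          by (simp add: indicator_def)
      qed
      also have "\<dots> \<le> (\<integral>\<^sup>+y\<in>cell (Suc k) x. ennreal (f y) \<partial>M)"
      proof (rule children_mono)
        have [measurable]: "{y. \<exists>j\<le>k. L < ave M f (cell j y) powr (1/\<theta>)} \<in> sets M"
        proof -
          have "{y \<in> space M. \<exists>j\<le>k. L < ave M f (cell j y) powr (1/\<theta>)} \<in> sets M" by measurable
          then show ?thesis by (simp add: space_UNIV)
        qed
        show "(\<lambda>y. ennreal (L powr \<theta>) * indicator {y. \<exists>j\<le>k. L < ave M f (cell j y) powr (1/\<theta>)} y) \<in> borel_measurable M"
          by measurable
      qed (use Suc in auto)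
      finally show ?thesis .
    qed
  }
qed

text \<open>
  Write \<open>F\<close> and \<open>G\<close> for the averages of \<open>f\<close> and
  \<open>g\<close> to the power \<open>1 / \<theta>\<close>. Start from a cell
  \<open>Q\<close> of generation \<open>j\<close> and follow its subcells as long as
  \<open>F \<le> L\<close>, where \<open>L = 2 powr (1 / \<theta>) * F(Q)\<close>. On these,
  \<open>F\<close> may be replaced by the constant \<open>L\<close>, and by Jensen's
  inequality the sum of \<open>I i * a' * G\<close> over the scales integrates to at most
  \<open>t * W j * a'(Q) * G(Q) * |Q|\<close>. By the weak type estimate at least half of
  \<open>Q\<close> is never stopped, so that the contribution of \<open>Q\<close> is at most
  a multiple of the integral of \<open>\<Psi>\<close> over the unstopped part. On the
  stopped cells the argument starts afresh, and the unstopped parts of different starting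
  cells are disjoint; hence a single integral of \<open>\<Psi>\<close> suffices, regardless
  of the number of scales.
\<close>

lemma sparse_bound:
  fixes \<theta> t :: real and I W :: "nat \<Rightarrow> real" and a' :: "'a set \<Rightarrow> real" and \<Psi> :: "'a \<Rightarrow> ennreal"
  defines "F \<equiv> \<lambda>f j y. ave M f (cell j y) powr (1/\<theta>)"
  assumes \<theta>: "1 < \<theta>" and t: "0 \<le> t"
    and f[measurable]: "f \<in> borel_measurable M" and g[measurable]: "g \<in> borel_measurable M"
    and finf: "\<And>j x. j \<le> k \<Longrightarrow> (\<integral>\<^sup>+y\<in>cell j x. ennreal (f y) \<partial>M) < \<infinity>"
    and fing: "\<And>j x. j \<le> k \<Longrightarrow> (\<integral>\<^sup>+y\<in>cell j x. ennreal (g y) \<partial>M) < \<infinity>"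
    and I: "\<And>j. 0 \<le> I j" and W: "\<And>j. j \<le> k \<Longrightarrow> (\<Sum>i\<le>j. I i) \<le> W j"
    and a0: "\<And>j x. 0 \<le> a' (cell j x)" and a: "\<And>i j x. i \<le> j \<Longrightarrow> j \<le> k \<Longrightarrow> a' (cell i x) \<le> t * a' (cell j x)"
    and Psi[measurable]: "\<Psi> \<in> borel_measurable M"
    and dom: "\<And>j y. j \<le> k \<Longrightarrow> ennreal (W j * a' (cell j y) * F f j y * F g j y) \<le> \<Psi> y"
  shows "(\<integral>\<^sup>+y\<in>cell k x. ennreal (\<Sum>i\<le>k. I i * a' (cell i y) * F f i y * F g i y) \<partial>M)
     \<le> ennreal (2 * 2 powr (1/\<theta>) * t) * (\<integral>\<^sup>+y\<in>cell k x. \<Psi> y \<partial>M)"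
proof -
  define C where "C = 2 * 2 powr (1/\<theta>) * t"
  have C0: "0 \<le> C" using t by (simp add: C_def)
  \<comment> \<open>the points in a cell at which \<open>F\<close> has exceeded the level
      \<open>L\<close>: the stopped part\<close>
  define D where "D k L = {y. \<exists>j\<le>k. L < F f j y}" for k L
  define bet where "bet i y = I i * a' (cell i y) * F g i y" for i y
  have F0: "0 \<le> F h j y" for h j y by (simp add: F_def)
  have Feq: "F h j y = F h j x" if "y \<in> cell j x" for h j x y using cell_eq[OF that] by (simp add: F_def)
  have bet0: "0 \<le> bet i y" for i y unfolding bet_def by (intro mult_nonneg_nonneg I a0 F0)
  have F_meas[measurable]: "F h j \<in> borel_measurable M" for h j unfolding F_def by measurable
  have bet_meas[measurable]: "bet i \<in> borel_measurable M" for i unfolding bet_def by measurable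
  have D_meas[measurable]: "D k L \<in> sets M" for k L
  proof -
    have "{y \<in> space M. \<exists>j\<le>k. L < F f j y} \<in> sets M" by measurable
    then show ?thesis by (simp add: space_UNIV D_def)
  qed
  \<comment> \<open>the sum without \<open>F\<close>, by Jensen's inequality for \<open>g\<close>\<close>
  have Gamma: "(\<integral>\<^sup>+y\<in>cell j x. ennreal (\<Sum>i\<le>j. bet i y) \<partial>M) \<le> ennreal (t * W j * a' (cell j x) * F g j x * measure M (cell j x))"
    if jk: "j \<le> k" for j x
  proof -
    let ?r = "t * a' (cell j x)"
    have r0: "0 \<le> ?r" using t a0 by simp
    have "(\<integral>\<^sup>+y\<in>cell j x. ennreal (\<Sum>i\<le>j. bet i y) \<partial>M) \<le> (\<integral>\<^sup>+y\<in>cell j x. (\<Sum>i\<le>j. ennreal (I i * ?r) * ennreal (F g i y)) \<partial>M)"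
    proof (rule cell_integral_mono)
      fix y assume y: "y \<in> cell j x"
      have "(\<Sum>i\<le>j. bet i y) \<le> (\<Sum>i\<le>j. I i * ?r * F g i y)"
        unfolding bet_def
        by (intro sum_mono mult_right_mono mult_left_mono I F0) (use a[OF _ jk, of _ y] cell_eq[OF y] in auto)
      then have "ennreal (\<Sum>i\<le>j. bet i y) \<le> ennreal (\<Sum>i\<le>j. I i * ?r * F g i y)" by (rule ennreal_leI)
      also have "\<dots> = (\<Sum>i\<le>j. ennreal (I i * ?r) * ennreal (F g i y))"
      proof -
        have "(\<Sum>i\<le>j. ennreal (I i * ?r) * ennreal (F g i y)) = (\<Sum>i\<le>j. ennreal (I i * ?r * F g i y))"
          by (intro sum.cong refl ennreal_mult[symmetric] mult_nonneg_nonneg I r0 F0)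
        also have "\<dots> = ennreal (\<Sum>i\<le>j. I i * ?r * F g i y)"
          by (intro sum_ennreal mult_nonneg_nonneg I r0 F0)
        finally show ?thesis by simp
      qed
      finally show "ennreal (\<Sum>i\<le>j. bet i y) \<le> (\<Sum>i\<le>j. ennreal (I i * ?r) * ennreal (F g i y))" .
    qed
    also have "\<dots> = (\<Sum>i\<le>j. \<integral>\<^sup>+y. ennreal (I i * ?r) * (ennreal (F g i y) * indicator (cell j x) y) \<partial>M)"
      by (subst nn_integral_sum[symmetric]) (auto simp: sum_distrib_right mult.assoc)
    also have "\<dots> = (\<Sum>i\<le>j. ennreal (I i * ?r) * (\<integral>\<^sup>+y\<in>cell j x. ennreal (F g i y) \<partial>M))"
      by (intro sum.cong refl nn_integral_cmult) measurable
    also have "\<dots> \<le> (\<Sum>i\<le>j. ennreal (I i * ?r) * ennreal (F g j x * measure M (cell j x)))"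
      unfolding F_def
      by (intro sum_mono mult_left_mono Jensen_descendants \<theta> g) (use jk fing in auto)
    also have "\<dots> = ennreal ((\<Sum>i\<le>j. I i) * (?r * (F g j x * measure M (cell j x))))"
    proof -
      have "(\<Sum>i\<le>j. ennreal (I i * ?r) * ennreal (F g j x * measure M (cell j x))) = (\<Sum>i\<le>j. ennreal (I i * ?r * (F g j x * measure M (cell j x))))"
        by (intro sum.cong refl ennreal_mult[symmetric] mult_nonneg_nonneg I r0 F0) auto
      also have "\<dots> = ennreal (\<Sum>i\<le>j. I i * ?r * (F g j x * measure M (cell j x)))"
        by (intro sum_ennreal mult_nonneg_nonneg I r0 F0) auto
      finally show ?thesis by (simp add: sum_distrib_right mult.assoc)
    qed
    also have "\<dots> \<le> ennreal (W j * (?r * (F g j x * measure M (cell j x))))"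
      by (intro ennreal_leI mult_right_mono W jk mult_nonneg_nonneg r0 F0) auto
    finally show ?thesis by (simp add: mult_ac)
  qed
  have meas1: "(\<lambda>y. ennreal (L * (\<Sum>i\<le>j. bet i y)) + ennreal C * \<Psi> y * indicator (D j L) y) \<in> borel_measurable M" for j L
    by measurable
  \<comment> \<open>one stopping step: \<open>L powr \<theta>\<close> is twice the average of
      \<open>f\<close>, so that the unstopped part of the cell has at least half of its
      measure and pays for the terms with \<open>F \<le> L\<close>\<close>
  have S2: "(\<integral>\<^sup>+y\<in>cell j x. ennreal (\<Sum>i\<le>j. bet i y * F f i y) \<partial>M) \<le> ennreal C * (\<integral>\<^sup>+y\<in>cell j x. \<Psi> y \<partial>M)"
    if jk: "j \<le> k" and S1: "\<And>L. F f j x \<le> L \<Longrightarrow> (\<integral>\<^sup>+y\<in>cell j x. ennreal (\<Sum>i\<le>j. bet i y * F f i y) \<partial>M)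
       \<le> (\<integral>\<^sup>+y\<in>cell j x. ennreal (L * (\<Sum>i\<le>j. bet i y)) + ennreal C * \<Psi> y * indicator (D j L) y \<partial>M)" for j x
  proof (cases "F f j x = 0")
    case True
    then have av0: "ave M f (cell j x) = 0" by (simp add: F_def)
    have "(\<integral>\<^sup>+y\<in>cell j x. ennreal (\<Sum>i\<le>j. bet i y * F f i y) \<partial>M) = (\<integral>\<^sup>+y\<in>cell j x. 0 \<partial>M)"
    proof (rule cell_integral_cong)
      fix y assume "y \<in> cell j x"
      then have "F f i y = 0" if "i \<le> j" for i
        using ave_zero_descendant[OF finf[OF jk] av0 _ that] by (simp add: F_def)
      then show "ennreal (\<Sum>i\<le>j. bet i y * F f i y) = 0" by simp
    qed
    then show ?thesis by simp
  next
    case False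
    define A where "A = 2 powr (1/\<theta>)"
    have A1: "1 \<le> A" using \<theta> by (simp add: A_def ge_one_powr_ge_zero)
    let ?Q = "cell j x"
    define L where "L = A * F f j x"
    have Fp: "0 < F f j x" using False F0[of f j x] by simp
    have L: "F f j x \<le> L" "0 < L" using A1 Fp by (auto simp: L_def)
    define c0 where "c0 = W j * a' ?Q * F f j x * F g j x"
    have W0: "0 \<le> W j" using W[OF jk] sum_nonneg[of "{..j}" I] I by (meson order_trans)
    have c00: "0 \<le> c0" unfolding c0_def by (intro mult_nonneg_nonneg W0 a0 F0)
    have half: "ennreal (measure M ?Q) \<le> 2 * (\<integral>\<^sup>+y\<in>?Q. indicator (- D j L) y \<partial>M)"
    proof -
      have "(\<integral>\<^sup>+y\<in>?Q. ennreal (L powr \<theta>) * indicator (D j L) y \<partial>M) \<le> (\<integral>\<^sup>+y\<in>?Q. ennreal (f y) \<partial>M)"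
        unfolding D_def F_def by (rule weak_type) (use \<theta> L jk finf in auto)
      also have "\<dots> = ennreal (F f j x powr \<theta> * measure M ?Q)"
        using finf[OF jk, of x] \<theta> ave_nonneg[of M f ?Q] by (simp add: cell_integral_ave F_def powr_powr)
      finally have "ennreal (L powr \<theta>) * (\<integral>\<^sup>+y\<in>?Q. indicator (D j L) y \<partial>M) \<le> ennreal (F f j x powr \<theta> * measure M ?Q)"
        by (simp add: cell_integral_cmult)
      moreover have "(\<integral>\<^sup>+y\<in>?Q. indicator (D j L) y \<partial>M) = ennreal (measure M (D j L \<inter> ?Q))"
      proof -
        have "emeasure M (D j L \<inter> ?Q) \<le> emeasure M ?Q" by (intro emeasure_mono cell_sets) auto
        then have "emeasure M (D j L \<inter> ?Q) < \<infinity>" using cell_fin[of j x] by (metis le_less_trans)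
        moreover have "(\<integral>\<^sup>+y\<in>?Q. indicator (D j L) y \<partial>M) = emeasure M (D j L \<inter> ?Q)"
          using cell_sets[of j x] by (simp flip: indicator_inter_arith add: Int_commute)
        ultimately show ?thesis by (simp add: emeasure_eq_ennreal_measure less_top)
      qed
      ultimately have "ennreal (L powr \<theta> * measure M (D j L \<inter> ?Q)) \<le> ennreal (F f j x powr \<theta> * measure M ?Q)"
        by (simp add: ennreal_mult)
      then have "L powr \<theta> * measure M (D j L \<inter> ?Q) \<le> F f j x powr \<theta> * measure M ?Q" by (simp add: ennreal_le_iff)
      moreover have "L powr \<theta> = 2 * F f j x powr \<theta>"
        using \<theta> Fp by (simp add: L_def A_def powr_mult powr_powr)
      ultimately have dm: "2 * measure M (D j L \<inter> ?Q) \<le> measure M ?Q"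
        using Fp by simp
      have fm: "?Q \<in> fmeasurable M" using cell_sets cell_fin by (auto simp: fmeasurable_def)
      have "measure M ?Q = measure M (D j L \<inter> ?Q) + measure M (- D j L \<inter> ?Q)"
      proof -
        have "measure M (?Q - (D j L \<inter> ?Q)) = measure M ?Q - measure M (D j L \<inter> ?Q)"
          using fm by (intro measurable_measure_Diff) (auto intro: fmeasurableD)
        moreover have "?Q - (D j L \<inter> ?Q) = - D j L \<inter> ?Q" by auto
        ultimately show ?thesis by simp
      qed
      then have "measure M ?Q \<le> 2 * measure M (- D j L \<inter> ?Q)" using dm by linarith
      moreover have "(\<integral>\<^sup>+y\<in>?Q. indicator (- D j L) y \<partial>M) = ennreal (measure M (- D j L \<inter> ?Q))"
      proof -
        have s: "- D j L \<inter> ?Q \<in> sets M"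
          using sets.compl_sets[OF D_meas, of j L] cell_sets[of j x] by (auto simp: space_UNIV Compl_eq_Diff_UNIV)
        have "(\<integral>\<^sup>+y\<in>?Q. indicator (- D j L) y \<partial>M) = emeasure M (- D j L \<inter> ?Q)"
          using s by (simp flip: indicator_inter_arith add: Int_commute)
        moreover have "emeasure M (- D j L \<inter> ?Q) \<le> emeasure M ?Q" by (intro emeasure_mono cell_sets) auto
        then have "emeasure M (- D j L \<inter> ?Q) < \<infinity>" using cell_fin[of j x] by (rule le_less_trans)
        ultimately show ?thesis by (simp add: emeasure_eq_ennreal_measure less_top)
      qed
      ultimately show ?thesis by (simp flip: ennreal_mult ennreal_numeral add: ennreal_leI)
    qed
    have cmpl[measurable]: "- D j L \<in> sets M"
      using sets.compl_sets[OF D_meas, of j L] by (simp add: space_UNIV Compl_eq_Diff_UNIV)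
    have "(\<integral>\<^sup>+y\<in>?Q. ennreal (\<Sum>i\<le>j. bet i y * F f i y) \<partial>M)
       \<le> (\<integral>\<^sup>+y\<in>?Q. ennreal (L * (\<Sum>i\<le>j. bet i y)) + ennreal C * \<Psi> y * indicator (D j L) y \<partial>M)"
      by (rule S1[OF L(1)])
    also have "\<dots> = ennreal L * (\<integral>\<^sup>+y\<in>?Q. ennreal (\<Sum>i\<le>j. bet i y) \<partial>M) + (\<integral>\<^sup>+y\<in>?Q. ennreal C * \<Psi> y * indicator (D j L) y \<partial>M)"
      using L(2) bet0 by (simp add: cell_integral_add ennreal_mult sum_nonneg cell_integral_cmult)
    also have "ennreal L * (\<integral>\<^sup>+y\<in>?Q. ennreal (\<Sum>i\<le>j. bet i y) \<partial>M) \<le> ennreal L * ennreal (t * W j * a' ?Q * F g j x * measure M ?Q)"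
      by (intro mult_left_mono Gamma jk) auto
    also have "\<dots> = ennreal (A * t * c0) * ennreal (measure M ?Q)"
      using L(2) A1 t c00 W0 a0 F0 by (simp flip: ennreal_mult) (simp add: L_def c0_def mult_ac)
    also have "\<dots> \<le> ennreal (A * t * c0) * (2 * (\<integral>\<^sup>+y\<in>?Q. indicator (- D j L) y \<partial>M))"
      by (intro mult_left_mono half) auto
    also have "\<dots> = (\<integral>\<^sup>+y\<in>?Q. ennreal C * ennreal c0 * indicator (- D j L) y \<partial>M)"
    proof -
      have "ennreal (A * t * c0) * 2 = ennreal C * ennreal c0"
        using A1 t c00 by (simp flip: ennreal_mult ennreal_numeral add: C_def A_def)
      then show ?thesis by (simp add: cell_integral_cmult mult.assoc[symmetric])
    qed
    also have "\<dots> \<le> (\<integral>\<^sup>+y\<in>?Q. ennreal C * \<Psi> y * indicator (- D j L) y \<partial>M)"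
    proof (rule cell_integral_mono)
      fix y assume y: "y \<in> ?Q"
      have "ennreal c0 \<le> \<Psi> y" using dom[OF jk, of y] Feq[OF y] cell_eq[OF y] by (simp add: c0_def)
      then show "ennreal C * ennreal c0 * indicator (- D j L) y \<le> ennreal C * \<Psi> y * indicator (- D j L) y"
        by (intro mult_right_mono mult_left_mono) auto
    qed
    also have "\<dots> + (\<integral>\<^sup>+y\<in>?Q. ennreal C * \<Psi> y * indicator (D j L) y \<partial>M)
      = (\<integral>\<^sup>+y\<in>?Q. ennreal C * \<Psi> y * indicator (- D j L) y + ennreal C * \<Psi> y * indicator (D j L) y \<partial>M)"
      by (rule cell_integral_add[symmetric]) measurable
    also have "\<dots> = (\<integral>\<^sup>+y\<in>?Q. ennreal C * \<Psi> y \<partial>M)"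
      by (rule cell_integral_cong) (auto simp: indicator_def)
    also have "\<dots> = ennreal C * (\<integral>\<^sup>+y\<in>?Q. \<Psi> y \<partial>M)" by (simp add: cell_integral_cmult)
    finally show ?thesis by (simp add: add_right_mono)
  qed
  \<comment> \<open>the sum up to the stopping cells for the level \<open>L\<close>; below the stopping
      cells the previous step gives the full bound\<close>
  have S1: "(\<integral>\<^sup>+y\<in>cell j x. ennreal (\<Sum>i\<le>j. bet i y * F f i y) \<partial>M)
       \<le> (\<integral>\<^sup>+y\<in>cell j x. ennreal (L * (\<Sum>i\<le>j. bet i y)) + ennreal C * \<Psi> y * indicator (D j L) y \<partial>M)"
    if "j \<le> k" "F f j x \<le> L" for j x L
    using that
  proof (induction j arbitrary: x L)
    case 0
    show ?case
    proof (rule cell_integral_mono)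
      fix y assume y: "y \<in> cell 0 x"
      have "F f 0 y \<le> L" using 0 Feq[OF y, of f] by simp
      then have "bet 0 y * F f 0 y \<le> L * bet 0 y" using mult_left_mono[of "F f 0 y" L "bet 0 y"] bet0[of 0 y] by (subst (2) mult.commute) blast
      then have "ennreal (\<Sum>i\<le>0. bet i y * F f i y) \<le> ennreal (L * (\<Sum>i\<le>0. bet i y))" by (simp add: ennreal_leI)
      then show "ennreal (\<Sum>i\<le>0. bet i y * F f i y) \<le> ennreal (L * (\<Sum>i\<le>0. bet i y)) + ennreal C * \<Psi> y * indicator (D 0 L) y"
        by (simp add: add_increasing2)
    qed
  next
    case (Suc j)
    have L0: "0 \<le> L" using Suc.prems F0 order_trans by blast
    let ?R = "\<lambda>y. ennreal (L * (\<Sum>i\<le>j. bet i y)) + ennreal C * \<Psi> y * indicator (D j L) y"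
    have old: "(\<integral>\<^sup>+y\<in>cell (Suc j) x. ennreal (\<Sum>i\<le>j. bet i y * F f i y) \<partial>M)
       \<le> (\<integral>\<^sup>+y\<in>cell (Suc j) x. ?R y \<partial>M)"
    proof (rule children_mono)
      fix z
      have IH: "(\<integral>\<^sup>+y\<in>cell j z. ennreal (\<Sum>i\<le>j. bet i y * F f i y) \<partial>M)
       \<le> (\<integral>\<^sup>+y\<in>cell j z. ?R y \<partial>M)" if "F f j z \<le> L"
        by (rule Suc.IH) (use that Suc.prems in auto)
      show "(\<integral>\<^sup>+y\<in>cell j z. ennreal (\<Sum>i\<le>j. bet i y * F f i y) \<partial>M) \<le> (\<integral>\<^sup>+y\<in>cell j z. ?R y \<partial>M)"
      proof (cases "F f j z \<le> L")
        case False
        have "(\<integral>\<^sup>+y\<in>cell j z. ennreal (\<Sum>i\<le>j. bet i y * F f i y) \<partial>M) \<le> ennreal C * (\<integral>\<^sup>+y\<in>cell j z. \<Psi> y \<partial>M)"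
          by (rule S2) (use Suc in auto)
        also have "\<dots> = (\<integral>\<^sup>+y\<in>cell j z. ennreal C * \<Psi> y \<partial>M)" by (simp add: cell_integral_cmult)
        also have "\<dots> \<le> (\<integral>\<^sup>+y\<in>cell j z. ?R y \<partial>M)"
        proof (rule cell_integral_mono)
          fix y assume "y \<in> cell j z"
          then have "y \<in> D j L" using False Feq[of y j z f] by (auto simp: D_def)
          then show "ennreal C * \<Psi> y \<le> ?R y" by simp
        qed
        finally show ?thesis .
      qed (rule IH)
    qed (use meas1 in auto)
    have "(\<integral>\<^sup>+y\<in>cell (Suc j) x. ennreal (\<Sum>i\<le>Suc j. bet i y * F f i y) \<partial>M)
      = (\<integral>\<^sup>+y\<in>cell (Suc j) x. ennreal (\<Sum>i\<le>j. bet i y * F f i y) + ennreal (bet (Suc j) y * F f (Suc j) y) \<partial>M)"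
      by (simp add: ennreal_plus[OF sum_nonneg] bet0 F0)
    also have "\<dots> = (\<integral>\<^sup>+y\<in>cell (Suc j) x. ennreal (\<Sum>i\<le>j. bet i y * F f i y) \<partial>M)
        + (\<integral>\<^sup>+y\<in>cell (Suc j) x. ennreal (bet (Suc j) y * F f (Suc j) y) \<partial>M)"
      by (rule cell_integral_add) measurable
    also have "\<dots> \<le> (\<integral>\<^sup>+y\<in>cell (Suc j) x. ?R y \<partial>M) + (\<integral>\<^sup>+y\<in>cell (Suc j) x. ennreal (L * bet (Suc j) y) \<partial>M)"
    proof (intro add_mono old cell_integral_mono ennreal_leI)
      fix y assume y: "y \<in> cell (Suc j) x"
      show "bet (Suc j) y * F f (Suc j) y \<le> L * bet (Suc j) y"
      proof -
        have "F f (Suc j) y \<le> L" using Suc.prems Feq[OF y, of f] by simp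
        then show ?thesis using mult_left_mono[of "F f (Suc j) y" L "bet (Suc j) y"] bet0[of "Suc j" y] by (subst (2) mult.commute) blast
      qed
    qed
    also have "\<dots> = (\<integral>\<^sup>+y\<in>cell (Suc j) x. ?R y + ennreal (L * bet (Suc j) y) \<partial>M)"
      by (rule cell_integral_add[symmetric]) measurable
    also have "\<dots> \<le> (\<integral>\<^sup>+y\<in>cell (Suc j) x. ennreal (L * (\<Sum>i\<le>Suc j. bet i y)) + ennreal C * \<Psi> y * indicator (D (Suc j) L) y \<partial>M)"
    proof (rule cell_integral_mono)
      fix y
      have ind: "indicator (D j L) y \<le> (indicator (D (Suc j) L) y :: ennreal)"
        by (auto simp: D_def indicator_def le_Suc_eq)
      have "0 \<le> L * (\<Sum>i\<le>j. bet i y)" "0 \<le> L * bet (Suc j) y"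
        using L0 bet0 by (auto intro: mult_nonneg_nonneg sum_nonneg)
      then have sum: "ennreal (L * (\<Sum>i\<le>j. bet i y)) + ennreal (L * bet (Suc j) y) = ennreal (L * (\<Sum>i\<le>Suc j. bet i y))"
        by (simp add: distrib_left flip: ennreal_plus)
      show "?R y + ennreal (L * bet (Suc j) y) \<le> ennreal (L * (\<Sum>i\<le>Suc j. bet i y)) + ennreal C * \<Psi> y * indicator (D (Suc j) L) y"
        by (rule add_right_comm_mono[OF mult_left_mono[OF ind] sum]) simp
    qed
    finally show ?case .
  qed
  show ?thesis
    using S2[OF order.refl S1[OF order.refl], of x] by (simp add: bet_def C_def mult_ac)
qed

text \<open>
  The numbers \<open>bq Q\<close> play the role of the averages of \<open>b\<close>; only
  their distance from other constants is used. Stop at the largest subcells whose average is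
  farther than \<open>2 * D\<close> from the centre. They fill at most half of the cell, and
  by the doubling condition the distance has not passed \<open>(2 + \<nu>) * D\<close>
  there, so that restarting costs the factor \<open>exp (c * (2 + \<nu>)) = 4/3\<close>. The
  constant \<open>4\<close> reproduces itself since \<open>4 = 4/3 + 1/2 * (4/3) *
  4\<close>.
\<close>

lemma John_Nirenberg_tree:
  fixes b :: "'a \<Rightarrow> real" and bq :: "'a set \<Rightarrow> real" and D \<nu> c :: real
  defines "c \<equiv> ln (4/3) / (2 + \<nu>)"
  assumes [measurable]: "b \<in> borel_measurable M" and D: "0 < D" and \<nu>: "0 \<le> \<nu>"
    and lower: "\<And>j y \<beta>. j \<le> k \<Longrightarrow> y \<in> cell k x \<Longrightarrow> ennreal (\<bar>bq (cell j y) - \<beta>\<bar> * measure M (cell j y)) \<le> (\<integral>\<^sup>+z\<in>cell j y. ennreal \<bar>b z - \<beta>\<bar> \<partial>M)"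
    and osc: "\<And>j y. j \<le> k \<Longrightarrow> y \<in> cell k x \<Longrightarrow> (\<integral>\<^sup>+z\<in>cell j y. ennreal \<bar>b z - bq (cell j y)\<bar> \<partial>M) \<le> ennreal (D * measure M (cell j y))"
    and doubling: "\<And>j y. j < k \<Longrightarrow> y \<in> cell k x \<Longrightarrow> measure M (cell (Suc j) y) \<le> \<nu> * measure M (cell j y)"
  shows "(\<integral>\<^sup>+y\<in>cell k x. ennreal (exp (c * \<bar>bq (cell 0 y) - bq (cell k x)\<bar> / D)) \<partial>M) \<le> ennreal (4 * measure M (cell k x))"
proof -
  have c0: "0 < c" using \<nu> by (simp add: c_def)
  have ec: "exp (c * (2 + \<nu>)) = 4/3" using \<nu> by (simp add: c_def)
  define bad where "bad j \<beta> = {y. \<exists>i\<le>j. 2 * D < \<bar>bq (cell i y) - \<beta>\<bar>}" for j \<beta>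
  have bad_meas[measurable]: "bad j \<beta> \<in> sets M" for j \<beta>
  proof -
    have "{y \<in> space M. \<exists>i\<le>j. 2 * D < \<bar>bq (cell i y) - \<beta>\<bar>} \<in> sets M" by measurable
    then show ?thesis by (simp add: space_UNIV bad_def)
  qed
  have jump: "\<bar>bq (cell j y) - bq (cell (Suc j) y)\<bar> \<le> \<nu> * D" if "j < k" "y \<in> cell k x" for j y
  proof -
    let ?R = "cell j y" and ?Q = "cell (Suc j) y"
    have "ennreal (\<bar>bq ?R - bq ?Q\<bar> * measure M ?R) \<le> (\<integral>\<^sup>+z\<in>?R. ennreal \<bar>b z - bq ?Q\<bar> \<partial>M)"
      by (rule lower) (use that in auto)
    also have "\<dots> \<le> (\<integral>\<^sup>+z\<in>?Q. ennreal \<bar>b z - bq ?Q\<bar> \<partial>M)"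
      by (intro nn_integral_mono) (use cell_Suc[of j y] in \<open>auto simp: indicator_def\<close>)
    also have "\<dots> \<le> ennreal (D * measure M ?Q)" by (rule osc) (use that in auto)
    also have "\<dots> \<le> ennreal (D * (\<nu> * measure M ?R))"
      by (intro ennreal_leI mult_left_mono doubling) (use that D in auto)
    finally have "\<bar>bq ?R - bq ?Q\<bar> * measure M ?R \<le> (\<nu> * D) * measure M ?R"
      using D \<nu> by (simp add: ennreal_le_iff mult_ac)
    then show ?thesis using cell_pos[of j y] by (simp add: mult_le_cancel_right)
  qed
  have weak: "(\<integral>\<^sup>+z\<in>cell j y. ennreal (2 * D) * indicator (bad j \<beta>) z \<partial>M) \<le> (\<integral>\<^sup>+z\<in>cell j y. ennreal \<bar>b z - \<beta>\<bar> \<partial>M)"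
    if "j \<le> k" "y \<in> cell k x" for j y \<beta>
    using that
  proof (induction j arbitrary: y)
    have sel: "(\<integral>\<^sup>+z\<in>cell j y. ennreal (2 * D) * indicator A z \<partial>M) \<le> (\<integral>\<^sup>+z\<in>cell j y. ennreal \<bar>b z - \<beta>\<bar> \<partial>M)"
      if "2 * D < \<bar>bq (cell j y) - \<beta>\<bar>" "j \<le> k" "y \<in> cell k x" for j y A
    proof -
      have "(\<integral>\<^sup>+z\<in>cell j y. ennreal (2 * D) * indicator A z \<partial>M) \<le> (\<integral>\<^sup>+z\<in>cell j y. ennreal \<bar>bq (cell j y) - \<beta>\<bar> \<partial>M)"
        by (rule cell_integral_mono) (use that(1) in \<open>auto simp: indicator_def ennreal_leI\<close>)
      also have "\<dots> = ennreal (\<bar>bq (cell j y) - \<beta>\<bar> * measure M (cell j y))" by (simp add: nn_integral_cell_const)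
      also have "\<dots> \<le> (\<integral>\<^sup>+z\<in>cell j y. ennreal \<bar>b z - \<beta>\<bar> \<partial>M)" by (rule lower) (use that in auto)
      finally show ?thesis .
    qed
    {
      case 0
      show ?case
      proof (cases "2 * D < \<bar>bq (cell 0 y) - \<beta>\<bar>")
        case True then show ?thesis by (rule sel) (use 0 in auto)
      next
        case False
        have "(\<integral>\<^sup>+z\<in>cell 0 y. ennreal (2 * D) * indicator (bad 0 \<beta>) z \<partial>M) = (\<integral>\<^sup>+z\<in>cell 0 y. 0 \<partial>M)"
          by (rule cell_integral_cong) (use False cell_eq in \<open>auto simp: bad_def indicator_def\<close>)
        then show ?thesis by simp
      qed
    next
      case (Suc j)
      show ?case
      proof (cases "2 * D < \<bar>bq (cell (Suc j) y) - \<beta>\<bar>")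
        case True then show ?thesis by (rule sel) (use Suc in auto)
      next
        case False
        have "(\<integral>\<^sup>+z\<in>cell (Suc j) y. ennreal (2 * D) * indicator (bad (Suc j) \<beta>) z \<partial>M)
          = (\<integral>\<^sup>+z\<in>cell (Suc j) y. ennreal (2 * D) * indicator (bad j \<beta>) z \<partial>M)"
        proof (rule cell_integral_cong)
          fix z assume "z \<in> cell (Suc j) y"
          then have "z \<in> bad (Suc j) \<beta> \<longleftrightarrow> z \<in> bad j \<beta>"
            using False cell_eq by (auto simp: bad_def le_Suc_eq)
          then show "ennreal (2 * D) * indicator (bad (Suc j) \<beta>) z = ennreal (2 * D) * indicator (bad j \<beta>) z"
            by (simp add: indicator_def)
        qed
        also have "\<dots> \<le> (\<integral>\<^sup>+z\<in>cell (Suc j) y. ennreal \<bar>b z - \<beta>\<bar> \<partial>M)"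
        proof (rule children_mono)
          fix z assume "z \<in> cell (Suc j) y"
          then have "z \<in> cell k x" using Suc.prems cell_eq' cell_mono by blast
          then show "(\<integral>\<^sup>+z\<in>cell j z. ennreal (2 * D) * indicator (bad j \<beta>) z \<partial>M) \<le> (\<integral>\<^sup>+z\<in>cell j z. ennreal \<bar>b z - \<beta>\<bar> \<partial>M)"
            by (intro Suc.IH) (use Suc.prems in auto)
        qed measurable
        finally show ?thesis .
      qed
    }
  qed
  let ?E = "\<lambda>\<beta> z. ennreal (exp (c * \<bar>bq (cell 0 z) - \<beta>\<bar> / D))"
  \<comment> \<open>the bound by stopped and unstopped part; \<open>16/3 = (4/3) * 4\<close>\<close>
  let ?S = "\<lambda>j \<beta> z. ennreal (exp (c * 2)) + ennreal (16/3) * indicator (bad j \<beta>) z"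
  have "(\<forall>\<beta>. \<bar>bq (cell j y) - \<beta>\<bar> \<le> 2 * D \<longrightarrow> (\<integral>\<^sup>+z\<in>cell j y. ?E \<beta> z \<partial>M) \<le> (\<integral>\<^sup>+z\<in>cell j y. ?S j \<beta> z \<partial>M)) \<and>
    (\<integral>\<^sup>+z\<in>cell j y. ?E (bq (cell j y)) z \<partial>M) \<le> ennreal (4 * measure M (cell j y))"
    (is "?J1 j y \<and> ?J2 j y") if "j \<le> k" "y \<in> cell k x" for j y
    using that
  proof (induction j arbitrary: y)
    have J2: "?J2 j y" if J1: "?J1 j y" and jy: "j \<le> k" "y \<in> cell k x" for j y
    proof -
      let ?Q = "cell j y" and ?b = "bq (cell j y)"
      have "ennreal (2 * D) * (\<integral>\<^sup>+z\<in>?Q. indicator (bad j ?b) z \<partial>M) = (\<integral>\<^sup>+z\<in>?Q. ennreal (2 * D) * indicator (bad j ?b) z \<partial>M)"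
        by (simp add: cell_integral_cmult)
      also have "\<dots> \<le> (\<integral>\<^sup>+z\<in>?Q. ennreal \<bar>b z - ?b\<bar> \<partial>M)" by (rule weak[OF jy])
      also have "\<dots> \<le> ennreal (D * measure M ?Q)" by (rule osc[OF jy])
      also have "\<dots> = ennreal (2 * D) * ennreal (measure M ?Q / 2)" using D by (simp flip: ennreal_mult)
      finally have half: "(\<integral>\<^sup>+z\<in>?Q. indicator (bad j ?b) z \<partial>M) \<le> ennreal (measure M ?Q / 2)"
        using D by (simp add: ennreal_mult_le_mult_iff)
      have "(\<integral>\<^sup>+z\<in>?Q. ?E ?b z \<partial>M) \<le> (\<integral>\<^sup>+z\<in>?Q. ?S j ?b z \<partial>M)" using J1 D by simp
      also have "\<dots> = ennreal (exp (c * 2) * measure M ?Q) + ennreal (16/3) * (\<integral>\<^sup>+z\<in>?Q. indicator (bad j ?b) z \<partial>M)"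
        by (simp add: cell_integral_add cell_integral_cmult nn_integral_cell_const)
      also have "\<dots> \<le> ennreal (4/3 * measure M ?Q) + ennreal (16/3) * ennreal (measure M ?Q / 2)"
      proof (intro add_mono mult_left_mono half ennreal_leI mult_right_mono)
        have "exp (c * 2) \<le> exp (c * (2 + \<nu>))" using c0 \<nu> by simp
        then show "exp (c * 2) \<le> 4/3" using ec by simp
      qed auto
      also have "\<dots> = ennreal (4 * measure M ?Q)" by (simp flip: ennreal_mult ennreal_plus)
      finally show ?thesis .
    qed
    {
      case 0
      have "?J1 0 y"
      proof (intro allI impI cell_integral_mono)
        fix \<beta> z assume \<beta>: "\<bar>bq (cell 0 y) - \<beta>\<bar> \<le> 2 * D" and z: "z \<in> cell 0 y"
        have "c * \<bar>bq (cell 0 z) - \<beta>\<bar> / D \<le> c * 2"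
          using \<beta> cell_eq[OF z] c0 D by (simp add: field_simps)
        then have "?E \<beta> z \<le> ennreal (exp (c * 2))" by (intro ennreal_leI) simp
        then show "?E \<beta> z \<le> ?S 0 \<beta> z" by (simp add: add_increasing2)
      qed
      then show ?case using J2[OF _ 0] by blast
    next
      case (Suc j)
      have "?J1 (Suc j) y"
      proof (intro allI impI)
        fix \<beta> assume \<beta>: "\<bar>bq (cell (Suc j) y) - \<beta>\<bar> \<le> 2 * D"
        have "(\<integral>\<^sup>+z\<in>cell (Suc j) y. ?E \<beta> z \<partial>M) \<le> (\<integral>\<^sup>+z\<in>cell (Suc j) y. ?S j \<beta> z \<partial>M)"
        proof (rule children_mono)
          fix w assume w: "w \<in> cell (Suc j) y"
          then have wk: "w \<in> cell k x" using Suc.prems cell_eq' cell_mono by blast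
          have IH: "?J1 j w" "?J2 j w" using Suc.IH[of w] Suc.prems wk by auto
          show "(\<integral>\<^sup>+z\<in>cell j w. ?E \<beta> z \<partial>M) \<le> (\<integral>\<^sup>+z\<in>cell j w. ?S j \<beta> z \<partial>M)"
          proof (cases "\<bar>bq (cell j w) - \<beta>\<bar> \<le> 2 * D")
            case True then show ?thesis using IH by blast
          next
            case False
            have far: "\<bar>bq (cell j w) - \<beta>\<bar> \<le> (2 + \<nu>) * D"
              using jump[of j w] \<beta> Suc.prems wk cell_eq[OF w] by (simp add: distrib_right)
            have "(\<integral>\<^sup>+z\<in>cell j w. ?E \<beta> z \<partial>M) \<le> (\<integral>\<^sup>+z\<in>cell j w. ennreal (4/3) * ?E (bq (cell j w)) z \<partial>M)"
            proof (rule cell_integral_mono)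
              fix z
              have "c * \<bar>bq (cell 0 z) - \<beta>\<bar> \<le> c * ((2 + \<nu>) * D + \<bar>bq (cell 0 z) - bq (cell j w)\<bar>)"
                using far c0 by (intro mult_left_mono) auto
              then have "c * \<bar>bq (cell 0 z) - \<beta>\<bar> / D \<le> c * (2 + \<nu>) + c * \<bar>bq (cell 0 z) - bq (cell j w)\<bar> / D"
                using D by (simp add: field_simps)
              then have "exp (c * \<bar>bq (cell 0 z) - \<beta>\<bar> / D) \<le> 4/3 * exp (c * \<bar>bq (cell 0 z) - bq (cell j w)\<bar> / D)"
                by (metis ec exp_add exp_le_cancel_iff)
              then show "?E \<beta> z \<le> ennreal (4/3) * ?E (bq (cell j w)) z"
                by (simp flip: ennreal_mult add: ennreal_leI)
            qed
            also have "\<dots> = ennreal (4/3) * (\<integral>\<^sup>+z\<in>cell j w. ?E (bq (cell j w)) z \<partial>M)"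
              by (rule cell_integral_cmult) measurable
            also have "\<dots> \<le> ennreal (4/3) * ennreal (4 * measure M (cell j w))" using IH by (intro mult_left_mono) auto
            also have "\<dots> = (\<integral>\<^sup>+z\<in>cell j w. ennreal (16/3) \<partial>M)"
              by (simp add: nn_integral_cell_const flip: ennreal_mult)
            also have "\<dots> \<le> (\<integral>\<^sup>+z\<in>cell j w. ?S j \<beta> z \<partial>M)"
            proof (rule cell_integral_mono)
              fix z assume "z \<in> cell j w"
              then have "z \<in> bad j \<beta>" using False cell_eq by (auto simp: bad_def)
              then show "ennreal (16/3) \<le> ?S j \<beta> z" by (simp add: add_increasing)
            qed
            finally show ?thesis .
          qed
        qed measurable
        also have "\<dots> \<le> (\<integral>\<^sup>+z\<in>cell (Suc j) y. ?S (Suc j) \<beta> z \<partial>M)"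
          by (intro cell_integral_mono add_mono mult_left_mono) (auto simp: bad_def indicator_def le_Suc_eq)
        finally show "(\<integral>\<^sup>+z\<in>cell (Suc j) y. ?E \<beta> z \<partial>M) \<le> (\<integral>\<^sup>+z\<in>cell (Suc j) y. ?S (Suc j) \<beta> z \<partial>M)" .
      qed
      then show ?case using J2[OF _ Suc.prems] by blast
    }
  qed
  then show ?thesis using cell_self by blast
qed

end

section \<open>Shifted dyadic grids\<close>

text \<open>
  Half-open cubes, since these partition the space; the closed cubes differ from them by a
  null set.
\<close>

definition hb :: "real ^ 'n \<Rightarrow> real \<Rightarrow> (real ^ 'n) set"
  where "hb z l = {x. \<forall>i. z $ i \<le> x $ i \<and> x $ i < z $ i + l}"

lemma hb_sets_borel [measurable]: "hb z l \<in> sets borel"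
proof -
  have "{x \<in> space borel. \<forall>i\<in>UNIV. z $ i \<le> x $ i \<and> x $ i < z $ i + l} \<in> sets borel"
    by measurable
  then show ?thesis by (simp add: hb_def)
qed

lemma hb_sets [measurable]: "hb z l \<in> sets lebesgue"
  using hb_sets_borel by auto

lemma hb_subset_cube: "hb z l \<subseteq> cube z l"
  by (auto simp: hb_def cube_def mem_box_cart less_imp_le)

lemma box_subset_hb: "box z (\<chi> i. z $ i + l) \<subseteq> hb z l"
  by (auto simp: hb_def mem_box_cart less_imp_le)

lemma cube_sets [measurable]: "cube z l \<in> sets lebesgue"
  by (simp add: cube_def)

lemma AE_hb_cube: "AE x in lebesgue. x \<in> hb z l \<longleftrightarrow> x \<in> cube z l"
proof -
  let ?b = "\<chi> i. z $ i + l"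
  have "negligible (cbox z ?b - box z ?b)" by (rule negligible_frontier_interval)
  then have "cbox z ?b - box z ?b \<in> null_sets lebesgue" by (simp add: negligible_iff_null_sets)
  then have "AE x in lebesgue. x \<notin> cbox z ?b - box z ?b" by (rule AE_not_in)
  then show ?thesis
    using hb_subset_cube[of z l] box_subset_hb[of z l] by (auto simp: cube_def)
qed

lemma nn_integral_hb_cube:
  "(\<integral>\<^sup>+x\<in>hb z l. \<phi> x \<partial>lebesgue) = (\<integral>\<^sup>+x\<in>cube z l. \<phi> x \<partial>lebesgue)"
  using AE_hb_cube[of z l] by (intro nn_integral_cong_AE) (auto simp: indicator_def)

lemma measure_cube: "0 \<le> l \<Longrightarrow> measure lebesgue (cube (z :: real ^ 'n) l) = l ^ CARD('n)"
  by (simp add: cube_def content_cbox_cart interval_ne_empty_cart)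

lemma emeasure_cube: "0 \<le> l \<Longrightarrow> emeasure lebesgue (cube (z :: real ^ 'n) l) = ennreal (l ^ CARD('n))"
proof -
  assume l: "0 \<le> l"
  have "cube z l \<in> lmeasurable" by (simp add: cube_def)
  then show ?thesis using measure_cube[OF l, of z] by (simp add: emeasure_eq_measure2)
qed

lemma emeasure_hb:
  assumes "0 \<le> l"
  shows "emeasure lebesgue (hb (z :: real ^ 'n) l) = ennreal (l ^ CARD('n))"
proof -
  have "(\<integral>\<^sup>+x\<in>hb z l. 1 \<partial>lebesgue) = (\<integral>\<^sup>+x\<in>cube z l. 1 \<partial>lebesgue)"
    by (rule nn_integral_hb_cube)
  moreover have "(\<integral>\<^sup>+x\<in>A. 1 \<partial>lebesgue) = emeasure lebesgue A" if "A \<in> sets lebesgue" for A :: "(real ^ 'n) set"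
    using nn_integral_indicator[OF that] by simp
  ultimately show ?thesis using emeasure_cube[OF assms, of z] hb_sets cube_sets by metis
qed

lemma measure_hb: "0 \<le> l \<Longrightarrow> measure lebesgue (hb (z :: real ^ 'n) l) = l ^ CARD('n)"
  unfolding measure_def by (subst emeasure_hb) auto

lemma hb_subsetD:
  assumes "hb z l \<subseteq> hb z' l'" "0 < l"
  shows "z' $ i \<le> z $ i \<and> z $ i + l \<le> z' $ i + l'"
proof
  have "z \<in> hb z l" using assms(2) by (simp add: hb_def)
  then have z: "z \<in> hb z' l'" using assms(1) by auto
  then show "z' $ i \<le> z $ i" by (simp add: hb_def)
  show "z $ i + l \<le> z' $ i + l'"
  proof (rule ccontr)
    assume n: "\<not> z $ i + l \<le> z' $ i + l'"
    define w where "w = (\<chi> k. if k = i then max (z $ i) (z' $ i + l') else z $ k)"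
    have "w \<in> hb z l" using n assms(2) by (auto simp: hb_def w_def)
    then have "w \<in> hb z' l'" using assms(1) by auto
    then have "w $ i < z' $ i + l'" by (simp add: hb_def)
    then show False by (simp add: w_def)
  qed
qed

lemma hb_inject:
  assumes "hb z l = hb z' l'" "0 < l" "0 < l'"
  shows "z = z' \<and> l = l'"
proof -
  have "z' $ i \<le> z $ i \<and> z $ i + l \<le> z' $ i + l'" "z $ i \<le> z' $ i \<and> z' $ i + l' \<le> z $ i + l" for i
    using hb_subsetD[of z l z' l' i] hb_subsetD[of z' l' z l i] assms by auto
  then have "z $ i = z' $ i \<and> l = l'" for i by (smt (verit))
  then show ?thesis by (auto simp: vec_eq_iff)
qed

text \<open>
  The cell of side \<open>\<delta> * 2 ^ j\<close> around \<open>x\<close> in the grid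
  through \<open>\<tau>\<close>. The smallest side \<open>\<delta>\<close> is fixed and
  \<open>j\<close> counts upwards, as in the abstract tree.
\<close>

definition dcell :: "real ^ 'n \<Rightarrow> real \<Rightarrow> nat \<Rightarrow> real ^ 'n \<Rightarrow> (real ^ 'n) set"
  where "dcell \<tau> \<delta> j x = {y. \<forall>i. \<lfloor>(y $ i - \<tau> $ i) / (\<delta> * 2 ^ j)\<rfloor> = \<lfloor>(x $ i - \<tau> $ i) / (\<delta> * 2 ^ j)\<rfloor>}"

definition corner :: "real ^ 'n \<Rightarrow> real \<Rightarrow> nat \<Rightarrow> real ^ 'n \<Rightarrow> real ^ 'n"
  where "corner \<tau> \<delta> j x = (\<chi> i. \<tau> $ i + \<delta> * 2 ^ j * of_int \<lfloor>(x $ i - \<tau> $ i) / (\<delta> * 2 ^ j)\<rfloor>)"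

lemma dcell_eq_hb: "0 < \<delta> \<Longrightarrow> dcell \<tau> \<delta> j x = hb (corner \<tau> \<delta> j x) (\<delta> * 2 ^ j)"
proof -
  assume d: "0 < \<delta>"
  define l where "l = \<delta> * 2 ^ j"
  have l: "0 < l" using d by (simp add: l_def)
  have "\<lfloor>(y - t) / l\<rfloor> = m \<longleftrightarrow> t + l * of_int m \<le> y \<and> y < t + l * of_int m + l" for y t :: real and m
    using l by (simp add: floor_eq_iff field_simps)
  then show ?thesis unfolding dcell_def hb_def corner_def l_def[symmetric] by simp
qed

lemma dcell_tree: "0 < \<delta> \<Longrightarrow> cell_tree (lebesgue :: (real ^ 'n) measure) (dcell \<tau> \<delta>)"
proof
  assume d: "0 < \<delta>"
  fix x :: "real ^ 'n" and j
  define C where "C j f = {y. \<forall>i. \<lfloor>(y $ i - \<tau> $ i) / (\<delta> * 2 ^ j)\<rfloor> = f i}" for j and f :: "'n \<Rightarrow> int"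
  have dC: "dcell \<tau> \<delta> j y = C j (\<lambda>i. \<lfloor>(y $ i - \<tau> $ i) / (\<delta> * 2 ^ j)\<rfloor>)" for j y
    by (simp add: dcell_def C_def)
  have fl: "\<lfloor>(y - t) / (\<delta> * 2 ^ Suc j)\<rfloor> = \<lfloor>(y - t) / (\<delta> * 2 ^ j)\<rfloor> div 2" for y t
  proof -
    have "(y - t) / (\<delta> * 2 ^ Suc j) = ((y - t) / (\<delta> * 2 ^ j)) / of_int 2" by (simp add: mult_ac)
    then show ?thesis by (simp only: floor_divide_real_eq_div)
  qed
  show "x \<in> dcell \<tau> \<delta> j x" by (simp add: dcell_def)
  show "dcell \<tau> \<delta> j x \<subseteq> dcell \<tau> \<delta> (Suc j) x"
    unfolding dcell_def fl by auto
  show "dcell \<tau> \<delta> j x \<in> sets lebesgue" unfolding dcell_eq_hb[OF d] by (rule hb_sets)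
  show "0 < measure lebesgue (dcell \<tau> \<delta> j x)" using d unfolding dcell_eq_hb[OF d] by (subst measure_hb) auto
  show "emeasure lebesgue (dcell \<tau> \<delta> j x) < \<infinity>" using d unfolding dcell_eq_hb[OF d] by (subst emeasure_hb) auto
  show "countable (range (dcell \<tau> \<delta> j))"
  proof (rule countable_subset)
    show "range (dcell \<tau> \<delta> j) \<subseteq> range (C j)" using dC by auto
  qed auto
  show "finite (dcell \<tau> \<delta> j ` dcell \<tau> \<delta> (Suc j) x)"
  proof (rule finite_subset)
    define m where "m i = \<lfloor>(x $ i - \<tau> $ i) / (\<delta> * 2 ^ Suc j)\<rfloor>" for i
    show "dcell \<tau> \<delta> j ` dcell \<tau> \<delta> (Suc j) x \<subseteq> C j ` (PiE UNIV (\<lambda>i. {2 * m i .. 2 * m i + 1}))"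
    proof (intro image_subsetI)
      fix y assume "y \<in> dcell \<tau> \<delta> (Suc j) x"
      then have y: "\<lfloor>(y $ i - \<tau> $ i) / (\<delta> * 2 ^ j)\<rfloor> div 2 = m i" for i
        unfolding dcell_def m_def fl by auto
      have "\<lfloor>(y $ i - \<tau> $ i) / (\<delta> * 2 ^ j)\<rfloor> \<in> {2 * m i .. 2 * m i + 1}" for i
        using y[of i] by auto
      then show "dcell \<tau> \<delta> j y \<in> C j ` (PiE UNIV (\<lambda>i. {2 * m i .. 2 * m i + 1}))"
        unfolding dC by (intro imageI) (simp add: PiE_UNIV_domain)
    qed
    show "finite (C j ` (PiE UNIV (\<lambda>i. {2 * m i .. 2 * m i + 1})))"
      by (intro finite_imageI finite_PiE) auto
  qed
  fix y assume "y \<in> dcell \<tau> \<delta> j x"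
  then show "dcell \<tau> \<delta> j y = dcell \<tau> \<delta> j x" by (simp add: dcell_def)
qed simp

text \<open>
  If \<open>a\<close> and \<open>b\<close> were separated both in the grid of step
  \<open>l\<close> through \<open>s\<close> and in its translate by a third of \<open>l * 2
  ^ k\<close>, then two division points, of the two grids, would lie within \<open>l /
  3\<close> of each other; but their distance is a multiple of \<open>l / 3\<close> that is
  nonzero, because \<open>3\<close> does not divide \<open>2 ^ k\<close>.
\<close>

lemma one_third:
  fixes a b s l :: real and k :: nat
  assumes l: "0 < l" and ab: "\<bar>a - b\<bar> < l / 3"
  shows "\<lfloor>(a - s) / l\<rfloor> = \<lfloor>(b - s) / l\<rfloor> \<or>
    \<lfloor>(a - (s - l * 2 ^ k / 3)) / l\<rfloor> = \<lfloor>(b - (s - l * 2 ^ k / 3)) / l\<rfloor>"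
proof -
  have gap: "\<exists>m::int. min u v < m \<and> m \<le> max u v" if "\<lfloor>u\<rfloor> \<noteq> \<lfloor>v\<rfloor>" for u v :: real
    using that by (intro exI[of _ "\<lfloor>max u v\<rfloor>"]) linarith
  define u v where "u = (a - s) / l" and "v = (b - s) / l"
  have uv: "\<bar>u - v\<bar> < 1/3" using l ab by (simp add: u_def v_def field_simps abs_if split: if_splits)
  have sh: "(a - (s - l * 2 ^ k / 3)) / l = u + 2 ^ k / 3" "(b - (s - l * 2 ^ k / 3)) / l = v + 2 ^ k / 3"
    using l by (simp_all add: u_def v_def field_simps)
  show ?thesis
  proof (rule ccontr)
    assume "\<not> ?thesis"
    then have "\<lfloor>u\<rfloor> \<noteq> \<lfloor>v\<rfloor>" "\<lfloor>u + 2 ^ k / 3\<rfloor> \<noteq> \<lfloor>v + 2 ^ k / 3\<rfloor>"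
      unfolding sh by (auto simp: u_def v_def)
    then obtain m m' :: int where m: "min u v < m" "m \<le> max u v"
      and m': "min (u + 2 ^ k / 3) (v + 2 ^ k / 3) < m'" "m' \<le> max (u + 2 ^ k / 3) (v + 2 ^ k / 3)"
      using gap by meson
    have "\<bar>real_of_int (3 * (m' - m)) - 2 ^ k\<bar> < 1" using m m' uv by (simp add: min_def max_def split: if_splits)
    then have "real_of_int \<bar>3 * (m' - m) - 2 ^ k\<bar> < 1" by simp
    then have "\<bar>3 * (m' - m) - 2 ^ k\<bar> < 1" by linarith
    then have "3 * (m' - m) = 2 ^ k" by linarith
    then have "(3::int) dvd 2 ^ k" by (metis dvd_triv_left)
    then have "(3::int) dvd 2" by (rule prime_dvd_power[rotated]) simp
    then show False by simp
  qed
qed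

text \<open>
  The two values in each coordinate differ by \<open>T / 3\<close>, as the previous lemma
  needs, and are such that the cell of side \<open>T\<close> that starts there contains all
  points near the origin.
\<close>

definition shift :: "real \<Rightarrow> ('n \<Rightarrow> bool) \<Rightarrow> real ^ 'n"
  where "shift T e = (\<chi> i. if e i then - T / 3 else - (2 * T / 3))"

lemma common_dcell:
  fixes x y :: "real ^ 'n"
  assumes d: "0 < \<delta>" and "j \<le> J" and xy: "\<And>i. \<bar>x $ i - y $ i\<bar> < \<delta> * 2 ^ j / 3"
  shows "\<exists>e. y \<in> dcell (shift (\<delta> * 2 ^ J) e) \<delta> j x"
proof -
  define l where "l = \<delta> * 2 ^ j"
  have T: "\<delta> * 2 ^ J = l * 2 ^ (J - j)" using assms by (simp add: l_def mult.assoc flip: power_add)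
  have l0: "0 < l" using d by (simp add: l_def)
  define e where "e i \<longleftrightarrow> \<lfloor>(x $ i + (l * 2 ^ (J - j)) / 3) / l\<rfloor> = \<lfloor>(y $ i + (l * 2 ^ (J - j)) / 3) / l\<rfloor>" for i
  have "y \<in> dcell (shift (\<delta> * 2 ^ J) e) \<delta> j x"
    unfolding dcell_def mem_Collect_eq T shift_def l_def[symmetric]
  proof
    fix i
    have "\<lfloor>(x $ i - - (l * 2 ^ (J - j)) / 3) / l\<rfloor> = \<lfloor>(y $ i - - (l * 2 ^ (J - j)) / 3) / l\<rfloor> \<or>
       \<lfloor>(x $ i - (- (l * 2 ^ (J - j)) / 3 - l * 2 ^ (J - j) / 3)) / l\<rfloor> = \<lfloor>(y $ i - (- (l * 2 ^ (J - j)) / 3 - l * 2 ^ (J - j) / 3)) / l\<rfloor>"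
      by (rule one_third[OF l0]) (use xy in \<open>simp add: l_def\<close>)
    moreover have "- (l * 2 ^ (J - j)) / 3 - l * 2 ^ (J - j) / 3 = - (2 * (l * 2 ^ (J - j)) / 3)" by simp
    ultimately show "\<lfloor>(y $ i - (\<chi> i. if e i then - (l * 2 ^ (J - j)) / 3 else - (2 * (l * 2 ^ (J - j)) / 3)) $ i) / l\<rfloor>
       = \<lfloor>(x $ i - (\<chi> i. if e i then - (l * 2 ^ (J - j)) / 3 else - (2 * (l * 2 ^ (J - j)) / 3)) $ i) / l\<rfloor>"
      by (auto simp: e_def)
  qed
  then show ?thesis by blast
qed

lemma corner_root:
  assumes "0 < \<delta>" and "\<And>i. \<tau> $ i \<le> x $ i \<and> x $ i < \<tau> $ i + \<delta> * 2 ^ J"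
  shows "corner \<tau> \<delta> J x = \<tau>"
proof -
  have "\<lfloor>(x $ i - \<tau> $ i) / (\<delta> * 2 ^ J)\<rfloor> = 0" for i
    using assms(1) assms(2)[of i] by (simp add: floor_eq_iff field_simps)
  then show ?thesis by (simp add: corner_def vec_eq_iff)
qed

lemma dcell_root:
  assumes "0 < \<delta>" and "x \<in> hb \<tau> (\<delta> * 2 ^ J)"
  shows "dcell \<tau> \<delta> J x = hb \<tau> (\<delta> * 2 ^ J)"
  using corner_root[of \<delta> \<tau> x J] assms by (simp add: dcell_eq_hb hb_def)

lemma shift_root:
  fixes x :: "real ^ 'n"
  assumes "\<And>i. \<bar>x $ i\<bar> < T / 3"
  shows "x \<in> hb (shift T e) T"
proof -
  have "shift T e $ i \<le> x $ i \<and> x $ i < shift T e $ i + T" for i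
    using assms[of i] by (auto simp: shift_def)
  then show ?thesis by (simp add: hb_def)
qed

text \<open>
  The enlargement keeps the lower corner, not the centre. It is a function of the cell as a
  set because the abstract stopping lemma attaches coefficients to sets.
\<close>

definition enlarge :: "real \<Rightarrow> (real ^ 'n) set \<Rightarrow> (real ^ 'n) set"
  where "enlarge L Q = (THE H. \<exists>z l. 0 < l \<and> Q = hb z l \<and> H = cube z (L * l))"

lemma enlarge_hb: "0 < l \<Longrightarrow> enlarge L (hb z l) = cube z (L * l)"
  unfolding enlarge_def using hb_inject by (intro the_equality) blast+

lemma cube_subsetI:
  assumes "\<And>i. z' $ i \<le> z $ i \<and> z $ i + l \<le> z' $ i + l'"
  shows "cube z l \<subseteq> cube z' l'"
proof
  fix x assume x: "x \<in> cube z l"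
  have "z' $ i \<le> x $ i \<and> x $ i \<le> z' $ i + l'" for i
    using assms[of i] x by (simp add: cube_def mem_box_cart) (smt (verit))
  then show "x \<in> cube z' l'" by (simp add: cube_def mem_box_cart)
qed

lemma enlarge_dcell_mono:
  assumes d: "0 < \<delta>" and L: "1 \<le> L" and "i \<le> j"
  shows "enlarge L (dcell \<tau> \<delta> i x) \<subseteq> enlarge L (dcell \<tau> \<delta> j x)"
proof -
  interpret cell_tree lebesgue "dcell \<tau> \<delta>" by (rule dcell_tree[OF d])
  let ?l = "\<delta> * 2 ^ i" and ?l' = "\<delta> * 2 ^ j"
  have l: "0 < ?l" "?l \<le> ?l'" using d \<open>i \<le> j\<close> by (auto intro: power_increasing)
  have sub: "hb (corner \<tau> \<delta> i x) ?l \<subseteq> hb (corner \<tau> \<delta> j x) ?l'"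
    using cell_mono[OF \<open>i \<le> j\<close>, of x] d by (simp add: dcell_eq_hb)
  have "(L - 1) * ?l \<le> (L - 1) * ?l'" using L by (intro mult_left_mono l(2)) auto
  then have Ll: "L * ?l - ?l \<le> L * ?l' - ?l'" by (simp only: left_diff_distrib mult_1)
  have "cube (corner \<tau> \<delta> i x) (L * ?l) \<subseteq> cube (corner \<tau> \<delta> j x) (L * ?l')"
  proof (rule cube_subsetI)
    fix k
    have "corner \<tau> \<delta> j x $ k \<le> corner \<tau> \<delta> i x $ k" "corner \<tau> \<delta> i x $ k + ?l \<le> corner \<tau> \<delta> j x $ k + ?l'"
      using hb_subsetD[OF sub l(1), of k] by auto
    then show "corner \<tau> \<delta> j x $ k \<le> corner \<tau> \<delta> i x $ k \<and> corner \<tau> \<delta> i x $ k + L * ?l \<le> corner \<tau> \<delta> j x $ k + L * ?l'"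
      using Ll by linarith
  qed
  then show ?thesis using d l by (simp add: dcell_eq_hb enlarge_hb)
qed

section \<open>Mean oscillation over cubes\<close>

lemma avg_hb: "avg b (hb z l) = avg b (cube (z :: real ^ 'n) l)" if "0 \<le> l" "b \<in> borel_measurable lebesgue"
proof -
  have [measurable]: "b \<in> borel_measurable lebesgue" by fact
  have "(LINT x:hb z l|lebesgue. b x) = (LINT x:cube z l|lebesgue. b x)"
    unfolding set_lebesgue_integral_def
    by (rule integral_cong_AE) (use AE_hb_cube[of z l] in \<open>auto simp: indicator_def\<close>)
  then show ?thesis using that by (simp add: avg_def measure_cube measure_hb del: measure_completion)
qed

lemma locally_integrable_measurable:
  fixes f :: "real ^ 'n \<Rightarrow> real"
  assumes "locally_integrable f" shows "f \<in> borel_measurable lebesgue"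
proof (rule borel_measurable_LIMSEQ_real)
  show "(\<lambda>N. indicator (cball 0 (real N)) x * f x) \<longlonglongrightarrow> f x" for x
  proof (rule tendsto_eventually)
    obtain M where "norm x \<le> real M" using real_arch_simple by blast
    then show "\<forall>\<^sub>F N in sequentially. indicator (cball 0 (real N)) x * f x = f x"
      by (intro eventually_sequentiallyI[of M]) (auto simp: indicator_def)
  qed
  show "(\<lambda>x. indicator (cball 0 (real N)) x * f x) \<in> borel_measurable lebesgue" for N
  proof -
    have "integrable lebesgue (\<lambda>x. indicator (cball 0 (real N)) x *\<^sub>R f x)"
      using assms[unfolded locally_integrable_def, rule_format, OF compact_cball]
      unfolding set_integrable_def .
    then show ?thesis using borel_measurable_integrable[of lebesgue "\<lambda>x. indicator (cball 0 (real N)) x *\<^sub>R f x"] by simp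
  qed
qed

lemma locally_integrable_subset:
  assumes "locally_integrable f" "compact U" "S \<subseteq> U" "S \<in> sets lebesgue"
  shows "set_integrable lebesgue S f"
  using assms set_integrable_subset unfolding locally_integrable_def by blast

lemma cube_in_cubes: "0 < l \<Longrightarrow> cube z l \<in> cubes"
  unfolding cubes_def by (intro CollectI exI[of _ z] exI[of _ l]) simp

lemma compact_cube: "compact (cube z l)"
  by (simp add: cube_def compact_cbox)

lemma avg_diff_le:
  fixes b :: "'a \<Rightarrow> real"
  assumes int: "set_integrable M S b" and S: "S \<in> sets M" "emeasure M S < \<infinity>"
  shows "ennreal (\<bar>(LINT x:S|M. b x) / measure M S - \<beta>\<bar> * measure M S) \<le> (\<integral>\<^sup>+x\<in>S. ennreal \<bar>b x - \<beta>\<bar> \<partial>M)"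
proof (cases "measure M S = 0")
  case False
  then have m: "0 < measure M S" by (simp add: zero_less_measure_iff)
  have c: "set_integrable M S (\<lambda>x. \<beta>)"
    using S by (simp add: set_integrable_def)
  have d: "set_integrable M S (\<lambda>x. b x - \<beta>)" by (rule set_integral_diff(1)[OF int c])
  have "(LINT x:S|M. b x - \<beta>) = (LINT x:S|M. b x) - measure M S * \<beta>"
  proof -
    have "(LINT x:S|M. \<beta>) = measure M S * \<beta>"
      using S by (simp add: set_lebesgue_integral_def sets.Int_space_eq2)
    then show ?thesis using set_integral_diff(2)[OF int c] by simp
  qed
  then have "\<bar>(LINT x:S|M. b x) / measure M S - \<beta>\<bar> * measure M S = \<bar>LINT x:S|M. b x - \<beta>\<bar>"
  proof -
    have "\<bar>(LINT x:S|M. b x) / measure M S - \<beta>\<bar> * measure M S = \<bar>((LINT x:S|M. b x) / measure M S - \<beta>) * measure M S\<bar>"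
      by (simp add: abs_mult)
    also have "((LINT x:S|M. b x) / measure M S - \<beta>) * measure M S = (LINT x:S|M. b x) - measure M S * \<beta>"
      using m by (simp add: field_simps)
    finally show ?thesis using \<open>(LINT x:S|M. b x - \<beta>) = (LINT x:S|M. b x) - measure M S * \<beta>\<close> by simp
  qed
  also have "\<dots> = \<bar>\<integral>x. indicator S x * (b x - \<beta>) \<partial>M\<bar>" by (simp add: set_lebesgue_integral_def)
  finally have "ennreal (\<bar>(LINT x:S|M. b x) / measure M S - \<beta>\<bar> * measure M S) = ennreal \<bar>\<integral>x. indicator S x * (b x - \<beta>) \<partial>M\<bar>" by simp
  also have "\<dots> \<le> (\<integral>\<^sup>+x. ennreal (norm (indicator S x * (b x - \<beta>))) \<partial>M)"
    using integral_norm_bound_ennreal[of M "\<lambda>x. indicator S x * (b x - \<beta>)"] d by (simp add: set_integrable_def)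
  also have "\<dots> = (\<integral>\<^sup>+x\<in>S. ennreal \<bar>b x - \<beta>\<bar> \<partial>M)"
    by (intro nn_integral_cong) (auto simp: indicator_def)
  finally show ?thesis .
qed simp

lemma oscillation_cube:
  fixes b :: "real ^ 'n \<Rightarrow> real"
  assumes N: "osc_bound 1 a b N" and l: "0 < l"
  shows "(\<integral>\<^sup>+x\<in>cube z l. ennreal \<bar>b x - avg b (cube z l)\<bar> \<partial>lebesgue) \<le> ennreal (N * a (cube z l) * l ^ CARD('n))"
proof -
  let ?Q = "cube z l" and ?f = "\<lambda>x. \<bar>b x - avg b (cube z l)\<bar>"
  have Q: "?Q \<in> cubes" using l by (auto simp: cubes_def)
  have int: "set_integrable lebesgue ?Q ?f" and le: "avg ?f ?Q \<le> N * a ?Q"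
    using N Q by (auto simp: osc_bound_def avg_def set_lebesgue_integral_def)
  have m: "measure lebesgue ?Q = l ^ CARD('n)" using l by (simp add: measure_cube)
  have "(\<integral>\<^sup>+x\<in>?Q. ennreal (?f x) \<partial>lebesgue) = (\<integral>\<^sup>+x. ennreal (indicator ?Q x * ?f x) \<partial>lebesgue)"
    by (intro nn_integral_cong) (auto simp: indicator_def)
  also have "\<dots> = ennreal (LINT x:?Q|lebesgue. ?f x)"
    unfolding set_lebesgue_integral_def real_scaleR_def
    by (rule nn_integral_eq_integral) (use int in \<open>auto simp: set_integrable_def\<close>)
  also have "(LINT x:?Q|lebesgue. ?f x) = avg ?f ?Q * l ^ CARD('n)" using l m by (simp add: avg_def del: measure_completion)
  also have "\<dots> \<le> N * a ?Q * l ^ CARD('n)" using le l by (intro mult_right_mono) auto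
  finally show ?thesis by (simp add: ennreal_leI)
qed

text \<open>
  The deviation of the two averages is at most the mean deviation over the smaller cube,
  hence \<open>2 ^ n\<close> times the mean oscillation over the larger one.
\<close>

lemma avg_subcube:
  fixes b :: "real ^ 'n \<Rightarrow> real"
  assumes b: "locally_integrable b" and N: "osc_bound 1 a b N" and l: "0 < l" "l \<le> 2 * l'" "cube z' l' \<subseteq> cube z l" and a: "0 \<le> N * a (cube z l)"
  shows "\<bar>avg b (cube z' l') - avg b (cube z l)\<bar> \<le> 2 ^ CARD('n) * (N * a (cube z l))"
proof -
  have l': "0 < l'" using l by simp
  have fin: "emeasure lebesgue (cube z' l') < \<infinity>" using l' by (subst emeasure_cube) auto
  have m: "measure lebesgue (cube z' l') = l' ^ CARD('n)" using l' by (simp add: measure_cube del: measure_completion)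
  have "ennreal (\<bar>avg b (cube z' l') - avg b (cube z l)\<bar> * l' ^ CARD('n)) \<le> (\<integral>\<^sup>+x\<in>cube z' l'. ennreal \<bar>b x - avg b (cube z l)\<bar> \<partial>lebesgue)"
    using avg_diff_le[OF locally_integrable_subset[OF b compact_cube order.refl cube_sets] cube_sets fin, of "avg b (cube z l)"]
    unfolding avg_def m by simp
  also have "\<dots> \<le> (\<integral>\<^sup>+x\<in>cube z l. ennreal \<bar>b x - avg b (cube z l)\<bar> \<partial>lebesgue)"
    by (intro nn_integral_mono) (use l in \<open>auto simp: indicator_def\<close>)
  also have "\<dots> \<le> ennreal (N * a (cube z l) * l ^ CARD('n))" by (rule oscillation_cube[OF N l(1)])
  also have "\<dots> \<le> ennreal (N * a (cube z l) * (2 * l') ^ CARD('n))"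
    by (intro ennreal_leI mult_left_mono power_mono a) (use l in auto)
  finally have "\<bar>avg b (cube z' l') - avg b (cube z l)\<bar> * l' ^ CARD('n) \<le> (2 ^ CARD('n) * (N * a (cube z l))) * l' ^ CARD('n)"
    using mult_nonneg_nonneg[OF a, of "(2 * l') ^ CARD('n)"] l' by (subst (asm) ennreal_le_iff) (auto simp: power_mult_distrib mult_ac)
  then show ?thesis using l' by (simp add: mult_le_cancel_right)
qed

lemma lebesgue_points_cubes:
  fixes b :: "real ^ 'n \<Rightarrow> real"
  assumes b: "locally_integrable b"
  shows "AE x in lebesgue. \<forall>e>0. \<exists>d>0. \<forall>h. 0 < h \<and> h < d \<longrightarrow> \<bar>avg b (cube x h) - b x\<bar> < e"
proof -
  have "b integrable_on cbox u v" for u v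
    using b by (simp add: locally_integrable_def set_lebesgue_integral_eq_integral(1))
  then obtain Z where Z: "negligible Z" and
    pt: "\<And>x e. \<lbrakk>x \<notin> Z; 0 < e\<rbrakk> \<Longrightarrow> \<exists>d>0. \<forall>h. 0 < h \<and> h < d \<longrightarrow>
          norm(integral (cbox x (x + h *\<^sub>R One)) b /\<^sub>R h ^ DIM(real ^ 'n) - b x) < e"
    by (rule integrable_ccontinuous_explicit) blast
  have cb: "cbox x (x + h *\<^sub>R One) = cube x h" for x :: "real ^ 'n" and h
    unfolding cube_def Cart_1[symmetric] by (rule arg_cong2[where f = cbox]) (auto simp: vec_eq_iff)
  have av: "integral (cbox x (x + h *\<^sub>R One)) b /\<^sub>R h ^ DIM(real ^ 'n) = avg b (cube x h)" if "0 < h" for x h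
  proof -
    have "integral (cube x h) b = (LINT y:cube x h|lebesgue. b y)"
      using locally_integrable_subset[OF b compact_cube order.refl cube_sets]
      by (simp add: set_lebesgue_integral_eq_integral(2))
    then show ?thesis using that by (simp add: cb avg_def measure_cube divide_inverse_commute del: measure_completion)
  qed
  have "AE x in lebesgue. x \<notin> Z" using Z by (simp add: AE_not_in negligible_iff_null_sets)
  then show ?thesis
  proof (eventually_elim, intro allI impI)
    fix x and e :: real assume x: "x \<notin> Z" and e: "0 < e"
    from pt[OF x e] obtain d where d: "d > 0" "\<And>h. 0 < h \<Longrightarrow> h < d \<Longrightarrow> norm(integral (cbox x (x + h *\<^sub>R One)) b /\<^sub>R h ^ DIM(real ^ 'n) - b x) < e" by blast
    have "\<bar>avg b (cube x h) - b x\<bar> < e" if "0 < h" "h < d" for h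
      using d(2)[OF that] unfolding av[OF that(1)] by simp
    then show "\<exists>d>0. \<forall>h. 0 < h \<and> h < d \<longrightarrow> \<bar>avg b (cube x h) - b x\<bar> < e" using d(1) by blast
  qed
qed

text \<open>
  The inequality on the tree of dyadic subcells bounds the averages of \<open>b\<close> over
  ever finer cells; almost everywhere these come close to \<open>b\<close>, by Lebesgue's
  differentiation theorem, and Fatou's lemma gives the claim. Differentiation is along cubes
  with a corner at \<open>x\<close>, which are compared with the cells through a common cube
  of twice the side. It may stick out of \<open>cube z l\<close>, which is why
  \<open>a\<close> is evaluated on the doubled cube.
\<close>

lemma John_Nirenberg_cube:
  fixes b :: "real ^ 'n \<Rightarrow> real" and z :: "real ^ 'n" and D :: real
  defines "c \<equiv> ln (4/3) / (2 + 2 ^ CARD('n))"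
  assumes b: "locally_integrable b" and N: "osc_bound 1 a b N" "0 \<le> N"
    and t: "0 \<le> t" "\<And>Q Q'. Q \<in> cubes \<Longrightarrow> Q' \<in> cubes \<Longrightarrow> Q' \<subseteq> Q \<Longrightarrow> a Q' \<le> t * a Q"
    and a0: "\<And>Q. Q \<in> cubes \<Longrightarrow> 0 \<le> a Q"
    and l: "0 < l" and D: "0 < D" "N * (t * a (cube z (2 * l))) \<le> D"
  shows "(\<integral>\<^sup>+x\<in>hb z l. ennreal (exp (c * \<bar>b x - avg b (cube z l)\<bar> / D)) \<partial>lebesgue)
    \<le> ennreal (4 * exp (c * (2 ^ (CARD('n) + 1) + 1)) * l ^ CARD('n))"
proof -
  let ?n = "CARD('n)"
  have c0: "0 < c" unfolding c_def by (intro divide_pos_pos) (auto intro: add_pos_pos)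
  have bm[measurable]: "b \<in> borel_measurable lebesgue" by (rule locally_integrable_measurable[OF b])
  have big: "N * a (cube w s) \<le> D" if "0 < s" "cube w s \<subseteq> cube z (2 * l)" for w s
  proof -
    have "a (cube w s) \<le> t * a (cube z (2 * l))"
    proof (rule t(2)[OF _ _ that(2)])
      show "cube z (2 * l) \<in> cubes" "cube w s \<in> cubes" using l that by (auto intro: cube_in_cubes)
    qed
    then show ?thesis using mult_left_mono[OF _ N(2)] D(2) order_trans by blast
  qed
  have a0': "0 \<le> N * a (cube w s)" if "0 < s" for w s
    by (intro mult_nonneg_nonneg N(2) a0 cube_in_cubes that)
  define \<delta> where "\<delta> k = l / 2 ^ k" for k :: nat
  have dpos: "0 < \<delta> k" for k using l by (simp add: \<delta>_def)
  have dk: "\<delta> k * 2 ^ k = l" for k by (simp add: \<delta>_def)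
  let ?cell = "\<lambda>k. dcell z (\<delta> k)"
  have root: "?cell k k x = hb z l" if "x \<in> hb z l" for k x
    using dcell_root[OF dpos, of x z k k] that dk by simp
  have incl: "hb (corner z (\<delta> k) j y) (\<delta> k * 2 ^ j) \<subseteq> hb z l" if "j \<le> k" "y \<in> hb z l" for k j y
  proof -
    interpret cell_tree lebesgue "?cell k" by (rule dcell_tree[OF dpos])
    show ?thesis using cell_mono[OF \<open>j \<le> k\<close>, of y] root[OF that(2), of k] dcell_eq_hb[OF dpos] by metis
  qed
  have zz: "z \<in> hb z l" using l by (simp add: hb_def)
  have tree: "(\<integral>\<^sup>+x\<in>hb z l. ennreal (exp (c * \<bar>avg b (?cell k 0 x) - avg b (cube z l)\<bar> / D)) \<partial>lebesgue) \<le> ennreal (4 * l ^ ?n)" for k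
  proof -
    interpret cell_tree lebesgue "?cell k" by (rule dcell_tree[OF dpos])
    have "(\<integral>\<^sup>+y\<in>?cell k k z. ennreal (exp (ln (4/3) / (2 + 2 ^ ?n) * \<bar>avg b (?cell k 0 y) - avg b (?cell k k z)\<bar> / D)) \<partial>lebesgue)
      \<le> ennreal (4 * measure lebesgue (?cell k k z))"
    proof (rule John_Nirenberg_tree[OF bm D(1)])
      fix j y \<beta> assume "j \<le> k" "y \<in> ?cell k k z"
      then have y: "y \<in> hb z l" using root[OF zz] by simp
      let ?s = "\<delta> k * 2 ^ j" and ?w = "corner z (\<delta> k) j y"
      have s: "0 < ?s" using dpos by simp
      have Q: "?cell k j y = hb ?w ?s" by (rule dcell_eq_hb[OF dpos])
      have fin: "emeasure lebesgue (hb ?w ?s) < \<infinity>" using s by (subst emeasure_hb) auto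
      show "ennreal (\<bar>avg b (?cell k j y) - \<beta>\<bar> * measure lebesgue (?cell k j y)) \<le> (\<integral>\<^sup>+z\<in>?cell k j y. ennreal \<bar>b z - \<beta>\<bar> \<partial>lebesgue)"
        unfolding Q avg_def
        by (rule avg_diff_le[OF locally_integrable_subset[OF b compact_cube hb_subset_cube hb_sets] hb_sets fin])
      have "hb ?w ?s \<subseteq> hb z l" using incl[OF \<open>j \<le> k\<close> y] .
      then have "cube ?w ?s \<subseteq> cube z (2 * l)"
        using hb_subsetD[of ?w ?s z l] s l by (intro cube_subsetI) (smt (verit))
      from big[OF s this] have "N * a (cube ?w ?s) * ?s ^ ?n \<le> D * ?s ^ ?n"
        using s by (intro mult_right_mono) auto
      then have "(\<integral>\<^sup>+x\<in>cube ?w ?s. ennreal \<bar>b x - avg b (cube ?w ?s)\<bar> \<partial>lebesgue) \<le> ennreal (D * ?s ^ ?n)"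
        using oscillation_cube[OF N(1) s, of ?w] by (meson ennreal_leI order_trans)
      then show "(\<integral>\<^sup>+z\<in>?cell k j y. ennreal \<bar>b z - avg b (?cell k j y)\<bar> \<partial>lebesgue) \<le> ennreal (D * measure lebesgue (?cell k j y))"
        unfolding Q using s by (simp add: nn_integral_hb_cube avg_hb measure_hb del: measure_completion)
    next
      fix j y
      have "measure lebesgue (?cell k (Suc j) y) = 2 ^ ?n * measure lebesgue (?cell k j y)"
        unfolding dcell_eq_hb[OF dpos] using dpos[of k] by (simp add: measure_hb power_mult_distrib del: measure_completion)
      then show "measure lebesgue (?cell k (Suc j) y) \<le> 2 ^ ?n * measure lebesgue (?cell k j y)" by simp
    qed simp
    then show ?thesis using l unfolding root[OF zz] by (simp add: c_def avg_hb measure_hb del: measure_completion)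
  qed
  let ?g = "\<lambda>k x. ennreal (exp (c * \<bar>avg b (?cell k 0 x) - avg b (cube z l)\<bar> / D))"
  let ?K = "exp (c * (2 ^ (?n + 1) + 1))"
  have [measurable]: "(\<lambda>x. avg b (?cell k 0 x)) \<in> borel_measurable lebesgue" for k
  proof -
    interpret cell_tree lebesgue "?cell k" by (rule dcell_tree[OF dpos])
    show ?thesis by (rule measurable_cell)
  qed
  have pt: "AE x in lebesgue. ennreal (exp (c * \<bar>b x - avg b (cube z l)\<bar> / D)) * indicator (hb z l) x
     \<le> liminf (\<lambda>k. ennreal ?K * (?g k x * indicator (hb z l) x))"
    using lebesgue_points_cubes[OF b]
  proof eventually_elim
    fix x assume leb: "\<forall>e>0. \<exists>d>0. \<forall>h. 0 < h \<and> h < d \<longrightarrow> \<bar>avg b (cube x h) - b x\<bar> < e"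
    show "ennreal (exp (c * \<bar>b x - avg b (cube z l)\<bar> / D)) * indicator (hb z l) x \<le> liminf (\<lambda>k. ennreal ?K * (?g k x * indicator (hb z l) x))"
    proof (cases "x \<in> hb z l")
      case True
      obtain d where d: "d > 0" "\<And>h. 0 < h \<Longrightarrow> h < d \<Longrightarrow> \<bar>avg b (cube x h) - b x\<bar> < D" using leb[rule_format, OF D(1)] by blast
      have "(\<lambda>k. l * (1/2) ^ k) \<longlonglongrightarrow> l * 0" by (intro tendsto_mult_left LIMSEQ_power_zero) simp
      then have "\<forall>\<^sub>F k in sequentially. l * (1/2) ^ k < d" using order_tendstoD(2)[of _ "l * 0" sequentially d] d(1) by simp
      then have "\<forall>\<^sub>F k in sequentially. ennreal (exp (c * \<bar>b x - avg b (cube z l)\<bar> / D)) \<le> ennreal ?K * ?g k x"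
      proof eventually_elim
        fix k assume "l * (1/2) ^ k < d"
        then have "\<delta> k < d" by (simp add: \<delta>_def power_divide)
        then have 1: "\<bar>avg b (cube x (\<delta> k)) - b x\<bar> < D" using d dpos by blast
        let ?w = "corner z (\<delta> k) 0 x"
        have Q: "?cell k 0 x = hb ?w (\<delta> k)" using dcell_eq_hb[OF dpos, of z k 0 x] by simp
        have xQ: "x \<in> hb ?w (\<delta> k)" using Q by (auto simp: dcell_def)
        have dl: "\<delta> k \<le> l" using l by (simp add: \<delta>_def field_simps)
        have sub: "hb ?w (\<delta> k) \<subseteq> hb z l" using incl[of 0 k x] True by simp
        have E1: "cube x (\<delta> k) \<subseteq> cube ?w (2 * \<delta> k)"
        proof (rule cube_subsetI)
          fix i
          have "?w $ i \<le> x $ i" "x $ i < ?w $ i + \<delta> k" using xQ by (simp_all add: hb_def)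
          then show "?w $ i \<le> x $ i \<and> x $ i + \<delta> k \<le> ?w $ i + 2 * \<delta> k" by linarith
        qed
        have E2: "cube ?w (\<delta> k) \<subseteq> cube ?w (2 * \<delta> k)" using dpos[of k] by (intro cube_subsetI) auto
        have E3: "cube ?w (2 * \<delta> k) \<subseteq> cube z (2 * l)"
          using hb_subsetD[OF sub dpos] dl by (intro cube_subsetI) (smt (verit))
        have E0: "0 < 2 * \<delta> k" using dpos by simp
        have NE: "N * a (cube ?w (2 * \<delta> k)) \<le> D" by (rule big[OF E0 E3])
        have 2: "\<bar>avg b (cube x (\<delta> k)) - avg b (cube ?w (2 * \<delta> k))\<bar> \<le> 2 ^ ?n * D"
          by (intro order_trans[OF avg_subcube[OF b N(1) E0 _ E1 a0'[OF E0]] mult_left_mono[OF NE]]) simp_all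
        have 3: "\<bar>avg b (cube ?w (\<delta> k)) - avg b (cube ?w (2 * \<delta> k))\<bar> \<le> 2 ^ ?n * D"
          by (intro order_trans[OF avg_subcube[OF b N(1) E0 _ E2 a0'[OF E0]] mult_left_mono[OF NE]]) simp_all
        have "avg b (?cell k 0 x) = avg b (cube ?w (\<delta> k))" unfolding Q using dpos[of k] by (simp add: avg_hb)
        then have "\<bar>b x - avg b (cube z l)\<bar> \<le> (2 ^ (?n + 1) + 1) * D + \<bar>avg b (?cell k 0 x) - avg b (cube z l)\<bar>"
          using 1 2 3 by (simp add: distrib_right mult.assoc)
        then have "c * \<bar>b x - avg b (cube z l)\<bar> \<le> c * ((2 ^ (?n + 1) + 1) * D + \<bar>avg b (?cell k 0 x) - avg b (cube z l)\<bar>)"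
          using c0 by (intro mult_left_mono) auto
        then have "c * \<bar>b x - avg b (cube z l)\<bar> / D \<le> c * (2 ^ (?n + 1) + 1) + c * \<bar>avg b (?cell k 0 x) - avg b (cube z l)\<bar> / D"
          using D(1) by (simp add: field_simps)
        then show "ennreal (exp (c * \<bar>b x - avg b (cube z l)\<bar> / D)) \<le> ennreal ?K * ?g k x"
          by (simp flip: ennreal_mult exp_add add: ennreal_leI)
      qed
      then show ?thesis using True by (intro Liminf_bounded) simp
    qed simp
  qed
  have "(\<integral>\<^sup>+x\<in>hb z l. ennreal (exp (c * \<bar>b x - avg b (cube z l)\<bar> / D)) \<partial>lebesgue)
    \<le> (\<integral>\<^sup>+x. liminf (\<lambda>k. ennreal ?K * (?g k x * indicator (hb z l) x)) \<partial>lebesgue)"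
    by (rule nn_integral_mono_AE[OF pt])
  also have "\<dots> \<le> liminf (\<lambda>k. \<integral>\<^sup>+x. ennreal ?K * (?g k x * indicator (hb z l) x) \<partial>lebesgue)"
    by (rule nn_integral_liminf) measurable
  also have "\<dots> \<le> limsup (\<lambda>k. \<integral>\<^sup>+x. ennreal ?K * (?g k x * indicator (hb z l) x) \<partial>lebesgue)"
    by (rule Liminf_le_Limsup) simp
  also have "\<dots> \<le> ennreal ?K * ennreal (4 * l ^ ?n)"
    by (rule Limsup_bounded) (auto simp: nn_integral_cmult intro!: mult_left_mono tree always_eventually)
  also have "\<dots> = ennreal (4 * ?K * l ^ ?n)" using l by (simp flip: ennreal_mult add: mult_ac)
  finally show ?thesis .
qed

lemma power_exp_bound:
  fixes c s :: real
  assumes "0 < c" "0 \<le> s"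
  obtains K where "0 < K" "\<And>y. 0 \<le> y \<Longrightarrow> y powr s \<le> K * exp (c * y)"
proof -
  obtain k :: nat where k: "s \<le> k" "0 < k" by (metis less_Suc_eq_0_disj of_nat_Suc real_arch_simple le_SucI of_nat_le_iff order_trans zero_less_Suc)
  define K where "K = 1 + (real k / c) ^ k"
  have K: "0 < K" using assms k by (simp add: K_def add_pos_nonneg)
  have "y powr s \<le> K * exp (c * y)" if y: "0 \<le> y" for y
  proof -
    have e: "1 \<le> exp (c * y)" using assms y by simp
    have "y powr s \<le> 1 + y ^ k"
    proof (cases "y \<le> 1")
      case True
      then have "y powr s \<le> 1" using y assms by (simp add: powr_le1)
      then show ?thesis using y by (simp add: add_increasing2)
    next
      case False
      then have "y powr s \<le> y powr real k" using k by (intro powr_mono) auto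
      then show ?thesis using False by (simp add: powr_realpow)
    qed
    also have "y ^ k = (real k / c) ^ k * (c * y / real k) ^ k"
      using assms k by (simp flip: power_mult_distrib)
    also have "(c * y / real k) ^ k \<le> (1 + c * y / real k) ^ k" using assms y k by (intro power_mono) auto
    also have "\<dots> \<le> exp (c * y)" by (rule exp_ge_one_plus_x_over_n_power_n) (use assms y k in \<open>auto intro: order_trans[of _ 0]\<close>)
    finally have "y powr s \<le> 1 + (real k / c) ^ k * exp (c * y)"
      using assms k by (simp add: mult_left_mono)
    then show ?thesis using e unfolding K_def distrib_right by linarith
  qed
  then show thesis using K that by blast
qed

text \<open>
  Powers are dominated by exponentials. The auxiliary \<open>e\<close> in the proof takes
  care of symbols with vanishing oscillation, where one cannot divide by the scale
  \<open>X\<close>.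
\<close>

lemma oscillation_moments:
  fixes s :: real and m :: nat and t :: real
  assumes s: "0 < s" and t: "0 \<le> t"
  obtains C where "0 < C"
    "\<And>(b :: real ^ 'n \<Rightarrow> real) N a z l. \<lbrakk>locally_integrable b; osc_bound 1 a b N; 0 \<le> N;
      \<And>Q Q'. Q \<in> cubes \<Longrightarrow> Q' \<in> cubes \<Longrightarrow> Q' \<subseteq> Q \<Longrightarrow> a Q' \<le> t * a Q; \<And>Q. Q \<in> cubes \<Longrightarrow> 0 \<le> a Q; 0 < l\<rbrakk> \<Longrightarrow>
      (\<integral>\<^sup>+x\<in>hb z l. ennreal ((\<bar>b x - avg b (cube z l)\<bar> ^ m) powr s) \<partial>lebesgue)
        \<le> ennreal (C * ((N * a (cube z (2 * l))) ^ m) powr s * l ^ CARD('n))"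
proof (cases "m = 0")
  case True
  show thesis
  proof (rule that[of 1])
    fix b :: "real ^ 'n \<Rightarrow> real" and N l :: real and a and z :: "real ^ 'n"
    assume "0 < l"
    then have "(\<integral>\<^sup>+x\<in>hb z l. 1 \<partial>lebesgue) = ennreal (l ^ CARD('n))"
      using nn_integral_indicator[OF hb_sets, of z l] emeasure_hb[of l z] by simp
    then show "(\<integral>\<^sup>+x\<in>hb z l. ennreal ((\<bar>b x - avg b (cube z l)\<bar> ^ m) powr s) \<partial>lebesgue)
        \<le> ennreal (1 * ((N * a (cube z (2 * l))) ^ m) powr s * l ^ CARD('n))"
      using True by simp
  qed simp
next
  case m: False
  define c :: real where "c = ln (4/3) / (2 + 2 ^ CARD('n))"
  have c0: "0 < c" unfolding c_def by (intro divide_pos_pos) (auto intro: add_pos_pos)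
  obtain K where K: "0 < K" "\<And>y. 0 \<le> y \<Longrightarrow> y powr (m * s) \<le> K * exp (c * y)"
    using power_exp_bound[of c "m * s"] c0 s by auto
  define E where "E = 4 * exp (c * (2 ^ (CARD('n) + 1) + 1))"
  have E0: "0 < E" by (simp add: E_def)
  define C where "C = K * E * t powr (m * s) + 1"
  show thesis
  proof (rule that[of C])
    show "0 < C" using K E0 by (simp add: C_def add_nonneg_pos)
    fix b :: "real ^ 'n \<Rightarrow> real" and N l :: real and a and z :: "real ^ 'n"
    assume b: "locally_integrable b" and N: "osc_bound 1 a b N" "0 \<le> N" and
      ta: "\<And>Q Q'. Q \<in> cubes \<Longrightarrow> Q' \<in> cubes \<Longrightarrow> Q' \<subseteq> Q \<Longrightarrow> a Q' \<le> t * a Q"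
      and a0: "\<And>Q. Q \<in> cubes \<Longrightarrow> 0 \<le> a Q" and l: "0 < l"
    have [measurable]: "b \<in> borel_measurable lebesgue" by (rule locally_integrable_measurable[OF b])
    define X where "X = N * (t * a (cube z (2 * l)))"
    have aX: "0 \<le> a (cube z (2 * l))" using l by (intro a0 cube_in_cubes) simp
    have X0: "0 \<le> X" unfolding X_def using N t aX by simp
    let ?I = "\<integral>\<^sup>+x\<in>hb z l. ennreal ((\<bar>b x - avg b (cube z l)\<bar> ^ m) powr s) \<partial>lebesgue"
    have pw: "(u ^ m) powr s = u powr (m * s)" if "0 \<le> u" for u :: real
      using that m by (cases "u = 0") (simp_all add: powr_realpow[symmetric] powr_powr)
    have eps: "?I \<le> ennreal (K * E * (X + e) powr (m * s) * l ^ CARD('n))" if e: "0 < e" for e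
    proof -
      have D: "0 < X + e" using X0 e by simp
      have "?I \<le> (\<integral>\<^sup>+x. ennreal (K * (X + e) powr (m * s)) * (ennreal (exp (c * \<bar>b x - avg b (cube z l)\<bar> / (X + e))) * indicator (hb z l) x) \<partial>lebesgue)"
      proof (rule nn_integral_mono)
        fix x
        let ?u = "\<bar>b x - avg b (cube z l)\<bar>"
        have "?u powr (m * s) = (X + e) powr (m * s) * (?u / (X + e)) powr (m * s)"
          using D by (simp flip: powr_mult)
        also have "\<dots> \<le> (X + e) powr (m * s) * (K * exp (c * (?u / (X + e))))"
          using D by (intro mult_left_mono K) auto
        finally have "(?u ^ m) powr s \<le> K * (X + e) powr (m * s) * exp (c * ?u / (X + e))"
          by (simp add: pw mult_ac)
        then have "ennreal ((?u ^ m) powr s) \<le> ennreal (K * (X + e) powr (m * s)) * ennreal (exp (c * ?u / (X + e)))"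
          using K by (simp flip: ennreal_mult add: ennreal_leI)
        then show "ennreal ((?u ^ m) powr s) * indicator (hb z l) x
          \<le> ennreal (K * (X + e) powr (m * s)) * (ennreal (exp (c * ?u / (X + e))) * indicator (hb z l) x)"
          by (auto simp: indicator_def)
      qed
      also have "\<dots> = ennreal (K * (X + e) powr (m * s)) * (\<integral>\<^sup>+x\<in>hb z l. ennreal (exp (c * \<bar>b x - avg b (cube z l)\<bar> / (X + e))) \<partial>lebesgue)"
        by (rule nn_integral_cmult) measurable
      also have "\<dots> \<le> ennreal (K * (X + e) powr (m * s)) * ennreal (E * l ^ CARD('n))"
        unfolding c_def E_def
        by (intro mult_left_mono John_Nirenberg_cube[OF b N t ta a0 l D]) (use e in \<open>auto simp: X_def\<close>)
      also have "\<dots> = ennreal (K * E * (X + e) powr (m * s) * l ^ CARD('n))"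
        using K l E0 by (simp flip: ennreal_mult add: mult_ac)
      finally show ?thesis .
    qed
    have ms: "0 < m * s" using m s by simp
    have "((\<lambda>e. ennreal (K * E * (X + e) powr (m * s) * l ^ CARD('n))) \<longlongrightarrow> ennreal (K * E * (X + 0) powr (m * s) * l ^ CARD('n))) (at_right 0)"
      using X0 ms by (intro tendsto_intros tendsto_powr') (auto simp: eventually_at_right_less intro: eventually_mono[OF eventually_at_right_less])
    then have "?I \<le> ennreal (K * E * (X + 0) powr (m * s) * l ^ CARD('n))"
      by (rule tendsto_lowerbound) (auto intro: eventually_mono[OF eventually_at_right_less] eps)
    also have "\<dots> \<le> ennreal (C * ((N * a (cube z (2 * l))) ^ m) powr s * l ^ CARD('n))"
    proof (intro ennreal_leI mult_right_mono)
      have "X powr (m * s) = t powr (m * s) * (N * a (cube z (2 * l))) powr (m * s)"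
        unfolding X_def by (simp add: powr_mult mult_ac)
      then show "K * E * (X + 0) powr (m * s) \<le> C * ((N * a (cube z (2 * l))) ^ m) powr s"
        using N aX by (simp add: pw C_def distrib_right)
    qed (use l in auto)
    finally show "?I \<le> ennreal (C * ((N * a (cube z (2 * l))) ^ m) powr s * l ^ CARD('n))" .
  qed
qed

section \<open>Log-Hoelder continuous reciprocal exponents\<close>

lemma norm_diff_cube:
  fixes x y :: "real ^ 'n" and l :: real
  assumes "x \<in> cube z l" "y \<in> cube z l"
  shows "norm (x - y) \<le> CARD('n) * l"
proof -
  have "\<bar>(x - y) $ i\<bar> \<le> l" for i
  proof -
    have "z $ i \<le> x $ i" "x $ i \<le> z $ i + l" "z $ i \<le> y $ i" "y $ i \<le> z $ i + l"
      using assms by (simp_all add: cube_def mem_box_cart)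
    then show ?thesis by (simp add: abs_le_iff)
  qed
  then have "(\<Sum>i\<in>UNIV. \<bar>(x - y) $ i\<bar>) \<le> (\<Sum>i\<in>(UNIV :: 'n set). l)" by (intro sum_mono)
  then show ?thesis using norm_le_l1_cart[of "x - y"] by simp
qed

lemma one_le_ln_e: "0 \<le> u \<Longrightarrow> 1 \<le> ln (exp 1 + u :: real)"
  by (metis add_increasing2 exp_gt_zero exp_ln_iff ln_exp ln_le_cancel_iff order_refl less_le_trans)

text \<open>
  The numbers \<open>A\<close> that may stand for the reciprocal exponent
  \<open>\<alpha>\<close> on a cube: its value at any point of the cube if the cube is not
  too large, and the limit \<open>\<beta>\<close> at infinity if it is not too small. For
  sides between \<open>1\<close> and \<open>L\<close> both are admitted, so that cubes may
  be enlarged by the factor \<open>L\<close> without changing \<open>A\<close>.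
\<close>

definition effective :: "(real ^ 'n \<Rightarrow> real) \<Rightarrow> real \<Rightarrow> real \<Rightarrow> real ^ 'n \<Rightarrow> real \<Rightarrow> real \<Rightarrow> bool"
  where "effective \<alpha> \<beta> L z l A \<longleftrightarrow> 0 < l \<and> ((l \<le> L \<and> (\<exists>x\<in>cube z l. A = \<alpha> x)) \<or> (1 \<le> l \<and> A = \<beta>))"

text \<open>
  Here \<open>\<alpha>\<close> is the reciprocal of an exponent. Reciprocals behave well:
  \<open>1 - \<alpha>\<close> belongs to the conjugate exponent, \<open>\<alpha> / r\<close>
  to the exponent multiplied by \<open>r\<close>, and all of them are log-Hoelder continuous
  again.
\<close>

locale lh_exp =
  fixes \<alpha> :: "real ^ 'n \<Rightarrow> real" and c lo hi \<beta> :: real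
  assumes meas [measurable]: "\<alpha> \<in> borel_measurable lebesgue"
    and c: "0 \<le> c" and lo: "0 < lo"
    and bounds: "\<And>x. lo \<le> \<alpha> x" "\<And>x. \<alpha> x \<le> hi" and bounds_inf: "lo \<le> \<beta>" "\<beta> \<le> hi"
    and loc: "\<And>x y. \<bar>\<alpha> x - \<alpha> y\<bar> \<le> c / ln (exp 1 + 1 / norm (x - y))"
    and inf: "\<And>x. \<bar>\<alpha> x - \<beta>\<bar> \<le> c / ln (exp 1 + norm x)"
begin

lemma hi_pos: "0 < hi" using lo bounds(1)[of 0] bounds(2)[of 0] by linarith
lemma alpha_pos: "0 < \<alpha> x" using lo bounds(1)[of x] by linarith
lemma beta_pos: "0 < \<beta>" using lo bounds_inf by linarith

lemma diff_le_c: "\<bar>\<alpha> x - \<alpha> y\<bar> \<le> c"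
proof -
  have "c / ln (exp 1 + 1 / norm (x - y)) \<le> c / 1"
    by (intro divide_left_mono c one_le_ln_e) (use one_le_ln_e[of "1 / norm (x - y)"] in auto)
  then show ?thesis using loc[of x y] by simp
qed

text \<open>
  Local log-Hoelder continuity says that \<open>l powr \<alpha> x\<close> and \<open>l powr
  \<alpha> y\<close> are comparable when \<open>x\<close> and \<open>y\<close> lie in a cube
  of side \<open>l\<close>.
\<close>

lemma osc_log:
  assumes "x \<in> cube z l" "y \<in> cube z l" "0 < l" "l \<le> L" "1 \<le> L"
  shows "\<bar>\<alpha> x - \<alpha> y\<bar> * \<bar>ln l\<bar> \<le> c * (1 + ln CARD('n) + ln L)"
proof (cases "x = y \<or> 1 \<le> l")
  case True
  have n: "0 \<le> ln (real CARD('n))" by (simp add: Suc_leI)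
  show ?thesis
  proof (cases "x = y")
    case True then show ?thesis using n c assms by simp
  next
    case False
    then have "1 \<le> l" using True by simp
    then have "\<bar>ln l\<bar> \<le> ln L" using assms by simp
    then have "\<bar>\<alpha> x - \<alpha> y\<bar> * \<bar>ln l\<bar> \<le> c * ln L"
      by (intro mult_mono diff_le_c c) auto
    also have "\<dots> \<le> c * (1 + ln CARD('n) + ln L)" using c n by (intro mult_left_mono) auto
    finally show ?thesis .
  qed
next
  case False
  let ?n = "real CARD('n)"
  have n1: "1 \<le> ?n" by (simp add: Suc_leI)
  have n: "0 \<le> ln ?n" using n1 by simp
  have xy: "0 < norm (x - y)" "norm (x - y) \<le> ?n * l" using False norm_diff_cube[OF assms(1,2)] by auto
  let ?k = "ln (exp 1 + 1 / norm (x - y))"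
  have k1: "1 \<le> ?k" by (rule one_le_ln_e) simp
  have "ln (1 / (?n * l)) \<le> ln (1 / norm (x - y))"
    using xy n1 assms by (subst ln_le_cancel_iff) (auto simp: frac_le)
  also have "\<dots> \<le> ?k" using xy by (subst ln_le_cancel_iff) (auto simp: add_pos_pos)
  finally have "\<bar>ln l\<bar> \<le> ?k + ln ?n"
    using False assms n1 by (simp add: ln_div ln_mult)
  also have "\<dots> \<le> ?k * (1 + ln ?n)" using mult_right_mono[OF k1 n] by (simp add: distrib_left)
  finally have "\<bar>\<alpha> x - \<alpha> y\<bar> * \<bar>ln l\<bar> \<le> c / ?k * (?k * (1 + ln ?n))"
    by (intro mult_mono loc) (use c k1 in auto)
  also have "\<dots> = c * (1 + ln ?n)" using k1 by simp
  also have "\<dots> \<le> c * (1 + ln ?n + ln L)" using c assms by (intro mult_left_mono) auto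
  finally show ?thesis .
qed

text \<open>
  The integrand is comparable with \<open>1 / |Q|\<close>: on small cubes by local
  log-Hoelder continuity, on large ones by the condition at infinity as long as \<open>norm
  y \<ge> l powr \<delta>\<close>. On the exceptional ball the integrand is at most \<open>l
  powr (- n * \<delta>)\<close>, the inverse of the volume of the ball up to a constant,
  because \<open>\<delta> = \<beta> / hi \<le> \<beta> / \<alpha> y\<close>.
\<close>

lemma power_integral_bound:
  assumes L: "1 \<le> L"
  obtains C where "0 < C"
    "\<And>z l A. effective \<alpha> \<beta> L z l A \<Longrightarrow> (\<integral>\<^sup>+y\<in>cube z l. ennreal ((l ^ CARD('n)) powr (- (A / \<alpha> y))) \<partial>lebesgue) \<le> ennreal C"
proof -
  let ?n = "CARD('n)"
  define C1 where "C1 = exp (?n * (c * (1 + ln ?n + ln L)) / lo)"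
  define \<delta> where "\<delta> = \<beta> / hi"
  have \<delta>: "0 < \<delta>" using beta_pos hi_pos by (simp add: \<delta>_def)
  define C2 where "C2 = exp (?n * c / (lo * \<delta>))"
  have pos: "0 < C1" "0 < C2" by (auto simp: C1_def C2_def)
  show thesis
  proof (rule that[of "C1 + (C2 + 2 ^ ?n)"])
    show "0 < C1 + (C2 + 2 ^ ?n)" using pos by (simp add: add_pos_pos)
    fix z :: "real ^ 'n" and l A assume eff: "effective \<alpha> \<beta> L z l A"
    then have l: "0 < l" by (simp add: effective_def)
    have split: "(l ^ ?n) powr (- (A / \<alpha> y)) = (1 / l ^ ?n) * exp (?n * ((\<alpha> y - A) / \<alpha> y * ln l))" for y
    proof -
      have "- (A / \<alpha> y) = - 1 + (\<alpha> y - A) / \<alpha> y" using alpha_pos[of y] by (simp add: field_simps)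
      then have "(l ^ ?n) powr (- (A / \<alpha> y)) = (l ^ ?n) powr (- 1) * (l ^ ?n) powr ((\<alpha> y - A) / \<alpha> y)"
        by (simp only: powr_add)
      also have "(l ^ ?n) powr (- 1) = 1 / l ^ ?n" using l by (simp add: powr_minus_divide)
      also have "(l ^ ?n) powr ((\<alpha> y - A) / \<alpha> y) = exp (?n * ((\<alpha> y - A) / \<alpha> y * ln l))"
        using l by (simp add: powr_def ln_realpow)
      finally show ?thesis .
    qed
    have vol: "emeasure lebesgue (cube z l) = ennreal (l ^ ?n)" using l by (intro emeasure_cube) simp
    have constint: "(\<integral>\<^sup>+y\<in>cube z l. ennreal (C / l ^ ?n) \<partial>lebesgue) = ennreal C" if "0 \<le> C" for C
      using l that by (subst nn_integral_cmult_indicator[OF cube_sets]) (auto simp del: emeasure_completion simp add: vol simp flip: ennreal_mult)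
    from eff consider (small) x where "l \<le> L" "x \<in> cube z l" "A = \<alpha> x" | (large) "1 \<le> l" "A = \<beta>"
      by (auto simp: effective_def)
    then show "(\<integral>\<^sup>+y\<in>cube z l. ennreal ((l ^ ?n) powr (- (A / \<alpha> y))) \<partial>lebesgue) \<le> ennreal (C1 + (C2 + 2 ^ ?n))"
    proof cases
      case small
      have "(\<integral>\<^sup>+y\<in>cube z l. ennreal ((l ^ ?n) powr (- (A / \<alpha> y))) \<partial>lebesgue) \<le> (\<integral>\<^sup>+y\<in>cube z l. ennreal (C1 / l ^ ?n) \<partial>lebesgue)"
      proof (rule nn_integral_mono)
        fix y
        have "(l ^ ?n) powr (- (A / \<alpha> y)) \<le> C1 / l ^ ?n" if y: "y \<in> cube z l"
        proof -
          have "(\<alpha> y - A) / \<alpha> y * ln l \<le> \<bar>(\<alpha> y - A) / \<alpha> y * ln l\<bar>" by (rule abs_ge_self)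
          also have "\<dots> = (\<bar>\<alpha> y - \<alpha> x\<bar> * \<bar>ln l\<bar>) / \<alpha> y" using alpha_pos[of y] small by (simp add: abs_mult)
          also have "\<dots> \<le> (c * (1 + ln ?n + ln L)) / lo"
            using osc_log[OF y small(2) l small(1) L] bounds(1)[of y] lo by (intro frac_le) (auto intro: order_trans[rotated])
          finally have "?n * ((\<alpha> y - A) / \<alpha> y * ln l) \<le> ?n * ((c * (1 + ln ?n + ln L)) / lo)"
            by (intro mult_left_mono) auto
          then show ?thesis unfolding split C1_def using l by (simp add: divide_right_mono)
        qed
        then show "ennreal ((l ^ ?n) powr (- (A / \<alpha> y))) * indicator (cube z l) y \<le> ennreal (C1 / l ^ ?n) * indicator (cube z l) y"
          by (auto simp: indicator_def ennreal_leI)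
      qed
      also have "\<dots> = ennreal C1" using pos by (intro constint) simp
      also have "\<dots> \<le> ennreal (C1 + (C2 + 2 ^ ?n))" using pos by (intro ennreal_leI) (simp add: add_nonneg_nonneg)
      finally show ?thesis .
    next
      case large
      let ?B = "cube (\<chi> i. - (l powr \<delta>) :: real ^ 'n) (2 * l powr \<delta>)"
      have lp: "0 < l powr \<delta>" using l by simp
      have "(\<integral>\<^sup>+y\<in>cube z l. ennreal ((l ^ ?n) powr (- (A / \<alpha> y))) \<partial>lebesgue)
        \<le> (\<integral>\<^sup>+y. ennreal (C2 / l ^ ?n) * indicator (cube z l) y + ennreal (1 / (l powr \<delta>) ^ ?n) * indicator ?B y \<partial>lebesgue)"
      proof (rule nn_integral_mono)
        fix y
        show "ennreal ((l ^ ?n) powr (- (A / \<alpha> y))) * indicator (cube z l) y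
          \<le> ennreal (C2 / l ^ ?n) * indicator (cube z l) y + ennreal (1 / (l powr \<delta>) ^ ?n) * indicator ?B y"
        proof (cases "norm y < l powr \<delta>")
          case True
          have "y \<in> ?B"
          proof -
            have "- (l powr \<delta>) \<le> y $ i \<and> y $ i \<le> - (l powr \<delta>) + 2 * l powr \<delta>" for i
              using component_le_norm_cart[of y i] True by (simp add: abs_le_iff)
            then show ?thesis by (simp add: cube_def mem_box_cart)
          qed
          moreover have "(l ^ ?n) powr (- (A / \<alpha> y)) \<le> 1 / (l powr \<delta>) ^ ?n"
          proof -
            have "\<delta> \<le> A / \<alpha> y" unfolding \<delta>_def large using bounds(2)[of y] alpha_pos[of y] beta_pos by (intro divide_left_mono) auto
            then have "(l ^ ?n) powr (- (A / \<alpha> y)) \<le> (l ^ ?n) powr (- \<delta>)" using large by (intro powr_mono) auto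
            also have "\<dots> = 1 / (l powr \<delta>) ^ ?n"
              using l by (simp add: powr_minus_divide flip: powr_realpow) (simp add: powr_powr mult.commute)
            finally show ?thesis .
          qed
          ultimately show ?thesis by (auto simp: indicator_def add_increasing ennreal_leI)
        next
          case False
          have "(l ^ ?n) powr (- (A / \<alpha> y)) \<le> C2 / l ^ ?n"
          proof -
            have ln0: "0 \<le> ln l" using large by simp
            have k1: "1 \<le> ln (exp 1 + norm y)" by (rule one_le_ln_e) simp
            have "\<delta> * ln l = ln (l powr \<delta>)" using l by (simp add: ln_powr)
            also have "\<dots> \<le> ln (exp 1 + norm y)" using False lp by (subst ln_le_cancel_iff) (auto simp: add_pos_nonneg intro: add_increasing)
            finally have lnl: "ln l \<le> ln (exp 1 + norm y) / \<delta>" using \<delta> by (simp add: field_simps)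
            have "(\<alpha> y - A) / \<alpha> y * ln l \<le> (\<bar>\<alpha> y - \<beta>\<bar> * ln l) / \<alpha> y"
              using alpha_pos[of y] ln0 large by (simp add: divide_right_mono mult_right_mono)
            also have "\<dots> \<le> (c / ln (exp 1 + norm y) * (ln (exp 1 + norm y) / \<delta>)) / lo"
              using lnl ln0 k1 lo bounds(1)[of y] c \<delta> by (intro frac_le mult_mono inf) auto
            also have "\<dots> = c / (lo * \<delta>)" using k1 by simp
            finally have "?n * ((\<alpha> y - A) / \<alpha> y * ln l) \<le> ?n * (c / (lo * \<delta>))" by (intro mult_left_mono) auto
            then show ?thesis unfolding split C2_def using l by (simp add: divide_right_mono)
          qed
          then show ?thesis by (auto simp: indicator_def add_increasing2 ennreal_leI)
        qed
      qed
      also have "\<dots> = (\<integral>\<^sup>+y\<in>cube z l. ennreal (C2 / l ^ ?n) \<partial>lebesgue) + ennreal (1 / (l powr \<delta>) ^ ?n) * emeasure lebesgue ?B"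
        using cube_sets[of z l] cube_sets[of "\<chi> i. - (l powr \<delta>)" "2 * l powr \<delta>"]
        by (subst nn_integral_add) (auto simp del: emeasure_completion simp add: nn_integral_cmult_indicator)
      also have "\<dots> = ennreal C2 + ennreal (2 ^ ?n)"
      proof -
        have "emeasure lebesgue ?B = ennreal ((2 * l powr \<delta>) ^ ?n)" using lp by (intro emeasure_cube) simp
        then show ?thesis using pos lp by (simp del: emeasure_completion add: constint power_mult_distrib flip: ennreal_mult)
      qed
      also have "\<dots> \<le> ennreal (C1 + (C2 + 2 ^ ?n))"
        using pos by (simp flip: ennreal_plus add: ennreal_leI)
      finally show ?thesis .
    qed
  qed
qed

lemma affine_exponent:
  assumes "0 < r" "r * hi < 1"
  shows "lh_exp (\<lambda>x. 1 - r * \<alpha> x) (r * c) (1 - r * hi) (1 - r * lo) (1 - r * \<beta>)"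
proof
  fix x y
  have "\<bar>(1 - r * \<alpha> x) - (1 - r * \<alpha> y)\<bar> = r * \<bar>\<alpha> x - \<alpha> y\<bar>"
    using assms by (simp add: abs_mult right_diff_distrib[symmetric] abs_minus_commute)
  also have "\<dots> \<le> r * (c / ln (exp 1 + 1 / norm (x - y)))" using assms by (intro mult_left_mono loc) simp
  finally show "\<bar>(1 - r * \<alpha> x) - (1 - r * \<alpha> y)\<bar> \<le> r * c / ln (exp 1 + 1 / norm (x - y))" by simp
  have "\<bar>(1 - r * \<alpha> x) - (1 - r * \<beta>)\<bar> = r * \<bar>\<alpha> x - \<beta>\<bar>"
    using assms by (simp add: abs_mult right_diff_distrib[symmetric] abs_minus_commute)
  also have "\<dots> \<le> r * (c / ln (exp 1 + norm x))" using assms by (intro mult_left_mono inf) simp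
  finally show "\<bar>(1 - r * \<alpha> x) - (1 - r * \<beta>)\<bar> \<le> r * c / ln (exp 1 + norm x)" by simp
qed (use assms c bounds bounds_inf in \<open>auto intro!: mult_left_mono\<close>)

text \<open>
  A substitute for Jensen's inequality: the mean of order \<open>r\<close>, below all
  exponents \<open>1 / \<alpha> y\<close>, is controlled by \<open>|Q| powr (- A)\<close>
  times the norm. Young's inequality with the exponents \<open>1 / (r * \<alpha> y)\<close>
  and \<open>1 / (1 - r * \<alpha> y)\<close>, depending on \<open>y\<close>, splits off the
  modular; the rest is the previous lemma for the exponent \<open>1 - r * \<alpha>\<close>.
\<close>

lemma average_le_modular:
  assumes L: "1 \<le> L" and r: "0 < r" "r * hi < 1"
  obtains C where "0 < C"
    "\<And>z l A u \<mu>. \<lbrakk>effective \<alpha> \<beta> L z l A; u \<in> borel_measurable lebesgue; \<And>y. 0 \<le> u y; 0 < \<mu>;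
       (\<integral>\<^sup>+y\<in>cube z l. ennreal ((u y / \<mu>) powr (1 / \<alpha> y)) \<partial>lebesgue) \<le> 1\<rbrakk> \<Longrightarrow>
       (\<integral>\<^sup>+y\<in>cube z l. ennreal (u y powr r) \<partial>lebesgue)
         \<le> ennreal ((C * \<mu> * (l ^ CARD('n)) powr (- A)) powr r * l ^ CARD('n))"
proof -
  let ?n = "CARD('n)"
  interpret t: lh_exp "\<lambda>x. 1 - r * \<alpha> x" "r * c" "1 - r * hi" "1 - r * lo" "1 - r * \<beta>"
    by (rule affine_exponent[OF r])
  obtain C0 where C0: "0 < C0" "\<And>z l A. effective (\<lambda>x. 1 - r * \<alpha> x) (1 - r * \<beta>) L z l A \<Longrightarrow> (\<integral>\<^sup>+y\<in>cube z l. ennreal ((l ^ CARD('n)) powr (- (A / (1 - r * \<alpha> y)))) \<partial>lebesgue) \<le> ennreal C0"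
    by (rule t.power_integral_bound[OF L]) blast
  define C where "C = (1 + C0) powr (1 / r)"
  show thesis
  proof (rule that[of C])
    show "0 < C" using C0 by (simp add: C_def)
    fix z :: "real ^ 'n" and l A \<mu> :: real and u
    assume eff: "effective \<alpha> \<beta> L z l A" and [measurable]: "u \<in> borel_measurable lebesgue"
      and u: "\<And>y. 0 \<le> u y" and lam: "0 < \<mu>"
      and mod: "(\<integral>\<^sup>+y\<in>cube z l. ennreal ((u y / \<mu>) powr (1 / \<alpha> y)) \<partial>lebesgue) \<le> 1"
    have l: "0 < l" using eff by (simp add: effective_def)
    let ?V = "l ^ ?n"
    have V: "0 < ?V" using l by simp
    have eff': "effective (\<lambda>x. 1 - r * \<alpha> x) (1 - r * \<beta>) L z l (1 - r * A)"
      using eff by (auto simp: effective_def)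
    have Young: "?V powr (r * A - 1) * (u y / \<mu>) powr r \<le> (u y / \<mu>) powr (1 / \<alpha> y) + ?V powr (- ((1 - r * A) / (1 - r * \<alpha> y)))" for y
    proof -
      have ra: "0 < r * \<alpha> y" "r * \<alpha> y < 1"
        using mult_pos_pos[OF r(1) alpha_pos[of y]] r mult_left_mono[OF bounds(2)[of y], of r] by linarith+
      let ?X = "(u y / \<mu>) powr r" and ?Y = "?V powr (r * A - 1)" and ?a = "r * \<alpha> y"
      have "?X * ?Y \<le> ?X powr (1 / ?a) / (1 / ?a) + ?Y powr (1 / (1 - ?a)) / (1 / (1 - ?a))"
        using ra by (intro Youngs_inequality) auto
      also have "\<dots> = ?X powr (1 / ?a) * ?a + ?Y powr (1 / (1 - ?a)) * (1 - ?a)" by simp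
      also have "\<dots> \<le> ?X powr (1 / ?a) * 1 + ?Y powr (1 / (1 - ?a)) * 1"
        using ra by (intro add_mono mult_left_mono) auto
      also have "?X powr (1 / ?a) = (u y / \<mu>) powr (1 / \<alpha> y)" using r by (simp add: powr_powr)
      also have "?Y powr (1 / (1 - ?a)) = ?V powr (- ((1 - r * A) / (1 - r * \<alpha> y)))"
      proof -
        have "(r * A - 1) * (1 / (1 - ?a)) = - ((1 - r * A) / (1 - r * \<alpha> y))" by (simp add: minus_divide_left)
        then show ?thesis by (simp only: powr_powr)
      qed
      finally show ?thesis by (simp add: mult.commute)
    qed
    have "ennreal (?V powr (r * A - 1)) * (\<integral>\<^sup>+y\<in>cube z l. ennreal ((u y / \<mu>) powr r) \<partial>lebesgue)
      = (\<integral>\<^sup>+y\<in>cube z l. ennreal (?V powr (r * A - 1) * (u y / \<mu>) powr r) \<partial>lebesgue)"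
      by (subst nn_integral_cmult[symmetric]) (auto simp: ennreal_mult mult.assoc)
    also have "\<dots> \<le> (\<integral>\<^sup>+y. ennreal ((u y / \<mu>) powr (1 / \<alpha> y)) * indicator (cube z l) y + ennreal (?V powr (- ((1 - r * A) / (1 - r * \<alpha> y)))) * indicator (cube z l) y \<partial>lebesgue)"
      by (rule nn_integral_mono) (use Young in \<open>auto simp: indicator_def ennreal_leI simp flip: ennreal_plus\<close>)
    also have "\<dots> = (\<integral>\<^sup>+y\<in>cube z l. ennreal ((u y / \<mu>) powr (1 / \<alpha> y)) \<partial>lebesgue) + (\<integral>\<^sup>+y\<in>cube z l. ennreal (?V powr (- ((1 - r * A) / (1 - r * \<alpha> y)))) \<partial>lebesgue)"
      by (rule nn_integral_add) measurable
    also have "\<dots> \<le> 1 + ennreal C0" by (intro add_mono mod C0 eff')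
    also have "\<dots> = ennreal (1 + C0)" using C0 by simp
    finally have main: "ennreal (?V powr (r * A - 1)) * (\<integral>\<^sup>+y\<in>cube z l. ennreal ((u y / \<mu>) powr r) \<partial>lebesgue) \<le> ennreal (1 + C0)" .
    define K where "K = \<mu> powr r * ?V powr (1 - r * A)"
    have "(\<integral>\<^sup>+y\<in>cube z l. ennreal (u y powr r) \<partial>lebesgue)
      = (\<integral>\<^sup>+y. ennreal (\<mu> powr r) * (ennreal ((u y / \<mu>) powr r) * indicator (cube z l) y) \<partial>lebesgue)"
      using lam u by (intro nn_integral_cong) (auto simp: powr_divide mult.assoc[symmetric] simp flip: ennreal_mult)
    also have "\<dots> = ennreal (\<mu> powr r) * (\<integral>\<^sup>+y\<in>cube z l. ennreal ((u y / \<mu>) powr r) \<partial>lebesgue)"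
      by (rule nn_integral_cmult) measurable
    also have "\<mu> powr r = K * ?V powr (r * A - 1)"
      using V l by (simp add: K_def mult.assoc flip: powr_add)
    also have "ennreal (K * ?V powr (r * A - 1)) * (\<integral>\<^sup>+y\<in>cube z l. ennreal ((u y / \<mu>) powr r) \<partial>lebesgue) \<le> ennreal K * ennreal (1 + C0)"
      using main by (simp add: ennreal_mult K_def mult.assoc mult_left_mono)
    also have "\<dots> = ennreal ((C * \<mu> * ?V powr (- A)) powr r * ?V)"
    proof -
      have "(C * \<mu> * ?V powr (- A)) powr r = C powr r * \<mu> powr r * ?V powr (- (r * A))"
        using V by (simp add: powr_mult powr_powr mult.commute)
      moreover have "C powr r = 1 + C0" using C0 r by (simp add: C_def powr_powr)
      moreover have "?V powr (- (r * A)) * ?V = ?V powr (1 - r * A)"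
        using V by (simp add: powr_diff powr_minus divide_inverse)
      ultimately have "K * (1 + C0) = (C * \<mu> * ?V powr (- A)) powr r * ?V" by (simp add: K_def mult_ac)
      moreover have "ennreal K * ennreal (1 + C0) = ennreal (K * (1 + C0))"
        by (rule ennreal_mult[symmetric]) (use C0 in \<open>auto simp: K_def\<close>)
      ultimately show ?thesis by simp
    qed
    finally show "(\<integral>\<^sup>+y\<in>cube z l. ennreal (u y powr r) \<partial>lebesgue) \<le> ennreal ((C * \<mu> * ?V powr (- A)) powr r * ?V)" .
  qed
qed

end

section \<open>The maximal function under a modular bound\<close>

text \<open>
  An integrable function to which all errors are charged that come from points where the
  quantity in question is too small to be compared.
\<close>

definition decay :: "real ^ 'n \<Rightarrow> real"
  where "decay x = (exp 1 + norm x) powr (- (real CARD('n) + 1))"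

lemma decay_nonneg: "0 \<le> decay x" by (simp add: decay_def)

lemma decay_measurable [measurable]: "(decay :: real ^ 'n \<Rightarrow> real) \<in> borel_measurable lebesgue"
proof -
  have "(decay :: real ^ 'n \<Rightarrow> real) \<in> borel_measurable lborel" unfolding decay_def by measurable
  then show ?thesis by (rule measurable_completion)
qed

lemma ennreal_term_le_suminf: "f k \<le> suminf f" for f :: "nat \<Rightarrow> ennreal"
  using sum_le_suminf[of f "{k}"] by simp

lemma decay_integral:
  "(\<integral>\<^sup>+x. ennreal (decay (x :: real ^ 'n)) \<partial>lebesgue) \<le> ennreal (2 ^ (2 * CARD('n) + 2))"
proof -
  let ?n = "CARD('n)"
  let ?B = "\<lambda>k::nat. cube (\<chi> i. - (2 ^ k) :: real ^ 'n) (2 * 2 ^ k)"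
  let ?w = "\<lambda>k::nat. 2 ^ (?n + 1) * (1/2) ^ (k * (?n + 1)) :: real"
  have pt: "ennreal (decay x) \<le> (\<Sum>k. ennreal (?w k) * indicator (?B k) x)" for x :: "real ^ 'n"
  proof -
    obtain k where k: "norm x \<le> 2 ^ k" "2 ^ k \<le> 2 * (exp 1 + norm x)"
    proof (cases "norm x \<le> 1")
      case True
      have "1 \<le> exp (1::real)" by simp
      then have "2 ^ 0 \<le> 2 * (exp 1 + norm x)" using norm_ge_zero[of x] by (simp, linarith)
      then show thesis using that[of 0] True by simp
    next
      case False
      have ex: "\<exists>k::nat. norm x \<le> 2 ^ k" using real_arch_pow[of 2 "norm x"] by (auto intro: less_imp_le)
      define k where "k = (LEAST k::nat. norm x \<le> 2 ^ k)"
      have k: "norm x \<le> 2 ^ k" unfolding k_def by (rule LeastI_ex[OF ex])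
      then have "k \<noteq> 0" using False by (auto intro!: Nat.gr0I)
      then obtain j where j: "k = Suc j" by (cases k) auto
      have "\<not> norm x \<le> 2 ^ j" using not_less_Least[of j "\<lambda>k. norm x \<le> 2 ^ k"] j k_def by auto
      then have "2 ^ k \<le> 2 * norm x" using j by simp
      then have "2 ^ k \<le> 2 * (exp 1 + norm x)" using exp_gt_zero[of "1::real"] by (smt (verit))
      then show thesis using that k by blast
    qed
    have inB: "x \<in> ?B k"
    proof -
      have "- (2 ^ k) \<le> x $ i \<and> x $ i \<le> - (2 ^ k) + 2 * 2 ^ k" for i
        using component_le_norm_cart[of x i] k by (simp add: abs_le_iff)
      then show ?thesis by (simp add: cube_def mem_box_cart)
    qed
    have "decay x \<le> ?w k"
    proof -
      have "(exp 1 + norm x) powr (- (real ?n + 1)) \<le> (2 ^ k / 2) powr (- (real ?n + 1))"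
        by (rule powr_mono2') (use k in auto)
      also have "\<dots> = 1 / (2 ^ k / 2) ^ (?n + 1)"
      proof -
        have b: "0 < (2::real) ^ k / 2" by simp
        have "real ?n + 1 = real (?n + 1)" by simp
        then show ?thesis unfolding powr_minus_divide by (simp only: powr_realpow[OF b])
      qed
      also have "\<dots> = ?w k" by (simp add: power_divide power_mult[symmetric] power_one_over power_add)
      finally show ?thesis by (simp add: decay_def)
    qed
    then have "ennreal (decay x) \<le> ennreal (?w k) * indicator (?B k) x" using inB by (simp add: ennreal_leI)
    also have "\<dots> \<le> (\<Sum>k. ennreal (?w k) * indicator (?B k) x)"
      by (rule ennreal_term_le_suminf)
    finally show ?thesis .
  qed
  have "(\<integral>\<^sup>+x. ennreal (decay (x :: real ^ 'n)) \<partial>lebesgue) \<le> (\<integral>\<^sup>+x. (\<Sum>k. ennreal (?w k) * indicator (?B k) x) \<partial>lebesgue)"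
    by (rule nn_integral_mono) (rule pt)
  also have "\<dots> = (\<Sum>k. \<integral>\<^sup>+x. ennreal (?w k) * indicator (?B k) x \<partial>lebesgue)"
    by (rule nn_integral_suminf) (use cube_sets in measurable)
  also have "\<dots> = (\<Sum>k. ennreal (2 ^ (2 * ?n + 1) * (1/2) ^ k))"
  proof (intro suminf_cong)
    fix k :: nat
    have "emeasure lebesgue (?B k) = ennreal ((2 * 2 ^ k) ^ ?n)" by (rule emeasure_cube) simp
    then have "(\<integral>\<^sup>+x. ennreal (?w k) * indicator (?B k) x \<partial>lebesgue) = ennreal (?w k * (2 * 2 ^ k) ^ ?n)"
      by (subst nn_integral_cmult_indicator[OF cube_sets]) (simp del: emeasure_completion flip: ennreal_mult)
    also have "?w k * (2 * 2 ^ k) ^ ?n = 2 ^ (2 * ?n + 1) * (1/2) ^ k"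
    proof -
      have "(2::real) ^ (?n * 2) = 2 ^ ?n * 2 ^ ?n" by (simp add: mult_2_right power_add)
      then show ?thesis by (simp add: power_mult_distrib power_add power_one_over field_simps flip: power_mult)
    qed
    finally show "(\<integral>\<^sup>+x. ennreal (?w k) * indicator (?B k) x \<partial>lebesgue) = ennreal (2 ^ (2 * ?n + 1) * (1/2) ^ k)" .
  qed
  also have "\<dots> = ennreal (\<Sum>k. 2 ^ (2 * ?n + 1) * (1/2) ^ k)"
    by (rule suminf_ennreal2) (auto intro!: summable_mult summable_geometric)
  also have "(\<Sum>k. 2 ^ (2 * ?n + 1) * (1/2 :: real) ^ k) = 2 ^ (2 * ?n + 1) * 2"
    by (subst suminf_mult) (auto simp: suminf_geometric intro!: summable_geometric)
  finally show ?thesis by simp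
qed

lemma ave_hb:
  assumes "(\<integral>\<^sup>+y\<in>hb (z :: real ^ 'n) l. ennreal (f y) \<partial>lebesgue) < \<infinity>" "0 < l"
  shows "(\<integral>\<^sup>+y\<in>hb z l. ennreal (f y) \<partial>lebesgue) = ennreal (ave lebesgue f (hb z l) * l ^ CARD('n))"
proof -
  have "measure lebesgue (hb z l) = l ^ CARD('n)" using assms by (intro measure_hb) simp
  then show ?thesis using assms unfolding ave_def by auto
qed

lemma ave_hb_le:
  assumes "(\<integral>\<^sup>+y\<in>hb (z :: real ^ 'n) l. ennreal (f y) \<partial>lebesgue) \<le> ennreal (K * l ^ CARD('n))" "0 < l" "0 \<le> K"
  shows "ave lebesgue f (hb z l) \<le> K"
proof -
  have "(\<integral>\<^sup>+y\<in>hb z l. ennreal (f y) \<partial>lebesgue) < \<infinity>" using assms(1) ennreal_less_top by (auto intro: le_less_trans)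
  from ave_hb[OF this assms(2)] have "ave lebesgue f (hb z l) * l ^ CARD('n) \<le> K * l ^ CARD('n)"
    using assms by (simp add: ennreal_le_iff)
  then show ?thesis using assms by simp
qed

context lh_exp begin

lemma integral_lower_power:
  assumes [measurable]: "h \<in> borel_measurable lebesgue" and h: "\<And>y. 0 \<le> h y"
    and mod: "(\<integral>\<^sup>+y. ennreal (h y powr (1 / \<alpha> y)) \<partial>lebesgue) \<le> 1"
    and e: "\<And>y. 0 \<le> e y" "\<And>y. e y \<le> 1 / \<alpha> y" and l: "0 < l"
  shows "(\<integral>\<^sup>+y\<in>hb z l. ennreal (h y powr e y) \<partial>lebesgue) < \<infinity>"
proof -
  have "(\<integral>\<^sup>+y\<in>hb z l. ennreal (h y powr e y) \<partial>lebesgue) \<le> (\<integral>\<^sup>+y. indicator (hb z l) y + ennreal (h y powr (1 / \<alpha> y)) \<partial>lebesgue)"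
  proof (rule nn_integral_mono)
    fix y
    have "h y powr e y \<le> 1 + h y powr (1 / \<alpha> y)"
    proof (cases "h y \<le> 1")
      case True
      then have "h y powr e y \<le> 1" using h[of y] e[of y] by (simp add: powr_le1)
      then show ?thesis by (simp add: add_increasing2)
    next
      case False
      then have "h y powr e y \<le> h y powr (1 / \<alpha> y)" using e[of y] by (intro powr_mono) auto
      then show ?thesis by simp
    qed
    then have "ennreal (h y powr e y) \<le> 1 + ennreal (h y powr (1 / \<alpha> y))"
      by (metis ennreal_1 ennreal_leI ennreal_plus powr_ge_zero zero_le_one)
    then show "ennreal (h y powr e y) * indicator (hb z l) y \<le> indicator (hb z l) y + ennreal (h y powr (1 / \<alpha> y))"
      by (auto simp: indicator_def)
  qed
  also have "\<dots> = emeasure lebesgue (hb z l) + (\<integral>\<^sup>+y. ennreal (h y powr (1 / \<alpha> y)) \<partial>lebesgue)"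
    using hb_sets[of z l] by (subst nn_integral_add) (auto simp del: emeasure_completion)
  also have "\<dots> \<le> ennreal (l ^ CARD('n)) + 1"
    using emeasure_hb[of l z] l mod by (intro add_mono) auto
  also have "\<dots> < \<infinity>" by (simp add: ennreal_add_less_top)
  finally show ?thesis .
qed

lemma average_power_bound:
  assumes s: "0 < s" "s * hi < 1"
  obtains C where "0 < C"
    "\<And>h z l A. \<lbrakk>h \<in> borel_measurable lebesgue; \<And>y. 0 \<le> h y; (\<integral>\<^sup>+y. ennreal (h y powr (1 / \<alpha> y)) \<partial>lebesgue) \<le> 1; effective \<alpha> \<beta> 1 z l A\<rbrakk> \<Longrightarrow>
     ave lebesgue (\<lambda>y. h y powr s) (hb z l) powr (1/s) \<le> C * (l ^ CARD('n)) powr (- A)"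
proof -
  obtain C where C: "0 < C" "\<And>z l A u \<mu>. \<lbrakk>effective \<alpha> \<beta> 1 z l A; u \<in> borel_measurable lebesgue; \<And>y. 0 \<le> u y; 0 < \<mu>;
       (\<integral>\<^sup>+y\<in>cube z l. ennreal ((u y / \<mu>) powr (1 / \<alpha> y)) \<partial>lebesgue) \<le> 1\<rbrakk> \<Longrightarrow>
       (\<integral>\<^sup>+y\<in>cube z l. ennreal (u y powr s) \<partial>lebesgue)
         \<le> ennreal ((C * \<mu> * (l ^ CARD('n)) powr (- A)) powr s * l ^ CARD('n))"
    by (rule average_le_modular[OF order.refl s]) blast
  show thesis
  proof (rule that[OF C(1)])
    fix h :: "real ^ 'n \<Rightarrow> real" and z :: "real ^ 'n" and l A :: real assume h: "h \<in> borel_measurable lebesgue" "\<And>y. 0 \<le> h y" "(\<integral>\<^sup>+y. ennreal (h y powr (1 / \<alpha> y)) \<partial>lebesgue) \<le> 1"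
      and eff: "effective \<alpha> \<beta> 1 z l A"
    have l: "0 < l" using eff by (simp add: effective_def)
    have "(\<integral>\<^sup>+y\<in>cube z l. ennreal ((h y / 1) powr (1 / \<alpha> y)) \<partial>lebesgue) \<le> (\<integral>\<^sup>+y. ennreal (h y powr (1 / \<alpha> y)) \<partial>lebesgue)"
      by (rule nn_integral_mono) (auto simp: indicator_def)
    then have "(\<integral>\<^sup>+y\<in>cube z l. ennreal ((h y / 1) powr (1 / \<alpha> y)) \<partial>lebesgue) \<le> 1" using h(3) by (rule order_trans)
    from C(2)[OF eff h(1,2) _ this]
    have "(\<integral>\<^sup>+y\<in>hb z l. ennreal (h y powr s) \<partial>lebesgue) \<le> ennreal ((C * (l ^ CARD('n)) powr (- A)) powr s * l ^ CARD('n))"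
      by (simp add: nn_integral_hb_cube)
    then have "ave lebesgue (\<lambda>y. h y powr s) (hb z l) \<le> (C * (l ^ CARD('n)) powr (- A)) powr s"
      by (rule ave_hb_le) (use l in auto)
    then have "ave lebesgue (\<lambda>y. h y powr s) (hb z l) powr (1/s) \<le> ((C * (l ^ CARD('n)) powr (- A)) powr s) powr (1/s)"
      using s by (intro powr_mono2 ave_nonneg) auto
    then show "ave lebesgue (\<lambda>y. h y powr s) (hb z l) powr (1/s) \<le> C * (l ^ CARD('n)) powr (- A)"
      using s C(1) l by (simp add: powr_powr)
  qed
qed

lemma log_shift:
  assumes "norm (x - y) \<le> CARD('n)"
  shows "ln (exp 1 + norm x) \<le> (1 + ln (1 + CARD('n))) * ln (exp 1 + norm (y :: real ^ 'n))"
proof -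
  let ?n = "real CARD('n)"
  have e1: "1 \<le> exp (1::real)" by simp
  have "norm x \<le> norm y + ?n" using assms norm_triangle_ineq2[of x y] by linarith
  moreover have "?n \<le> ?n * (exp 1 + norm y)" using mult_left_mono[of 1 "exp 1 + norm y" ?n] by (simp add: add_increasing2)
  ultimately have "exp 1 + norm x \<le> (1 + ?n) * (exp 1 + norm y)"
    unfolding distrib_right mult_1 by linarith
  then have "ln (exp 1 + norm x) \<le> ln ((1 + ?n) * (exp 1 + norm y))"
    by (subst ln_le_cancel_iff) (auto simp: add_pos_nonneg intro!: mult_pos_pos)
  also have "\<dots> = ln (1 + ?n) + ln (exp 1 + norm y)" by (rule ln_mult_pos) (auto simp: add_pos_nonneg)
  also have "ln (1 + ?n) \<le> ln (1 + ?n) * ln (exp 1 + norm y)"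
    using mult_left_mono[OF one_le_ln_e[of "norm y"], of "ln (1 + ?n)"] by simp
  finally show ?thesis by (simp add: distrib_right)
qed

lemma reciprocal_diff: "\<bar>1 / \<alpha> x - 1 / u\<bar> \<le> \<bar>\<alpha> x - u\<bar> / lo\<^sup>2" if "lo \<le> u"
proof -
  have u: "0 < u" using that lo by linarith
  have "\<bar>1 / \<alpha> x - 1 / u\<bar> = \<bar>(u - \<alpha> x) / (\<alpha> x * u)\<bar>"
    using u alpha_pos[of x] by (simp add: divide_simps)
  also have "\<dots> = \<bar>\<alpha> x - u\<bar> / (\<alpha> x * u)"
    using u alpha_pos[of x] by (simp add: abs_mult abs_minus_commute)
  also have "\<dots> \<le> \<bar>\<alpha> x - u\<bar> / lo\<^sup>2"
    unfolding power2_eq_square using that bounds(1)[of x] lo by (intro divide_left_mono mult_mono mult_pos_pos) auto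
  finally show ?thesis .
qed

lemma powr_change_exponent:
  fixes A d e K :: real
  assumes "0 < A" "\<bar>d\<bar> * \<bar>ln A\<bar> \<le> K"
  shows "A powr (e + d) \<le> exp K * A powr e"
proof -
  have "d * ln A \<le> \<bar>d\<bar> * \<bar>ln A\<bar>" using abs_ge_self[of "d * ln A"] by (simp only: abs_mult)
  then have "d * ln A \<le> K" using assms(2) by (rule order_trans)
  then have "A powr d \<le> exp K" using assms(1) by (simp add: powr_def)
  then show ?thesis by (simp add: powr_add mult.commute mult_right_mono)
qed

lemma decay_threshold:
  assumes A: "0 \<le> A" "A \<le> (exp 1 + norm (x :: real ^ 'n)) powr (- ((real CARD('n) + 1) * hi))" and u: "0 < u" "u \<le> hi"
  shows "A powr (1 / u) \<le> decay x"
proof -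
  let ?n = "real CARD('n)"
  have e1: "1 \<le> exp 1 + norm x" using one_le_exp_iff[of "1::real"] norm_ge_zero[of x] by linarith
  have "A powr (1 / u) \<le> ((exp 1 + norm x) powr (- ((?n + 1) * hi))) powr (1 / u)"
    using A u by (intro powr_mono2) auto
  also have "\<dots> = (exp 1 + norm x) powr (- ((?n + 1) * hi / u))" by (simp add: powr_powr)
  also have "\<dots> \<le> (exp 1 + norm x) powr (- (?n + 1))"
  proof (intro powr_mono e1)
    have "(?n + 1) * 1 \<le> (?n + 1) * (hi / u)" using u by (intro mult_left_mono) auto
    then show "- ((?n + 1) * hi / u) \<le> - (?n + 1)" by simp
  qed
  finally show ?thesis by (simp add: decay_def)
qed

text \<open>
  Let \<open>A\<close> be the mean of \<open>h\<close> of order \<open>s\<close> over the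
  cell. Either \<open>A\<close> is so small that \<open>A powr (1 / \<alpha> x)\<close> is
  charged to \<open>decay x\<close>, or \<open>|ln A|\<close> is at most a constant times
  \<open>1 + |ln l|\<close> (if \<open>A \<ge> 1\<close>, by the modular bound) or \<open>ln
  (e + norm x)\<close> (if \<open>A < 1\<close>). In both cases log-Hoelder continuity makes
  \<open>A powr (1 / \<alpha> y)\<close> comparable with \<open>A powr (1 / \<alpha>
  x)\<close> for all \<open>y\<close> in the cell. This allows one to pass to the fixed
  integrand \<open>h y powr (s * hi / \<alpha> y)\<close>, which does not depend on
  \<open>x\<close> and whose power \<open>1 / (s * hi)\<close> is the integrand of the
  modular. As this power is greater than \<open>1\<close>, Doob's inequality applies to it.
\<close>

lemma pointwise_small:
  assumes s: "0 < s" "s * hi < 1"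
  obtains C where "0 < C"
    "\<And>h z l x. \<lbrakk>h \<in> borel_measurable lebesgue; \<And>y. 0 \<le> h y; (\<integral>\<^sup>+y. ennreal (h y powr (1 / \<alpha> y)) \<partial>lebesgue) \<le> 1;
       0 < l; l \<le> 1; x \<in> hb z l\<rbrakk> \<Longrightarrow>
     ave lebesgue (\<lambda>y. h y powr s) (hb z l) powr (1 / (s * \<alpha> x))
       \<le> C * (ave lebesgue (\<lambda>y. h y powr (s * hi / \<alpha> y)) (hb z l) powr (1 / (s * hi)) + decay x)"
proof -
  let ?n = "real CARD('n)"
  obtain CB where CB: "0 < CB"
    "\<And>h z l A. \<lbrakk>h \<in> borel_measurable lebesgue; \<And>y. 0 \<le> h y; (\<integral>\<^sup>+y. ennreal (h y powr (1 / \<alpha> y)) \<partial>lebesgue) \<le> 1; effective \<alpha> \<beta> 1 z l A\<rbrakk> \<Longrightarrow>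
     ave lebesgue (\<lambda>y. h y powr s) (hb z l) powr (1/s) \<le> CB * (l ^ CARD('n)) powr (- A)"
    by (rule average_power_bound[OF s]) blast
  define N where "N = (?n + 1) * hi"
  have N: "0 < N" using hi_pos by (simp add: N_def)
  have n1: "1 \<le> ?n" by (simp add: Suc_leI)
  define K1 where "K1 = c * \<bar>ln CB\<bar> + hi * ?n * (c * (1 + ln ?n))"
  define K2 where "K2 = N * (c * (2 + ln (1 + ?n)))"
  have K1: "0 \<le> K1" unfolding K1_def using c hi_pos n1 by (intro add_nonneg_nonneg mult_nonneg_nonneg) auto
  have K2: "0 \<le> K2" unfolding K2_def using c N by (intro mult_nonneg_nonneg add_nonneg_nonneg) auto
  define K where "K = s * hi * ((K1 + K2) / lo\<^sup>2)"
  define C1 where "C1 = 2 powr (hi / lo)"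
  define M where "M = 2 * C1 * exp K"
  have M: "0 < M" by (simp add: M_def C1_def)
  define C where "C = M powr (1 / (s * hi)) + 1"
  have C: "1 \<le> C" "M powr (1 / (s * hi)) \<le> C" by (auto simp: C_def)
  show thesis
  proof (rule that[of C])
    show "0 < C" using C by simp
    fix h :: "real ^ 'n \<Rightarrow> real" and z x :: "real ^ 'n" and l :: real
    assume hm[measurable]: "h \<in> borel_measurable lebesgue" and h: "\<And>y. 0 \<le> h y"
      and mod: "(\<integral>\<^sup>+y. ennreal (h y powr (1 / \<alpha> y)) \<partial>lebesgue) \<le> 1" and l: "0 < l" "l \<le> 1" and x: "x \<in> hb z l"
    let ?Q = "hb z l" and ?V = "l ^ CARD('n)"
    define a where "a = ave lebesgue (\<lambda>y. h y powr s) ?Q"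
    define g where "g = ave lebesgue (\<lambda>y. h y powr (s * hi / \<alpha> y)) ?Q"
    define A where "A = a powr (1 / s)"
    have a0: "0 \<le> a" "0 \<le> g" by (simp_all add: a_def g_def ave_nonneg)
    have A0: "0 \<le> A" by (simp add: A_def)
    have aA: "a = A powr s" using a0 s by (simp add: A_def powr_powr)
    have xc: "x \<in> cube z l" using x hb_subset_cube by blast
    have lhs: "a powr (1 / (s * \<alpha> x)) = A powr (1 / \<alpha> x)" by (simp add: A_def powr_powr)
    have dec: "0 \<le> decay x" by (rule decay_nonneg)
    have gp: "0 \<le> g powr (1 / (s * hi))" by simp
    show "ave lebesgue (\<lambda>y. h y powr s) ?Q powr (1 / (s * \<alpha> x)) \<le> C * (ave lebesgue (\<lambda>y. h y powr (s * hi / \<alpha> y)) ?Q powr (1 / (s * hi)) + decay x)"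
      unfolding a_def[symmetric] g_def[symmetric] lhs
    proof (cases "A \<le> (exp 1 + norm x) powr (- ((?n + 1) * hi))")
      case True
      then have "A powr (1 / \<alpha> x) \<le> decay x" by (intro decay_threshold A0 alpha_pos bounds)
      also have "\<dots> \<le> C * decay x" using mult_right_mono[OF C(1) dec] by simp
      also have "\<dots> \<le> C * (g powr (1 / (s * hi)) + decay x)" using C(1) by (intro mult_left_mono) auto
      finally show "A powr (1 / \<alpha> x) \<le> C * (g powr (1 / (s * hi)) + decay x)" .
    next
      case False
      then have low: "(exp 1 + norm x) powr (- N) < A" by (simp add: N_def)
      have ex: "0 < exp 1 + norm x" by (simp add: add_pos_nonneg)
      have Ap: "0 < A" using low by (meson less_le_trans less_imp_le powr_ge_zero le_less_trans)
      have Aup: "A \<le> CB * ?V powr (- \<alpha> x)"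
        unfolding A_def a_def using l xc by (intro CB(2) hm h mod) (auto simp: effective_def)
      have logA: "\<bar>\<alpha> x - \<alpha> y\<bar> * \<bar>ln A\<bar> \<le> K1 + K2" if y: "y \<in> ?Q" for y
      proof (cases "1 \<le> A")
        case True
        have yc: "y \<in> cube z l" using y hb_subset_cube by blast
        have "ln A \<le> ln (CB * ?V powr (- \<alpha> x))" using Ap Aup by (intro ln_mono) auto
        also have "\<dots> = ln CB - \<alpha> x * (?n * ln l)" using CB(1) l by (simp add: ln_mult ln_powr ln_realpow)
        also have "\<dots> \<le> \<bar>ln CB\<bar> + hi * ?n * \<bar>ln l\<bar>"
        proof -
          have "- (\<alpha> x * (?n * ln l)) \<le> \<bar>\<alpha> x * (?n * ln l)\<bar>" by (rule abs_ge_minus_self)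
          also have "\<dots> = \<alpha> x * (?n * \<bar>ln l\<bar>)" using alpha_pos[of x] by (simp add: abs_mult)
          also have "\<dots> \<le> hi * (?n * \<bar>ln l\<bar>)" by (intro mult_right_mono bounds) auto
          finally show ?thesis by simp
        qed
        finally have "\<bar>ln A\<bar> \<le> \<bar>ln CB\<bar> + hi * ?n * \<bar>ln l\<bar>" using True by simp
        then have "\<bar>\<alpha> x - \<alpha> y\<bar> * \<bar>ln A\<bar> \<le> \<bar>\<alpha> x - \<alpha> y\<bar> * (\<bar>ln CB\<bar> + hi * ?n * \<bar>ln l\<bar>)" by (rule mult_left_mono) simp
        also have "\<dots> = \<bar>\<alpha> x - \<alpha> y\<bar> * \<bar>ln CB\<bar> + hi * ?n * (\<bar>\<alpha> x - \<alpha> y\<bar> * \<bar>ln l\<bar>)" by (simp add: algebra_simps)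
        also have "\<dots> \<le> c * \<bar>ln CB\<bar> + hi * ?n * (c * (1 + ln ?n + ln 1))"
          using hi_pos l by (intro add_mono mult_right_mono mult_left_mono diff_le_c osc_log[OF xc yc]) auto
        finally show ?thesis using K2 by (simp add: K1_def)
      next
        case False
        let ?k = "ln (exp 1 + norm x)"
        have k1: "1 \<le> ?k" "1 \<le> ln (exp 1 + norm y)" by (simp_all add: one_le_ln_e)
        have "- N * ?k = ln ((exp 1 + norm x) powr (- N))" using ex by (simp add: ln_powr)
        also have "\<dots> \<le> ln A" using low ex by (intro ln_mono) auto
        finally have lnA: "\<bar>ln A\<bar> \<le> N * ?k" using False Ap by simp
        have "norm (x - y) \<le> ?n * l" using norm_diff_cube[of x z l y] xc y hb_subset_cube by blast
        also have "\<dots> \<le> ?n" using l by simp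
        finally have sh: "?k \<le> (1 + ln (1 + ?n)) * ln (exp 1 + norm y)" using log_shift by simp
        have "\<bar>\<alpha> x - \<alpha> y\<bar> \<le> c / ?k + c / ln (exp 1 + norm y)"
          using inf[of x] inf[of y] by linarith
        also have "c / ln (exp 1 + norm y) \<le> c * ((1 + ln (1 + ?n)) / ?k)"
        proof -
          have "1 / ln (exp 1 + norm y) \<le> (1 + ln (1 + ?n)) / ?k" using sh k1 by (simp add: field_simps)
          from mult_left_mono[OF this c] show ?thesis by simp
        qed
        also have "c / ?k + c * ((1 + ln (1 + ?n)) / ?k) = c * (2 + ln (1 + ?n)) / ?k"
          by (simp only: times_divide_eq_right add_divide_distrib[symmetric]) (simp add: algebra_simps)
        finally have d: "\<bar>\<alpha> x - \<alpha> y\<bar> \<le> c * (2 + ln (1 + ?n)) / ?k" by simp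
        have "\<bar>\<alpha> x - \<alpha> y\<bar> * \<bar>ln A\<bar> \<le> (c * (2 + ln (1 + ?n)) / ?k) * (N * ?k)"
          by (intro mult_mono d lnA) (use c k1 N in \<open>auto intro!: divide_nonneg_pos mult_nonneg_nonneg add_nonneg_nonneg\<close>)
        also have "\<dots> = K2" using k1 by (simp add: K2_def)
        finally show ?thesis using K1 by simp
      qed
      have change: "A powr (s - s * hi / \<alpha> y) \<le> exp K * A powr (s - s * hi / \<alpha> x)" if y: "y \<in> ?Q" for y
      proof -
        let ?d = "s * hi * (1 / \<alpha> x - 1 / \<alpha> y)"
        have "\<bar>?d\<bar> * \<bar>ln A\<bar> = s * hi * (\<bar>1 / \<alpha> x - 1 / \<alpha> y\<bar> * \<bar>ln A\<bar>)" using s hi_pos by (simp add: abs_mult)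
        also have "\<dots> \<le> s * hi * ((\<bar>\<alpha> x - \<alpha> y\<bar> / lo\<^sup>2) * \<bar>ln A\<bar>)"
          using s hi_pos by (intro mult_left_mono mult_right_mono reciprocal_diff bounds) auto
        also have "\<dots> = s * hi * ((\<bar>\<alpha> x - \<alpha> y\<bar> * \<bar>ln A\<bar>) / lo\<^sup>2)" by simp
        also have "\<dots> \<le> K" unfolding K_def using s hi_pos by (intro mult_left_mono divide_right_mono logA y) auto
        finally have "A powr ((s - s * hi / \<alpha> x) + ?d) \<le> exp K * A powr (s - s * hi / \<alpha> x)" by (rule powr_change_exponent[OF Ap])
        moreover have "(s - s * hi / \<alpha> x) + ?d = s - s * hi / \<alpha> y" by (simp add: algebra_simps)
        ultimately show ?thesis by simp
      qed
      \<comment> \<open>Jensen's inequality with variable exponent \<open>\<kappa> = hi / \<alpha> y \<ge>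
          1\<close>, in the form \<open>t \<le> 1/2 + C * t powr \<kappa>\<close>; averaging
          absorbs the first summand\<close>
      have pt: "h y powr s \<le> a / 2 + (C1 * exp K * A powr (s - s * hi / \<alpha> x)) * h y powr (s * hi / \<alpha> y)" if y: "y \<in> ?Q" for y
      proof -
        define \<kappa> where "\<kappa> = hi / \<alpha> y"
        have kap: "1 \<le> \<kappa>" "\<kappa> \<le> hi / lo" unfolding \<kappa>_def using bounds[of y] alpha_pos[of y] lo hi_pos by (auto intro: divide_left_mono)
        define t where "t = (h y / A) powr s"
        have t0: "0 \<le> t" by (simp add: t_def)
        have "t \<le> 1/2 + C1 * t powr \<kappa>"
        proof (cases "t \<le> 1/2")
          case True
          then show ?thesis by (simp add: C1_def add_increasing2)
        next
          case False
          then have tp: "1/2 < t" by simp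
          have "t = t powr \<kappa> * t powr (1 - \<kappa>)" using tp by (simp flip: powr_add)
          also have "\<dots> \<le> t powr \<kappa> * (1/2) powr (1 - \<kappa>)" using tp kap by (intro mult_left_mono powr_mono2') auto
          also have "(1/2) powr (1 - \<kappa>) = 2 powr (\<kappa> - 1)" by (simp add: powr_divide powr_minus powr_diff)
          also have "t powr \<kappa> * 2 powr (\<kappa> - 1) \<le> t powr \<kappa> * C1" unfolding C1_def using kap by (intro mult_left_mono powr_mono) auto
          finally show ?thesis by (simp add: mult.commute)
        qed
        then have "A powr s * t \<le> A powr s * (1/2 + C1 * t powr \<kappa>)" by (intro mult_left_mono) auto
        also have "\<dots> = a / 2 + C1 * (A powr s * t powr \<kappa>)" by (simp add: aA algebra_simps)
        also have "A powr s * t = h y powr s" using Ap h[of y] by (simp add: t_def powr_divide)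
        also have "A powr s * t powr \<kappa> = A powr (s - s * hi / \<alpha> y) * h y powr (s * hi / \<alpha> y)"
          using Ap h[of y] by (simp add: t_def \<kappa>_def powr_powr powr_divide powr_diff)
        also have "\<dots> \<le> exp K * A powr (s - s * hi / \<alpha> x) * h y powr (s * hi / \<alpha> y)"
          by (intro mult_right_mono change y) simp
        finally show ?thesis by (simp add: C1_def mult.assoc)
      qed
      have fin1: "(\<integral>\<^sup>+y\<in>?Q. ennreal (h y powr s) \<partial>lebesgue) < \<infinity>"
      proof (rule integral_lower_power[OF hm h mod _ _ l(1)])
        fix y
        have "s * \<alpha> y \<le> s * hi" using s by (intro mult_left_mono bounds) auto
        then have "s * \<alpha> y \<le> 1" using s by linarith
        then show "s \<le> 1 / \<alpha> y" using alpha_pos[of y] by (simp add: pos_le_divide_eq)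
      qed (use s in auto)
      have fin2: "(\<integral>\<^sup>+y\<in>?Q. ennreal (h y powr (s * hi / \<alpha> y)) \<partial>lebesgue) < \<infinity>"
        by (rule integral_lower_power[OF hm h mod _ _ l(1)]) (use s hi_pos alpha_pos in \<open>auto intro!: divide_right_mono simp: less_imp_le\<close>)
      let ?M = "C1 * exp K * A powr (s - s * hi / \<alpha> x)"
      have M0: "0 \<le> ?M" by (simp add: C1_def)
      have V: "0 < ?V" using l by simp
      have vol: "emeasure lebesgue ?Q = ennreal ?V" using l by (intro emeasure_hb) simp
      have "ennreal (a * ?V) = (\<integral>\<^sup>+y\<in>?Q. ennreal (h y powr s) \<partial>lebesgue)" unfolding a_def by (rule ave_hb[OF fin1 l(1), symmetric])
      also have "\<dots> \<le> (\<integral>\<^sup>+y. ennreal (a / 2) * indicator ?Q y + ennreal ?M * (ennreal (h y powr (s * hi / \<alpha> y)) * indicator ?Q y) \<partial>lebesgue)"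
      proof (rule nn_integral_mono)
        fix y
        show "ennreal (h y powr s) * indicator ?Q y \<le> ennreal (a / 2) * indicator ?Q y + ennreal ?M * (ennreal (h y powr (s * hi / \<alpha> y)) * indicator ?Q y)"
          using pt[of y] a0 M0 by (auto simp: indicator_def simp flip: ennreal_mult ennreal_plus intro!: ennreal_leI)
      qed
      also have "\<dots> = ennreal (a / 2) * ennreal ?V + ennreal ?M * (\<integral>\<^sup>+y\<in>?Q. ennreal (h y powr (s * hi / \<alpha> y)) \<partial>lebesgue)"
        using hb_sets[of z l] by (subst nn_integral_add) (auto simp del: emeasure_completion simp add: nn_integral_cmult_indicator nn_integral_cmult vol)
      also have "(\<integral>\<^sup>+y\<in>?Q. ennreal (h y powr (s * hi / \<alpha> y)) \<partial>lebesgue) = ennreal (g * ?V)" unfolding g_def by (rule ave_hb[OF fin2 l(1)])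
      also have "ennreal (a / 2) * ennreal ?V + ennreal ?M * ennreal (g * ?V) = ennreal ((a / 2 + ?M * g) * ?V)"
      proof -
        have "0 \<le> a / 2 * ?V" "0 \<le> ?M * (g * ?V)" using a0 M0 V by auto
        then have "ennreal (a / 2 * ?V) + ennreal (?M * (g * ?V)) = ennreal (a / 2 * ?V + ?M * (g * ?V))" by (rule ennreal_plus[symmetric])
        moreover have "ennreal (a / 2) * ennreal ?V = ennreal (a / 2 * ?V)" using a0 V by (intro ennreal_mult[symmetric]) auto
        moreover have "ennreal ?M * ennreal (g * ?V) = ennreal (?M * (g * ?V))" using a0 V M0 by (intro ennreal_mult[symmetric]) auto
        ultimately show ?thesis by (simp add: distrib_right mult.assoc)
      qed
      finally have "a * ?V \<le> (a / 2 + ?M * g) * ?V"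
        using a0 M0 V by (subst (asm) ennreal_le_iff) (auto intro!: mult_nonneg_nonneg add_nonneg_nonneg)
      then have "a \<le> a / 2 + ?M * g" using V by (simp add: mult_le_cancel_right)
      then have le: "a \<le> 2 * (?M * g)" by linarith
      have "A powr (s - s * hi / \<alpha> x) = A powr s * A powr (- (s * hi / \<alpha> x))" by (simp flip: powr_add)
      then have "2 * (?M * g) = A powr s * (A powr (- (s * hi / \<alpha> x)) * (M * g))" by (simp add: M_def)
      with le have "A powr s \<le> A powr s * (A powr (- (s * hi / \<alpha> x)) * (M * g))" by (simp only: aA[symmetric])
      then have "1 \<le> A powr (- (s * hi / \<alpha> x)) * (M * g)" using Ap by simp
      then have "A powr (s * hi / \<alpha> x) \<le> M * g" using Ap by (simp add: powr_minus field_simps)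
      then have "(A powr (s * hi / \<alpha> x)) powr (1 / (s * hi)) \<le> (M * g) powr (1 / (s * hi))"
        using s hi_pos by (intro powr_mono2) auto
      then have "A powr (1 / \<alpha> x) \<le> M powr (1 / (s * hi)) * g powr (1 / (s * hi))"
        using s hi_pos M a0 by (simp add: powr_powr powr_mult)
      also have "\<dots> \<le> C * g powr (1 / (s * hi))" by (intro mult_right_mono C) simp
      also have "\<dots> \<le> C * (g powr (1 / (s * hi)) + decay x)" using C(1) dec by (intro mult_left_mono) auto
      finally show "A powr (1 / \<alpha> x) \<le> C * (g powr (1 / (s * hi)) + decay x)" .
    qed
  qed
qed

text \<open>
  On cells of unit side the exponent at a point may be exchanged for the limit exponent, by
  the same comparison and with the same error.
\<close>

lemma pointwise_unit:
  assumes s: "0 < s" "s * hi < 1"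
  obtains C where "0 < C"
    "\<And>h z x. \<lbrakk>h \<in> borel_measurable lebesgue; \<And>y. 0 \<le> h y; (\<integral>\<^sup>+y. ennreal (h y powr (1 / \<alpha> y)) \<partial>lebesgue) \<le> 1; x \<in> hb z 1\<rbrakk> \<Longrightarrow>
     ave lebesgue (\<lambda>y. h y powr s) (hb z 1) powr (1 / (s * \<beta>))
       \<le> C * (ave lebesgue (\<lambda>y. h y powr s) (hb z 1) powr (1 / (s * \<alpha> x)) + decay x)"
proof -
  let ?n = "real CARD('n)"
  obtain CB where CB: "0 < CB"
    "\<And>h z l A. \<lbrakk>h \<in> borel_measurable lebesgue; \<And>y. 0 \<le> h y; (\<integral>\<^sup>+y. ennreal (h y powr (1 / \<alpha> y)) \<partial>lebesgue) \<le> 1; effective \<alpha> \<beta> 1 z l A\<rbrakk> \<Longrightarrow>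
     ave lebesgue (\<lambda>y. h y powr s) (hb z l) powr (1/s) \<le> CB * (l ^ CARD('n)) powr (- A)"
    by (rule average_power_bound[OF s]) blast
  define N where "N = (?n + 1) * hi"
  have N: "0 < N" using hi_pos by (simp add: N_def)
  define K where "K = (c * \<bar>ln CB\<bar> + c * N) / lo\<^sup>2"
  define C where "C = exp K + 1"
  have C: "1 \<le> C" "exp K \<le> C" by (auto simp: C_def)
  show thesis
  proof (rule that[of C])
    show "0 < C" using C by simp
    fix h :: "real ^ 'n \<Rightarrow> real" and z x :: "real ^ 'n"
    assume h: "h \<in> borel_measurable lebesgue" "\<And>y. 0 \<le> h y"
      "(\<integral>\<^sup>+y. ennreal (h y powr (1 / \<alpha> y)) \<partial>lebesgue) \<le> 1" and x: "x \<in> hb z 1"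
    define a where "a = ave lebesgue (\<lambda>y. h y powr s) (hb z 1)"
    define A where "A = a powr (1 / s)"
    have A0: "0 \<le> A" by (simp add: A_def)
    have eq: "a powr (1 / (s * u)) = A powr (1 / u)" for u by (simp add: A_def powr_powr)
    have dec: "0 \<le> decay x" by (rule decay_nonneg)
    show "ave lebesgue (\<lambda>y. h y powr s) (hb z 1) powr (1 / (s * \<beta>)) \<le> C * (ave lebesgue (\<lambda>y. h y powr s) (hb z 1) powr (1 / (s * \<alpha> x)) + decay x)"
      unfolding a_def[symmetric] eq
    proof (cases "A \<le> (exp 1 + norm x) powr (- ((?n + 1) * hi))")
      case True
      then have "A powr (1 / \<beta>) \<le> decay x" by (intro decay_threshold A0 beta_pos bounds_inf)
      also have "\<dots> \<le> C * decay x" using mult_right_mono[OF C(1) dec] by simp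
      also have "\<dots> \<le> C * (A powr (1 / \<alpha> x) + decay x)" using C(1) by (intro mult_left_mono) auto
      finally show "A powr (1 / \<beta>) \<le> C * (A powr (1 / \<alpha> x) + decay x)" .
    next
      case False
      then have low: "(exp 1 + norm x) powr (- N) < A" by (simp add: N_def)
      have ex: "0 < exp 1 + norm x" by (simp add: add_pos_nonneg)
      have Ap: "0 < A" using low by (meson less_le_trans less_imp_le powr_ge_zero le_less_trans)
      have "effective \<alpha> \<beta> 1 z 1 \<beta>" by (simp add: effective_def)
      from CB(2)[OF h this] have Aup: "A \<le> CB" by (simp add: A_def a_def)
      let ?k = "ln (exp 1 + norm x)"
      have k1: "1 \<le> ?k" by (simp add: one_le_ln_e)
      have d1: "\<bar>\<alpha> x - \<beta>\<bar> \<le> c" using inf[of x] divide_left_mono[OF k1 c] k1 by simp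
      have "\<bar>\<alpha> x - \<beta>\<bar> * \<bar>ln A\<bar> \<le> c * \<bar>ln CB\<bar> + c * N"
      proof (cases "1 \<le> A")
        case True
        then have "\<bar>ln A\<bar> \<le> \<bar>ln CB\<bar>" using Aup Ap by simp
        then have "\<bar>\<alpha> x - \<beta>\<bar> * \<bar>ln A\<bar> \<le> c * \<bar>ln CB\<bar>" by (intro mult_mono d1 c) auto
        then show ?thesis using c N by (simp add: add_increasing2)
      next
        case False
        have "- N * ?k = ln ((exp 1 + norm x) powr (- N))" using ex by (simp add: ln_powr)
        also have "\<dots> \<le> ln A" using low ex by (intro ln_mono) auto
        finally have "\<bar>ln A\<bar> \<le> N * ?k" using False Ap by simp
        then have "\<bar>\<alpha> x - \<beta>\<bar> * \<bar>ln A\<bar> \<le> (c / ?k) * (N * ?k)" using c k1 by (intro mult_mono inf) auto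
        also have "\<dots> = c * N" using k1 by simp
        finally show ?thesis using c by (simp add: add_increasing)
      qed
      then have K': "(\<bar>\<alpha> x - \<beta>\<bar> * \<bar>ln A\<bar>) / lo\<^sup>2 \<le> K" unfolding K_def by (rule divide_right_mono) simp
      have "\<bar>1 / \<beta> - 1 / \<alpha> x\<bar> * \<bar>ln A\<bar> \<le> (\<bar>\<alpha> x - \<beta>\<bar> / lo\<^sup>2) * \<bar>ln A\<bar>"
        using reciprocal_diff[OF bounds_inf(1), of x] by (intro mult_right_mono) (auto simp: abs_minus_commute)
      also have "\<dots> \<le> K" using K' by simp
      finally have "A powr (1 / \<alpha> x + (1 / \<beta> - 1 / \<alpha> x)) \<le> exp K * A powr (1 / \<alpha> x)" by (rule powr_change_exponent[OF Ap])
      then have "A powr (1 / \<beta>) \<le> exp K * A powr (1 / \<alpha> x)" by simp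
      also have "\<dots> \<le> C * A powr (1 / \<alpha> x)" by (intro mult_right_mono C) simp
      also have "\<dots> \<le> C * (A powr (1 / \<alpha> x) + decay x)" using C(1) dec by (intro mult_left_mono) auto
      finally show "A powr (1 / \<beta>) \<le> C * (A powr (1 / \<alpha> x) + decay x)" .
    qed
  qed
qed

text \<open>
  Small cells are handled pointwise and then by Doob's inequality. For the cells of side at
  least \<open>1\<close> only the averages \<open>Ht\<close> of \<open>h powr s\<close> over
  unit cells matter, and for these the constant exponent \<open>1 / \<beta>\<close> is the
  right one: \<open>Ht powr (1 / (s * \<beta>))\<close> is integrable by the comparison on
  unit cells, and Doob's inequality for the exponent \<open>1 / (s * \<beta>) > 1\<close>
  applies to all larger cells at once. The generation \<open>J0\<close> is the one of the
  unit cells.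
\<close>

lemma maximal_control:
  assumes s: "0 < s" "s * hi < 1"
  obtains C where "0 < C"
    "\<And>\<tau> \<delta> J0 k x0 h. \<lbrakk>0 < \<delta>; \<delta> * 2 ^ J0 = 1; J0 \<le> k; h \<in> borel_measurable lebesgue; \<And>y. 0 \<le> h y;
       (\<integral>\<^sup>+y. ennreal (h y powr (1 / \<alpha> y)) \<partial>lebesgue) \<le> 1\<rbrakk> \<Longrightarrow>
     \<exists>\<Psi>. \<Psi> \<in> borel_measurable lebesgue \<and> (\<forall>x. 0 \<le> \<Psi> x) \<and> (\<integral>\<^sup>+x\<in>dcell \<tau> \<delta> k x0. ennreal (\<Psi> x) \<partial>lebesgue) \<le> ennreal C \<and>
       (\<forall>j\<le>k. \<forall>x. (j \<le> J0 \<longrightarrow> ave lebesgue (\<lambda>y. h y powr s) (dcell \<tau> \<delta> j x) powr (1 / (s * \<alpha> x)) \<le> \<Psi> x) \<and>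
                  (J0 \<le> j \<longrightarrow> ave lebesgue (\<lambda>y. h y powr s) (dcell \<tau> \<delta> j x) powr (1 / (s * \<beta>)) \<le> \<Psi> x))"
proof -
  obtain C1 where C1: "0 < C1"
    "\<And>h z l x. \<lbrakk>h \<in> borel_measurable lebesgue; \<And>y. 0 \<le> h y; (\<integral>\<^sup>+y. ennreal (h y powr (1 / \<alpha> y)) \<partial>lebesgue) \<le> 1;
       0 < l; l \<le> 1; x \<in> hb z l\<rbrakk> \<Longrightarrow>
     ave lebesgue (\<lambda>y. h y powr s) (hb z l) powr (1 / (s * \<alpha> x))
       \<le> C1 * (ave lebesgue (\<lambda>y. h y powr (s * hi / \<alpha> y)) (hb z l) powr (1 / (s * hi)) + decay x)"
    by (rule pointwise_small[OF s]) blast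
  obtain C2 where C2: "0 < C2"
    "\<And>h z x. \<lbrakk>h \<in> borel_measurable lebesgue; \<And>y. 0 \<le> h y; (\<integral>\<^sup>+y. ennreal (h y powr (1 / \<alpha> y)) \<partial>lebesgue) \<le> 1; x \<in> hb z 1\<rbrakk> \<Longrightarrow>
     ave lebesgue (\<lambda>y. h y powr s) (hb z 1) powr (1 / (s * \<beta>))
       \<le> C2 * (ave lebesgue (\<lambda>y. h y powr s) (hb z 1) powr (1 / (s * \<alpha> x)) + decay x)"
    by (rule pointwise_unit[OF s]) blast
  define \<gamma> where "\<gamma> = 1 / (s * hi)"
  define \<gamma>' where "\<gamma>' = 1 / (s * \<beta>)"
  have shi: "0 < s * hi" and sb: "0 < s * \<beta>" using s hi_pos beta_pos by auto
  have "s * \<beta> \<le> s * hi" using s by (intro mult_left_mono bounds_inf) auto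
  then have "s * \<beta> < 1" using s by linarith
  then have g: "1 < \<gamma>" "1 < \<gamma>'" using s shi sb by (auto simp: \<gamma>_def \<gamma>'_def)
  define d1 where "d1 = (\<gamma> / (\<gamma> - 1)) powr \<gamma>"
  define d2 where "d2 = (\<gamma>' / (\<gamma>' - 1)) powr \<gamma>'"
  have d: "0 \<le> d1" "0 \<le> d2" by (simp_all add: d1_def d2_def)
  define Dn :: real where "Dn = 2 ^ (2 * CARD('n) + 2)"
  have Dn: "0 \<le> Dn" by (simp add: Dn_def)
  define E1 where "E1 = C1 * (d1 + Dn)"
  have E1: "0 \<le> E1" using C1(1) d Dn by (simp add: E1_def)
  define C where "C = E1 + d2 * (C2 * (E1 + Dn)) + 1"
  show thesis
  proof (rule that[of C])
    show "0 < C" unfolding C_def using E1 d C2(1) Dn by (intro add_nonneg_pos add_nonneg_nonneg mult_nonneg_nonneg) auto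
    fix \<tau> x0 :: "real ^ 'n" and \<delta> :: real and J0 k :: nat and h :: "real ^ 'n \<Rightarrow> real"
    assume \<delta>: "0 < \<delta>" "\<delta> * 2 ^ J0 = 1" and J0: "J0 \<le> k" and hm[measurable]: "h \<in> borel_measurable lebesgue"
      and h: "\<And>y. 0 \<le> h y" and mod: "(\<integral>\<^sup>+y. ennreal (h y powr (1 / \<alpha> y)) \<partial>lebesgue) \<le> 1"
    let ?cell = "dcell \<tau> \<delta>"
    interpret T: cell_tree lebesgue ?cell by (rule dcell_tree[OF \<delta>(1)])
    let ?H = "\<lambda>y. h y powr s"
    define G where "G y = h y powr (s * hi / \<alpha> y)" for y
    define Ht where "Ht y = ave lebesgue ?H (?cell J0 y)" for y
    have Gm[measurable]: "G \<in> borel_measurable lebesgue" unfolding G_def by measurable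
    have Htm[measurable]: "Ht \<in> borel_measurable lebesgue" unfolding Ht_def by (rule T.measurable_cell)
    have side: "0 < \<delta> * 2 ^ j" for j :: nat using \<delta> by simp
    have finH: "(\<integral>\<^sup>+y\<in>?cell j x. ennreal (?H y) \<partial>lebesgue) < \<infinity>" for j x
      unfolding dcell_eq_hb[OF \<delta>(1)]
    proof (rule integral_lower_power[OF hm h mod _ _ side])
      fix y
      have "s * \<alpha> y \<le> s * hi" using s by (intro mult_left_mono bounds) auto
      then have "s * \<alpha> y \<le> 1" using s by linarith
      then show "s \<le> 1 / \<alpha> y" using alpha_pos[of y] by (simp add: pos_le_divide_eq)
    qed (use s in auto)
    have finG: "(\<integral>\<^sup>+y\<in>?cell j x. ennreal (G y) \<partial>lebesgue) < \<infinity>" for j x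
      unfolding dcell_eq_hb[OF \<delta>(1)] G_def
      by (rule integral_lower_power[OF hm h mod _ _ side]) (use s hi_pos alpha_pos in \<open>auto intro!: divide_right_mono simp: less_imp_le\<close>)
    have Ht_cell: "(\<integral>\<^sup>+z\<in>?cell j y. ennreal (Ht z) \<partial>lebesgue) = ennreal (Ht y * measure lebesgue (?cell j y))" if "j \<le> J0" for j y
    proof -
      have "(\<integral>\<^sup>+z\<in>?cell j y. ennreal (Ht z) \<partial>lebesgue) = (\<integral>\<^sup>+z\<in>?cell j y. ennreal (Ht y) \<partial>lebesgue)"
        by (rule T.cell_integral_cong) (use T.cell_eq'[OF _ that] in \<open>auto simp: Ht_def\<close>)
      also have "\<dots> = ennreal (Ht y * measure lebesgue (?cell j y))"
        by (rule T.nn_integral_cell_const) (simp add: Ht_def ave_nonneg)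
      finally show ?thesis .
    qed
    have Ht_base: "(\<integral>\<^sup>+z\<in>?cell J0 y. ennreal (Ht z) \<partial>lebesgue) = (\<integral>\<^sup>+z\<in>?cell J0 y. ennreal (?H z) \<partial>lebesgue)" for y
      unfolding Ht_cell[OF order.refl] T.cell_integral_ave[OF finH] by (simp only: Ht_def)
    have Ht_int: "(\<integral>\<^sup>+z\<in>?cell j y. ennreal (Ht z) \<partial>lebesgue) = (\<integral>\<^sup>+z\<in>?cell j y. ennreal (?H z) \<partial>lebesgue)" if "J0 \<le> j" for j y
      by (intro antisym T.descendants_mono[OF _ _ that]) (auto simp: Ht_base)
    have finHt: "(\<integral>\<^sup>+y\<in>?cell j x. ennreal (Ht y) \<partial>lebesgue) < \<infinity>" for j x
    proof (cases "j \<le> J0")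
      case True then show ?thesis by (simp add: Ht_cell)
    next
      case False then show ?thesis using finH by (simp add: Ht_int)
    qed
    have Ht_ave: "ave lebesgue Ht (?cell j x) = ave lebesgue ?H (?cell j x)" if "J0 \<le> j" for j x
      unfolding ave_def Ht_int[OF that] ..
    define P1 where "P1 x = C1 * (T.mx G k x powr \<gamma> + decay x)" for x
    define \<Psi> where "\<Psi> x = P1 x + T.mx Ht k x powr \<gamma>'" for x
    have P1m[measurable]: "P1 \<in> borel_measurable lebesgue" unfolding P1_def by measurable
    have P10: "0 \<le> P1 x" for x using C1(1) decay_nonneg[of x] by (simp add: P1_def)
    have small: "ave lebesgue ?H (?cell j x) powr (1 / (s * \<alpha> x)) \<le> P1 x" if "j \<le> J0" for j x
    proof -
      have "\<delta> * 2 ^ j \<le> \<delta> * 2 ^ J0" using that \<delta> by (intro mult_left_mono power_increasing) auto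
      then have l1: "\<delta> * 2 ^ j \<le> 1" using \<delta> by simp
      have "x \<in> hb (corner \<tau> \<delta> j x) (\<delta> * 2 ^ j)" using T.cell_self[of x j] dcell_eq_hb[OF \<delta>(1)] by blast
      from C1(2)[OF hm h mod side l1 this]
      have "ave lebesgue ?H (?cell j x) powr (1 / (s * \<alpha> x)) \<le> C1 * (ave lebesgue G (?cell j x) powr \<gamma> + decay x)"
        by (simp add: dcell_eq_hb[OF \<delta>(1)] G_def[abs_def] \<gamma>_def)
      also have "\<dots> \<le> P1 x"
        unfolding P1_def using C1(1) g that J0
        by (intro mult_left_mono add_right_mono powr_mono2 ave_nonneg T.mx_ge) auto
      finally show ?thesis .
    qed
    let ?root = "?cell k x0"
    have P1_int: "(\<integral>\<^sup>+x\<in>?root. ennreal (P1 x) \<partial>lebesgue) \<le> ennreal E1"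
      and dec_int: "(\<integral>\<^sup>+x\<in>?root. ennreal (decay x) \<partial>lebesgue) \<le> ennreal Dn"
    proof -
      have "(\<integral>\<^sup>+x\<in>?root. ennreal (decay x) \<partial>lebesgue) \<le> (\<integral>\<^sup>+x. ennreal (decay (x :: real ^ 'n)) \<partial>lebesgue)"
        by (rule nn_integral_mono) (auto simp: indicator_def)
      then show dec: "(\<integral>\<^sup>+x\<in>?root. ennreal (decay x) \<partial>lebesgue) \<le> ennreal Dn"
        using decay_integral unfolding Dn_def by (rule order_trans)
      have "(\<integral>\<^sup>+x\<in>?root. ennreal (T.mx G k x powr \<gamma>) \<partial>lebesgue) \<le> ennreal d1 * (\<integral>\<^sup>+x\<in>?root. ennreal (G x powr \<gamma>) \<partial>lebesgue)"
        unfolding d1_def by (rule T.Doob_maximal[OF g(1) Gm _ finG]) (simp add: G_def)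
      also have "(\<integral>\<^sup>+x\<in>?root. ennreal (G x powr \<gamma>) \<partial>lebesgue) \<le> (\<integral>\<^sup>+y. ennreal (h y powr (1 / \<alpha> y)) \<partial>lebesgue)"
        using shi s hi_pos by (intro nn_integral_mono) (auto simp: indicator_def G_def \<gamma>_def powr_powr)
      also have "\<dots> \<le> 1" by (rule mod)
      finally have mxG: "(\<integral>\<^sup>+x\<in>?root. ennreal (T.mx G k x powr \<gamma>) \<partial>lebesgue) \<le> ennreal d1" by (simp add: mult_left_mono)
      have "(\<integral>\<^sup>+x\<in>?root. ennreal (P1 x) \<partial>lebesgue) = (\<integral>\<^sup>+x\<in>?root. ennreal C1 * (ennreal (T.mx G k x powr \<gamma>) + ennreal (decay x)) \<partial>lebesgue)"
        using C1(1) by (intro T.cell_integral_cong) (simp add: decay_nonneg P1_def ennreal_mult' ennreal_plus)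
      also have "\<dots> = ennreal C1 * ((\<integral>\<^sup>+x\<in>?root. ennreal (T.mx G k x powr \<gamma>) \<partial>lebesgue) + (\<integral>\<^sup>+x\<in>?root. ennreal (decay x) \<partial>lebesgue))"
        by (simp add: T.cell_integral_cmult T.cell_integral_add)
      also have "\<dots> \<le> ennreal C1 * (ennreal d1 + ennreal Dn)" by (intro mult_left_mono add_mono mxG dec) auto
      also have "\<dots> = ennreal E1" using C1(1) d Dn by (simp add: E1_def ennreal_mult' ennreal_plus)
      finally show "(\<integral>\<^sup>+x\<in>?root. ennreal (P1 x) \<partial>lebesgue) \<le> ennreal E1" .
    qed
    have Ht_pt: "Ht y powr \<gamma>' \<le> C2 * (P1 y + decay y)" for y
    proof -
      have "y \<in> hb (corner \<tau> \<delta> J0 y) 1" using T.cell_self[of y J0] dcell_eq_hb[OF \<delta>(1), of \<tau> J0 y] \<delta>(2) by simp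
      from C2(2)[OF hm h mod this]
      have "Ht y powr \<gamma>' \<le> C2 * (ave lebesgue ?H (?cell J0 y) powr (1 / (s * \<alpha> y)) + decay y)"
        by (simp add: Ht_def \<gamma>'_def dcell_eq_hb[OF \<delta>(1)] \<delta>(2))
      also have "\<dots> \<le> C2 * (P1 y + decay y)" using C2(1) by (intro mult_left_mono add_right_mono small) auto
      finally show ?thesis .
    qed
    have "(\<integral>\<^sup>+x\<in>?root. ennreal (T.mx Ht k x powr \<gamma>') \<partial>lebesgue) \<le> ennreal d2 * (\<integral>\<^sup>+x\<in>?root. ennreal (Ht x powr \<gamma>') \<partial>lebesgue)"
      unfolding d2_def by (rule T.Doob_maximal[OF g(2) Htm _ finHt]) (simp add: Ht_def ave_nonneg)
    also have "(\<integral>\<^sup>+x\<in>?root. ennreal (Ht x powr \<gamma>') \<partial>lebesgue) \<le> (\<integral>\<^sup>+x\<in>?root. ennreal C2 * (ennreal (P1 x) + ennreal (decay x)) \<partial>lebesgue)"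
      using C2(1) P10 Ht_pt
      by (intro T.cell_integral_mono) (simp flip: ennreal_mult' ennreal_plus add: ennreal_leI decay_nonneg)
    also have "\<dots> = ennreal C2 * ((\<integral>\<^sup>+x\<in>?root. ennreal (P1 x) \<partial>lebesgue) + (\<integral>\<^sup>+x\<in>?root. ennreal (decay x) \<partial>lebesgue))"
      by (simp add: T.cell_integral_cmult T.cell_integral_add)
    also have "\<dots> \<le> ennreal C2 * (ennreal E1 + ennreal Dn)" by (intro mult_left_mono add_mono P1_int dec_int) auto
    also have "\<dots> = ennreal (C2 * (E1 + Dn))" using C2(1) E1 Dn by (simp add: ennreal_mult' ennreal_plus)
    finally have mxHt: "(\<integral>\<^sup>+x\<in>?root. ennreal (T.mx Ht k x powr \<gamma>') \<partial>lebesgue) \<le> ennreal (d2 * (C2 * (E1 + Dn)))"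
      using d by (simp add: ennreal_mult' mult_left_mono)
    show "\<exists>\<Psi>. \<Psi> \<in> borel_measurable lebesgue \<and> (\<forall>x. 0 \<le> \<Psi> x) \<and> (\<integral>\<^sup>+x\<in>dcell \<tau> \<delta> k x0. ennreal (\<Psi> x) \<partial>lebesgue) \<le> ennreal C \<and>
       (\<forall>j\<le>k. \<forall>x. (j \<le> J0 \<longrightarrow> ave lebesgue (\<lambda>y. h y powr s) (dcell \<tau> \<delta> j x) powr (1 / (s * \<alpha> x)) \<le> \<Psi> x) \<and>
                  (J0 \<le> j \<longrightarrow> ave lebesgue (\<lambda>y. h y powr s) (dcell \<tau> \<delta> j x) powr (1 / (s * \<beta>)) \<le> \<Psi> x))"
    proof (intro exI[of _ \<Psi>] conjI allI impI)
      show "\<Psi> \<in> borel_measurable lebesgue" unfolding \<Psi>_def by measurable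
      show "0 \<le> \<Psi> x" for x using P10[of x] by (simp add: \<Psi>_def)
      have "(\<integral>\<^sup>+x\<in>?root. ennreal (\<Psi> x) \<partial>lebesgue) = (\<integral>\<^sup>+x\<in>?root. ennreal (P1 x) + ennreal (T.mx Ht k x powr \<gamma>') \<partial>lebesgue)"
        using P10 by (intro T.cell_integral_cong) (simp add: \<Psi>_def ennreal_plus)
      also have "\<dots> = (\<integral>\<^sup>+x\<in>?root. ennreal (P1 x) \<partial>lebesgue) + (\<integral>\<^sup>+x\<in>?root. ennreal (T.mx Ht k x powr \<gamma>') \<partial>lebesgue)"
        by (rule T.cell_integral_add) measurable
      also have "\<dots> \<le> ennreal E1 + ennreal (d2 * (C2 * (E1 + Dn)))" by (intro add_mono P1_int mxHt)
      also have "\<dots> = ennreal (E1 + d2 * (C2 * (E1 + Dn)))"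
        by (rule ennreal_plus[symmetric]) (use E1 d C2(1) Dn in auto)
      also have "\<dots> \<le> ennreal C" unfolding C_def by (intro ennreal_leI) simp
      finally show "(\<integral>\<^sup>+x\<in>?root. ennreal (\<Psi> x) \<partial>lebesgue) \<le> ennreal C" .
    next
      fix j x assume "j \<le> J0"
      then have "ave lebesgue ?H (?cell j x) powr (1 / (s * \<alpha> x)) \<le> P1 x" by (rule small)
      then show "ave lebesgue ?H (?cell j x) powr (1 / (s * \<alpha> x)) \<le> \<Psi> x" unfolding \<Psi>_def by (simp add: add_increasing2)
    next
      fix j x assume "j \<le> k" "J0 \<le> j"
      then have "ave lebesgue ?H (?cell j x) powr \<gamma>' \<le> T.mx Ht k x powr \<gamma>'"
        using g T.mx_ge[of j k Ht x] by (intro powr_mono2) (auto simp: Ht_ave ave_nonneg)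
      then show "ave lebesgue ?H (?cell j x) powr (1 / (s * \<beta>)) \<le> \<Psi> x"
        using P10[of x] unfolding \<Psi>_def \<gamma>'_def by (simp add: add_increasing)
    qed
  qed
qed

end

section \<open>Norms of cubes and the weight condition\<close>

lemma ennreal_lincomb:
  "0 \<le> c \<Longrightarrow> 0 \<le> x \<Longrightarrow> 0 \<le> d \<Longrightarrow> 0 \<le> y \<Longrightarrow> ennreal (c * x + d * y) = ennreal c * ennreal x + ennreal d * ennreal y"
  by (simp add: ennreal_mult ennreal_plus)

lemma Holder_normalized:
  fixes p q A B V :: real and f g :: "'a \<Rightarrow> real"
  assumes pq: "1 < p" "1 < q" "1 / p + 1 / q = 1"
    and [measurable]: "f \<in> borel_measurable M" "g \<in> borel_measurable M" "S \<in> sets M"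
    and fg: "\<And>x. 0 \<le> f x" "\<And>x. 0 \<le> g x" and AB: "0 \<le> A" "0 \<le> B" "0 \<le> V"
    and f: "(\<integral>\<^sup>+x\<in>S. ennreal (f x powr p) \<partial>M) \<le> ennreal (A powr p * V)"
    and g: "(\<integral>\<^sup>+x\<in>S. ennreal (g x powr q) \<partial>M) \<le> ennreal (B powr q * V)"
  shows "(\<integral>\<^sup>+x\<in>S. ennreal (f x * g x) \<partial>M) \<le> ennreal (A * B * V)"
proof -
  have zero: "(\<integral>\<^sup>+x\<in>S. ennreal (f x * g x) \<partial>M) = 0"
    if "(\<integral>\<^sup>+x\<in>S. ennreal (h x powr e) \<partial>M) \<le> 0" "h = f \<or> h = g" for h e
  proof -
    have [measurable]: "h \<in> borel_measurable M" using that(2) by auto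
    have "AE x in M. ennreal (h x powr e) * indicator S x = 0"
      using that(1) by (subst nn_integral_0_iff_AE[symmetric]) auto
    then have "AE x in M. ennreal (f x * g x) * indicator S x = 0"
      by eventually_elim (use that(2) in \<open>auto simp: indicator_def split: if_splits\<close>)
    then show ?thesis by (subst nn_integral_0_iff_AE) auto
  qed
  show ?thesis
  proof (cases "A = 0 \<or> B = 0")
    case True
    then have "(\<integral>\<^sup>+x\<in>S. ennreal (f x * g x) \<partial>M) = 0"
      using zero[of f p] zero[of g q] f g by auto
    then show ?thesis by simp
  next
    case False
    then have AB': "0 < A" "0 < B" using AB by auto
    have pt: "f x * g x \<le> A * B * (f x powr p * (1 / (p * A powr p)) + g x powr q * (1 / (q * B powr q)))" for x
    proof -
      have "(f x / A) * (g x / B) \<le> (f x / A) powr p / p + (g x / B) powr q / q"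
        using pq fg[of x] AB' by (intro Youngs_inequality) auto
      then have "A * B * ((f x / A) * (g x / B)) \<le> A * B * ((f x / A) powr p / p + (g x / B) powr q / q)"
        using AB' by (intro mult_left_mono) auto
      then show ?thesis using AB' fg[of x] by (simp add: powr_divide mult.commute)
    qed
    have "(\<integral>\<^sup>+x\<in>S. ennreal (f x * g x) \<partial>M)
      \<le> (\<integral>\<^sup>+x. ennreal (A * B / (p * A powr p)) * (ennreal (f x powr p) * indicator S x) + ennreal (A * B / (q * B powr q)) * (ennreal (g x powr q) * indicator S x) \<partial>M)"
    proof (rule nn_integral_mono)
      fix x
      have "ennreal (f x * g x) \<le> ennreal (A * B / (p * A powr p) * f x powr p + A * B / (q * B powr q) * g x powr q)"
        using pt[of x] by (intro ennreal_leI) (simp add: algebra_simps)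
      also have "\<dots> = ennreal (A * B / (p * A powr p)) * ennreal (f x powr p) + ennreal (A * B / (q * B powr q)) * ennreal (g x powr q)"
        using AB' pq by (intro ennreal_lincomb) auto
      finally show "ennreal (f x * g x) * indicator S x \<le> ennreal (A * B / (p * A powr p)) * (ennreal (f x powr p) * indicator S x) + ennreal (A * B / (q * B powr q)) * (ennreal (g x powr q) * indicator S x)"
        by (auto simp: indicator_def)
    qed
    also have "\<dots> = ennreal (A * B / (p * A powr p)) * (\<integral>\<^sup>+x\<in>S. ennreal (f x powr p) \<partial>M) + ennreal (A * B / (q * B powr q)) * (\<integral>\<^sup>+x\<in>S. ennreal (g x powr q) \<partial>M)"
      by (subst nn_integral_add) (auto simp: nn_integral_cmult)
    also have "\<dots> \<le> ennreal (A * B / (p * A powr p)) * ennreal (A powr p * V) + ennreal (A * B / (q * B powr q)) * ennreal (B powr q * V)"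
      by (intro add_mono mult_left_mono f g) auto
    also have "\<dots> = ennreal (A * B * V * (1 / p) + A * B * V * (1 / q))"
    proof -
      have "ennreal (A * B / (p * A powr p)) * ennreal (A powr p * V) = ennreal (A * B * V * (1 / p))"
        "ennreal (A * B / (q * B powr q)) * ennreal (B powr q * V) = ennreal (A * B * V * (1 / q))"
        using AB' pq AB by (simp_all flip: ennreal_mult)
      then show ?thesis using AB' pq AB by (simp add: ennreal_plus)
    qed
    also have "A * B * V * (1 / p) + A * B * V * (1 / q) = A * B * V"
      using pq(3) by (simp only: distrib_left[symmetric] mult_1_right)
    finally show ?thesis .
  qed
qed

definition rexp :: "(real ^ 'n \<Rightarrow> ennreal) \<Rightarrow> real ^ 'n \<Rightarrow> real"
  where "rexp p x = enn2real (1 / p x)"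

lemma lh_exp_of_log_exponents:
  fixes p :: "real ^ 'n \<Rightarrow> ennreal"
  assumes p: "p \<in> log_exponents" and B: "1 \<le> B" "\<And>x. p x \<le> ennreal B" and b: "1 \<le> b" "\<And>x. ennreal b \<le> p x"
  obtains c \<beta> where "lh_exp (rexp p) c (1 / B) (1 / b) \<beta>" "\<And>x. p x = ennreal (1 / rexp p x)"
proof -
  have real: "\<exists>r. p x = ennreal r \<and> b \<le> r \<and> r \<le> B" for x
  proof -
    have "p x < \<infinity>" using B(2)[of x] by (auto intro: le_less_trans)
    then obtain r where r: "p x = ennreal r" "0 \<le> r" by (cases "p x") auto
    then show ?thesis using B(2)[of x] b(2)[of x] B(1) b(1) by (auto simp: ennreal_le_iff ennreal_le_iff2)
  qed
  have rx: "rexp p x = 1 / r" if "p x = ennreal r" "1 \<le> r" for x r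
  proof -
    have "1 / ennreal r = ennreal (1 / r)" using that divide_ennreal[of 1 r] by simp
    then show ?thesis using that by (simp add: rexp_def)
  qed
  have bd: "1 / B \<le> rexp p x" "rexp p x \<le> 1 / b" "p x = ennreal (1 / rexp p x)" for x
  proof -
    obtain r where r: "p x = ennreal r" "b \<le> r" "r \<le> B" using real by blast
    then have "rexp p x = 1 / r" using b by (intro rx) auto
    then show "1 / B \<le> rexp p x" "rexp p x \<le> 1 / b" "p x = ennreal (1 / rexp p x)"
      using r b by (auto intro!: divide_left_mono)
  qed
  from p have m: "p \<in> borel_measurable lebesgue" and lh: "log_holder (rexp p)"
    by (auto simp: log_exponents_def exponents_def rexp_def[abs_def])
  from lh obtain c \<beta> where c: "0 < c" "0 < \<beta>"
    "\<And>x y. \<bar>rexp p x - rexp p y\<bar> \<le> c / ln (exp 1 + 1 / norm (x - y))"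
    "\<And>x. \<bar>rexp p x - \<beta>\<bar> \<le> c / ln (exp 1 + norm x)"
    unfolding log_holder_def by blast
  have close: "\<exists>x. \<bar>rexp p x - \<beta>\<bar> < e" if e: "0 < e" for e
  proof -
    obtain x :: "real ^ 'n" where x: "norm x = exp (c / e + 1)" using vector_choose_size[of "exp (c / e + 1)"] by auto
    have "c / e + 1 = ln (exp (c / e + 1))" by simp
    also have "\<dots> \<le> ln (exp 1 + norm x)" unfolding x by (subst ln_le_cancel_iff) (auto simp: add_pos_pos)
    finally have l: "c / e + 1 \<le> ln (exp 1 + norm x)" .
    have "0 < c / e" using c e by simp
    then have "c / ln (exp 1 + norm x) \<le> c / (c / e + 1)" using l c by (intro divide_left_mono) auto
    also have "\<dots> < e" using c e by (simp add: field_simps)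
    finally show ?thesis using c(4)[of x] by (intro exI[of _ x]) linarith
  qed
  have "1 / B \<le> \<beta>"
  proof (rule ccontr)
    assume "\<not> 1 / B \<le> \<beta>"
    then obtain x where "\<bar>rexp p x - \<beta>\<bar> < 1 / B - \<beta>" using close[of "1 / B - \<beta>"] by auto
    then show False using bd(1)[of x] by linarith
  qed
  moreover have "\<beta> \<le> 1 / b"
  proof (rule ccontr)
    assume "\<not> \<beta> \<le> 1 / b"
    then obtain x where "\<bar>rexp p x - \<beta>\<bar> < \<beta> - 1 / b" using close[of "\<beta> - 1 / b"] by auto
    then show False using bd(2)[of x] by linarith
  qed
  moreover have "rexp p \<in> borel_measurable lebesgue" unfolding rexp_def[abs_def] using m by measurable
  ultimately have "lh_exp (rexp p) c (1 / B) (1 / b) \<beta>"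
    using c bd B by unfold_locales auto
  then show thesis using that bd(3) by blast
qed

context lh_exp begin

lemma scaled_exponent:
  assumes "0 < r"
  shows "lh_exp (\<lambda>x. \<alpha> x / r) (c / r) (lo / r) (hi / r) (\<beta> / r)"
proof
  fix x y
  have "\<bar>\<alpha> x / r - \<alpha> y / r\<bar> = \<bar>\<alpha> x - \<alpha> y\<bar> / r" using assms by (simp add: diff_divide_distrib[symmetric])
  also have "\<dots> \<le> (c / ln (exp 1 + 1 / norm (x - y))) / r" using assms by (intro divide_right_mono loc) simp
  finally show "\<bar>\<alpha> x / r - \<alpha> y / r\<bar> \<le> c / r / ln (exp 1 + 1 / norm (x - y))" by (simp add: mult.commute)
  have "\<bar>\<alpha> x / r - \<beta> / r\<bar> = \<bar>\<alpha> x - \<beta>\<bar> / r" using assms by (simp add: diff_divide_distrib[symmetric])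
  also have "\<dots> \<le> (c / ln (exp 1 + norm x)) / r" using assms by (intro divide_right_mono inf) simp
  finally show "\<bar>\<alpha> x / r - \<beta> / r\<bar> \<le> c / r / ln (exp 1 + norm x)" by (simp add: mult.commute)
qed (use assms c lo bounds bounds_inf in \<open>auto intro!: divide_right_mono\<close>)

abbreviation nrm :: "(real ^ 'n \<Rightarrow> real) \<Rightarrow> ennreal"
  where "nrm \<equiv> lux_norm (\<lambda>x. ennreal (1 / \<alpha> x))"

lemma varphi_exponent: "varphi (ennreal (1 / \<alpha> x)) t = ennreal (t powr (1 / \<alpha> x))"
  using alpha_pos[of x] by (simp add: varphi_def)

lemma nrm_leI:
  assumes "0 < s" "(\<integral>\<^sup>+x. ennreal ((\<bar>f x\<bar> / s) powr (1 / \<alpha> x)) \<partial>lebesgue) \<le> 1"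
  shows "nrm f \<le> ennreal s"
  unfolding lux_norm_def by (rule INF_lower) (use assms in \<open>simp add: varphi_exponent\<close>)

lemma nrm_lessD:
  assumes "nrm f < ennreal s"
  shows "0 < s" "(\<integral>\<^sup>+x. ennreal ((\<bar>f x\<bar> / s) powr (1 / \<alpha> x)) \<partial>lebesgue) \<le> 1"
proof -
  from assms obtain s' where s': "0 < s'" "(\<integral>\<^sup>+x. ennreal ((\<bar>f x\<bar> / s') powr (1 / \<alpha> x)) \<partial>lebesgue) \<le> 1" "ennreal s' < ennreal s"
    unfolding lux_norm_def by (auto simp: INF_less_iff varphi_exponent)
  then have less: "s' < s" by (simp add: ennreal_less_iff)
  then show "0 < s" using s' by simp
  have "(\<integral>\<^sup>+x. ennreal ((\<bar>f x\<bar> / s) powr (1 / \<alpha> x)) \<partial>lebesgue) \<le> (\<integral>\<^sup>+x. ennreal ((\<bar>f x\<bar> / s') powr (1 / \<alpha> x)) \<partial>lebesgue)"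
    using s' less alpha_pos
    by (intro nn_integral_mono ennreal_leI powr_mono2 divide_left_mono) (auto simp: less_imp_le)
  then show "(\<integral>\<^sup>+x. ennreal ((\<bar>f x\<bar> / s) powr (1 / \<alpha> x)) \<partial>lebesgue) \<le> 1" using s'(2) by (rule order_trans)
qed

lemma nrm_indicator_le:
  assumes L: "1 \<le> L"
  obtains C where "0 < C" "\<And>z l A. effective \<alpha> \<beta> L z l A \<Longrightarrow> nrm (indicator (cube z l)) \<le> ennreal (C * (l ^ CARD('n)) powr A)"
proof -
  obtain C0 where C0: "0 < C0" "\<And>z l A. effective \<alpha> \<beta> L z l A \<Longrightarrow> (\<integral>\<^sup>+y\<in>cube z l. ennreal ((l ^ CARD('n)) powr (- (A / \<alpha> y))) \<partial>lebesgue) \<le> ennreal C0"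
    by (rule power_integral_bound[OF L]) blast
  define C where "C = (1 + C0) powr hi"
  have C1: "1 \<le> C" using C0 hi_pos by (simp add: C_def ge_one_powr_ge_zero)
  show thesis
  proof (rule that[of C])
    show "0 < C" using C1 by simp
    fix z l A assume eff: "effective \<alpha> \<beta> L z l A"
    then have l: "0 < l" by (simp add: effective_def)
    let ?V = "l ^ CARD('n)"
    have V: "0 < ?V" using l by simp
    show "nrm (indicator (cube z l)) \<le> ennreal (C * ?V powr A)"
    proof (rule nrm_leI)
      show "0 < C * ?V powr A" using C1 V l by simp
      have "(\<integral>\<^sup>+x. ennreal ((\<bar>indicator (cube z l) x\<bar> / (C * ?V powr A)) powr (1 / \<alpha> x)) \<partial>lebesgue)
        \<le> (\<integral>\<^sup>+x. ennreal (1 / (1 + C0)) * (ennreal (?V powr (- (A / \<alpha> x))) * indicator (cube z l) x) \<partial>lebesgue)"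
      proof (rule nn_integral_mono)
        fix x
        have "(1 / (C * ?V powr A)) powr (1 / \<alpha> x) = C powr (- (1 / \<alpha> x)) * ?V powr (- (A / \<alpha> x))"
        proof -
          have "1 / (C * ?V powr A) = C powr (- 1) * ?V powr (- A)"
            using C1 by (simp add: powr_minus divide_inverse)
          then show ?thesis by (simp only: powr_mult powr_powr) simp
        qed
        also have "\<dots> \<le> C powr (- (1 / hi)) * ?V powr (- (A / \<alpha> x))"
          using C1 bounds(2)[of x] alpha_pos[of x] hi_pos by (intro mult_right_mono powr_mono) (auto intro: divide_left_mono)
        also have "C powr (- (1 / hi)) = 1 / (1 + C0)" using C0 hi_pos by (simp add: C_def powr_powr powr_minus_divide)
        finally have "ennreal ((1 / (C * ?V powr A)) powr (1 / \<alpha> x)) \<le> ennreal (1 / (1 + C0)) * ennreal (?V powr (- (A / \<alpha> x)))"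
          using C0 by (simp flip: ennreal_mult add: ennreal_leI)
        then show "ennreal ((\<bar>indicator (cube z l) x\<bar> / (C * ?V powr A)) powr (1 / \<alpha> x)) \<le> ennreal (1 / (1 + C0)) * (ennreal (?V powr (- (A / \<alpha> x))) * indicator (cube z l) x)"
          by (auto simp: indicator_def)
      qed
      also have "\<dots> = ennreal (1 / (1 + C0)) * (\<integral>\<^sup>+x\<in>cube z l. ennreal (?V powr (- (A / \<alpha> x))) \<partial>lebesgue)"
        using cube_sets[of z l] by (intro nn_integral_cmult) measurable
      also have "\<dots> \<le> ennreal (1 / (1 + C0)) * ennreal C0" by (intro mult_left_mono C0 eff) simp
      also have "\<dots> \<le> 1" using C0 by (simp flip: ennreal_mult)
      finally show "(\<integral>\<^sup>+x. ennreal ((\<bar>indicator (cube z l) x\<bar> / (C * ?V powr A)) powr (1 / \<alpha> x)) \<partial>lebesgue) \<le> 1" .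
    qed
  qed
qed

lemma average_le_nrm:
  assumes L: "1 \<le> L" and r: "0 < r" "r * hi < 1"
  obtains C where "0 < C"
    "\<And>z l A u N. \<lbrakk>effective \<alpha> \<beta> L z l A; u \<in> borel_measurable lebesgue; \<And>y. 0 \<le> u y; 0 \<le> N;
       nrm (\<lambda>x. indicator (cube z l) x * u x) \<le> ennreal N\<rbrakk> \<Longrightarrow>
       (\<integral>\<^sup>+y\<in>cube z l. ennreal (u y powr r) \<partial>lebesgue)
         \<le> ennreal ((C * N * (l ^ CARD('n)) powr (- A)) powr r * l ^ CARD('n))"
proof -
  obtain C where C: "0 < C"
    "\<And>z l A u \<mu>. \<lbrakk>effective \<alpha> \<beta> L z l A; u \<in> borel_measurable lebesgue; \<And>y. 0 \<le> u y; 0 < \<mu>;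
       (\<integral>\<^sup>+y\<in>cube z l. ennreal ((u y / \<mu>) powr (1 / \<alpha> y)) \<partial>lebesgue) \<le> 1\<rbrakk> \<Longrightarrow>
       (\<integral>\<^sup>+y\<in>cube z l. ennreal (u y powr r) \<partial>lebesgue)
         \<le> ennreal ((C * \<mu> * (l ^ CARD('n)) powr (- A)) powr r * l ^ CARD('n))"
    by (rule average_le_modular[OF L r]) blast
  show thesis
  proof (rule that[OF C(1)])
    fix z l A N and u :: "real ^ 'n \<Rightarrow> real"
    assume eff: "effective \<alpha> \<beta> L z l A" and u: "u \<in> borel_measurable lebesgue" "\<And>y. 0 \<le> u y" and N: "0 \<le> N"
      and nu: "nrm (\<lambda>x. indicator (cube z l) x * u x) \<le> ennreal N"
    let ?V = "l ^ CARD('n)" and ?I = "\<integral>\<^sup>+y\<in>cube z l. ennreal (u y powr r) \<partial>lebesgue"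
    have l: "0 < l" using eff by (simp add: effective_def)
    have eps: "?I \<le> ennreal ((C * (N + e) * ?V powr (- A)) powr r * ?V)" if e: "0 < e" for e
    proof (rule C(2)[OF eff u])
      show "0 < N + e" using N e by simp
      have "nrm (\<lambda>x. indicator (cube z l) x * u x) < ennreal (N + e)"
        using nu by (rule le_less_trans) (use N e in \<open>simp add: ennreal_less_iff\<close>)
      from nrm_lessD(2)[OF this]
      have "(\<integral>\<^sup>+x. ennreal ((\<bar>indicator (cube z l) x * u x\<bar> / (N + e)) powr (1 / \<alpha> x)) \<partial>lebesgue) \<le> 1" .
      moreover have "(\<integral>\<^sup>+y\<in>cube z l. ennreal ((u y / (N + e)) powr (1 / \<alpha> y)) \<partial>lebesgue) \<le> (\<integral>\<^sup>+x. ennreal ((\<bar>indicator (cube z l) x * u x\<bar> / (N + e)) powr (1 / \<alpha> x)) \<partial>lebesgue)"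
        using u(2) by (intro nn_integral_mono) (auto simp: indicator_def)
      ultimately show "(\<integral>\<^sup>+y\<in>cube z l. ennreal ((u y / (N + e)) powr (1 / \<alpha> y)) \<partial>lebesgue) \<le> 1" by (rule order_trans[rotated])
    qed
    have "((\<lambda>e. ennreal ((C * (N + e) * ?V powr (- A)) powr r * ?V)) \<longlongrightarrow> ennreal ((C * (N + 0) * ?V powr (- A)) powr r * ?V)) (at_right 0)"
      using r C(1) N by (intro tendsto_intros tendsto_powr') (auto intro!: eventually_mono[OF eventually_at_right_less] mult_nonneg_nonneg)
    then have "?I \<le> ennreal ((C * (N + 0) * ?V powr (- A)) powr r * ?V)"
      by (rule tendsto_lowerbound) (auto intro: eventually_mono[OF eventually_at_right_less] eps)
    then show "?I \<le> ennreal ((C * N * ?V powr (- A)) powr r * ?V)" by simp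
  qed
qed

text \<open>
  The upper bound is \<open>power_integral_bound\<close>, the lower bound follows from
  applying \<open>average_le_nrm\<close> to the constant function \<open>1\<close>.
\<close>

lemma nrm_indicator:
  assumes L: "1 \<le> L"
  obtains C where "0 < C" "\<And>z l A. effective \<alpha> \<beta> L z l A \<Longrightarrow>
    \<exists>N. nrm (indicator (cube z l)) = ennreal N \<and> 0 < N \<and> N \<le> C * (l ^ CARD('n)) powr A \<and> (l ^ CARD('n)) powr A \<le> C * N"
proof -
  obtain C1 where C1: "0 < C1" "\<And>z l A. effective \<alpha> \<beta> L z l A \<Longrightarrow> nrm (indicator (cube z l)) \<le> ennreal (C1 * (l ^ CARD('n)) powr A)"
    by (rule nrm_indicator_le[OF L]) blast
  define r where "r = 1 / (2 * hi)"
  have r: "0 < r" "r * hi < 1" using hi_pos by (simp_all add: r_def)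
  obtain C2 where C2: "0 < C2"
    "\<And>z l A u N. \<lbrakk>effective \<alpha> \<beta> L z l A; u \<in> borel_measurable lebesgue; \<And>y. 0 \<le> u y; 0 \<le> N;
       nrm (\<lambda>x. indicator (cube z l) x * u x) \<le> ennreal N\<rbrakk> \<Longrightarrow>
       (\<integral>\<^sup>+y\<in>cube z l. ennreal (u y powr r) \<partial>lebesgue)
         \<le> ennreal ((C2 * N * (l ^ CARD('n)) powr (- A)) powr r * l ^ CARD('n))"
    by (rule average_le_nrm[OF L r]) blast
  define C where "C = max C1 C2"
  show thesis
  proof (rule that[of C])
    show "0 < C" using C1 by (simp add: C_def)
    fix z l A assume eff: "effective \<alpha> \<beta> L z l A"
    let ?V = "l ^ CARD('n)"
    have l: "0 < l" using eff by (simp add: effective_def)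
    then have V: "0 < ?V" by simp
    have fin: "nrm (indicator (cube z l)) \<le> ennreal (C1 * ?V powr A)" by (rule C1(2)[OF eff])
    then have "nrm (indicator (cube z l)) < \<infinity>" by (auto intro: le_less_trans)
    then obtain N where N: "nrm (indicator (cube z l)) = ennreal N" "0 \<le> N" by (cases "nrm (indicator (cube z l))") auto
    have up: "N \<le> C1 * ?V powr A" using fin N C1(1) by (simp add: ennreal_le_iff)
    have "(\<integral>\<^sup>+y\<in>cube z l. ennreal (1 powr r) \<partial>lebesgue) \<le> ennreal ((C2 * N * ?V powr (- A)) powr r * ?V)"
      by (rule C2(2)[OF eff]) (use N in auto)
    moreover have "(\<integral>\<^sup>+y\<in>cube z l. ennreal (1 powr r) \<partial>lebesgue) = ennreal ?V"
      using nn_integral_indicator[OF cube_sets, of z l] emeasure_cube[of l z] l by simp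
    ultimately have "?V \<le> (C2 * N * ?V powr (- A)) powr r * ?V"
      using V by (simp add: ennreal_le_iff)
    then have "1 \<le> (C2 * N * ?V powr (- A)) powr r" using V by simp
    then have "1 \<le> C2 * N * ?V powr (- A)"
      using powr_less_mono2[of r "C2 * N * ?V powr (- A)" 1] r C2(1) N by (cases "C2 * N * ?V powr (- A) < 1") auto
    then have low: "?V powr A \<le> C2 * N" using V l by (simp add: powr_minus field_simps)
    moreover have "0 < ?V powr A" using l by simp
    ultimately have "0 < C2 * N" by linarith
    then have "0 < N" using C2(1) by (simp add: zero_less_mult_iff)
    have "C1 * ?V powr A \<le> C * ?V powr A" "C2 * N \<le> C * N"
      using N by (auto simp: C_def intro!: mult_right_mono)
    then show "\<exists>N. nrm (indicator (cube z l)) = ennreal N \<and> 0 < N \<and> N \<le> C * ?V powr A \<and> ?V powr A \<le> C * N"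
      using N up low \<open>0 < N\<close> by (intro exI[of _ N]) linarith
  qed
qed

lemma effective_affine: "effective \<alpha> \<beta> L z l A \<Longrightarrow> effective (\<lambda>x. (1 - \<alpha> x) / R) ((1 - \<beta>) / R) L z l ((1 - A) / R)"
  by (auto simp: effective_def)

lemma effective_scaled: "effective \<alpha> \<beta> L z l A \<Longrightarrow> effective (\<lambda>x. \<alpha> x / R) (\<beta> / R) L z l (A / R)"
  by (auto simp: effective_def)

lemma conjugate_scaled:
  assumes "hi < 1" "0 < R"
  shows "lh_exp (\<lambda>x. (1 - \<alpha> x) / R) (c / R) ((1 - hi) / R) ((1 - lo) / R) ((1 - \<beta>) / R)"
proof -
  interpret c: lh_exp "\<lambda>x. 1 - 1 * \<alpha> x" "1 * c" "1 - 1 * hi" "1 - 1 * lo" "1 - 1 * \<beta>"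
    by (rule affine_exponent) (use assms in auto)
  show ?thesis using c.scaled_exponent[OF assms(2)] by simp
qed

end

text \<open>
  \<open>U\<close> and \<open>W\<close> bound the means over the cube of \<open>u\<close> in
  \<open>L\<^sup>r\<close> and of \<open>w\<close> in \<open>L\<^sup>t\<close>. Bounds are
  used in place of the means themselves to avoid the case of infinite integrals.
\<close>

abbreviation mean_product_le ::
    "real \<Rightarrow> real \<Rightarrow> (real ^ 'n \<Rightarrow> real) \<Rightarrow> (real ^ 'n \<Rightarrow> real) \<Rightarrow> real ^ 'n \<Rightarrow> real \<Rightarrow> real \<Rightarrow> real \<Rightarrow> bool"
  where "mean_product_le r t u w z l A B \<equiv> \<exists>U W. 0 \<le> U \<and> 0 \<le> W \<and>
    (\<integral>\<^sup>+y\<in>cube z l. ennreal (u y powr r) \<partial>lebesgue) \<le> ennreal (U powr r * l ^ CARD('n)) \<and>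
    (\<integral>\<^sup>+y\<in>cube z l. ennreal (w y powr t) \<partial>lebesgue) \<le> ennreal (W powr t * l ^ CARD('n)) \<and>
    A * U * W \<le> B"

text \<open>
  Each of the norms of cubes is a power of the volume, and \<open>average_le_nrm\<close>
  turns the two normalised norms of \<open>u\<close> and \<open>w\<close> into means with
  constant exponents. The conditions on \<open>r\<close> and \<open>t\<close> say that these
  exponents lie below those of the norms.
\<close>

lemma weight_condition:
  fixes \<alpha>p \<alpha>q :: "real ^ 'n \<Rightarrow> real"
  assumes P: "lh_exp \<alpha>p cp lop hip \<beta>p" and Q: "lh_exp \<alpha>q cq loq hiq \<beta>q" and hip: "hip < 1"
    and L: "1 \<le> L" and R: "0 < R" and S: "0 < S"
    and r: "0 < r" "r * (1 - lop) < R" and t: "0 < t" "t * hiq < S"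
  obtains C where "0 < C" "\<And>z l Ap Aq u w A0 \<kappa>.
    \<lbrakk>effective \<alpha>p \<beta>p L z l Ap; effective \<alpha>q \<beta>q L z l Aq; u \<in> borel_measurable lebesgue; w \<in> borel_measurable lebesgue;
     \<And>x. 0 \<le> u x; \<And>x. 0 \<le> w x; AE x in lebesgue. 0 < w x; 0 < A0; 0 \<le> \<kappa>;
     lux_norm (\<lambda>x. ennreal (1 / (\<alpha>q x / S))) (\<lambda>x. indicator (cube z l) x * w x) < \<infinity>;
     ennreal A0 * (lux_norm (\<lambda>x. ennreal (1 / \<alpha>q x)) (indicator (cube z l)) / lux_norm (\<lambda>x. ennreal (1 / \<alpha>p x)) (indicator (cube z l))) *
     (lux_norm (\<lambda>x. ennreal (1 / ((1 - \<alpha>p x) / R))) (\<lambda>x. indicator (cube z l) x * u x) / lux_norm (\<lambda>x. ennreal (1 / ((1 - \<alpha>p x) / R))) (indicator (cube z l))) *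
     (lux_norm (\<lambda>x. ennreal (1 / (\<alpha>q x / S))) (\<lambda>x. indicator (cube z l) x * w x) / lux_norm (\<lambda>x. ennreal (1 / (\<alpha>q x / S))) (indicator (cube z l))) \<le> ennreal \<kappa>\<rbrakk> \<Longrightarrow>
    mean_product_le r t u w z l (A0 * (l ^ CARD('n)) powr (Aq - Ap)) (C * \<kappa>)"
proof -
  interpret P: lh_exp \<alpha>p cp lop hip \<beta>p by fact
  interpret Q: lh_exp \<alpha>q cq loq hiq \<beta>q by fact
  interpret PR: lh_exp "\<lambda>x. (1 - \<alpha>p x) / R" "cp / R" "(1 - hip) / R" "(1 - lop) / R" "(1 - \<beta>p) / R"
    by (rule P.conjugate_scaled[OF hip R])
  interpret QS: lh_exp "\<lambda>x. \<alpha>q x / S" "cq / S" "loq / S" "hiq / S" "\<beta>q / S"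
    by (rule Q.scaled_exponent[OF S])
  obtain C1 where C1: "0 < C1" "\<And>z l A. effective \<alpha>p \<beta>p L z l A \<Longrightarrow>
    \<exists>N. P.nrm (indicator (cube z l)) = ennreal N \<and> 0 < N \<and> N \<le> C1 * (l ^ CARD('n)) powr A \<and> (l ^ CARD('n)) powr A \<le> C1 * N"
    by (rule P.nrm_indicator[OF L]) blast
  obtain C2 where C2: "0 < C2" "\<And>z l A. effective \<alpha>q \<beta>q L z l A \<Longrightarrow>
    \<exists>N. Q.nrm (indicator (cube z l)) = ennreal N \<and> 0 < N \<and> N \<le> C2 * (l ^ CARD('n)) powr A \<and> (l ^ CARD('n)) powr A \<le> C2 * N"
    by (rule Q.nrm_indicator[OF L]) blast
  obtain C3 where C3: "0 < C3" "\<And>z l A. effective (\<lambda>x. (1 - \<alpha>p x) / R) ((1 - \<beta>p) / R) L z l A \<Longrightarrow>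
    \<exists>N. PR.nrm (indicator (cube z l)) = ennreal N \<and> 0 < N \<and> N \<le> C3 * (l ^ CARD('n)) powr A \<and> (l ^ CARD('n)) powr A \<le> C3 * N"
    by (rule PR.nrm_indicator[OF L]) blast
  obtain C4 where C4: "0 < C4" "\<And>z l A. effective (\<lambda>x. \<alpha>q x / S) (\<beta>q / S) L z l A \<Longrightarrow>
    \<exists>N. QS.nrm (indicator (cube z l)) = ennreal N \<and> 0 < N \<and> N \<le> C4 * (l ^ CARD('n)) powr A \<and> (l ^ CARD('n)) powr A \<le> C4 * N"
    by (rule QS.nrm_indicator[OF L]) blast
  obtain C5 where C5: "0 < C5"
    "\<And>z l A u N. \<lbrakk>effective (\<lambda>x. (1 - \<alpha>p x) / R) ((1 - \<beta>p) / R) L z l A; u \<in> borel_measurable lebesgue; \<And>y. 0 \<le> u y; 0 \<le> N;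
       PR.nrm (\<lambda>x. indicator (cube z l) x * u x) \<le> ennreal N\<rbrakk> \<Longrightarrow>
       (\<integral>\<^sup>+y\<in>cube z l. ennreal (u y powr r) \<partial>lebesgue)
         \<le> ennreal ((C5 * N * (l ^ CARD('n)) powr (- A)) powr r * l ^ CARD('n))"
  proof (rule PR.average_le_nrm[OF L r(1)])
    show "r * ((1 - lop) / R) < 1" using r R by (simp add: field_simps)
  qed blast
  obtain C6 where C6: "0 < C6"
    "\<And>z l A u N. \<lbrakk>effective (\<lambda>x. \<alpha>q x / S) (\<beta>q / S) L z l A; u \<in> borel_measurable lebesgue; \<And>y. 0 \<le> u y; 0 \<le> N;
       QS.nrm (\<lambda>x. indicator (cube z l) x * u x) \<le> ennreal N\<rbrakk> \<Longrightarrow>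
       (\<integral>\<^sup>+y\<in>cube z l. ennreal (u y powr t) \<partial>lebesgue)
         \<le> ennreal ((C6 * N * (l ^ CARD('n)) powr (- A)) powr t * l ^ CARD('n))"
  proof (rule QS.average_le_nrm[OF L t(1)])
    show "t * (hiq / S) < 1" using t S by (simp add: field_simps)
  qed blast
  define C where "C = C1 * C2 * (C3 * C5) * (C4 * C6)"
  show thesis
  proof (rule that[of C])
    show "0 < C" unfolding C_def by (intro mult_pos_pos C1(1) C2(1) C3(1) C4(1) C5(1) C6(1))
    fix z :: "real ^ 'n" and l Ap Aq A0 \<kappa> :: real and u w :: "real ^ 'n \<Rightarrow> real"
    let ?Q = "cube z l"
    assume ep: "effective \<alpha>p \<beta>p L z l Ap" and eq: "effective \<alpha>q \<beta>q L z l Aq"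
      and um: "u \<in> borel_measurable lebesgue" and wm: "w \<in> borel_measurable lebesgue"
      and u0: "\<And>x. 0 \<le> u x" and w0: "\<And>x. 0 \<le> w x" and wpos: "AE x in lebesgue. 0 < w x" and A0: "0 < A0" and \<kappa>: "0 \<le> \<kappa>"
      and wfin: "QS.nrm (\<lambda>x. indicator ?Q x * w x) < \<infinity>"
      and cond: "ennreal A0 * (Q.nrm (indicator ?Q) / P.nrm (indicator ?Q)) *
        (PR.nrm (\<lambda>x. indicator ?Q x * u x) / PR.nrm (indicator ?Q)) *
        (QS.nrm (\<lambda>x. indicator ?Q x * w x) / QS.nrm (indicator ?Q)) \<le> ennreal \<kappa>"
    have l: "0 < l" using ep by (simp add: effective_def)
    let ?V = "l ^ CARD('n)"
    have V: "0 < ?V" using l by simp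
    let ?AR = "(1 - Ap) / R" and ?AS = "Aq / S"
    have eR: "effective (\<lambda>x. (1 - \<alpha>p x) / R) ((1 - \<beta>p) / R) L z l ?AR" by (rule P.effective_affine[OF ep])
    have eS: "effective (\<lambda>x. \<alpha>q x / S) (\<beta>q / S) L z l ?AS" by (rule Q.effective_scaled[OF eq])
    obtain np where np: "P.nrm (indicator ?Q) = ennreal np" "0 < np" "np \<le> C1 * ?V powr Ap" using C1(2)[OF ep] by blast
    obtain nq where nq: "Q.nrm (indicator ?Q) = ennreal nq" "0 < nq" "?V powr Aq \<le> C2 * nq" using C2(2)[OF eq] by blast
    obtain nR where nR: "PR.nrm (indicator ?Q) = ennreal nR" "0 < nR" "nR \<le> C3 * ?V powr ?AR" using C3(2)[OF eR] by blast
    obtain nS where nS: "QS.nrm (indicator ?Q) = ennreal nS" "0 < nS" "nS \<le> C4 * ?V powr ?AS" using C4(2)[OF eS] by blast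
    obtain nw where nw: "QS.nrm (\<lambda>x. indicator ?Q x * w x) = ennreal nw" "0 \<le> nw"
      using wfin by (cases "QS.nrm (\<lambda>x. indicator ?Q x * w x)") auto
    have Wint: "(\<integral>\<^sup>+y\<in>?Q. ennreal (w y powr t) \<partial>lebesgue) \<le> ennreal ((C6 * nw * ?V powr (- ?AS)) powr t * ?V)"
      by (rule C6(2)[OF eS wm w0 nw(2)]) (simp only: nw order.refl)
    have nwpos: "0 < nw"
    proof (rule ccontr)
      assume "\<not> 0 < nw"
      then have "(\<integral>\<^sup>+y\<in>?Q. ennreal (w y powr t) \<partial>lebesgue) = 0" using Wint nw(2) by simp
      moreover have "(\<lambda>y. ennreal (w y powr t) * indicator ?Q y) \<in> borel_measurable lebesgue"
        using wm cube_sets[of z l] by measurable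
      ultimately have "AE y in lebesgue. ennreal (w y powr t) * indicator ?Q y = 0"
        by (simp only: nn_integral_0_iff_AE)
      then have "AE y in lebesgue. y \<notin> ?Q" using wpos
        by eventually_elim (auto simp: indicator_def ennreal_eq_0_iff split: if_splits dest: leD)
      then have "emeasure lebesgue ?Q = 0" using cube_sets[of z l] by (subst (asm) AE_iff_measurable[OF cube_sets]) (auto simp del: emeasure_completion)
      then show False using emeasure_cube[of l z] l by simp
    qed
    have "PR.nrm (\<lambda>x. indicator ?Q x * u x) \<noteq> \<infinity>"
    proof
      assume top: "PR.nrm (\<lambda>x. indicator ?Q x * u x) = \<infinity>"
      have "ennreal A0 * (ennreal nq / ennreal np) * (top / ennreal nR) * (ennreal nw / ennreal nS) = top"
        using A0 np nq nR nS nwpos by (simp add: divide_ennreal ennreal_top_divide ennreal_mult_top ennreal_top_mult flip: ennreal_mult)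
      then show False using cond unfolding np(1) nq(1) nR(1) nS(1) nw(1) top by (simp add: top_unique)
    qed
    then obtain nu where nu: "PR.nrm (\<lambda>x. indicator ?Q x * u x) = ennreal nu" "0 \<le> nu"
      by (cases "PR.nrm (\<lambda>x. indicator ?Q x * u x)") auto
    have Uint: "(\<integral>\<^sup>+y\<in>?Q. ennreal (u y powr r) \<partial>lebesgue) \<le> ennreal ((C5 * nu * ?V powr (- ?AR)) powr r * ?V)"
      by (rule C5(2)[OF eR um u0 nu(2)]) (simp only: nu order.refl)
    have "ennreal (A0 * (nq / np) * (nu / nR) * (nw / nS)) \<le> ennreal \<kappa>"
    proof -
      have "ennreal (A0 * (nq / np) * (nu / nR) * (nw / nS)) = ennreal A0 * (ennreal nq / ennreal np) * (ennreal nu / ennreal nR) * (ennreal nw / ennreal nS)"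
        using A0 np(2) nq(2) nR(2) nS(2) nu(2) nw(2) by (simp add: divide_ennreal less_imp_le flip: ennreal_mult)
      then show ?thesis using cond unfolding np(1) nq(1) nR(1) nS(1) nw(1) nu(1) by simp
    qed
    then have main: "A0 * (nq / np) * (nu / nR) * (nw / nS) \<le> \<kappa>" using \<kappa> by (simp add: ennreal_le_iff)
    have 1: "?V powr (Aq - Ap) \<le> C1 * C2 * (nq / np)"
    proof -
      have "?V powr Aq * np \<le> (C2 * nq) * (C1 * ?V powr Ap)"
        by (intro mult_mono) (use np nq C2(1) in auto)
      then show ?thesis using np(2) l by (simp add: powr_diff field_simps)
    qed
    have 2: "nu * ?V powr (- ?AR) \<le> C3 * (nu / nR)"
    proof -
      have "nu * nR \<le> nu * (C3 * ?V powr ?AR)" by (intro mult_left_mono nR nu)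
      then show ?thesis using nR(2) l by (simp add: powr_minus field_simps)
    qed
    have 3: "nw * ?V powr (- ?AS) \<le> C4 * (nw / nS)"
    proof -
      have "nw * nS \<le> nw * (C4 * ?V powr ?AS)" by (intro mult_left_mono nS nw)
      then show ?thesis using nS(2) l by (simp add: powr_minus field_simps)
    qed
    define U where "U = C5 * (nu * ?V powr (- ?AR))"
    define W where "W = C6 * (nw * ?V powr (- ?AS))"
    have UW: "0 \<le> U" "0 \<le> W" using C5(1) C6(1) nu nw by (simp_all add: U_def W_def)
    have a1: "A0 * ?V powr (Aq - Ap) \<le> A0 * (C1 * C2 * (nq / np))" using A0 by (intro mult_left_mono 1) auto
    have a2: "U \<le> C5 * (C3 * (nu / nR))" unfolding U_def using C5(1) by (intro mult_left_mono 2) auto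
    have a3: "W \<le> C6 * (C4 * (nw / nS))" unfolding W_def using C6(1) by (intro mult_left_mono 3) auto
    have n1: "0 \<le> A0 * (C1 * C2 * (nq / np))" using A0 C1(1) C2(1) nq(2) np(2) by simp
    have n2: "0 \<le> A0 * (C1 * C2 * (nq / np)) * (C5 * (C3 * (nu / nR)))"
    proof -
      have "0 \<le> C5 * (C3 * (nu / nR))" using C3(1) C5(1) nu(2) nR(2) by simp
      then show ?thesis by (rule mult_nonneg_nonneg[OF n1])
    qed
    have "A0 * ?V powr (Aq - Ap) * U * W \<le> A0 * (C1 * C2 * (nq / np)) * (C5 * (C3 * (nu / nR))) * (C6 * (C4 * (nw / nS)))"
      by (intro mult_mono[OF mult_mono[OF a1 a2 n1 UW(1)] a3 n2 UW(2)])
    also have "\<dots> = C * (A0 * (nq / np) * (nu / nR) * (nw / nS))" by (simp add: C_def mult_ac)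
    also have "\<dots> \<le> C * \<kappa>" using \<open>0 < C\<close> by (intro mult_left_mono main) simp
    finally have fin: "A0 * ?V powr (Aq - Ap) * U * W \<le> C * \<kappa>" .
    show "\<exists>U W. 0 \<le> U \<and> 0 \<le> W \<and> (\<integral>\<^sup>+y\<in>?Q. ennreal (u y powr r) \<partial>lebesgue) \<le> ennreal (U powr r * ?V) \<and>
      (\<integral>\<^sup>+y\<in>?Q. ennreal (w y powr t) \<partial>lebesgue) \<le> ennreal (W powr t * ?V) \<and>
      A0 * ?V powr (Aq - Ap) * U * W \<le> C * \<kappa>"
    proof (rule exI[of _ U], rule exI[of _ W], intro conjI UW fin)
      show "(\<integral>\<^sup>+y\<in>?Q. ennreal (u y powr r) \<partial>lebesgue) \<le> ennreal (U powr r * ?V)" using Uint by (simp add: U_def mult.assoc)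
      show "(\<integral>\<^sup>+y\<in>?Q. ennreal (w y powr t) \<partial>lebesgue) \<le> ennreal (W powr t * ?V)" using Wint by (simp add: W_def mult.assoc)
    qed
  qed
qed

section \<open>The estimate on one dyadic grid\<close>

text \<open>
  Young's inequality with the exponents \<open>1 / Aq\<close> and \<open>1 / (1 -
  Aq)\<close>. In the first factor the excess power of \<open>Ah\<close> is traded for a
  power of the volume, using the a priori bound on \<open>Ah\<close>; since \<open>Aq \<le>
  Ap\<close>, its exponent \<open>1 / Aq - 1 / Ap\<close> is nonnegative, and the powers of
  the volume cancel. This is where \<open>p \<le> q\<close> enters.
\<close>

lemma exponent_pair_bound:
  fixes Ap Aq V Ah Ag C lq :: real
  assumes "lq \<le> Aq" "0 < lq" "Aq \<le> Ap" "Ap < 1" "0 < V" "0 \<le> Ah" "0 \<le> Ag" "1 \<le> C" "Ah \<le> C * V powr (- Ap)"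
  shows "V powr (Ap - Aq) * Ah * Ag \<le> C powr (1 / lq) * (Ah powr (1 / Ap) + Ag powr (1 / (1 - Aq)))"
proof (cases "Ah = 0")
  case True then show ?thesis by simp
next
  case False
  have q: "0 < Aq" "Aq < 1" "0 < Ap" using assms by auto
  define e where "e = 1 / Aq - 1 / Ap"
  have e: "0 \<le> e" "e \<le> 1 / lq"
  proof -
    show "0 \<le> e" using assms q by (simp add: e_def frac_le)
    have "1 / Aq \<le> 1 / lq" using assms by (simp add: frac_le)
    moreover have "0 \<le> 1 / Ap" using q by simp
    ultimately show "e \<le> 1 / lq" unfolding e_def by linarith
  qed
  let ?X = "V powr (Ap - Aq) * Ah"
  have "?X * Ag \<le> ?X powr (1 / Aq) / (1 / Aq) + Ag powr (1 / (1 - Aq)) / (1 / (1 - Aq))"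
    using assms q by (intro Youngs_inequality) auto
  also have "\<dots> \<le> ?X powr (1 / Aq) + Ag powr (1 / (1 - Aq))"
    using q mult_left_mono[of Aq 1 "?X powr (1 / Aq)"] mult_left_mono[of "1 - Aq" 1 "Ag powr (1 / (1 - Aq))"]
    by simp
  also have "?X powr (1 / Aq) = V powr ((Ap - Aq) / Aq) * (Ah powr (1 / Ap) * Ah powr e)"
    by (simp add: powr_mult powr_powr e_def flip: powr_add)
  also have "\<dots> \<le> V powr ((Ap - Aq) / Aq) * (Ah powr (1 / Ap) * (C * V powr (- Ap)) powr e)"
    using assms e by (intro mult_left_mono powr_mono2) auto
  also have "\<dots> = C powr e * Ah powr (1 / Ap)"
  proof -
    have "(Ap - Aq) / Aq + - Ap * e = 0" using q by (simp add: e_def field_simps)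
    then have "V powr ((Ap - Aq) / Aq) * (V powr (- Ap)) powr e = 1" using assms by (simp add: powr_powr flip: powr_add)
    then show ?thesis by (simp add: powr_mult)
  qed
  also have "\<dots> \<le> C powr (1 / lq) * Ah powr (1 / Ap)"
    using assms e by (intro mult_right_mono powr_mono) auto
  finally have "?X * Ag \<le> C powr (1 / lq) * Ah powr (1 / Ap) + Ag powr (1 / (1 - Aq))" by simp
  moreover have "1 \<le> C powr (1 / lq)" using assms by (simp add: ge_one_powr_ge_zero)
  then have "Ag powr (1 / (1 - Aq)) \<le> C powr (1 / lq) * Ag powr (1 / (1 - Aq))"
    using mult_right_mono[of 1 "C powr (1 / lq)" "Ag powr (1 / (1 - Aq))"] by simp
  ultimately show ?thesis by (simp add: distrib_left)
qed

lemma finite_integral_normalized: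
  assumes "(I :: ennreal) < \<infinity>" "0 < V" "p \<noteq> 0"
  obtains A :: real where "0 \<le> A" "I = ennreal (A powr p * V)"
proof -
  obtain r where r: "I = ennreal r" "0 \<le> r" using assms(1) by (cases I) auto
  have "I = ennreal (((r / V) powr (1 / p)) powr p * V)"
    using r assms by (simp add: powr_powr)
  then show thesis using that[of "(r / V) powr (1 / p)"] by simp
qed

lemma Holder_product_power:
  fixes \<theta> r s U A V :: real
  assumes e: "0 < \<theta>" "\<theta> < r" "\<theta> < s" "1 / \<theta> = 1 / r + 1 / s"
    and [measurable]: "u \<in> borel_measurable M" "h \<in> borel_measurable M" "S \<in> sets M"
    and nn: "\<And>x. 0 \<le> u x" "\<And>x. 0 \<le> h x" "0 \<le> U" "0 \<le> A" "0 \<le> V"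
    and u: "(\<integral>\<^sup>+x\<in>S. ennreal (u x powr r) \<partial>M) \<le> ennreal (U powr r * V)"
    and h: "(\<integral>\<^sup>+x\<in>S. ennreal (h x powr s) \<partial>M) \<le> ennreal (A powr s * V)"
  shows "(\<integral>\<^sup>+x\<in>S. ennreal ((u x * h x) powr \<theta>) \<partial>M) \<le> ennreal ((U * A) powr \<theta> * V)"
proof -
  have "(\<integral>\<^sup>+x\<in>S. ennreal (u x powr \<theta> * h x powr \<theta>) \<partial>M) \<le> ennreal (U powr \<theta> * A powr \<theta> * V)"
  proof (rule Holder_normalized[where p = "r / \<theta>" and q = "s / \<theta>"])
    have "\<theta> * (1 / r + 1 / s) = 1" using e by (simp flip: e(4))
    then show "1 / (r / \<theta>) + 1 / (s / \<theta>) = 1" using e by (simp add: distrib_left)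
  qed (use e nn u h in \<open>auto simp: powr_powr\<close>)
  then show ?thesis by (simp add: powr_mult)
qed

text \<open>
  After \<open>|b x - b y| ^ m \<le> 2 ^ m * (D x + D y)\<close>, Hoelder's inequality with
  the exponent \<open>\<theta>\<close> on the functions and the conjugate exponent on the
  oscillation \<open>D\<close> is applied in each variable. The first estimate keeps the
  variable \<open>x\<close> free, so that it can serve as a pointwise majorant.
\<close>

lemma cell_commutator_bounds:
  fixes b f g :: "'a \<Rightarrow> real" and \<beta> \<theta> C1 X F G V :: real and m :: nat
  defines "D \<equiv> \<lambda>x. \<bar>b x - \<beta>\<bar> ^ m"
  assumes \<theta>: "1 < \<theta>" and [measurable]: "b \<in> borel_measurable M" "f \<in> borel_measurable M" "g \<in> borel_measurable M" "Q \<in> sets M"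
    and nn: "\<And>x. 0 \<le> f x" "\<And>x. 0 \<le> g x" "0 \<le> X" "0 \<le> F" "0 \<le> G" "0 \<le> V" "1 \<le> C1"
    and vol: "emeasure M Q \<le> ennreal V"
    and f: "(\<integral>\<^sup>+x\<in>Q. ennreal (f x powr \<theta>) \<partial>M) \<le> ennreal (F powr \<theta> * V)"
    and g: "(\<integral>\<^sup>+x\<in>Q. ennreal (g x powr \<theta>) \<partial>M) \<le> ennreal (G powr \<theta> * V)"
    and D: "(\<integral>\<^sup>+x\<in>Q. ennreal (D x powr (\<theta> / (\<theta> - 1))) \<partial>M) \<le> ennreal ((C1 * X) powr (\<theta> / (\<theta> - 1)) * V)"
  shows "(\<integral>\<^sup>+y\<in>Q. ennreal (\<bar>b x - b y\<bar> ^ m * f y) \<partial>M) \<le> ennreal (2 ^ m * F * V * (D x + C1 * X))"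
    and "(\<integral>\<^sup>+x\<in>Q. ennreal (g x * (2 ^ m * F * V * (D x + C1 * X))) \<partial>M) \<le> ennreal (2 ^ (m + 1) * C1 * X * F * G * V * V)"
proof -
  have [measurable]: "D \<in> borel_measurable M" unfolding D_def by measurable
  have D0: "0 \<le> D x" for x by (simp add: D_def)
  have conj: "1 < \<theta> / (\<theta> - 1)" "1 / \<theta> + 1 / (\<theta> / (\<theta> - 1)) = 1" using \<theta> by (simp_all add: field_simps)
  have one: "(\<integral>\<^sup>+x\<in>Q. ennreal (1 powr (\<theta> / (\<theta> - 1))) \<partial>M) \<le> ennreal (1 powr (\<theta> / (\<theta> - 1)) * V)"
    using vol by simp
  have hD: "(\<integral>\<^sup>+x\<in>Q. ennreal (h x * D x) \<partial>M) \<le> ennreal (H * (C1 * X) * V)"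
    and h1: "(\<integral>\<^sup>+x\<in>Q. ennreal (h x) \<partial>M) \<le> ennreal (H * V)"
    if "h \<in> borel_measurable M" "\<And>x. 0 \<le> h x" "0 \<le> H" "(\<integral>\<^sup>+x\<in>Q. ennreal (h x powr \<theta>) \<partial>M) \<le> ennreal (H powr \<theta> * V)" for h H
  proof -
    show "(\<integral>\<^sup>+x\<in>Q. ennreal (h x * D x) \<partial>M) \<le> ennreal (H * (C1 * X) * V)"
      by (rule Holder_normalized[OF \<theta> conj]) (use that nn D0 D in auto)
    have "(\<integral>\<^sup>+x\<in>Q. ennreal (h x * 1) \<partial>M) \<le> ennreal (H * 1 * V)"
      by (rule Holder_normalized[OF \<theta> conj]) (use that nn one in auto)
    then show "(\<integral>\<^sup>+x\<in>Q. ennreal (h x) \<partial>M) \<le> ennreal (H * V)" by simp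
  qed
  note F1 = h1[OF assms(4) nn(1) nn(4) f] and FD = hD[OF assms(4) nn(1) nn(4) f]
    and G1 = h1[OF assms(5) nn(2) nn(5) g] and GD = hD[OF assms(5) nn(2) nn(5) g]
  have split: "\<bar>b x - b y\<bar> ^ m \<le> 2 ^ m * (D x + D y)" for x y
  proof -
    have "\<bar>b x - b y\<bar> \<le> \<bar>b x - \<beta>\<bar> + \<bar>b y - \<beta>\<bar>"
      using abs_triangle_ineq4[of "b x - \<beta>" "b y - \<beta>"] by simp
    also have "\<dots> \<le> max \<bar>b x - \<beta>\<bar> \<bar>b y - \<beta>\<bar> + max \<bar>b x - \<beta>\<bar> \<bar>b y - \<beta>\<bar>"
      by (intro add_mono max.cobounded1 max.cobounded2)
    finally have "\<bar>b x - b y\<bar> \<le> 2 * max \<bar>b x - \<beta>\<bar> \<bar>b y - \<beta>\<bar>" by simp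
    then have "\<bar>b x - b y\<bar> ^ m \<le> (2 * max \<bar>b x - \<beta>\<bar> \<bar>b y - \<beta>\<bar>) ^ m" by (intro power_mono) auto
    also have "\<dots> = 2 ^ m * max (D x) (D y)"
    proof -
      have "(max \<bar>b x - \<beta>\<bar> \<bar>b y - \<beta>\<bar>) ^ m = max (D x) (D y)"
      proof (cases "\<bar>b x - \<beta>\<bar> \<le> \<bar>b y - \<beta>\<bar>")
        case True
        then have "D x \<le> D y" unfolding D_def by (intro power_mono) auto
        then show ?thesis using True by (simp add: max_absorb2 D_def)
      next
        case False
        then have "D y \<le> D x" unfolding D_def by (intro power_mono) auto
        then show ?thesis using False by (simp add: max_absorb1 D_def)
      qed
      then show ?thesis by (simp add: power_mult_distrib)
    qed
    also have "\<dots> \<le> 2 ^ m * (D x + D y)" using D0[of x] D0[of y] by (intro mult_left_mono) auto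
    finally show ?thesis .
  qed
  show "(\<integral>\<^sup>+y\<in>Q. ennreal (\<bar>b x - b y\<bar> ^ m * f y) \<partial>M) \<le> ennreal (2 ^ m * F * V * (D x + C1 * X))"
  proof -
    have "(\<integral>\<^sup>+y\<in>Q. ennreal (\<bar>b x - b y\<bar> ^ m * f y) \<partial>M)
      \<le> (\<integral>\<^sup>+y. ennreal (2 ^ m * D x) * (ennreal (f y) * indicator Q y) + ennreal (2 ^ m) * (ennreal (f y * D y) * indicator Q y) \<partial>M)"
    proof (rule nn_integral_mono)
      fix y
      have "\<bar>b x - b y\<bar> ^ m * f y \<le> (2 ^ m * D x) * f y + 2 ^ m * (f y * D y)"
      proof -
        have "2 ^ m * (D x + D y) * f y = (2 ^ m * D x) * f y + 2 ^ m * (f y * D y)" by (simp only: distrib_left distrib_right mult.assoc mult.commute[of "D y"])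
        then show ?thesis using mult_right_mono[OF split[of x y] nn(1)[of y]] by (simp only:)
      qed
      then have "ennreal (\<bar>b x - b y\<bar> ^ m * f y) \<le> ennreal ((2 ^ m * D x) * f y + 2 ^ m * (f y * D y))" by (rule ennreal_leI)
      also have "\<dots> = ennreal (2 ^ m * D x) * ennreal (f y) + ennreal (2 ^ m) * ennreal (f y * D y)"
        using D0 nn by (intro ennreal_lincomb) auto
      finally show "ennreal (\<bar>b x - b y\<bar> ^ m * f y) * indicator Q y
        \<le> ennreal (2 ^ m * D x) * (ennreal (f y) * indicator Q y) + ennreal (2 ^ m) * (ennreal (f y * D y) * indicator Q y)"
        by (auto simp: indicator_def)
    qed
    also have "\<dots> = ennreal (2 ^ m * D x) * (\<integral>\<^sup>+y\<in>Q. ennreal (f y) \<partial>M) + ennreal (2 ^ m) * (\<integral>\<^sup>+y\<in>Q. ennreal (f y * D y) \<partial>M)"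
      by (subst nn_integral_add) (auto simp: nn_integral_cmult)
    also have "\<dots> \<le> ennreal (2 ^ m * D x) * ennreal (F * V) + ennreal (2 ^ m) * ennreal (F * (C1 * X) * V)"
      by (intro add_mono mult_left_mono F1 FD) auto
    also have "\<dots> = ennreal ((2 ^ m * D x) * (F * V) + 2 ^ m * (F * (C1 * X) * V))"
      using D0 nn by (intro ennreal_lincomb[symmetric]) auto
    also have "(2 ^ m * D x) * (F * V) + 2 ^ m * (F * (C1 * X) * V) = 2 ^ m * F * V * (D x + C1 * X)"
      by (simp add: algebra_simps)
    finally show ?thesis .
  qed
  show "(\<integral>\<^sup>+x\<in>Q. ennreal (g x * (2 ^ m * F * V * (D x + C1 * X))) \<partial>M) \<le> ennreal (2 ^ (m + 1) * C1 * X * F * G * V * V)"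
  proof -
    have FV: "0 \<le> 2 ^ m * F * V" using nn by simp
    have "(\<integral>\<^sup>+x\<in>Q. ennreal (g x * (2 ^ m * F * V * (D x + C1 * X))) \<partial>M)
      = (\<integral>\<^sup>+x. ennreal (2 ^ m * F * V) * (ennreal (g x * D x) * indicator Q x) + ennreal (2 ^ m * F * V * (C1 * X)) * (ennreal (g x) * indicator Q x) \<partial>M)"
    proof (rule nn_integral_cong)
      fix x
      have "g x * (2 ^ m * F * V * (D x + C1 * X)) = (2 ^ m * F * V) * (g x * D x) + 2 ^ m * F * V * (C1 * X) * g x"
        by (simp add: algebra_simps)
      then have "ennreal (g x * (2 ^ m * F * V * (D x + C1 * X))) = ennreal (2 ^ m * F * V) * ennreal (g x * D x) + ennreal (2 ^ m * F * V * (C1 * X)) * ennreal (g x)"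
        using FV D0 nn by (simp only:) (intro ennreal_lincomb, auto)
      then show "ennreal (g x * (2 ^ m * F * V * (D x + C1 * X))) * indicator Q x
        = ennreal (2 ^ m * F * V) * (ennreal (g x * D x) * indicator Q x) + ennreal (2 ^ m * F * V * (C1 * X)) * (ennreal (g x) * indicator Q x)"
        by (auto simp: indicator_def)
    qed
    also have "\<dots> = ennreal (2 ^ m * F * V) * (\<integral>\<^sup>+x\<in>Q. ennreal (g x * D x) \<partial>M) + ennreal (2 ^ m * F * V * (C1 * X)) * (\<integral>\<^sup>+x\<in>Q. ennreal (g x) \<partial>M)"
      by (subst nn_integral_add) (auto simp: nn_integral_cmult)
    also have "\<dots> \<le> ennreal (2 ^ m * F * V) * ennreal (G * (C1 * X) * V) + ennreal (2 ^ m * F * V * (C1 * X)) * ennreal (G * V)"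
      by (intro add_mono mult_left_mono G1 GD) auto
    also have "\<dots> = ennreal ((2 ^ m * F * V) * (G * (C1 * X) * V) + 2 ^ m * F * V * (C1 * X) * (G * V))"
      using nn by (intro ennreal_lincomb[symmetric]) auto
    also have "(2 ^ m * F * V) * (G * (C1 * X) * V) + 2 ^ m * F * V * (C1 * X) * (G * V) = 2 ^ (m + 1) * C1 * X * F * G * V * V"
      by (simp add: algebra_simps)
    finally show ?thesis .
  qed
qed

text \<open>
  The integrable majorant needed for the summation over the scales. On each cell Hoelder's
  inequality separates \<open>u\<close> from \<open>h\<close> and \<open>w\<close> from
  \<open>g\<close>; the weight condition, on the cube enlarged by \<open>L\<close>, removes
  \<open>u\<close> and \<open>w\<close> and leaves a power of the volume, and Young's
  inequality brings in the two maximal functions. The effective exponents are the values at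
  the given point up to unit side and the limits at infinity beyond.
\<close>

lemma stopping_dominated:
  fixes \<alpha>p \<alpha>q :: "real ^ 'n \<Rightarrow> real" and L \<theta> r s t \<sigma> :: real
  assumes P: "lh_exp \<alpha>p cp lop hip \<beta>p" and Q: "lh_exp \<alpha>q cq loq hiq \<beta>q" and hip: "hip < 1" and hiq: "hiq < 1"
    and pq: "\<And>x. \<alpha>q x \<le> \<alpha>p x" "\<beta>q \<le> \<beta>p" and L: "1 \<le> L"
    and \<theta>: "1 < \<theta>" "\<theta> < r" "\<theta> < s" "1 / \<theta> = 1 / r + 1 / s" "\<theta> < t" "\<theta> < \<sigma>" "1 / \<theta> = 1 / t + 1 / \<sigma>"
    and s: "s * hip < 1" and \<sigma>: "\<sigma> * (1 - loq) < 1"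
  obtains C where "0 < C"
    "\<And>J0 k \<delta> \<tau> x0 u w f h g ka \<kappa>. \<lbrakk>0 < \<delta>; \<delta> * 2 ^ J0 = 1; J0 \<le> k;
      u \<in> borel_measurable lebesgue; w \<in> borel_measurable lebesgue; f \<in> borel_measurable lebesgue; h \<in> borel_measurable lebesgue; g \<in> borel_measurable lebesgue;
      \<And>x. 0 \<le> u x; \<And>x. 0 \<le> w x; \<And>x. 0 \<le> h x; \<And>x. 0 \<le> g x; AE x in lebesgue. f x = u x * h x;
      (\<integral>\<^sup>+y. ennreal (h y powr (1 / \<alpha>p y)) \<partial>lebesgue) \<le> 1; (\<integral>\<^sup>+y. ennreal (g y powr (1 / (1 - \<alpha>q y))) \<partial>lebesgue) \<le> 1;
      0 \<le> \<kappa>; \<And>z l. 0 < l \<Longrightarrow> 0 \<le> ka z l;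
      \<And>z l Ap Aq. effective \<alpha>p \<beta>p L z l Ap \<Longrightarrow> effective \<alpha>q \<beta>q L z l Aq \<Longrightarrow> Aq \<le> Ap \<Longrightarrow> 0 < ka z l \<Longrightarrow>
        mean_product_le r t u w z l (ka z l * (l ^ CARD('n)) powr (Aq - Ap)) \<kappa>\<rbrakk> \<Longrightarrow>
     \<exists>\<Psi>. \<Psi> \<in> borel_measurable lebesgue \<and> (\<integral>\<^sup>+x\<in>dcell \<tau> \<delta> k x0. \<Psi> x \<partial>lebesgue) \<le> ennreal (C * \<kappa>) \<and>
       (\<forall>j\<le>k. \<forall>x. ennreal (ka (corner \<tau> \<delta> j x) (L * (\<delta> * 2 ^ j)) *
          ave lebesgue (\<lambda>y. f y powr \<theta>) (dcell \<tau> \<delta> j x) powr (1 / \<theta>) *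
          ave lebesgue (\<lambda>y. (w y * g y) powr \<theta>) (dcell \<tau> \<delta> j x) powr (1 / \<theta>)) \<le> \<Psi> x)"
proof -
  let ?n = "CARD('n)"
  interpret P: lh_exp \<alpha>p cp lop hip \<beta>p by fact
  interpret Q: lh_exp \<alpha>q cq loq hiq \<beta>q by fact
  have "lh_exp (\<lambda>x. 1 - \<alpha>q x) cq (1 - hiq) (1 - loq) (1 - \<beta>q)"
    using Q.affine_exponent[of 1] hiq by simp
  then interpret Q': lh_exp "\<lambda>x. 1 - \<alpha>q x" cq "1 - hiq" "1 - loq" "1 - \<beta>q" .
  have s0: "0 < s" and \<sigma>0: "0 < \<sigma>" and r0: "0 < r" and t0: "0 < t" using \<theta> by auto
  obtain Ch where Ch: "0 < Ch" "\<And>\<tau> \<delta> J0 k x0 h. \<lbrakk>0 < \<delta>; \<delta> * 2 ^ J0 = 1; J0 \<le> k; h \<in> borel_measurable lebesgue; \<And>y. 0 \<le> h y;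
       (\<integral>\<^sup>+y. ennreal (h y powr (1 / \<alpha>p y)) \<partial>lebesgue) \<le> 1\<rbrakk> \<Longrightarrow>
     \<exists>\<Psi>. \<Psi> \<in> borel_measurable lebesgue \<and> (\<forall>x. 0 \<le> \<Psi> x) \<and> (\<integral>\<^sup>+x\<in>dcell \<tau> \<delta> k x0. ennreal (\<Psi> x) \<partial>lebesgue) \<le> ennreal Ch \<and>
       (\<forall>j\<le>k. \<forall>x. (j \<le> J0 \<longrightarrow> ave lebesgue (\<lambda>y. h y powr s) (dcell \<tau> \<delta> j x) powr (1 / (s * \<alpha>p x)) \<le> \<Psi> x) \<and>
                  (J0 \<le> j \<longrightarrow> ave lebesgue (\<lambda>y. h y powr s) (dcell \<tau> \<delta> j x) powr (1 / (s * \<beta>p)) \<le> \<Psi> x))"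
    by (rule P.maximal_control[OF s0 s]) blast
  obtain Cg where Cg: "0 < Cg" "\<And>\<tau> \<delta> J0 k x0 h. \<lbrakk>0 < \<delta>; \<delta> * 2 ^ J0 = 1; J0 \<le> k; h \<in> borel_measurable lebesgue; \<And>y. 0 \<le> h y;
       (\<integral>\<^sup>+y. ennreal (h y powr (1 / (1 - \<alpha>q y))) \<partial>lebesgue) \<le> 1\<rbrakk> \<Longrightarrow>
     \<exists>\<Psi>. \<Psi> \<in> borel_measurable lebesgue \<and> (\<forall>x. 0 \<le> \<Psi> x) \<and> (\<integral>\<^sup>+x\<in>dcell \<tau> \<delta> k x0. ennreal (\<Psi> x) \<partial>lebesgue) \<le> ennreal Cg \<and>
       (\<forall>j\<le>k. \<forall>x. (j \<le> J0 \<longrightarrow> ave lebesgue (\<lambda>y. h y powr \<sigma>) (dcell \<tau> \<delta> j x) powr (1 / (\<sigma> * (1 - \<alpha>q x))) \<le> \<Psi> x) \<and>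
                  (J0 \<le> j \<longrightarrow> ave lebesgue (\<lambda>y. h y powr \<sigma>) (dcell \<tau> \<delta> j x) powr (1 / (\<sigma> * (1 - \<beta>q))) \<le> \<Psi> x))"
    by (rule Q'.maximal_control[OF \<sigma>0 \<sigma>]) blast
  obtain CB where CB: "0 < CB"
    "\<And>h z l A. \<lbrakk>h \<in> borel_measurable lebesgue; \<And>y. 0 \<le> h y; (\<integral>\<^sup>+y. ennreal (h y powr (1 / \<alpha>p y)) \<partial>lebesgue) \<le> 1; effective \<alpha>p \<beta>p 1 z l A\<rbrakk> \<Longrightarrow>
     ave lebesgue (\<lambda>y. h y powr s) (hb z l) powr (1/s) \<le> CB * (l ^ CARD('n)) powr (- A)"
    by (rule P.average_power_bound[OF s0 s]) blast
  define CB' where "CB' = max 1 CB"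
  define K where "K = L powr (?n / r) * L powr (?n / t) * L ^ ?n * CB' powr (1 / loq)"
  have K: "0 < K" using L by (simp add: K_def CB'_def)
  define C where "C = K * (Ch + Cg)"
  show thesis
  proof (rule that[of C])
    show "0 < C" using K Ch(1) Cg(1) by (simp add: C_def)
    fix J0 k :: nat and \<delta> \<kappa> :: real and \<tau> x0 :: "real ^ 'n" and u w f h g :: "real ^ 'n \<Rightarrow> real" and ka :: "real ^ 'n \<Rightarrow> real \<Rightarrow> real"
    assume \<delta>: "0 < \<delta>" "\<delta> * 2 ^ J0 = 1" and J0: "J0 \<le> k"
      and um[measurable]: "u \<in> borel_measurable lebesgue" and wm[measurable]: "w \<in> borel_measurable lebesgue" and fm[measurable]: "f \<in> borel_measurable lebesgue"
      and hm[measurable]: "h \<in> borel_measurable lebesgue" and gm[measurable]: "g \<in> borel_measurable lebesgue"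
      and nn: "\<And>x. 0 \<le> u x" "\<And>x. 0 \<le> w x" "\<And>x. 0 \<le> h x" "\<And>x. 0 \<le> g x" and fuh: "AE x in lebesgue. f x = u x * h x"
      and hmod: "(\<integral>\<^sup>+y. ennreal (h y powr (1 / \<alpha>p y)) \<partial>lebesgue) \<le> 1" and gmod: "(\<integral>\<^sup>+y. ennreal (g y powr (1 / (1 - \<alpha>q y))) \<partial>lebesgue) \<le> 1"
      and \<kappa>: "0 \<le> \<kappa>" and ka0: "\<And>z l. 0 < l \<Longrightarrow> 0 \<le> ka z l"
      and cond: "\<And>z l Ap Aq. effective \<alpha>p \<beta>p L z l Ap \<Longrightarrow> effective \<alpha>q \<beta>q L z l Aq \<Longrightarrow> Aq \<le> Ap \<Longrightarrow> 0 < ka z l \<Longrightarrow>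
        mean_product_le r t u w z l (ka z l * (l ^ ?n) powr (Aq - Ap)) \<kappa>"
    let ?cell = "dcell \<tau> \<delta>"
    interpret T: cell_tree lebesgue ?cell by (rule dcell_tree[OF \<delta>(1)])
    obtain \<Psi>h where \<Psi>h: "\<Psi>h \<in> borel_measurable lebesgue" "\<And>x. 0 \<le> \<Psi>h x" "(\<integral>\<^sup>+x\<in>?cell k x0. ennreal (\<Psi>h x) \<partial>lebesgue) \<le> ennreal Ch"
      "\<And>j x. j \<le> k \<Longrightarrow> j \<le> J0 \<Longrightarrow> ave lebesgue (\<lambda>y. h y powr s) (?cell j x) powr (1 / (s * \<alpha>p x)) \<le> \<Psi>h x"
      "\<And>j x. j \<le> k \<Longrightarrow> J0 \<le> j \<Longrightarrow> ave lebesgue (\<lambda>y. h y powr s) (?cell j x) powr (1 / (s * \<beta>p)) \<le> \<Psi>h x"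
      using Ch(2)[OF \<delta> J0 hm nn(3) hmod, of \<tau> x0] by blast
    obtain \<Psi>g where \<Psi>g: "\<Psi>g \<in> borel_measurable lebesgue" "\<And>x. 0 \<le> \<Psi>g x" "(\<integral>\<^sup>+x\<in>?cell k x0. ennreal (\<Psi>g x) \<partial>lebesgue) \<le> ennreal Cg"
      "\<And>j x. j \<le> k \<Longrightarrow> j \<le> J0 \<Longrightarrow> ave lebesgue (\<lambda>y. g y powr \<sigma>) (?cell j x) powr (1 / (\<sigma> * (1 - \<alpha>q x))) \<le> \<Psi>g x"
      "\<And>j x. j \<le> k \<Longrightarrow> J0 \<le> j \<Longrightarrow> ave lebesgue (\<lambda>y. g y powr \<sigma>) (?cell j x) powr (1 / (\<sigma> * (1 - \<beta>q))) \<le> \<Psi>g x"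
      using Cg(2)[OF \<delta> J0 gm nn(4) gmod, of \<tau> x0] by blast
    note [measurable] = \<Psi>h(1) \<Psi>g(1)
    define \<Psi> where "\<Psi> x = ennreal (K * \<kappa>) * (ennreal (\<Psi>h x) + ennreal (\<Psi>g x))" for x
    have side: "0 < \<delta> * 2 ^ j" for j :: nat using \<delta> by simp
    have "(\<integral>\<^sup>+x\<in>?cell k x0. \<Psi> x \<partial>lebesgue) = ennreal (K * \<kappa>) * ((\<integral>\<^sup>+x\<in>?cell k x0. ennreal (\<Psi>h x) \<partial>lebesgue) + (\<integral>\<^sup>+x\<in>?cell k x0. ennreal (\<Psi>g x) \<partial>lebesgue))"
      by (simp add: \<Psi>_def T.cell_integral_cmult T.cell_integral_add)
    also have "\<dots> \<le> ennreal (K * \<kappa>) * (ennreal Ch + ennreal Cg)" by (intro mult_left_mono add_mono \<Psi>h \<Psi>g) auto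
    also have "\<dots> = ennreal (K * \<kappa> * (Ch + Cg))" using K \<kappa> Ch(1) Cg(1) by (simp flip: ennreal_plus ennreal_mult)
    finally have int: "(\<integral>\<^sup>+x\<in>?cell k x0. \<Psi> x \<partial>lebesgue) \<le> ennreal (C * \<kappa>)" by (simp add: C_def mult_ac)
    have dom: "ennreal (ka (corner \<tau> \<delta> j x) (L * (\<delta> * 2 ^ j)) *
          ave lebesgue (\<lambda>y. f y powr \<theta>) (?cell j x) powr (1 / \<theta>) *
          ave lebesgue (\<lambda>y. (w y * g y) powr \<theta>) (?cell j x) powr (1 / \<theta>)) \<le> \<Psi> x" if jk: "j \<le> k" for j x
    proof -
      define l where "l = \<delta> * 2 ^ j"
      define z where "z = corner \<tau> \<delta> j x"
      have l: "0 < l" by (simp add: l_def side)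
      have cell: "?cell j x = hb z l" using dcell_eq_hb[OF \<delta>(1)] by (simp add: z_def l_def)
      have xQ: "x \<in> hb z l" using T.cell_self[of x j] cell by simp
      let ?V = "l ^ ?n"
      have V: "0 < ?V" using l by simp
      have Ll: "l \<le> L * l" using L l by simp
      have subH: "cube z l \<subseteq> cube z (L * l)" using Ll by (intro cube_subsetI) auto
      define F where "F = ave lebesgue (\<lambda>y. f y powr \<theta>) (hb z l) powr (1 / \<theta>)"
      define G where "G = ave lebesgue (\<lambda>y. (w y * g y) powr \<theta>) (hb z l) powr (1 / \<theta>)"
      define Ah where "Ah = ave lebesgue (\<lambda>y. h y powr s) (hb z l) powr (1 / s)"
      define Ag where "Ag = ave lebesgue (\<lambda>y. g y powr \<sigma>) (hb z l) powr (1 / \<sigma>)"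
      have pos: "0 \<le> F" "0 \<le> G" "0 \<le> Ah" "0 \<le> Ag" by (simp_all add: F_def G_def Ah_def Ag_def)
      have "\<exists>Ap Aq. effective \<alpha>p \<beta>p L z (L * l) Ap \<and> effective \<alpha>q \<beta>q L z (L * l) Aq \<and> Aq \<le> Ap \<and> lop \<le> Ap \<and> Ap \<le> hip \<and> loq \<le> Aq \<and>
         effective \<alpha>p \<beta>p 1 z l Ap \<and> Ah powr (1 / Ap) \<le> \<Psi>h x \<and> Ag powr (1 / (1 - Aq)) \<le> \<Psi>g x"
      proof (cases "j \<le> J0")
        case True
        have "l \<le> \<delta> * 2 ^ J0" unfolding l_def using True \<delta>(1) by (intro mult_left_mono power_increasing) auto
        then have l1: "l \<le> 1" using \<delta>(2) by simp
        then have "L * l \<le> L" using L by (simp add: mult_left_le)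
        moreover have "x \<in> cube z l" using xQ hb_subset_cube by blast
        moreover have "x \<in> cube z (L * l)" using calculation subH by blast
        ultimately have "effective \<alpha>p \<beta>p L z (L * l) (\<alpha>p x)" "effective \<alpha>q \<beta>q L z (L * l) (\<alpha>q x)" "effective \<alpha>p \<beta>p 1 z l (\<alpha>p x)"
          using l l1 L by (auto simp: effective_def)
        moreover have "Ah powr (1 / \<alpha>p x) \<le> \<Psi>h x" using \<Psi>h(4)[OF jk True, of x] by (simp add: cell Ah_def powr_powr)
        moreover have "Ag powr (1 / (1 - \<alpha>q x)) \<le> \<Psi>g x" using \<Psi>g(4)[OF jk True, of x] by (simp add: cell Ag_def powr_powr)
        ultimately show ?thesis using pq P.bounds Q.bounds by blast
      next
        case False
        then have "\<delta> * 2 ^ J0 \<le> l" unfolding l_def using \<delta>(1) by (intro mult_left_mono power_increasing) auto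
        then have l1: "1 \<le> l" using \<delta>(2) by simp
        then have "1 \<le> L * l" using Ll by linarith
        then have "effective \<alpha>p \<beta>p L z (L * l) \<beta>p" "effective \<alpha>q \<beta>q L z (L * l) \<beta>q" "effective \<alpha>p \<beta>p 1 z l \<beta>p"
          using l l1 L by (auto simp: effective_def)
        moreover have "Ah powr (1 / \<beta>p) \<le> \<Psi>h x" using \<Psi>h(5)[of j x] jk False by (simp add: cell Ah_def powr_powr)
        moreover have "Ag powr (1 / (1 - \<beta>q)) \<le> \<Psi>g x" using \<Psi>g(5)[of j x] jk False by (simp add: cell Ag_def powr_powr)
        ultimately show ?thesis using pq P.bounds_inf Q.bounds_inf by blast
      qed
      then obtain Ap Aq where A: "effective \<alpha>p \<beta>p L z (L * l) Ap" "effective \<alpha>q \<beta>q L z (L * l) Aq" "Aq \<le> Ap" "lop \<le> Ap" "Ap \<le> hip" "loq \<le> Aq"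
        "effective \<alpha>p \<beta>p 1 z l Ap" "Ah powr (1 / Ap) \<le> \<Psi>h x" "Ag powr (1 / (1 - Aq)) \<le> \<Psi>g x" by blast
      let ?ka = "ka z (L * l)"
      have goal: "?ka * F * G \<le> K * \<kappa> * (\<Psi>h x + \<Psi>g x)"
      proof (cases "?ka = 0")
        case True then show ?thesis using K \<kappa> \<Psi>h(2)[of x] \<Psi>g(2)[of x] by simp
      next
        case False
        have kap: "0 < ?ka" using False ka0[of "L * l" z] l L by (simp add: less_le)
        obtain U W where UW: "0 \<le> U" "0 \<le> W" "(\<integral>\<^sup>+y\<in>cube z (L * l). ennreal (u y powr r) \<partial>lebesgue) \<le> ennreal (U powr r * (L * l) ^ ?n)"
          "(\<integral>\<^sup>+y\<in>cube z (L * l). ennreal (w y powr t) \<partial>lebesgue) \<le> ennreal (W powr t * (L * l) ^ ?n)"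
          "?ka * ((L * l) ^ ?n) powr (Aq - Ap) * U * W \<le> \<kappa>"
          using cond[OF A(1-3) kap] by blast
        have small: "(\<integral>\<^sup>+y\<in>hb z l. ennreal (v y powr e) \<partial>lebesgue) \<le> ennreal ((L powr (?n / e) * X) powr e * ?V)"
          if "(\<integral>\<^sup>+y\<in>cube z (L * l). ennreal (v y powr e) \<partial>lebesgue) \<le> ennreal (X powr e * (L * l) ^ ?n)" "0 \<le> X" "0 < e" for v X e
        proof -
          have "(\<integral>\<^sup>+y\<in>hb z l. ennreal (v y powr e) \<partial>lebesgue) \<le> (\<integral>\<^sup>+y\<in>cube z (L * l). ennreal (v y powr e) \<partial>lebesgue)"
            using subH hb_subset_cube[of z l] by (intro nn_integral_mono) (auto simp: indicator_def)
          also note that(1)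
          also have "X powr e * (L * l) ^ ?n = (L powr (?n / e) * X) powr e * ?V"
            using that L by (simp add: powr_mult powr_powr powr_realpow power_mult_distrib)
          finally show ?thesis .
        qed
        define Lu where "Lu = L powr (?n / r)"
        define Lw where "Lw = L powr (?n / t)"
        have LL: "0 < Lu" "0 < Lw" using L by (simp_all add: Lu_def Lw_def)
        have finh: "(\<integral>\<^sup>+y\<in>hb z l. ennreal (h y powr s) \<partial>lebesgue) < \<infinity>"
        proof (rule P.integral_lower_power[OF hm nn(3) hmod _ _ l])
          fix y
          have "s * \<alpha>p y \<le> s * hip" using s0 by (intro mult_left_mono P.bounds) auto
          then have "s * \<alpha>p y \<le> 1" using s by linarith
          then show "s \<le> 1 / \<alpha>p y" using P.alpha_pos[of y] by (simp add: pos_le_divide_eq)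
        qed (use s0 in auto)
        have fing: "(\<integral>\<^sup>+y\<in>hb z l. ennreal (g y powr \<sigma>) \<partial>lebesgue) < \<infinity>"
        proof (rule Q'.integral_lower_power[OF gm nn(4) gmod _ _ l])
          fix y
          have "\<sigma> * (1 - \<alpha>q y) \<le> \<sigma> * (1 - loq)" using \<sigma>0 Q'.bounds(2)[of y] by (intro mult_left_mono) auto
          then have "\<sigma> * (1 - \<alpha>q y) \<le> 1" using \<sigma> by linarith
          then show "\<sigma> \<le> 1 / (1 - \<alpha>q y)" using Q'.alpha_pos[of y] by (simp add: pos_le_divide_eq)
        qed (use \<sigma>0 in auto)
        have inth: "(\<integral>\<^sup>+y\<in>hb z l. ennreal (h y powr s) \<partial>lebesgue) \<le> ennreal (Ah powr s * ?V)"
          using s0 ave_nonneg[of lebesgue "\<lambda>y. h y powr s" "hb z l"] unfolding ave_hb[OF finh l] by (simp add: Ah_def powr_powr)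
        have intg: "(\<integral>\<^sup>+y\<in>hb z l. ennreal (g y powr \<sigma>) \<partial>lebesgue) \<le> ennreal (Ag powr \<sigma> * ?V)"
          using \<sigma>0 ave_nonneg[of lebesgue "\<lambda>y. g y powr \<sigma>" "hb z l"] unfolding ave_hb[OF fing l] by (simp add: Ag_def powr_powr)
        have root: "X powr (1 / \<theta>) \<le> B" if "X \<le> B powr \<theta>" "0 \<le> X" "0 \<le> B" for X B
        proof -
          have "X powr (1 / \<theta>) \<le> (B powr \<theta>) powr (1 / \<theta>)" using that \<theta> by (intro powr_mono2) auto
          then show ?thesis using that \<theta>(1) by (simp add: powr_powr)
        qed
        have Fle: "F \<le> Lu * U * Ah"
        proof -
          have "(\<integral>\<^sup>+y\<in>hb z l. ennreal (f y powr \<theta>) \<partial>lebesgue) = (\<integral>\<^sup>+y\<in>hb z l. ennreal ((u y * h y) powr \<theta>) \<partial>lebesgue)"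
            by (rule nn_integral_cong_AE) (use fuh in eventually_elim, auto)
          also have "\<dots> \<le> ennreal ((Lu * U * Ah) powr \<theta> * ?V)"
            by (rule Holder_product_power[OF _ \<theta>(2-4)])
               (use \<theta> nn pos UW LL V hb_sets small[OF UW(3,1) r0] inth in \<open>auto simp: Lu_def\<close>)
          finally have "ave lebesgue (\<lambda>y. f y powr \<theta>) (hb z l) \<le> (Lu * U * Ah) powr \<theta>" by (rule ave_hb_le) (use l in auto)
          then show ?thesis unfolding F_def by (rule root) (use UW LL pos in \<open>auto simp: ave_nonneg\<close>)
        qed
        have Gle: "G \<le> Lw * W * Ag"
        proof -
          have "(\<integral>\<^sup>+y\<in>hb z l. ennreal ((w y * g y) powr \<theta>) \<partial>lebesgue) \<le> ennreal ((Lw * W * Ag) powr \<theta> * ?V)"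
            by (rule Holder_product_power[OF _ \<theta>(5-7)])
               (use \<theta> nn pos UW LL V hb_sets small[OF UW(4,2) t0] intg in \<open>auto simp: Lw_def\<close>)
          then have "ave lebesgue (\<lambda>y. (w y * g y) powr \<theta>) (hb z l) \<le> (Lw * W * Ag) powr \<theta>" by (rule ave_hb_le) (use l in auto)
          then show ?thesis unfolding G_def by (rule root) (use UW LL pos in \<open>auto simp: ave_nonneg\<close>)
        qed
        have "?ka * F * G \<le> ?ka * (Lu * U * Ah) * (Lw * W * Ag)"
          using kap Fle Gle pos UW LL by (intro mult_mono) auto
        also have "\<dots> = Lu * Lw * (?ka * U * W) * (Ah * Ag)" by (simp add: mult_ac)
        also have "\<dots> \<le> Lu * Lw * (\<kappa> * (L ^ ?n * ?V powr (Ap - Aq))) * (Ah * Ag)"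
        proof (intro mult_right_mono mult_left_mono)
          have LV: "0 < (L * l) ^ ?n" using L l by simp
          have "?ka * U * W * (((L * l) ^ ?n) powr (Aq - Ap) * ((L * l) ^ ?n) powr (Ap - Aq)) \<le> \<kappa> * ((L * l) ^ ?n) powr (Ap - Aq)"
            using mult_right_mono[OF UW(5), of "((L * l) ^ ?n) powr (Ap - Aq)"] by (simp add: mult_ac)
          moreover have "((L * l) ^ ?n) powr (Aq - Ap) * ((L * l) ^ ?n) powr (Ap - Aq) = 1"
            using LV L l by (simp flip: powr_add)
          ultimately have "?ka * U * W \<le> \<kappa> * ((L * l) ^ ?n) powr (Ap - Aq)" by simp
          also have "((L * l) ^ ?n) powr (Ap - Aq) = (L ^ ?n) powr (Ap - Aq) * ?V powr (Ap - Aq)"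
            by (simp add: power_mult_distrib powr_mult)
          also have "(L ^ ?n) powr (Ap - Aq) \<le> (L ^ ?n) powr 1"
            using A hip Q.lo L by (intro powr_mono) auto
          also have "(L ^ ?n) powr 1 = L ^ ?n" using L by simp
          finally show "?ka * U * W \<le> \<kappa> * (L ^ ?n * ?V powr (Ap - Aq))" using \<kappa> by (simp add: mult_left_mono mult_right_mono)
        qed (use LL pos in auto)
        also have "\<dots> = Lu * Lw * L ^ ?n * \<kappa> * (?V powr (Ap - Aq) * Ah * Ag)" by (simp add: mult_ac)
        also have "\<dots> \<le> Lu * Lw * L ^ ?n * \<kappa> * (CB' powr (1 / loq) * (Ah powr (1 / Ap) + Ag powr (1 / (1 - Aq))))"
        proof (intro mult_left_mono exponent_pair_bound)
          have "Ah \<le> CB * ?V powr (- Ap)" unfolding Ah_def by (rule CB(2)[OF hm nn(3) hmod A(7)])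
          also have "\<dots> \<le> CB' * ?V powr (- Ap)" by (intro mult_right_mono) (auto simp: CB'_def)
          finally show "Ah \<le> CB' * ?V powr (- Ap)" .
        qed (use A hip Q.lo V pos LL L \<kappa> in \<open>auto simp: CB'_def\<close>)
        also have "\<dots> = K * \<kappa> * (Ah powr (1 / Ap) + Ag powr (1 / (1 - Aq)))" by (simp add: K_def Lu_def Lw_def mult_ac)
        also have "\<dots> \<le> K * \<kappa> * (\<Psi>h x + \<Psi>g x)" using K \<kappa> by (intro mult_left_mono add_mono A) auto
        finally show ?thesis .
      qed
      have "\<Psi> x = ennreal (K * \<kappa> * (\<Psi>h x + \<Psi>g x))"
        using K \<kappa> \<Psi>h(2) \<Psi>g(2) by (simp add: \<Psi>_def ennreal_mult ennreal_plus)
      then show ?thesis using goal by (simp add: cell F_def G_def z_def[symmetric] l_def[symmetric] ennreal_leI)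
    qed
    show "\<exists>\<Psi>. \<Psi> \<in> borel_measurable lebesgue \<and> (\<integral>\<^sup>+x\<in>?cell k x0. \<Psi> x \<partial>lebesgue) \<le> ennreal (C * \<kappa>) \<and>
       (\<forall>j\<le>k. \<forall>x. ennreal (ka (corner \<tau> \<delta> j x) (L * (\<delta> * 2 ^ j)) *
          ave lebesgue (\<lambda>y. f y powr \<theta>) (?cell j x) powr (1 / \<theta>) *
          ave lebesgue (\<lambda>y. (w y * g y) powr \<theta>) (?cell j x) powr (1 / \<theta>)) \<le> \<Psi> x)"
    proof (intro exI[of _ \<Psi>] conjI int allI impI dom)
      show "\<Psi> \<in> borel_measurable lebesgue" unfolding \<Psi>_def by measurable
    qed
  qed
qed

text \<open>
  The pointwise majorant \<open>\<Phi>\<close> comes from the oscillation estimate in the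
  inner variable. Integrated over a cell of generation \<open>i\<close>, the outer variable
  gives the terms \<open>I i * a ^ m * F * G\<close> of \<open>sparse_bound\<close>, for
  which the previous lemma provides the majorant. The functional \<open>a\<close> is needed
  on cubes enlarged by \<open>L\<close>; by its monotonicity up to constants this also
  covers the doubled cubes of the oscillation estimate.
\<close>

lemma grid_estimate:
  fixes \<alpha>p \<alpha>q :: "real ^ 'n \<Rightarrow> real" and L \<theta> r s t \<sigma> tt :: real and m :: nat
  assumes P: "lh_exp \<alpha>p cp lop hip \<beta>p" and Q: "lh_exp \<alpha>q cq loq hiq \<beta>q" and hip: "hip < 1" and hiq: "hiq < 1"
    and pq: "\<And>x. \<alpha>q x \<le> \<alpha>p x" "\<beta>q \<le> \<beta>p" and L: "2 \<le> L"
    and \<theta>: "1 < \<theta>" "\<theta> < r" "\<theta> < s" "1 / \<theta> = 1 / r + 1 / s" "\<theta> < t" "\<theta> < \<sigma>" "1 / \<theta> = 1 / t + 1 / \<sigma>"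
    and s: "s * hip < 1" and \<sigma>: "\<sigma> * (1 - loq) < 1" and tt: "0 < tt"
  obtains C where "0 < C"
    "\<And>J0 k \<delta> \<tau> x0 u w f h g kt \<kappa> a b N I B. \<lbrakk>0 < \<delta>; \<delta> * 2 ^ J0 = 1; J0 \<le> k;
      u \<in> borel_measurable lebesgue; w \<in> borel_measurable lebesgue; f \<in> borel_measurable lebesgue; h \<in> borel_measurable lebesgue; g \<in> borel_measurable lebesgue;
      \<And>x. 0 \<le> u x; \<And>x. 0 \<le> w x; \<And>x. 0 \<le> h x; \<And>x. 0 \<le> g x; \<And>x. 0 \<le> f x; \<And>x. f x \<le> B; AE x in lebesgue. f x = u x * h x;
      (\<integral>\<^sup>+y. ennreal (h y powr (1 / \<alpha>p y)) \<partial>lebesgue) \<le> 1; (\<integral>\<^sup>+y. ennreal (g y powr (1 / (1 - \<alpha>q y))) \<partial>lebesgue) \<le> 1;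
      \<And>z l. 0 < l \<Longrightarrow> (\<integral>\<^sup>+y\<in>cube z l. ennreal (w y powr t) \<partial>lebesgue) < \<infinity>;
      locally_integrable b; osc_bound 1 a b N; 0 \<le> N;
      \<And>Q Q'. Q \<in> cubes \<Longrightarrow> Q' \<in> cubes \<Longrightarrow> Q' \<subseteq> Q \<Longrightarrow> a Q' \<le> tt * a Q; \<And>Q. Q \<in> cubes \<Longrightarrow> 0 \<le> a Q;
      \<And>i. 0 \<le> I i; \<And>l. 0 \<le> kt l; \<And>j. j \<le> k \<Longrightarrow> (\<Sum>i\<le>j. I i) \<le> kt (L * (\<delta> * 2 ^ j)); 0 \<le> \<kappa>;
      \<And>z l Ap Aq. effective \<alpha>p \<beta>p L z l Ap \<Longrightarrow> effective \<alpha>q \<beta>q L z l Aq \<Longrightarrow> Aq \<le> Ap \<Longrightarrow> 0 < kt l * a (cube z l) ^ m \<Longrightarrow>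
        mean_product_le r t u w z l (kt l * a (cube z l) ^ m * (l ^ CARD('n)) powr (Aq - Ap)) \<kappa>\<rbrakk> \<Longrightarrow>
     \<exists>\<Phi>. \<Phi> \<in> borel_measurable lebesgue \<and> (\<integral>\<^sup>+x\<in>dcell \<tau> \<delta> k x0. \<Phi> x \<partial>lebesgue) \<le> ennreal (C * \<kappa> * N ^ m) \<and>
       (\<forall>x. ennreal (w x * g x) * (\<Sum>i\<le>k. ennreal (I i / (\<delta> * 2 ^ i) ^ CARD('n)) *
         (\<integral>\<^sup>+y\<in>dcell \<tau> \<delta> i x. ennreal (\<bar>b x - b y\<bar> ^ m * f y) \<partial>lebesgue)) \<le> \<Phi> x)"
proof -
  let ?n = "CARD('n)"
  interpret P: lh_exp \<alpha>p cp lop hip \<beta>p by fact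
  interpret Q: lh_exp \<alpha>q cq loq hiq \<beta>q by fact
  have "lh_exp (\<lambda>x. 1 - \<alpha>q x) cq (1 - hiq) (1 - loq) (1 - \<beta>q)"
    using Q.affine_exponent[of 1] hiq by simp
  then interpret Q': lh_exp "\<lambda>x. 1 - \<alpha>q x" cq "1 - hiq" "1 - loq" "1 - \<beta>q" .
  define \<theta>' where "\<theta>' = \<theta> / (\<theta> - 1)"
  have \<theta>': "0 < \<theta>'" using \<theta>(1) by (simp add: \<theta>'_def)
  have L1: "1 \<le> L" using L by simp
  have t0: "0 < t" and \<sigma>0: "0 < \<sigma>" using \<theta> by auto
  obtain C0 where C0: "0 < C0"
    "\<And>(b :: real ^ 'n \<Rightarrow> real) N a z l. \<lbrakk>locally_integrable b; osc_bound 1 a b N; 0 \<le> N;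
      \<And>Q Q'. Q \<in> cubes \<Longrightarrow> Q' \<in> cubes \<Longrightarrow> Q' \<subseteq> Q \<Longrightarrow> a Q' \<le> tt * a Q; \<And>Q. Q \<in> cubes \<Longrightarrow> 0 \<le> a Q; 0 < l\<rbrakk> \<Longrightarrow>
      (\<integral>\<^sup>+x\<in>hb z l. ennreal ((\<bar>b x - avg b (cube z l)\<bar> ^ m) powr \<theta>') \<partial>lebesgue)
        \<le> ennreal (C0 * ((N * a (cube z (2 * l))) ^ m) powr \<theta>' * l ^ CARD('n))"
    by (rule oscillation_moments[OF \<theta>' less_imp_le[OF tt], where m = m]) blast
  obtain CS where CS: "0 < CS"
    "\<And>J0 k \<delta> \<tau> x0 u w f h g ka \<kappa>. \<lbrakk>0 < \<delta>; \<delta> * 2 ^ J0 = 1; J0 \<le> k;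
      u \<in> borel_measurable lebesgue; w \<in> borel_measurable lebesgue; f \<in> borel_measurable lebesgue; h \<in> borel_measurable lebesgue; g \<in> borel_measurable lebesgue;
      \<And>x. 0 \<le> u x; \<And>x. 0 \<le> w x; \<And>x. 0 \<le> h x; \<And>x. 0 \<le> g x; AE x in lebesgue. f x = u x * h x;
      (\<integral>\<^sup>+y. ennreal (h y powr (1 / \<alpha>p y)) \<partial>lebesgue) \<le> 1; (\<integral>\<^sup>+y. ennreal (g y powr (1 / (1 - \<alpha>q y))) \<partial>lebesgue) \<le> 1;
      0 \<le> \<kappa>; \<And>z l. 0 < l \<Longrightarrow> 0 \<le> ka z l;
      \<And>z l Ap Aq. effective \<alpha>p \<beta>p L z l Ap \<Longrightarrow> effective \<alpha>q \<beta>q L z l Aq \<Longrightarrow> Aq \<le> Ap \<Longrightarrow> 0 < ka z l \<Longrightarrow>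
        mean_product_le r t u w z l (ka z l * (l ^ CARD('n)) powr (Aq - Ap)) \<kappa>\<rbrakk> \<Longrightarrow>
     \<exists>\<Psi>. \<Psi> \<in> borel_measurable lebesgue \<and> (\<integral>\<^sup>+x\<in>dcell \<tau> \<delta> k x0. \<Psi> x \<partial>lebesgue) \<le> ennreal (CS * \<kappa>) \<and>
       (\<forall>j\<le>k. \<forall>x. ennreal (ka (corner \<tau> \<delta> j x) (L * (\<delta> * 2 ^ j)) *
          ave lebesgue (\<lambda>y. f y powr \<theta>) (dcell \<tau> \<delta> j x) powr (1 / \<theta>) *
          ave lebesgue (\<lambda>y. (w y * g y) powr \<theta>) (dcell \<tau> \<delta> j x) powr (1 / \<theta>)) \<le> \<Psi> x)"
    by (rule stopping_dominated[OF P Q hip hiq pq L1 \<theta> s \<sigma>]) blast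
  define C1 where "C1 = max 1 (C0 powr (1 / \<theta>'))"
  have C1: "1 \<le> C1" by (simp add: C1_def)
  define c0 where "c0 = 2 ^ (m + 1) * C1 * tt ^ m"
  have c0: "0 < c0" using C1 tt by (simp add: c0_def)
  define cs where "cs = 2 * 2 powr (1 / \<theta>) * tt ^ m"
  have cs: "0 < cs" using tt by (simp add: cs_def)
  show thesis
  proof (rule that[of "c0 * cs * CS"])
    show "0 < c0 * cs * CS" using c0 cs CS(1) by simp
    fix J0 k :: nat and \<delta> \<kappa> N B :: real and \<tau> x0 :: "real ^ 'n" and u w f h g b :: "real ^ 'n \<Rightarrow> real" and kt :: "real \<Rightarrow> real"
      and a :: "(real ^ 'n) set \<Rightarrow> real" and I :: "nat \<Rightarrow> real"
    assume \<delta>: "0 < \<delta>" "\<delta> * 2 ^ J0 = 1" and J0: "J0 \<le> k"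
      and um[measurable]: "u \<in> borel_measurable lebesgue" and wm[measurable]: "w \<in> borel_measurable lebesgue" and fm[measurable]: "f \<in> borel_measurable lebesgue"
      and hm[measurable]: "h \<in> borel_measurable lebesgue" and gm[measurable]: "g \<in> borel_measurable lebesgue"
      and nn: "\<And>x. 0 \<le> u x" "\<And>x. 0 \<le> w x" "\<And>x. 0 \<le> h x" "\<And>x. 0 \<le> g x" and f0: "\<And>x. 0 \<le> f x" and fB: "\<And>x. f x \<le> B"
      and fuh: "AE x in lebesgue. f x = u x * h x"
      and hmod: "(\<integral>\<^sup>+y. ennreal (h y powr (1 / \<alpha>p y)) \<partial>lebesgue) \<le> 1" and gmod: "(\<integral>\<^sup>+y. ennreal (g y powr (1 / (1 - \<alpha>q y))) \<partial>lebesgue) \<le> 1"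
      and wfin: "\<And>z l. 0 < l \<Longrightarrow> (\<integral>\<^sup>+y\<in>cube z l. ennreal (w y powr t) \<partial>lebesgue) < \<infinity>"
      and b: "locally_integrable b" and N: "osc_bound 1 a b N" "0 \<le> N"
      and ta: "\<And>Q Q'. Q \<in> cubes \<Longrightarrow> Q' \<in> cubes \<Longrightarrow> Q' \<subseteq> Q \<Longrightarrow> a Q' \<le> tt * a Q" and a0: "\<And>Q. Q \<in> cubes \<Longrightarrow> 0 \<le> a Q"
      and I0: "\<And>i. 0 \<le> I i" and kt0: "\<And>l. 0 \<le> kt l" and IW: "\<And>j. j \<le> k \<Longrightarrow> (\<Sum>i\<le>j. I i) \<le> kt (L * (\<delta> * 2 ^ j))" and \<kappa>: "0 \<le> \<kappa>"
      and cond: "\<And>z l Ap Aq. effective \<alpha>p \<beta>p L z l Ap \<Longrightarrow> effective \<alpha>q \<beta>q L z l Aq \<Longrightarrow> Aq \<le> Ap \<Longrightarrow> 0 < kt l * a (cube z l) ^ m \<Longrightarrow>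
        mean_product_le r t u w z l (kt l * a (cube z l) ^ m * (l ^ ?n) powr (Aq - Ap)) \<kappa>"
    let ?cell = "dcell \<tau> \<delta>"
    interpret T: cell_tree lebesgue ?cell by (rule dcell_tree[OF \<delta>(1)])
    have bm[measurable]: "b \<in> borel_measurable lebesgue" by (rule locally_integrable_measurable[OF b])
    let ?l = "\<lambda>j::nat. \<delta> * 2 ^ j" and ?z = "corner \<tau> \<delta>"
    have side: "0 < ?l j" for j using \<delta> by simp
    have cell: "?cell j x = hb (?z j x) (?l j)" for j x by (rule dcell_eq_hb[OF \<delta>(1)])
    have meas_cell: "measure lebesgue (?cell j x) = ?l j ^ ?n" for j x
      unfolding cell using side[of j] by (intro measure_hb) simp
    have a_pos: "0 \<le> a (cube z l)" if "0 < l" for z l using that by (intro a0 cube_in_cubes)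
    define G0 where "G0 x = w x * g x" for x
    have G0m[measurable]: "G0 \<in> borel_measurable lebesgue" unfolding G0_def by measurable
    have G00: "0 \<le> G0 x" for x using nn by (simp add: G0_def)
    define f\<theta> where "f\<theta> x = f x powr \<theta>" for x
    define g\<theta> where "g\<theta> x = G0 x powr \<theta>" for x
    have [measurable]: "f\<theta> \<in> borel_measurable lebesgue" "g\<theta> \<in> borel_measurable lebesgue" unfolding f\<theta>_def g\<theta>_def by measurable
    have finf: "(\<integral>\<^sup>+y\<in>?cell j x. ennreal (f\<theta> y) \<partial>lebesgue) < \<infinity>" for j x
    proof -
      have "(\<integral>\<^sup>+y\<in>?cell j x. ennreal (f\<theta> y) \<partial>lebesgue) \<le> (\<integral>\<^sup>+y\<in>?cell j x. ennreal (B powr \<theta>) \<partial>lebesgue)"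
        using f0 fB \<theta>(1) by (intro T.cell_integral_mono ennreal_leI) (auto simp: f\<theta>_def intro: powr_mono2)
      also have "\<dots> < \<infinity>" by (subst T.nn_integral_cell_const) auto
      finally show ?thesis .
    qed
    have fing: "(\<integral>\<^sup>+y\<in>?cell j x. ennreal (g\<theta> y) \<partial>lebesgue) < \<infinity>" for j x
    proof -
      let ?V = "?l j ^ ?n"
      have V: "0 < ?V" using side by simp
      have "(\<integral>\<^sup>+y\<in>?cell j x. ennreal (w y powr t) \<partial>lebesgue) < \<infinity>"
        unfolding cell nn_integral_hb_cube by (rule wfin[OF side])
      then obtain W where W: "0 \<le> W" "(\<integral>\<^sup>+y\<in>?cell j x. ennreal (w y powr t) \<partial>lebesgue) = ennreal (W powr t * ?V)"
        by (rule finite_integral_normalized[OF _ V less_imp_neq[OF t0, symmetric]]) blast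
      have "(\<integral>\<^sup>+y\<in>hb (?z j x) (?l j). ennreal (g y powr \<sigma>) \<partial>lebesgue) < \<infinity>"
      proof (rule Q'.integral_lower_power[OF gm nn(4) gmod _ _ side])
        fix y
        have "\<sigma> * (1 - \<alpha>q y) \<le> \<sigma> * (1 - loq)" using \<sigma>0 Q'.bounds(2)[of y] by (intro mult_left_mono) auto
        then have "\<sigma> * (1 - \<alpha>q y) \<le> 1" using \<sigma> by linarith
        then show "\<sigma> \<le> 1 / (1 - \<alpha>q y)" using Q'.alpha_pos[of y] by (simp add: pos_le_divide_eq)
      qed (use \<sigma>0 in auto)
      then obtain A where A: "0 \<le> A" "(\<integral>\<^sup>+y\<in>?cell j x. ennreal (g y powr \<sigma>) \<partial>lebesgue) = ennreal (A powr \<sigma> * ?V)"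
        unfolding cell by (rule finite_integral_normalized[OF _ V less_imp_neq[OF \<sigma>0, symmetric]]) blast
      have "(\<integral>\<^sup>+y\<in>?cell j x. ennreal ((w y * g y) powr \<theta>) \<partial>lebesgue) \<le> ennreal ((W * A) powr \<theta> * ?V)"
        by (rule Holder_product_power[OF _ \<theta>(5-7)]) (use \<theta> nn A W V T.cell_sets in auto)
      then show ?thesis unfolding g\<theta>_def G0_def by (rule le_less_trans) simp
    qed
    define F where "F j x = ave lebesgue f\<theta> (?cell j x) powr (1 / \<theta>)" for j x
    define G where "G j x = ave lebesgue g\<theta> (?cell j x) powr (1 / \<theta>)" for j x
    define X where "X j x = (N * a (enlarge 2 (?cell j x))) ^ m" for j x
    define A where "A j x = a (enlarge L (?cell j x)) ^ m" for j x
    define bq where "bq j x = avg b (?cell j x)" for j x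
    have [measurable]: "F j \<in> borel_measurable lebesgue" "G j \<in> borel_measurable lebesgue" "X j \<in> borel_measurable lebesgue"
      "A j \<in> borel_measurable lebesgue" "bq j \<in> borel_measurable lebesgue" for j
      unfolding F_def G_def X_def A_def bq_def by (rule T.measurable_cell)+
    have nnF: "0 \<le> F j x" "0 \<le> G j x" for j x by (simp_all add: F_def G_def)
    have enl: "enlarge M (?cell j x) = cube (?z j x) (M * ?l j)" for M j x by (simp add: cell enlarge_hb side)
    have X0: "0 \<le> X j x" for j x
      unfolding X_def enl using N(2) side[of j] by (intro zero_le_power mult_nonneg_nonneg a_pos) auto
    have A0: "0 \<le> A j x" for j x
      unfolding A_def enl using side[of j] L by (intro zero_le_power a_pos) auto
    have XA: "X j x \<le> N ^ m * tt ^ m * A j x" for j x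
    proof -
      have "a (cube (?z j x) (2 * ?l j)) \<le> tt * a (cube (?z j x) (L * ?l j))"
      proof (rule ta)
        have "2 * ?l j \<le> L * ?l j" using L side[of j] by (intro mult_right_mono) auto
        then show "cube (?z j x) (2 * ?l j) \<subseteq> cube (?z j x) (L * ?l j)" by (intro cube_subsetI) auto
      qed (use side[of j] L in \<open>auto intro: cube_in_cubes\<close>)
      then have "(N * a (enlarge 2 (?cell j x))) ^ m \<le> (N * (tt * a (enlarge L (?cell j x)))) ^ m"
        unfolding enl using N(2) side[of j] by (intro power_mono mult_left_mono mult_nonneg_nonneg a_pos) auto
      then show ?thesis by (simp add: X_def A_def power_mult_distrib mult_ac)
    qed
    define c where "c = 2 ^ (m + 1) * C1"
    define \<Phi> where "\<Phi> j x = ennreal (G0 x * (2 ^ m * F j x * ?l j ^ ?n * (\<bar>b x - bq j x\<bar> ^ m + C1 * X j x)))" for j x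
    have \<Phi>m[measurable]: "\<Phi> j \<in> borel_measurable lebesgue" for j unfolding \<Phi>_def by measurable
    have cell_bounds:
      "(\<integral>\<^sup>+y\<in>?cell j x. ennreal (\<bar>b v - b y\<bar> ^ m * f y) \<partial>lebesgue) \<le> ennreal (2 ^ m * F j x * ?l j ^ ?n * (\<bar>b v - bq j x\<bar> ^ m + C1 * X j x))"
      "(\<integral>\<^sup>+v\<in>?cell j x. ennreal (G0 v * (2 ^ m * F j x * ?l j ^ ?n * (\<bar>b v - bq j x\<bar> ^ m + C1 * X j x))) \<partial>lebesgue)
        \<le> ennreal (2 ^ (m + 1) * C1 * X j x * F j x * G j x * ?l j ^ ?n * ?l j ^ ?n)" for j x v
    proof -
      have 1: "emeasure lebesgue (?cell j x) \<le> ennreal (?l j ^ ?n)" by (simp only: T.emeasure_cell meas_cell)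
      have 2: "(\<integral>\<^sup>+y\<in>?cell j x. ennreal (f y powr \<theta>) \<partial>lebesgue) \<le> ennreal (F j x powr \<theta> * ?l j ^ ?n)"
        using T.cell_integral_ave[OF finf, of j x] \<theta>(1) ave_nonneg[of lebesgue f\<theta> "?cell j x"]
        by (simp only: meas_cell F_def powr_powr f\<theta>_def[symmetric]) simp
      have 3: "(\<integral>\<^sup>+y\<in>?cell j x. ennreal (G0 y powr \<theta>) \<partial>lebesgue) \<le> ennreal (G j x powr \<theta> * ?l j ^ ?n)"
        using T.cell_integral_ave[OF fing, of j x] \<theta>(1) ave_nonneg[of lebesgue g\<theta> "?cell j x"]
        by (simp only: meas_cell G_def powr_powr g\<theta>_def[symmetric]) simp
      have 4: "(\<integral>\<^sup>+v\<in>?cell j x. ennreal ((\<bar>b v - bq j x\<bar> ^ m) powr (\<theta> / (\<theta> - 1))) \<partial>lebesgue) \<le> ennreal ((C1 * X j x) powr (\<theta> / (\<theta> - 1)) * ?l j ^ ?n)"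
      proof -
        have bq: "bq j x = avg b (cube (?z j x) (?l j))" unfolding bq_def cell using side[of j] bm by (intro avg_hb) auto
        have "(\<integral>\<^sup>+v\<in>?cell j x. ennreal ((\<bar>b v - bq j x\<bar> ^ m) powr \<theta>') \<partial>lebesgue) \<le> ennreal (C0 * X j x powr \<theta>' * ?l j ^ ?n)"
          unfolding bq cell X_def enlarge_hb[OF side] by (rule C0(2)[OF b N ta a0 side])
        also have "\<dots> \<le> ennreal ((C1 * X j x) powr \<theta>' * ?l j ^ ?n)"
        proof (intro ennreal_leI mult_right_mono)
          have "C0 = (C0 powr (1 / \<theta>')) powr \<theta>'" using C0(1) \<theta>' by (simp add: powr_powr)
          also have "\<dots> \<le> C1 powr \<theta>'" using \<theta>' by (intro powr_mono2) (auto simp: C1_def)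
          finally show "C0 * X j x powr \<theta>' \<le> (C1 * X j x) powr \<theta>'" by (simp add: powr_mult mult_right_mono)
        qed (use side[of j] in auto)
        finally show ?thesis unfolding \<theta>'_def .
      qed
      show "(\<integral>\<^sup>+y\<in>?cell j x. ennreal (\<bar>b v - b y\<bar> ^ m * f y) \<partial>lebesgue) \<le> ennreal (2 ^ m * F j x * ?l j ^ ?n * (\<bar>b v - bq j x\<bar> ^ m + C1 * X j x))"
        by (rule cell_commutator_bounds(1)[OF \<theta>(1) bm fm G0m T.cell_sets f0 G00 X0 nnF _ C1 1 2 3 4]) (use side[of j] in simp)
      show "(\<integral>\<^sup>+v\<in>?cell j x. ennreal (G0 v * (2 ^ m * F j x * ?l j ^ ?n * (\<bar>b v - bq j x\<bar> ^ m + C1 * X j x))) \<partial>lebesgue)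
        \<le> ennreal (2 ^ (m + 1) * C1 * X j x * F j x * G j x * ?l j ^ ?n * ?l j ^ ?n)"
        by (rule cell_commutator_bounds(2)[OF \<theta>(1) bm fm G0m T.cell_sets f0 G00 X0 nnF _ C1 1 2 3 4]) (use side[of j] in simp)
    qed
    have const: "F j v = F j x" "G j v = G j x" "X j v = X j x" "A j v = A j x" "bq j v = bq j x" if "v \<in> ?cell j x" for j v x
      using T.cell_eq[OF that] by (simp_all add: F_def G_def X_def A_def bq_def)
    have \<Phi>_int: "(\<integral>\<^sup>+v\<in>?cell k x0. \<Phi> j v \<partial>lebesgue) \<le> (\<integral>\<^sup>+v\<in>?cell k x0. ennreal (c0 * N ^ m * ?l j ^ ?n) * ennreal (A j v * F j v * G j v) \<partial>lebesgue)" if "j \<le> k" for j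
    proof (rule T.descendants_mono[OF _ _ that])
      fix x
      have V: "0 \<le> ?l j ^ ?n" using side[of j] by simp
      have "(\<integral>\<^sup>+v\<in>?cell j x. \<Phi> j v \<partial>lebesgue) = (\<integral>\<^sup>+v\<in>?cell j x. ennreal (G0 v * (2 ^ m * F j x * ?l j ^ ?n * (\<bar>b v - bq j x\<bar> ^ m + C1 * X j x))) \<partial>lebesgue)"
        by (rule T.cell_integral_cong) (simp add: \<Phi>_def const)
      also note cell_bounds(2)
      also have "2 ^ (m + 1) * C1 * X j x * F j x * G j x * ?l j ^ ?n * ?l j ^ ?n \<le> 2 ^ (m + 1) * C1 * (N ^ m * tt ^ m * A j x) * F j x * G j x * ?l j ^ ?n * ?l j ^ ?n"
        using C1 nnF V by (intro mult_right_mono mult_left_mono XA) auto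
      also have "\<dots> = (c0 * N ^ m * ?l j ^ ?n) * (A j x * F j x * G j x) * measure lebesgue (?cell j x)"
        unfolding meas_cell by (simp add: c0_def mult_ac)
      also have "ennreal \<dots> = (\<integral>\<^sup>+v\<in>?cell j x. ennreal ((c0 * N ^ m * ?l j ^ ?n) * (A j x * F j x * G j x)) \<partial>lebesgue)"
        using c0 N(2) V A0 nnF by (intro T.nn_integral_cell_const[symmetric]) auto
      also have "\<dots> = (\<integral>\<^sup>+v\<in>?cell j x. ennreal (c0 * N ^ m * ?l j ^ ?n) * ennreal (A j v * F j v * G j v) \<partial>lebesgue)"
        using c0 N(2) V A0 nnF by (intro T.cell_integral_cong) (simp add: const ennreal_mult')
      finally show "(\<integral>\<^sup>+v\<in>?cell j x. \<Phi> j v \<partial>lebesgue) \<le> (\<integral>\<^sup>+v\<in>?cell j x. ennreal (c0 * N ^ m * ?l j ^ ?n) * ennreal (A j v * F j v * G j v) \<partial>lebesgue)"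
        by (simp add: ennreal_leI)
    qed measurable
    define a' where "a' Q = a (enlarge L Q) ^ m" for Q
    obtain \<Psi> where \<Psi>: "\<Psi> \<in> borel_measurable lebesgue" "(\<integral>\<^sup>+x\<in>?cell k x0. \<Psi> x \<partial>lebesgue) \<le> ennreal (CS * \<kappa>)"
      "\<And>j x. j \<le> k \<Longrightarrow> ennreal (kt (L * ?l j) * a (cube (?z j x) (L * ?l j)) ^ m *
          ave lebesgue (\<lambda>y. f y powr \<theta>) (?cell j x) powr (1 / \<theta>) *
          ave lebesgue (\<lambda>y. (w y * g y) powr \<theta>) (?cell j x) powr (1 / \<theta>)) \<le> \<Psi> x"
      using CS(2)[OF \<delta> J0 um wm fm hm gm nn fuh hmod gmod \<kappa>, of "\<lambda>z l. kt l * a (cube z l) ^ m" \<tau> x0] cond kt0 a_pos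
      by (auto intro: mult_nonneg_nonneg)
    have sparse: "(\<integral>\<^sup>+x\<in>?cell k x0. ennreal (\<Sum>i\<le>k. I i * a' (?cell i x) * ave lebesgue f\<theta> (?cell i x) powr (1 / \<theta>) * ave lebesgue g\<theta> (?cell i x) powr (1 / \<theta>)) \<partial>lebesgue)
      \<le> ennreal (2 * 2 powr (1 / \<theta>) * tt ^ m) * (\<integral>\<^sup>+x\<in>?cell k x0. \<Psi> x \<partial>lebesgue)"
    proof (rule T.sparse_bound[where W = "\<lambda>j. kt (L * ?l j)"])
      show "0 \<le> a' (?cell j x)" for j x using A0[of j x] by (simp add: A_def a'_def)
      show "a' (?cell i x) \<le> tt ^ m * a' (?cell j x)" if "i \<le> j" "j \<le> k" for i j x
      proof -
        have "a (enlarge L (?cell i x)) \<le> tt * a (enlarge L (?cell j x))"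
        proof (rule ta)
          show "enlarge L (?cell i x) \<subseteq> enlarge L (?cell j x)" by (rule enlarge_dcell_mono[OF \<delta>(1) L1 that(1)])
        qed (use side L in \<open>auto simp: enl intro!: cube_in_cubes\<close>)
        then have "a (enlarge L (?cell i x)) ^ m \<le> (tt * a (enlarge L (?cell j x))) ^ m"
          using side L by (intro power_mono) (auto simp: enl intro!: a_pos)
        then show ?thesis by (simp add: a'_def power_mult_distrib)
      qed
      show "ennreal (kt (L * ?l j) * a' (?cell j y) * ave lebesgue f\<theta> (?cell j y) powr (1 / \<theta>) * ave lebesgue g\<theta> (?cell j y) powr (1 / \<theta>)) \<le> \<Psi> y" if "j \<le> k" for j y
        using \<Psi>(3)[OF that, of y] by (simp add: a'_def enl f\<theta>_def[abs_def] g\<theta>_def[abs_def] G0_def)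
    qed (use \<theta>(1) tt finf fing I0 IW \<Psi>(1) in auto)
    have pt: "ennreal (w x * g x) * (\<Sum>i\<le>k. ennreal (I i / ?l i ^ ?n) * (\<integral>\<^sup>+y\<in>?cell i x. ennreal (\<bar>b x - b y\<bar> ^ m * f y) \<partial>lebesgue))
      \<le> (\<Sum>i\<le>k. ennreal (I i / ?l i ^ ?n) * \<Phi> i x)" for x
    proof -
      have "ennreal (G0 x) * (\<integral>\<^sup>+y\<in>?cell i x. ennreal (\<bar>b x - b y\<bar> ^ m * f y) \<partial>lebesgue) \<le> \<Phi> i x" for i
        unfolding \<Phi>_def ennreal_mult'[OF G00] by (intro mult_left_mono cell_bounds(1)) simp
      then have "(\<Sum>i\<le>k. ennreal (I i / ?l i ^ ?n) * (ennreal (G0 x) * (\<integral>\<^sup>+y\<in>?cell i x. ennreal (\<bar>b x - b y\<bar> ^ m * f y) \<partial>lebesgue))) \<le> (\<Sum>i\<le>k. ennreal (I i / ?l i ^ ?n) * \<Phi> i x)"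
        by (intro sum_mono mult_left_mono) auto
      then show ?thesis by (simp add: sum_distrib_left G0_def mult_ac)
    qed
    have "(\<integral>\<^sup>+x\<in>?cell k x0. (\<Sum>i\<le>k. ennreal (I i / ?l i ^ ?n) * \<Phi> i x) \<partial>lebesgue) = (\<Sum>i\<le>k. ennreal (I i / ?l i ^ ?n) * (\<integral>\<^sup>+x\<in>?cell k x0. \<Phi> i x \<partial>lebesgue))"
      by (simp add: sum_distrib_right mult.assoc nn_integral_sum nn_integral_cmult)
    also have "\<dots> \<le> (\<Sum>i\<le>k. ennreal (I i / ?l i ^ ?n) * (\<integral>\<^sup>+v\<in>?cell k x0. ennreal (c0 * N ^ m * ?l i ^ ?n) * ennreal (A i v * F i v * G i v) \<partial>lebesgue))"
      by (intro sum_mono mult_left_mono \<Phi>_int) auto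
    also have "\<dots> = (\<Sum>i\<le>k. \<integral>\<^sup>+v. ennreal (c0 * N ^ m) * (ennreal (I i * A i v * F i v * G i v) * indicator (?cell k x0) v) \<partial>lebesgue)"
    proof (intro sum.cong refl)
      fix i
      have eq: "ennreal (I i / ?l i ^ ?n) * (ennreal (c0 * N ^ m * ?l i ^ ?n) * ennreal y) = ennreal (c0 * N ^ m) * ennreal (I i * y)" if "0 \<le> y" for y
      proof -
        have "ennreal (I i / ?l i ^ ?n) * (ennreal (c0 * N ^ m * ?l i ^ ?n) * ennreal y) = ennreal (I i / ?l i ^ ?n * (c0 * N ^ m * ?l i ^ ?n * y))"
          using that I0[of i] side[of i] c0 N(2) by (simp flip: ennreal_mult)
        also have "I i / ?l i ^ ?n * (c0 * N ^ m * ?l i ^ ?n * y) = c0 * N ^ m * (I i * y)" using \<delta>(1) by (simp add: field_simps)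
        finally show ?thesis using that I0[of i] c0 N(2) by (simp flip: ennreal_mult)
      qed
      have "ennreal (I i / ?l i ^ ?n) * (\<integral>\<^sup>+v\<in>?cell k x0. ennreal (c0 * N ^ m * ?l i ^ ?n) * ennreal (A i v * F i v * G i v) \<partial>lebesgue)
        = (\<integral>\<^sup>+v. ennreal (I i / ?l i ^ ?n) * (ennreal (c0 * N ^ m * ?l i ^ ?n) * ennreal (A i v * F i v * G i v)) * indicator (?cell k x0) v \<partial>lebesgue)"
        by (subst nn_integral_cmult[symmetric]) (auto simp: mult.assoc)
      also have "\<dots> = (\<integral>\<^sup>+v. ennreal (c0 * N ^ m) * (ennreal (I i * A i v * F i v * G i v) * indicator (?cell k x0) v) \<partial>lebesgue)"
      proof (rule nn_integral_cong)
        fix v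
        have "0 \<le> A i v * F i v * G i v" using A0 nnF by simp
        from eq[OF this] show "ennreal (I i / ?l i ^ ?n) * (ennreal (c0 * N ^ m * ?l i ^ ?n) * ennreal (A i v * F i v * G i v)) * indicator (?cell k x0) v
          = ennreal (c0 * N ^ m) * (ennreal (I i * A i v * F i v * G i v) * indicator (?cell k x0) v)"
          by (simp only: mult.assoc[symmetric])
      qed
      finally show "ennreal (I i / ?l i ^ ?n) * (\<integral>\<^sup>+v\<in>?cell k x0. ennreal (c0 * N ^ m * ?l i ^ ?n) * ennreal (A i v * F i v * G i v) \<partial>lebesgue)
        = (\<integral>\<^sup>+v. ennreal (c0 * N ^ m) * (ennreal (I i * A i v * F i v * G i v) * indicator (?cell k x0) v) \<partial>lebesgue)" .
    qed
    also have "\<dots> = ennreal (c0 * N ^ m) * (\<integral>\<^sup>+v\<in>?cell k x0. (\<Sum>i\<le>k. ennreal (I i * A i v * F i v * G i v)) \<partial>lebesgue)"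
      by (subst nn_integral_sum[symmetric]) (auto simp: sum_distrib_left[symmetric] sum_distrib_right nn_integral_cmult)
    also have "(\<integral>\<^sup>+v\<in>?cell k x0. (\<Sum>i\<le>k. ennreal (I i * A i v * F i v * G i v)) \<partial>lebesgue) = (\<integral>\<^sup>+x\<in>?cell k x0. ennreal (\<Sum>i\<le>k. I i * a' (?cell i x) * ave lebesgue f\<theta> (?cell i x) powr (1 / \<theta>) * ave lebesgue g\<theta> (?cell i x) powr (1 / \<theta>)) \<partial>lebesgue)"
      using I0 A0 nnF by (intro T.cell_integral_cong) (simp add: A_def a'_def F_def G_def sum_ennreal)
    also note sparse
    also have "ennreal (2 * 2 powr (1 / \<theta>) * tt ^ m) * (\<integral>\<^sup>+x\<in>?cell k x0. \<Psi> x \<partial>lebesgue) \<le> ennreal cs * ennreal (CS * \<kappa>)"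
      unfolding cs_def by (intro mult_left_mono \<Psi>(2)) auto
    also have "ennreal (c0 * N ^ m) * (ennreal cs * ennreal (CS * \<kappa>)) = ennreal (c0 * cs * CS * \<kappa> * N ^ m)"
      using c0 cs CS(1) \<kappa> N(2) by (simp flip: ennreal_mult add: mult_ac)
    finally have int: "(\<integral>\<^sup>+x\<in>?cell k x0. (\<Sum>i\<le>k. ennreal (I i / ?l i ^ ?n) * \<Phi> i x) \<partial>lebesgue) \<le> ennreal (c0 * cs * CS * \<kappa> * N ^ m)"
      by (simp add: mult_left_mono)
    show "\<exists>\<Phi>. \<Phi> \<in> borel_measurable lebesgue \<and> (\<integral>\<^sup>+x\<in>?cell k x0. \<Phi> x \<partial>lebesgue) \<le> ennreal (c0 * cs * CS * \<kappa> * N ^ m) \<and>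
       (\<forall>x. ennreal (w x * g x) * (\<Sum>i\<le>k. ennreal (I i / ?l i ^ ?n) * (\<integral>\<^sup>+y\<in>?cell i x. ennreal (\<bar>b x - b y\<bar> ^ m * f y) \<partial>lebesgue)) \<le> \<Phi> x)"
      by (rule exI[of _ "\<lambda>x. \<Sum>i\<le>k. ennreal (I i / ?l i ^ ?n) * \<Phi> i x"], intro conjI int allI pt) measurable
  qed
qed

section \<open>Kernels on dyadic annuli\<close>

definition annulus :: "real \<Rightarrow> real \<Rightarrow> real \<Rightarrow> (real ^ 'n) set"
  where "annulus \<eta> \<epsilon> \<rho> = {y. \<eta> * (1 - \<epsilon>) * \<rho> < norm y \<and> norm y \<le> 2 * \<eta> * (1 + \<epsilon>) * \<rho>}"

lemma annulus_sets [measurable]: "annulus \<eta> \<epsilon> \<rho> \<in> sets lebesgue"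
proof -
  have "{y \<in> space borel. \<eta> * (1 - \<epsilon>) * \<rho> < norm y \<and> norm y \<le> 2 * \<eta> * (1 + \<epsilon>) * \<rho>} \<in> sets borel" by measurable
  then show ?thesis by (simp add: annulus_def)
qed

lemma annulus_subset: "annulus \<eta> \<epsilon> \<rho> \<subseteq> cball 0 (2 * \<eta> * (1 + \<epsilon>) * \<rho>)"
  by (auto simp: annulus_def)

lemma kernel_class_bound:
  fixes K :: "real ^ 'n \<Rightarrow> real"
  assumes "K \<in> kernel_class"
  obtains \<eta> c \<epsilon> where "0 < \<eta>" "0 < c" "0 \<le> \<epsilon>" "\<epsilon> < 1" "\<And>x. 0 \<le> K x" "locally_integrable K"
    "\<And>(k::int) x. 2 powi k < norm x \<Longrightarrow> norm x \<le> 2 powi (k + 1) \<Longrightarrow>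
       K x \<le> c / (2 powi k) ^ CARD('n) * (LINT y:annulus \<eta> \<epsilon> (2 powi k)|lebesgue. K y)"
proof -
  from assms obtain \<eta> c \<epsilon> where K: "\<And>x. 0 \<le> K x" "locally_integrable K" and e: "0 < \<eta>" "0 < c" "0 \<le> \<epsilon>" "\<epsilon> < 1"
    and S: "\<And>k::int. (SUP x\<in>{x. 2 powi k < norm x \<and> norm x \<le> 2 powi (k + 1)}. ennreal (K x)) \<le>
        ennreal (c / (2 powi k) ^ CARD('n) * (LINT y:annulus \<eta> \<epsilon> (2 powi k)|lebesgue. K y))"
    unfolding kernel_class_def annulus_def by blast
  show thesis
  proof (rule that[OF e K])
    fix k :: int and x :: "real ^ 'n" assume x: "2 powi k < norm x" "norm x \<le> 2 powi (k + 1)"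
    have "ennreal (K x) \<le> ennreal (c / (2 powi k) ^ CARD('n) * (LINT y:annulus \<eta> \<epsilon> (2 powi k)|lebesgue. K y))"
      using x by (intro order_trans[OF SUP_upper S]) auto
    moreover have "0 \<le> (LINT y:annulus \<eta> \<epsilon> (2 powi k)|lebesgue. K y)"
      unfolding set_lebesgue_integral_def using K by (intro Bochner_Integration.integral_nonneg) auto
    then have "0 \<le> c / (2 powi k) ^ CARD('n) * (LINT y:annulus \<eta> \<epsilon> (2 powi k)|lebesgue. K y)"
      using e by (intro mult_nonneg_nonneg) auto
    ultimately show "K x \<le> c / (2 powi k) ^ CARD('n) * (LINT y:annulus \<eta> \<epsilon> (2 powi k)|lebesgue. K y)"
      by (simp only: ennreal_le_iff)
  qed
qed

lemma Ktilde_nonneg: "(\<And>x. 0 \<le> K x) \<Longrightarrow> 0 \<le> Ktilde K t"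
  unfolding Ktilde_def set_lebesgue_integral_def by (intro Bochner_Integration.integral_nonneg) auto

lemma cball_norm: "{z. norm z \<le> t} = cball 0 t"
  by auto

lemma Ktilde_mono:
  fixes K :: "real ^ 'n \<Rightarrow> real"
  assumes "\<And>x. 0 \<le> K x" "locally_integrable K" "s \<le> t"
  shows "Ktilde K s \<le> Ktilde K t"
proof -
  have int: "integrable lebesgue (\<lambda>x. indicator (cball 0 u) x *\<^sub>R K x)" for u
    using assms(2) compact_cball unfolding locally_integrable_def set_integrable_def by blast
  show ?thesis
    unfolding Ktilde_def set_lebesgue_integral_def cball_norm
    by (rule integral_mono[OF int int]) (use assms in \<open>auto simp: indicator_def\<close>)
qed

text \<open>
  A point lies in at most \<open>N + 1\<close> of the annuli, since the ratio of their outer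
  and inner radii is \<open>2 * (1 + \<epsilon>) / (1 - \<epsilon>) \<le> 4 / (1 -
  \<epsilon>) < 2 ^ N\<close>.
\<close>

lemma annuli_sum:
  fixes K :: "real ^ 'n \<Rightarrow> real"
  assumes K: "\<And>x. 0 \<le> K x" "locally_integrable K" and e: "0 < \<eta>" "0 \<le> \<epsilon>" "\<epsilon> < 1"
  obtains M where "0 < M" "\<And>\<rho> j. 0 < \<rho> \<Longrightarrow> (\<Sum>i\<le>j. LINT y:annulus \<eta> \<epsilon> (\<rho> * 2 ^ i)|lebesgue. K y) \<le> M * Ktilde K (4 * \<eta> * \<rho> * 2 ^ j)"
proof -
  obtain N :: nat where N: "4 / (1 - \<epsilon>) < 2 ^ N" using real_arch_pow[of 2 "4 / (1 - \<epsilon>)"] by auto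
  show thesis
  proof (rule that[of "real N + 1"])
    fix \<rho> :: real and j :: nat assume \<rho>: "0 < \<rho>"
    let ?A = "\<lambda>i. annulus \<eta> \<epsilon> (\<rho> * 2 ^ i) :: (real ^ 'n) set" and ?B = "cball 0 (4 * \<eta> * \<rho> * 2 ^ j) :: (real ^ 'n) set"
    have AB: "?A i \<subseteq> ?B" if "i \<le> j" for i
    proof -
      have "2 * \<eta> * (1 + \<epsilon>) * (\<rho> * 2 ^ i) \<le> 2 * \<eta> * 2 * (\<rho> * 2 ^ j)"
        using e \<rho> that by (intro mult_mono mult_nonneg_nonneg power_increasing) auto
      then show ?thesis using annulus_subset[of \<eta> \<epsilon> "\<rho> * 2 ^ i"] by (auto simp: mult_ac)
    qed
    have intB: "integrable lebesgue (\<lambda>y. indicator ?B y *\<^sub>R K y)"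
      using K(2) compact_cball unfolding locally_integrable_def set_integrable_def by blast
    have intA: "integrable lebesgue (\<lambda>y. indicator (?A i) y *\<^sub>R K y)" if "i \<le> j" for i
      using locally_integrable_subset[OF K(2) compact_cball AB[OF that] annulus_sets] unfolding set_integrable_def .
    have count: "(\<Sum>i\<le>j. indicator (?A i) y *\<^sub>R K y) \<le> (real N + 1) * (indicator ?B y *\<^sub>R K y)" for y
    proof (cases "y \<in> ?B")
      case False
      then have "y \<notin> ?A i" if "i \<le> j" for i using AB[OF that] by auto
      then show ?thesis using False by simp
    next
      case True
      define T where "T = {i. i \<le> j \<and> y \<in> ?A i}"
      have finT: "finite T" by (rule finite_subset[of _ "{..j}"]) (auto simp: T_def)
      have "card T \<le> N + 1"
      proof (cases "T = {}")
        case False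
        define i0 where "i0 = Min T"
        have i0: "i0 \<in> T" using finT False by (simp add: i0_def)
        have "T \<subseteq> {i0..i0 + N}"
        proof
          fix i assume i: "i \<in> T"
          have "i0 \<le> i" using finT i by (simp add: i0_def)
          have "\<eta> * (1 - \<epsilon>) * (\<rho> * 2 ^ i) < norm y" "norm y \<le> 2 * \<eta> * (1 + \<epsilon>) * (\<rho> * 2 ^ i0)"
            using i i0 by (auto simp: T_def annulus_def)
          then have "\<eta> * (1 - \<epsilon>) * (\<rho> * 2 ^ i) < 2 * \<eta> * (1 + \<epsilon>) * (\<rho> * 2 ^ i0)" by linarith
          also have "2 ^ i = (2::real) ^ i0 * 2 ^ (i - i0)" using \<open>i0 \<le> i\<close> by (simp flip: power_add)
          finally have "(\<eta> * \<rho> * 2 ^ i0) * ((1 - \<epsilon>) * 2 ^ (i - i0)) < (\<eta> * \<rho> * 2 ^ i0) * (2 * (1 + \<epsilon>))" by (simp add: mult_ac)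
          then have "(1 - \<epsilon>) * 2 ^ (i - i0) < 2 * (1 + \<epsilon>)" using e \<rho> by (simp add: mult_less_cancel_left_pos)
          also have "\<dots> \<le> 4" using e by simp
          finally have "2 ^ (i - i0) < 4 / (1 - \<epsilon>)" using e by (simp add: field_simps)
          then have "(2::real) ^ (i - i0) < 2 ^ N" using N by linarith
          then have "i - i0 < N" by simp
          then show "i \<in> {i0..i0 + N}" using \<open>i0 \<le> i\<close> by auto
        qed
        then have "card T \<le> card {i0..i0 + N}" by (intro card_mono) auto
        then show ?thesis by simp
      qed simp
      moreover have "(\<Sum>i\<le>j. indicator (?A i) y *\<^sub>R K y) = real (card T) * K y"
      proof -
        have "(\<Sum>i\<le>j. indicator (?A i) y *\<^sub>R K y) = (\<Sum>i\<in>T. K y)"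
          by (rule sum.mono_neutral_cong_right) (auto simp: T_def indicator_def)
        then show ?thesis by simp
      qed
      ultimately show ?thesis
        using True mult_right_mono[of "real (card T)" "real N + 1" "K y"] K(1)[of y] by (simp only: indicator_simps(1)) simp
    qed
    have "(\<Sum>i\<le>j. LINT y:?A i|lebesgue. K y) = (\<integral>y. (\<Sum>i\<le>j. indicator (?A i) y *\<^sub>R K y) \<partial>lebesgue)"
      unfolding set_lebesgue_integral_def by (rule Bochner_Integration.integral_sum[symmetric]) (use intA in auto)
    also have "\<dots> \<le> (\<integral>y. (real N + 1) * (indicator ?B y *\<^sub>R K y) \<partial>lebesgue)"
    proof (rule integral_mono)
      show "integrable lebesgue (\<lambda>y. \<Sum>i\<le>j. indicator (?A i) y *\<^sub>R K y)"
        by (intro Bochner_Integration.integrable_sum intA) simp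
      show "integrable lebesgue (\<lambda>y. (real N + 1) * (indicator ?B y *\<^sub>R K y))"
        by (intro integrable_mult_right intB)
    qed (rule count)
    also have "\<dots> = (real N + 1) * Ktilde K (4 * \<eta> * \<rho> * 2 ^ j)"
      unfolding Ktilde_def set_lebesgue_integral_def cball_norm by (rule integral_mult_right_zero)
    finally show "(\<Sum>i\<le>j. LINT y:?A i|lebesgue. K y) \<le> (real N + 1) * Ktilde K (4 * \<eta> * \<rho> * 2 ^ j)" .
  qed simp
qed

text \<open>
  For each \<open>y\<close> in the range, take the least \<open>i\<close> with \<open>norm
  (x - y) \<le> \<delta> * 2 ^ i / 4\<close>. Then \<open>x\<close> and \<open>y\<close>
  share a cell of generation \<open>i\<close> in one of the shifted grids, and the
  corresponding term alone dominates the kernel.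
\<close>

lemma kernel_grid_bound:
  fixes K :: "real ^ 'n \<Rightarrow> real" and I :: "nat \<Rightarrow> real"
  assumes \<delta>: "0 < \<delta>"
    and KB: "\<And>i z. i \<le> k \<Longrightarrow> \<delta> * 2 ^ i / 8 < norm z \<Longrightarrow> norm z \<le> \<delta> * 2 ^ i / 4 \<Longrightarrow> K z \<le> I i / (\<delta> * 2 ^ i) ^ CARD('n)"
    and [measurable]: "\<phi> \<in> borel_measurable lebesgue"
  shows "(\<integral>\<^sup>+y. ennreal (K (x - y)) * \<phi> y * indicator {y. \<delta> / 8 < norm (x - y) \<and> norm (x - y) \<le> \<delta> * 2 ^ k / 4} y \<partial>lebesgue)
    \<le> (\<Sum>e\<in>(UNIV :: ('n \<Rightarrow> bool) set). \<Sum>i\<le>k. ennreal (I i / (\<delta> * 2 ^ i) ^ CARD('n)) * (\<integral>\<^sup>+y\<in>dcell (shift (\<delta> * 2 ^ k) e) \<delta> i x. \<phi> y \<partial>lebesgue))"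
proof -
  let ?c = "\<lambda>i. ennreal (I i / (\<delta> * 2 ^ i) ^ CARD('n))" and ?Q = "\<lambda>e i. dcell (shift (\<delta> * 2 ^ k) e) \<delta> i x"
  have Qm[measurable]: "?Q e i \<in> sets lebesgue" for e i by (simp add: dcell_eq_hb[OF \<delta>] del: borel_measurable_indicator_iff)
  have pt: "ennreal (K (x - y)) * \<phi> y * indicator {y. \<delta> / 8 < norm (x - y) \<and> norm (x - y) \<le> \<delta> * 2 ^ k / 4} y
    \<le> (\<Sum>e\<in>UNIV. \<Sum>i\<le>k. ?c i * (\<phi> y * indicator (?Q e i) y))" for y
  proof (cases "\<delta> / 8 < norm (x - y) \<and> norm (x - y) \<le> \<delta> * 2 ^ k / 4")
    case True
    define i where "i = (LEAST i. norm (x - y) \<le> \<delta> * 2 ^ i / 4)"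
    have i: "norm (x - y) \<le> \<delta> * 2 ^ i / 4" unfolding i_def by (rule LeastI[of _ k]) (use True in simp)
    have ik: "i \<le> k" unfolding i_def by (rule Least_le) (use True in simp)
    have low: "\<delta> * 2 ^ i / 8 < norm (x - y)"
    proof (cases i)
      case 0 then show ?thesis using True by simp
    next
      case (Suc i')
      then have "\<not> norm (x - y) \<le> \<delta> * 2 ^ i' / 4" using not_less_Least[of i' "\<lambda>i. norm (x - y) \<le> \<delta> * 2 ^ i / 4"] by (simp add: i_def)
      then show ?thesis using Suc by simp
    qed
    have "\<bar>x $ c - y $ c\<bar> < \<delta> * 2 ^ i / 3" for c
    proof -
      have "\<bar>x $ c - y $ c\<bar> \<le> norm (x - y)" using component_le_norm_cart[of "x - y" c] by simp
      also have "\<dots> \<le> \<delta> * 2 ^ i / 4" by (rule i)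
      also have "\<dots> < \<delta> * 2 ^ i / 3" using \<delta> by simp
      finally show ?thesis .
    qed
    from common_dcell[OF \<delta> ik this] obtain e where e: "y \<in> ?Q e i" by blast
    have "ennreal (K (x - y)) * \<phi> y \<le> ?c i * \<phi> y"
      by (intro mult_right_mono ennreal_leI KB ik low i) simp
    also have "\<dots> = ?c i * (\<phi> y * indicator (?Q e i) y)" using e by simp
    also have "\<dots> \<le> (\<Sum>i\<le>k. ?c i * (\<phi> y * indicator (?Q e i) y))"
      using ik by (intro member_le_sum) auto
    also have "\<dots> \<le> (\<Sum>e\<in>UNIV. \<Sum>i\<le>k. ?c i * (\<phi> y * indicator (?Q e i) y))"
      by (rule member_le_sum[of e UNIV "\<lambda>e. \<Sum>i\<le>k. ?c i * (\<phi> y * indicator (?Q e i) y)"]) auto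
    finally show ?thesis using True by simp
  qed simp
  have "(\<integral>\<^sup>+y. ennreal (K (x - y)) * \<phi> y * indicator {y. \<delta> / 8 < norm (x - y) \<and> norm (x - y) \<le> \<delta> * 2 ^ k / 4} y \<partial>lebesgue)
    \<le> (\<integral>\<^sup>+y. (\<Sum>e\<in>UNIV. \<Sum>i\<le>k. ?c i * (\<phi> y * indicator (?Q e i) y)) \<partial>lebesgue)"
    by (rule nn_integral_mono) (rule pt)
  also have "\<dots> = (\<Sum>e\<in>UNIV. \<Sum>i\<le>k. ?c i * (\<integral>\<^sup>+y\<in>?Q e i. \<phi> y \<partial>lebesgue))"
    by (simp add: nn_integral_sum nn_integral_cmult)
  finally show ?thesis .
qed

section \<open>Duality and measurability\<close>

text \<open>
  Finiteness follows by testing with a positive \<open>g\<close>. For the modular, truncate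
  \<open>F\<close>, so that its modular \<open>I\<close> is finite, and test with the
  extremal function of Hoelder's inequality, normalised pointwise by \<open>I powr (- (1 -
  \<alpha> x))\<close>. If \<open>I > 1\<close>, this gives \<open>D * I powr lo \<le>
  D\<close>, a contradiction.
\<close>

lemma (in lh_exp) modular_by_duality:
  fixes F :: "real ^ 'n \<Rightarrow> ennreal"
  assumes hi1: "hi < 1" and Fm[measurable]: "F \<in> borel_measurable lebesgue" and D: "0 < D"
    and dual: "\<And>g. g \<in> borel_measurable lebesgue \<Longrightarrow> (\<And>x. 0 \<le> g x) \<Longrightarrow>
      (\<integral>\<^sup>+x. ennreal (g x powr (1 / (1 - \<alpha> x))) \<partial>lebesgue) \<le> 1 \<Longrightarrow> (\<integral>\<^sup>+x. F x * ennreal (g x) \<partial>lebesgue) \<le> ennreal D"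
  shows "AE x in lebesgue. F x < \<infinity>" "(\<integral>\<^sup>+x. ennreal ((enn2real (F x) / D) powr (1 / \<alpha> x)) \<partial>lebesgue) \<le> 1"
proof -
  have a1: "\<alpha> x < 1" for x using bounds(2)[of x] hi1 by linarith
  define Dn :: real where "Dn = 2 ^ (2 * CARD('n) + 2)"
  have Dn: "0 < Dn" by (simp add: Dn_def)
  show fin: "AE x in lebesgue. F x < \<infinity>"
  proof -
    define g where "g x = (decay x / Dn) powr (1 - \<alpha> x)" for x
    have [measurable]: "g \<in> borel_measurable lebesgue" unfolding g_def by measurable
    have gpos: "0 < g x" for x
    proof -
      have "0 < exp 1 + norm x" by (simp add: add_pos_nonneg)
      then show ?thesis using Dn by (simp add: g_def decay_def)
    qed
    have "(\<integral>\<^sup>+x. F x * ennreal (g x) \<partial>lebesgue) \<le> ennreal D"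
    proof (rule dual)
      have "(\<integral>\<^sup>+x. ennreal (g x powr (1 / (1 - \<alpha> x))) \<partial>lebesgue) = (\<integral>\<^sup>+x. ennreal (1 / Dn) * ennreal (decay (x :: real ^ 'n)) \<partial>lebesgue)"
      proof (rule nn_integral_cong)
        fix x
        have "1 - \<alpha> x \<noteq> 0" using a1[of x] by simp
        then show "ennreal (g x powr (1 / (1 - \<alpha> x))) = ennreal (1 / Dn) * ennreal (decay x)"
          using Dn decay_nonneg[of x] by (simp add: g_def powr_powr flip: ennreal_mult)
      qed
      also have "\<dots> = ennreal (1 / Dn) * (\<integral>\<^sup>+x. ennreal (decay (x :: real ^ 'n)) \<partial>lebesgue)" by (rule nn_integral_cmult) measurable
      also have "\<dots> \<le> ennreal (1 / Dn) * ennreal Dn" unfolding Dn_def by (intro mult_left_mono decay_integral) auto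
      also have "\<dots> = 1" using Dn by (simp flip: ennreal_mult)
      finally show "(\<integral>\<^sup>+x. ennreal (g x powr (1 / (1 - \<alpha> x))) \<partial>lebesgue) \<le> 1" .
    qed (use gpos in \<open>auto simp: less_imp_le\<close>)
    then have "(\<integral>\<^sup>+x. F x * ennreal (g x) \<partial>lebesgue) \<noteq> \<infinity>" by (auto simp: top_unique)
    then have "AE x in lebesgue. F x * ennreal (g x) \<noteq> \<infinity>" by (intro nn_integral_noteq_infinite) measurable
    then show ?thesis
      by eventually_elim (use gpos in \<open>auto simp: ennreal_mult_eq_top_iff less_top ennreal_eq_0_iff not_le\<close>)
  qed
  define R where "R x = enn2real (F x)" for x
  have Rm[measurable]: "R \<in> borel_measurable lebesgue" unfolding R_def by measurable
  have R0: "0 \<le> R x" for x by (simp add: R_def)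
  have RF: "ennreal (R x) \<le> F x" for x unfolding R_def by (cases "F x") auto
  define \<phi> where "\<phi> N x = min (R x) (real N) * indicator (cball 0 (real N)) x" for N :: nat and x
  have [measurable]: "cball (0 :: real ^ 'n) (real N) \<in> sets lebesgue" for N :: nat by simp
  have \<phi>m[measurable]: "\<phi> N \<in> borel_measurable lebesgue" for N unfolding \<phi>_def by measurable
  have \<phi>0: "0 \<le> \<phi> N x" "\<phi> N x \<le> R x" for N x using R0[of x] by (auto simp: \<phi>_def indicator_def)
  let ?u = "\<lambda>N x. (\<phi> N x / D) powr (1 / \<alpha> x)"
  have bound: "(\<integral>\<^sup>+x. ennreal (?u N x) \<partial>lebesgue) \<le> 1" for N
  proof -
    define B where "B = max 1 (real N / D) powr (1 / lo)"
    have "(\<integral>\<^sup>+x. ennreal (?u N x) \<partial>lebesgue) \<le> (\<integral>\<^sup>+x. ennreal B * indicator (cball (0 :: real ^ 'n) (real N)) x \<partial>lebesgue)"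
    proof (rule nn_integral_mono)
      fix x
      show "ennreal (?u N x) \<le> ennreal B * indicator (cball 0 (real N)) x"
      proof (cases "x \<in> cball 0 (real N)")
        case True
        have "?u N x \<le> max 1 (real N / D) powr (1 / \<alpha> x)"
          using \<phi>0(1)[of N x] D alpha_pos[of x] True
          by (intro powr_mono2) (auto simp: \<phi>_def intro!: max.coboundedI2 divide_right_mono)
        also have "\<dots> \<le> B" unfolding B_def using bounds(1)[of x] lo by (intro powr_mono) (auto intro: frac_le)
        finally show ?thesis using True by (simp add: ennreal_leI)
      qed (simp add: \<phi>_def)
    qed
    also have "\<dots> = ennreal B * emeasure lebesgue (cball (0 :: real ^ 'n) (real N))" by (rule nn_integral_cmult_indicator) auto
    also have "\<dots> < \<infinity>" using emeasure_lborel_cball_finite[of "0 :: real ^ 'n" "real N"] by (simp add: ennreal_mult_less_top)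
    finally obtain I where I: "(\<integral>\<^sup>+x. ennreal (?u N x) \<partial>lebesgue) = ennreal I" "0 \<le> I"
      by (cases "\<integral>\<^sup>+x. ennreal (?u N x) \<partial>lebesgue") auto
    have "I \<le> 1"
    proof (rule ccontr)
      assume "\<not> I \<le> 1"
      then have I1: "1 < I" by simp
      define g where "g x = (\<phi> N x / D) powr (1 / \<alpha> x - 1) * I powr (- (1 - \<alpha> x))" for x
      have gm[measurable]: "g \<in> borel_measurable lebesgue" unfolding g_def by measurable
      have "(\<integral>\<^sup>+x. F x * ennreal (g x) \<partial>lebesgue) \<le> ennreal D"
      proof (rule dual)
        have "(\<integral>\<^sup>+x. ennreal (g x powr (1 / (1 - \<alpha> x))) \<partial>lebesgue) = (\<integral>\<^sup>+x. ennreal (1 / I) * ennreal (?u N x) \<partial>lebesgue)"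
        proof (rule nn_integral_cong)
          fix x
          have e: "(1 / \<alpha> x - 1) * (1 / (1 - \<alpha> x)) = 1 / \<alpha> x" "- (1 - \<alpha> x) * (1 / (1 - \<alpha> x)) = - 1"
            using a1[of x] alpha_pos[of x] by (simp_all add: field_simps)
          have "g x powr (1 / (1 - \<alpha> x)) = ?u N x * I powr (- 1)"
            unfolding g_def powr_mult powr_powr e ..
          then show "ennreal (g x powr (1 / (1 - \<alpha> x))) = ennreal (1 / I) * ennreal (?u N x)"
            using I1 by (simp add: powr_minus_divide flip: ennreal_mult)
        qed
        also have "\<dots> = ennreal (1 / I) * ennreal I" unfolding I(1)[symmetric] by (rule nn_integral_cmult) measurable
        also have "\<dots> = 1" using I1 by (simp flip: ennreal_mult)
        finally show "(\<integral>\<^sup>+x. ennreal (g x powr (1 / (1 - \<alpha> x))) \<partial>lebesgue) \<le> 1" by simp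
      qed (auto simp: g_def)
      moreover have "ennreal (D * I powr (lo - 1)) * ennreal I \<le> (\<integral>\<^sup>+x. F x * ennreal (g x) \<partial>lebesgue)"
      proof -
        have "ennreal (D * I powr (lo - 1)) * ennreal I = (\<integral>\<^sup>+x. ennreal (D * I powr (lo - 1)) * ennreal (?u N x) \<partial>lebesgue)"
          unfolding I(1)[symmetric] by (rule nn_integral_cmult[symmetric]) measurable
        also have "\<dots> \<le> (\<integral>\<^sup>+x. F x * ennreal (g x) \<partial>lebesgue)"
        proof (rule nn_integral_mono)
          fix x
          have "D * I powr (lo - 1) * ?u N x \<le> D * I powr (- (1 - \<alpha> x)) * ?u N x"
            using D I1 bounds(1)[of x] by (intro mult_right_mono mult_left_mono powr_mono) auto
          also have "\<dots> = \<phi> N x * g x"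
          proof (cases "\<phi> N x = 0")
            case False
            then have "0 < \<phi> N x / D" using \<phi>0(1)[of N x] D by simp
            then have "?u N x = \<phi> N x / D * (\<phi> N x / D) powr (1 / \<alpha> x - 1)"
              by (subst powr_mult_base) auto
            then show ?thesis using D by (simp add: g_def)
          qed simp
          also have "\<dots> \<le> R x * g x" using \<phi>0(2)[of N x] by (intro mult_right_mono) (auto simp: g_def)
          finally have "ennreal (D * I powr (lo - 1) * ?u N x) \<le> ennreal (R x) * ennreal (g x)"
            using R0[of x] by (simp add: g_def ennreal_leI flip: ennreal_mult)
          also have "\<dots> \<le> F x * ennreal (g x)" by (intro mult_right_mono RF) simp
          finally show "ennreal (D * I powr (lo - 1)) * ennreal (?u N x) \<le> F x * ennreal (g x)"
            using D by (simp add: ennreal_mult')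
        qed
        finally show ?thesis .
      qed
      ultimately have "ennreal (D * I powr (lo - 1)) * ennreal I \<le> ennreal D" by (rule order_trans[rotated])
      then have "D * I powr (lo - 1) * I \<le> D" using D I1 by (simp flip: ennreal_mult)
      then have "I powr (lo - 1) * I \<le> 1" using D by simp
      moreover have "I powr (lo - 1) * I = I powr lo" using I1 by (simp add: powr_diff)
      moreover have "1 < I powr lo" using powr_less_mono2[of lo 1 I] I1 lo by simp
      ultimately show False by simp
    qed
    then show ?thesis using I by simp
  qed
  have "(\<integral>\<^sup>+x. ennreal ((R x / D) powr (1 / \<alpha> x)) \<partial>lebesgue) \<le> (\<integral>\<^sup>+x. liminf (\<lambda>N. ennreal (?u N x)) \<partial>lebesgue)"
  proof (rule nn_integral_mono)
    fix x
    obtain M :: nat where M: "max (R x) (norm x) \<le> real M" using real_arch_simple by blast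
    have "\<forall>\<^sub>F N in sequentially. ennreal ((R x / D) powr (1 / \<alpha> x)) \<le> ennreal (?u N x)"
    proof (rule eventually_sequentiallyI[of M])
      fix N assume "M \<le> N"
      then have "max (R x) (norm x) \<le> real N" using M by linarith
      then have "\<phi> N x = R x" by (simp add: \<phi>_def)
      then show "ennreal ((R x / D) powr (1 / \<alpha> x)) \<le> ennreal (?u N x)" by simp
    qed
    then show "ennreal ((R x / D) powr (1 / \<alpha> x)) \<le> liminf (\<lambda>N. ennreal (?u N x))" by (rule Liminf_bounded)
  qed
  also have "\<dots> \<le> liminf (\<lambda>N. \<integral>\<^sup>+x. ennreal (?u N x) \<partial>lebesgue)" by (rule nn_integral_liminf) measurable
  also have "\<dots> \<le> limsup (\<lambda>N. \<integral>\<^sup>+x. ennreal (?u N x) \<partial>lebesgue)" by (rule Liminf_le_Limsup) simp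
  also have "\<dots> \<le> 1" by (rule Limsup_bounded) (auto intro: bound always_eventually)
  finally show "(\<integral>\<^sup>+x. ennreal ((enn2real (F x) / D) powr (1 / \<alpha> x)) \<partial>lebesgue) \<le> 1" by (simp add: R_def)
qed

lemma lebesgue_measurable_AE_cong:
  fixes f g :: "'a :: euclidean_space \<Rightarrow> 'b :: topological_space"
  assumes f: "f \<in> borel_measurable lebesgue" and eq: "AE x in lebesgue. f x = g x"
  shows "g \<in> borel_measurable lebesgue"
proof (rule measurableI)
  fix A :: "'b set" assume A: "A \<in> sets borel"
  have cm: "complete_measure (lebesgue :: 'a measure)" by unfold_locales
  show "g -` A \<inter> space lebesgue \<in> sets lebesgue"
  proof (rule complete_measure.in_sets_AE[OF cm])
    show "f -` A \<inter> space lebesgue \<in> sets lebesgue" using f A by (rule measurable_sets)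
    show "AE x in lebesgue. x \<in> f -` A \<inter> space lebesgue \<longleftrightarrow> x \<in> g -` A \<inter> space lebesgue"
      using eq by eventually_elim auto
  qed auto
qed simp

lemma AE_reflect:
  fixes x :: "'a :: euclidean_space"
  assumes "AE z in lebesgue. P z"
  shows "AE y in lebesgue. P (x - y)"
proof -
  have "lborel = distr lborel borel (\<lambda>y. x - y)"
    using lborel_affine[of "- 1" x] by (simp add: density_1)
  from subst[OF this, of "\<lambda>M. AE z in M. P z"]
  have "AE z in distr lborel borel (\<lambda>y. x - y). P z" using assms by (simp only: AE_completion_iff)
  then have "AE y in lborel. P (x - y)" by (rule AE_distrD[rotated]) simp
  then show ?thesis by (simp only: AE_completion_iff)
qed

text \<open>
  Functions that are only Lebesgue measurable do not compose with the subtraction of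
  arguments, and the product of two completed measures is not complete. Hence measurability
  of the commutator is first shown for Borel representatives of its three ingredients.
\<close>

lemma lebesgue_borel_representative:
  fixes f :: "'a :: euclidean_space \<Rightarrow> real"
  assumes "f \<in> borel_measurable lebesgue"
  obtains f' where "f' \<in> borel_measurable borel" "AE x in lebesgue. f x = f' x"
proof -
  obtain f' where "f' \<in> borel_measurable lborel" "AE x in lborel. f x = f' x"
    using completion_ex_borel_measurable_real[OF assms] by auto
  then show thesis using that by (simp add: AE_completion_iff)
qed

context
  fixes b K f :: "real ^ 'n \<Rightarrow> real" and m :: nat
  assumes b: "b \<in> borel_measurable lebesgue" and K: "K \<in> borel_measurable lebesgue" and f: "f \<in> borel_measurable lebesgue"
begin

lemma reflected_kernel_measurable: "(\<lambda>y. K (x - y)) \<in> borel_measurable lebesgue"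
proof -
  obtain K' where K': "K' \<in> borel_measurable borel" "AE x in lebesgue. K x = K' x" by (rule lebesgue_borel_representative[OF K])
  have "(\<lambda>y. K' (x - y)) \<in> borel_measurable lborel" using K'(1) by measurable
  then have 1: "(\<lambda>y. K' (x - y)) \<in> borel_measurable lebesgue" by (rule measurable_completion)
  show ?thesis
    by (rule lebesgue_measurable_AE_cong[OF 1]) (use AE_reflect[OF K'(2), of x] in \<open>eventually_elim, simp\<close>)
qed

lemma comm_integrand_measurable: "comm_integrand K b m f x \<in> borel_measurable lebesgue"
proof -
  note [measurable] = b f reflected_kernel_measurable[of x]
  show ?thesis unfolding comm_integrand_def by measurable
qed

lemma
  shows commutator_measurable: "commutator K b m f \<in> borel_measurable lebesgue"
    and abs_commutator_measurable: "(\<lambda>x. \<integral>\<^sup>+y. ennreal \<bar>comm_integrand K b m f x y\<bar> \<partial>lebesgue) \<in> borel_measurable lebesgue"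
proof -
  obtain b' where b': "b' \<in> borel_measurable borel" "AE x in lebesgue. b x = b' x" by (rule lebesgue_borel_representative[OF b])
  obtain K' where K': "K' \<in> borel_measurable borel" "AE x in lebesgue. K x = K' x" by (rule lebesgue_borel_representative[OF K])
  obtain f' where f': "f' \<in> borel_measurable borel" "AE x in lebesgue. f x = f' x" by (rule lebesgue_borel_representative[OF f])
  note [measurable] = b'(1) K'(1) f'(1)
  have eq: "AE x in lebesgue. AE y in lebesgue. comm_integrand K b m f x y = comm_integrand K' b' m f' x y"
    using b'(2)
  proof eventually_elim
    fix x assume bx: "b x = b' x"
    show "AE y in lebesgue. comm_integrand K b m f x y = comm_integrand K' b' m f' x y"
      using b'(2) f'(2) AE_reflect[OF K'(2), of x] by eventually_elim (simp add: comm_integrand_def bx)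
  qed
  have bm: "comm_integrand K' b' m f' x \<in> borel_measurable lborel" for x
    unfolding comm_integrand_def by measurable
  have joint: "(\<lambda>(x, y). comm_integrand K' b' m f' x y) \<in> borel_measurable (lborel \<Otimes>\<^sub>M lborel)"
    unfolding comm_integrand_def by measurable
  have "(\<lambda>x. \<integral>y. comm_integrand K' b' m f' x y \<partial>lborel) \<in> borel_measurable lborel"
    by (rule lborel.borel_measurable_lebesgue_integral[OF joint])
  then have 1: "(\<lambda>x. \<integral>y. comm_integrand K' b' m f' x y \<partial>lborel) \<in> borel_measurable lebesgue" by (rule measurable_completion)
  show "commutator K b m f \<in> borel_measurable lebesgue"
  proof (rule lebesgue_measurable_AE_cong[OF 1])
    show "AE x in lebesgue. (\<integral>y. comm_integrand K' b' m f' x y \<partial>lborel) = commutator K b m f x"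
      using eq
    proof eventually_elim
      fix x assume ae: "AE y in lebesgue. comm_integrand K b m f x y = comm_integrand K' b' m f' x y"
      have "(\<integral>y. comm_integrand K' b' m f' x y \<partial>lborel) = (\<integral>y. comm_integrand K' b' m f' x y \<partial>lebesgue)"
        by (rule integral_completion[OF bm, symmetric])
      also have "\<dots> = commutator K b m f x" unfolding commutator_def
        by (rule integral_cong_AE) (use ae measurable_completion[OF bm] comm_integrand_measurable in \<open>auto elim: eventually_mono\<close>)
      finally show "(\<integral>y. comm_integrand K' b' m f' x y \<partial>lborel) = commutator K b m f x" .
    qed
  qed
  have joint2: "(\<lambda>(x, y). ennreal \<bar>comm_integrand K' b' m f' x y\<bar>) \<in> borel_measurable (lborel \<Otimes>\<^sub>M lborel)"
    unfolding comm_integrand_def by measurable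
  have "(\<lambda>x. \<integral>\<^sup>+y. ennreal \<bar>comm_integrand K' b' m f' x y\<bar> \<partial>lborel) \<in> borel_measurable lborel"
    using lborel.borel_measurable_nn_integral_fst[OF joint2] by simp
  then have 2: "(\<lambda>x. \<integral>\<^sup>+y. ennreal \<bar>comm_integrand K' b' m f' x y\<bar> \<partial>lborel) \<in> borel_measurable lebesgue" by (rule measurable_completion)
  show "(\<lambda>x. \<integral>\<^sup>+y. ennreal \<bar>comm_integrand K b m f x y\<bar> \<partial>lebesgue) \<in> borel_measurable lebesgue"
  proof (rule lebesgue_measurable_AE_cong[OF 2])
    show "AE x in lebesgue. (\<integral>\<^sup>+y. ennreal \<bar>comm_integrand K' b' m f' x y\<bar> \<partial>lborel) = (\<integral>\<^sup>+y. ennreal \<bar>comm_integrand K b m f x y\<bar> \<partial>lebesgue)"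
      using eq
    proof eventually_elim
      fix x assume ae: "AE y in lebesgue. comm_integrand K b m f x y = comm_integrand K' b' m f' x y"
      have "(\<integral>\<^sup>+y. ennreal \<bar>comm_integrand K' b' m f' x y\<bar> \<partial>lborel) = (\<integral>\<^sup>+y. ennreal \<bar>comm_integrand K' b' m f' x y\<bar> \<partial>lebesgue)"
        by (rule nn_integral_completion[symmetric])
      also have "\<dots> = (\<integral>\<^sup>+y. ennreal \<bar>comm_integrand K b m f x y\<bar> \<partial>lebesgue)"
        by (rule nn_integral_cong_AE) (use ae in \<open>auto elim: eventually_mono\<close>)
      finally show "(\<integral>\<^sup>+y. ennreal \<bar>comm_integrand K' b' m f' x y\<bar> \<partial>lborel) = (\<integral>\<^sup>+y. ennreal \<bar>comm_integrand K b m f x y\<bar> \<partial>lebesgue)" .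
    qed
  qed
qed

end

section \<open>The dual form of the commutator\<close>

text \<open>
  Truncate the kernel to an annulus around the origin, \<open>f\<close> to bounded functions
  and \<open>x\<close> to a ball; Fatou's lemma removes the truncations at the end. For the
  truncation of order \<open>J\<close>, the grids with cells from side \<open>2 ^ (-
  J)\<close> to side \<open>2 ^ J\<close> are sufficient, and all points in the ball belong
  to the largest cell around the origin. Applying \<open>grid_estimate\<close> on each of
  the finitely many shifted grids gives the bound.
\<close>

lemma commutator_dual_bound:
  fixes \<alpha>p \<alpha>q :: "real ^ 'n \<Rightarrow> real" and \<theta> r s t \<sigma> tt :: real and m :: nat and K :: "real ^ 'n \<Rightarrow> real"
  assumes P: "lh_exp \<alpha>p cp lop hip \<beta>p" and Q: "lh_exp \<alpha>q cq loq hiq \<beta>q" and hip: "hip < 1" and hiq: "hiq < 1"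
    and pq: "\<And>x. \<alpha>q x \<le> \<alpha>p x" "\<beta>q \<le> \<beta>p" and K: "K \<in> kernel_class"
    and \<theta>: "1 < \<theta>" "\<theta> < r" "\<theta> < s" "1 / \<theta> = 1 / r + 1 / s" "\<theta> < t" "\<theta> < \<sigma>" "1 / \<theta> = 1 / t + 1 / \<sigma>"
    and s: "s * hip < 1" and \<sigma>: "\<sigma> * (1 - loq) < 1" and tt: "0 < tt"
  obtains L C where "2 \<le> L" "0 < C"
    "\<And>u w f h g \<kappa> a b N. \<lbrakk>
      u \<in> borel_measurable lebesgue; w \<in> borel_measurable lebesgue; f \<in> borel_measurable lebesgue; h \<in> borel_measurable lebesgue; g \<in> borel_measurable lebesgue;
      \<And>x. 0 \<le> u x; \<And>x. 0 \<le> w x; \<And>x. 0 \<le> h x; \<And>x. 0 \<le> g x; \<And>x. 0 \<le> f x; AE x in lebesgue. f x = u x * h x;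
      (\<integral>\<^sup>+y. ennreal (h y powr (1 / \<alpha>p y)) \<partial>lebesgue) \<le> 1; (\<integral>\<^sup>+y. ennreal (g y powr (1 / (1 - \<alpha>q y))) \<partial>lebesgue) \<le> 1;
      \<And>z l. 0 < l \<Longrightarrow> (\<integral>\<^sup>+y\<in>cube z l. ennreal (w y powr t) \<partial>lebesgue) < \<infinity>;
      locally_integrable b; osc_bound 1 a b N; 0 \<le> N;
      \<And>Q Q'. Q \<in> cubes \<Longrightarrow> Q' \<in> cubes \<Longrightarrow> Q' \<subseteq> Q \<Longrightarrow> a Q' \<le> tt * a Q; \<And>Q. Q \<in> cubes \<Longrightarrow> 0 \<le> a Q; 0 \<le> \<kappa>;
      \<And>z l Ap Aq. effective \<alpha>p \<beta>p L z l Ap \<Longrightarrow> effective \<alpha>q \<beta>q L z l Aq \<Longrightarrow> Aq \<le> Ap \<Longrightarrow> 0 < Ktilde K l * a (cube z l) ^ m \<Longrightarrow>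
        mean_product_le r t u w z l (Ktilde K l * a (cube z l) ^ m * (l ^ CARD('n)) powr (Aq - Ap)) \<kappa>\<rbrakk> \<Longrightarrow>
     (\<integral>\<^sup>+x. ennreal (w x) * (\<integral>\<^sup>+y. ennreal \<bar>comm_integrand K b m f x y\<bar> \<partial>lebesgue) * ennreal (g x) \<partial>lebesgue) \<le> ennreal (C * \<kappa> * N ^ m)"
proof -
  let ?n = "CARD('n)"
  obtain \<eta> cK \<epsilon> where e: "0 < \<eta>" "0 < cK" "0 \<le> \<epsilon>" "\<epsilon> < 1" and K0: "\<And>x. 0 \<le> K x" and Kli: "locally_integrable K"
    and KB: "\<And>(k::int) x. 2 powi k < norm x \<Longrightarrow> norm x \<le> 2 powi (k + 1) \<Longrightarrow>
       K x \<le> cK / (2 powi k) ^ ?n * (LINT y:annulus \<eta> \<epsilon> (2 powi k)|lebesgue. K y)"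
    by (rule kernel_class_bound[OF K]) blast
  obtain M where M: "0 < M" "\<And>\<rho> j. 0 < \<rho> \<Longrightarrow> (\<Sum>i\<le>j. LINT y:annulus \<eta> \<epsilon> (\<rho> * 2 ^ i)|lebesgue. K y) \<le> M * Ktilde K (4 * \<eta> * \<rho> * 2 ^ j)"
    by (rule annuli_sum[OF K0 Kli e(1,3,4)]) blast
  have Km[measurable]: "K \<in> borel_measurable lebesgue" by (rule locally_integrable_measurable[OF Kli])
  define L where "L = max 2 \<eta>"
  have L: "2 \<le> L" "\<eta> \<le> L" by (simp_all add: L_def)
  define c1 where "c1 = cK * 8 ^ ?n * M"
  have c1: "0 < c1" using e M by (simp add: c1_def)
  obtain C where C: "0 < C"
    "\<And>J0 k \<delta> \<tau> x0 u w f h g kt \<kappa> a b N I B. \<lbrakk>0 < \<delta>; \<delta> * 2 ^ J0 = 1; J0 \<le> k;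
      u \<in> borel_measurable lebesgue; w \<in> borel_measurable lebesgue; f \<in> borel_measurable lebesgue; h \<in> borel_measurable lebesgue; g \<in> borel_measurable lebesgue;
      \<And>x. 0 \<le> u x; \<And>x. 0 \<le> w x; \<And>x. 0 \<le> h x; \<And>x. 0 \<le> g x; \<And>x. 0 \<le> f x; \<And>x. f x \<le> B; AE x in lebesgue. f x = u x * h x;
      (\<integral>\<^sup>+y. ennreal (h y powr (1 / \<alpha>p y)) \<partial>lebesgue) \<le> 1; (\<integral>\<^sup>+y. ennreal (g y powr (1 / (1 - \<alpha>q y))) \<partial>lebesgue) \<le> 1;
      \<And>z l. 0 < l \<Longrightarrow> (\<integral>\<^sup>+y\<in>cube z l. ennreal (w y powr t) \<partial>lebesgue) < \<infinity>;
      locally_integrable b; osc_bound 1 a b N; 0 \<le> N;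
      \<And>Q Q'. Q \<in> cubes \<Longrightarrow> Q' \<in> cubes \<Longrightarrow> Q' \<subseteq> Q \<Longrightarrow> a Q' \<le> tt * a Q; \<And>Q. Q \<in> cubes \<Longrightarrow> 0 \<le> a Q;
      \<And>i. 0 \<le> I i; \<And>l. 0 \<le> kt l; \<And>j. j \<le> k \<Longrightarrow> (\<Sum>i\<le>j. I i) \<le> kt (L * (\<delta> * 2 ^ j)); 0 \<le> \<kappa>;
      \<And>z l Ap Aq. effective \<alpha>p \<beta>p L z l Ap \<Longrightarrow> effective \<alpha>q \<beta>q L z l Aq \<Longrightarrow> Aq \<le> Ap \<Longrightarrow> 0 < kt l * a (cube z l) ^ m \<Longrightarrow>
        mean_product_le r t u w z l (kt l * a (cube z l) ^ m * (l ^ CARD('n)) powr (Aq - Ap)) \<kappa>\<rbrakk> \<Longrightarrow>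
     \<exists>\<Phi>. \<Phi> \<in> borel_measurable lebesgue \<and> (\<integral>\<^sup>+x\<in>dcell \<tau> \<delta> k x0. \<Phi> x \<partial>lebesgue) \<le> ennreal (C * \<kappa> * N ^ m) \<and>
       (\<forall>x. ennreal (w x * g x) * (\<Sum>i\<le>k. ennreal (I i / (\<delta> * 2 ^ i) ^ CARD('n)) *
         (\<integral>\<^sup>+y\<in>dcell \<tau> \<delta> i x. ennreal (\<bar>b x - b y\<bar> ^ m * f y) \<partial>lebesgue)) \<le> \<Phi> x)"
    by (rule grid_estimate[OF P Q hip hiq pq L(1) \<theta> s \<sigma> tt, where m = m]) blast
  define nE where "nE = real (card (UNIV :: ('n \<Rightarrow> bool) set))"
  have nE: "0 < nE" by (simp add: nE_def card_gt_0_iff)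
  show thesis
  proof (rule that[of L "nE * (C * c1)"])
    show "2 \<le> L" "0 < nE * (C * c1)" using L C(1) c1 nE by auto
    fix u w f h g b :: "real ^ 'n \<Rightarrow> real" and \<kappa> N :: real and a :: "(real ^ 'n) set \<Rightarrow> real"
    assume um: "u \<in> borel_measurable lebesgue" and wm[measurable]: "w \<in> borel_measurable lebesgue" and fm[measurable]: "f \<in> borel_measurable lebesgue"
      and hm[measurable]: "h \<in> borel_measurable lebesgue" and gm[measurable]: "g \<in> borel_measurable lebesgue"
      and nn: "\<And>x. 0 \<le> u x" "\<And>x. 0 \<le> w x" "\<And>x. 0 \<le> h x" "\<And>x. 0 \<le> g x" and f0: "\<And>x. 0 \<le> f x" and fuh: "AE x in lebesgue. f x = u x * h x"
      and hmod: "(\<integral>\<^sup>+y. ennreal (h y powr (1 / \<alpha>p y)) \<partial>lebesgue) \<le> 1" and gmod: "(\<integral>\<^sup>+y. ennreal (g y powr (1 / (1 - \<alpha>q y))) \<partial>lebesgue) \<le> 1"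
      and wfin: "\<And>z l. 0 < l \<Longrightarrow> (\<integral>\<^sup>+y\<in>cube z l. ennreal (w y powr t) \<partial>lebesgue) < \<infinity>"
      and b: "locally_integrable b" and N: "osc_bound 1 a b N" "0 \<le> N"
      and ta: "\<And>Q Q'. Q \<in> cubes \<Longrightarrow> Q' \<in> cubes \<Longrightarrow> Q' \<subseteq> Q \<Longrightarrow> a Q' \<le> tt * a Q" and a0: "\<And>Q. Q \<in> cubes \<Longrightarrow> 0 \<le> a Q" and \<kappa>: "0 \<le> \<kappa>"
      and cond: "\<And>z l Ap Aq. effective \<alpha>p \<beta>p L z l Ap \<Longrightarrow> effective \<alpha>q \<beta>q L z l Aq \<Longrightarrow> Aq \<le> Ap \<Longrightarrow> 0 < Ktilde K l * a (cube z l) ^ m \<Longrightarrow>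
        mean_product_le r t u w z l (Ktilde K l * a (cube z l) ^ m * (l ^ ?n) powr (Aq - Ap)) \<kappa>"
    have bm[measurable]: "b \<in> borel_measurable lebesgue" by (rule locally_integrable_measurable[OF b])
    define E where "E = ennreal (nE * (C * c1) * \<kappa> * N ^ m)"
    define A where "A J = {z :: real ^ 'n. (1 / 2 ^ J) / 8 < norm z \<and> norm z \<le> 2 ^ J / 4}" for J :: nat
    define KJ where "KJ J z = K z * indicator (A J) z" for J z
    define fJ where "fJ J y = min (f y) (real J)" for J y
    have AJ[measurable]: "A J \<in> sets lebesgue" for J
    proof -
      have "{z :: real ^ 'n \<in> space borel. (1 / 2 ^ J) / 8 < norm z \<and> norm z \<le> 2 ^ J / 4} \<in> sets borel" by measurable
      then show ?thesis by (simp add: A_def)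
    qed
    have KJm[measurable]: "KJ J \<in> borel_measurable lebesgue" for J unfolding KJ_def by measurable
    have fJm[measurable]: "fJ J \<in> borel_measurable lebesgue" for J unfolding fJ_def by measurable
    have fJ0: "0 \<le> fJ J y" "fJ J y \<le> f y" "fJ J y \<le> real J" for J y using f0[of y] by (auto simp: fJ_def)
    define T where "T J x = (\<integral>\<^sup>+y. ennreal \<bar>comm_integrand (KJ J) b m (fJ J) x y\<bar> \<partial>lebesgue)" for J x
    have Tm[measurable]: "T J \<in> borel_measurable lebesgue" for J
      unfolding T_def by (rule abs_commutator_measurable[OF bm KJm fJm])
    define B where "B J = {x :: real ^ 'n. norm x < 2 ^ J / 3}" for J :: nat
    have BJ[measurable]: "B J \<in> sets lebesgue" for J
    proof -
      have "{x :: real ^ 'n \<in> space borel. norm x < 2 ^ J / 3} \<in> sets borel" by measurable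
      then show ?thesis by (simp add: B_def)
    qed
    have step: "(\<integral>\<^sup>+x. ennreal (w x * g x) * T J x * indicator (B J) x \<partial>lebesgue) \<le> E" for J
    proof -
      define \<delta> :: real where "\<delta> = 1 / 2 ^ J"
      define k where "k = 2 * J"
      have \<delta>: "0 < \<delta>" "\<delta> * 2 ^ J = 1" by (simp_all add: \<delta>_def)
      have Jk: "J \<le> k" by (simp add: k_def)
      have dk: "\<delta> * 2 ^ k = 2 ^ J" by (simp add: \<delta>_def k_def mult_2 power_add)
      \<comment> \<open>the kernel at distances from \<open>\<delta> * 2 ^ i / 8\<close> to
          \<open>\<delta> * 2 ^ i / 4\<close> is controlled by the annulus of radius
          \<open>\<delta> / 8 * 2 ^ i\<close>; the factor \<open>8 ^ n\<close> adjusts the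
          volume\<close>
      define I where "I i = cK * 8 ^ ?n * (LINT y:annulus \<eta> \<epsilon> (\<delta> / 8 * 2 ^ i)|lebesgue. K y)" for i
      have lint0: "0 \<le> (LINT y:annulus \<eta> \<epsilon> \<rho>|lebesgue. K y)" for \<rho>
        unfolding set_lebesgue_integral_def using K0 by (intro Bochner_Integration.integral_nonneg) auto
      have I0: "0 \<le> I i" for i unfolding I_def using e lint0 by (intro mult_nonneg_nonneg) auto
      define kt where "kt l = c1 * Ktilde K l" for l
      have kt0: "0 \<le> kt l" for l unfolding kt_def using c1 Ktilde_nonneg[of K l] K0 by simp
      have IW: "(\<Sum>i\<le>j. I i) \<le> kt (L * (\<delta> * 2 ^ j))" for j
      proof -
        have "(\<Sum>i\<le>j. I i) = cK * 8 ^ ?n * (\<Sum>i\<le>j. LINT y:annulus \<eta> \<epsilon> (\<delta> / 8 * 2 ^ i)|lebesgue. K y)"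
          by (simp add: I_def sum_distrib_left)
        also have "\<dots> \<le> cK * 8 ^ ?n * (M * Ktilde K (4 * \<eta> * (\<delta> / 8) * 2 ^ j))"
          using e \<delta>(1) by (intro mult_left_mono M) auto
        also have "\<dots> \<le> cK * 8 ^ ?n * (M * Ktilde K (L * (\<delta> * 2 ^ j)))"
        proof (intro mult_left_mono Ktilde_mono K0 Kli)
          have "4 * \<eta> * (\<delta> / 8) * 2 ^ j = (\<eta> / 2) * (\<delta> * 2 ^ j)" by simp
          also have "\<dots> \<le> L * (\<delta> * 2 ^ j)" using L e \<delta>(1) by (intro mult_right_mono) auto
          finally show "4 * \<eta> * (\<delta> / 8) * 2 ^ j \<le> L * (\<delta> * 2 ^ j)" .
        qed (use e M in auto)
        finally show ?thesis by (simp add: kt_def c1_def mult.assoc)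
      qed
      have KB': "K z \<le> I i / (\<delta> * 2 ^ i) ^ ?n" if z: "\<delta> * 2 ^ i / 8 < norm z" "norm z \<le> \<delta> * 2 ^ i / 4" for i z
      proof -
        define kk where "kk = int i - int J - 3"
        have p: "(2::real) powi kk = \<delta> / 8 * 2 ^ i"
          by (simp add: kk_def power_int_diff \<delta>_def)
        have p1: "(2::real) powi (kk + 1) = \<delta> * 2 ^ i / 4" using p by (simp add: power_int_add)
        have "K z \<le> cK / (\<delta> / 8 * 2 ^ i) ^ ?n * (LINT y:annulus \<eta> \<epsilon> (\<delta> / 8 * 2 ^ i)|lebesgue. K y)"
          using KB[of kk z] z unfolding p p1 by simp
        also have "\<dots> = I i / (\<delta> * 2 ^ i) ^ ?n"
          by (simp add: I_def power_mult_distrib power_divide)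
        finally show ?thesis .
      qed
      \<comment> \<open>truncating \<open>f\<close> must be matched by \<open>h\<close> in order to keep
          \<open>f = u * h\<close>\<close>
      define hJ where "hJ y = (if f y = 0 then 0 else h y * (fJ J y / f y))" for y
      have hJm: "hJ \<in> borel_measurable lebesgue" unfolding hJ_def by measurable
      have hJ: "0 \<le> hJ y" "hJ y \<le> h y" for y
      proof -
        show "0 \<le> hJ y" using nn(3)[of y] fJ0(1)[of J y] f0[of y] by (simp add: hJ_def)
        have "f y \<noteq> 0 \<Longrightarrow> fJ J y / f y \<le> 1" using fJ0(2)[of J y] f0[of y] by (simp add: divide_le_eq_1)
        then show "hJ y \<le> h y" using nn(3)[of y] mult_left_mono[of "fJ J y / f y" 1 "h y"] by (auto simp: hJ_def)
      qed
      have hJmod: "(\<integral>\<^sup>+y. ennreal (hJ y powr (1 / \<alpha>p y)) \<partial>lebesgue) \<le> 1"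
      proof -
        have "(\<integral>\<^sup>+y. ennreal (hJ y powr (1 / \<alpha>p y)) \<partial>lebesgue) \<le> (\<integral>\<^sup>+y. ennreal (h y powr (1 / \<alpha>p y)) \<partial>lebesgue)"
          using hJ lh_exp.alpha_pos[OF P] by (intro nn_integral_mono ennreal_leI powr_mono2) (auto simp: less_imp_le)
        then show ?thesis using hmod by (rule order_trans)
      qed
      have fuhJ: "AE y in lebesgue. fJ J y = u y * hJ y"
        using fuh
      proof eventually_elim
        fix y assume y: "f y = u y * h y"
        show "fJ J y = u y * hJ y"
        proof (cases "f y = 0")
          case True then show ?thesis by (simp add: hJ_def fJ_def)
        next
          case False
          have "u y * hJ y = (u y * h y) * (fJ J y / f y)" using False by (simp add: hJ_def)
          also have "\<dots> = fJ J y" unfolding y[symmetric] using False by simp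
          finally show ?thesis by simp
        qed
      qed
      have cond': "mean_product_le r t u w z l (kt l * a (cube z l) ^ m * (l ^ ?n) powr (Aq - Ap)) (c1 * \<kappa>)"
        if eff: "effective \<alpha>p \<beta>p L z l Ap" "effective \<alpha>q \<beta>q L z l Aq" "Aq \<le> Ap" "0 < kt l * a (cube z l) ^ m" for z l Ap Aq
      proof -
        have "0 < c1 * (Ktilde K l * a (cube z l) ^ m)" using eff(4) by (simp add: kt_def mult.assoc)
        then have "0 < Ktilde K l * a (cube z l) ^ m" using c1 by (simp add: zero_less_mult_iff)
        from cond[OF eff(1-3) this] obtain U W where UW: "0 \<le> U" "0 \<le> W" "(\<integral>\<^sup>+y\<in>cube z l. ennreal (u y powr r) \<partial>lebesgue) \<le> ennreal (U powr r * l ^ ?n)"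
          "(\<integral>\<^sup>+y\<in>cube z l. ennreal (w y powr t) \<partial>lebesgue) \<le> ennreal (W powr t * l ^ ?n)"
          "Ktilde K l * a (cube z l) ^ m * (l ^ ?n) powr (Aq - Ap) * U * W \<le> \<kappa>" by blast
        have "kt l * a (cube z l) ^ m * (l ^ ?n) powr (Aq - Ap) * U * W \<le> c1 * \<kappa>"
          using mult_left_mono[OF UW(5), of c1] c1 by (simp add: kt_def mult.assoc)
        then show ?thesis using UW by blast
      qed
      have c1\<kappa>: "0 \<le> c1 * \<kappa>" using c1 \<kappa> by simp
      define G where "G e \<Phi> \<longleftrightarrow> \<Phi> \<in> borel_measurable lebesgue \<and> (\<integral>\<^sup>+x\<in>dcell (shift (\<delta> * 2 ^ k) e) \<delta> k 0. \<Phi> x \<partial>lebesgue) \<le> ennreal (C * (c1 * \<kappa>) * N ^ m) \<and>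
       (\<forall>x. ennreal (w x * g x) * (\<Sum>i\<le>k. ennreal (I i / (\<delta> * 2 ^ i) ^ ?n) *
         (\<integral>\<^sup>+y\<in>dcell (shift (\<delta> * 2 ^ k) e) \<delta> i x. ennreal (\<bar>b x - b y\<bar> ^ m * fJ J y) \<partial>lebesgue)) \<le> \<Phi> x)" for e :: "'n \<Rightarrow> bool" and \<Phi>
      have "\<exists>\<Phi>. G e \<Phi>" for e unfolding G_def
        by (rule C(2)[OF \<delta> Jk um wm fJm hJm gm nn(1,2) hJ(1) nn(4) fJ0(1) fJ0(3) fuhJ hJmod gmod wfin b N ta a0 I0 kt0 IW c1\<kappa> cond'])
      then obtain \<Phi> where G: "\<And>e. G e (\<Phi> e)" by metis
      have \<Phi>: "\<And>e. \<Phi> e \<in> borel_measurable lebesgue"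
        "\<And>e. (\<integral>\<^sup>+x\<in>dcell (shift (\<delta> * 2 ^ k) e) \<delta> k 0. \<Phi> e x \<partial>lebesgue) \<le> ennreal (C * (c1 * \<kappa>) * N ^ m)"
        "\<And>e x. ennreal (w x * g x) * (\<Sum>i\<le>k. ennreal (I i / (\<delta> * 2 ^ i) ^ ?n) *
         (\<integral>\<^sup>+y\<in>dcell (shift (\<delta> * 2 ^ k) e) \<delta> i x. ennreal (\<bar>b x - b y\<bar> ^ m * fJ J y) \<partial>lebesgue)) \<le> \<Phi> e x"
        using G unfolding G_def by blast+
      note [measurable] = \<Phi>(1)
      let ?root = "\<lambda>e. dcell (shift (\<delta> * 2 ^ k) e) \<delta> k 0"
      have root_sets[measurable]: "?root e \<in> sets lebesgue" for e :: "'n \<Rightarrow> bool" unfolding dcell_eq_hb[OF \<delta>(1)] by (rule hb_sets)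
      have in_root: "x \<in> ?root e" if "x \<in> B J" for x and e :: "'n \<Rightarrow> bool"
      proof -
        have "\<bar>x $ i\<bar> < \<delta> * 2 ^ k / 3" for i using component_le_norm_cart[of x i] that unfolding B_def dk by simp
        then have "x \<in> hb (shift (\<delta> * 2 ^ k) e) (\<delta> * 2 ^ k)" by (rule shift_root)
        moreover have "(0 :: real ^ 'n) \<in> hb (shift (\<delta> * 2 ^ k) e) (\<delta> * 2 ^ k)" using \<delta>(1) by (intro shift_root) simp
        ultimately show ?thesis using dcell_root[OF \<delta>(1)] by blast
      qed
      have TJ: "T J x \<le> (\<Sum>e\<in>UNIV. \<Sum>i\<le>k. ennreal (I i / (\<delta> * 2 ^ i) ^ ?n) * (\<integral>\<^sup>+y\<in>dcell (shift (\<delta> * 2 ^ k) e) \<delta> i x. ennreal (\<bar>b x - b y\<bar> ^ m * fJ J y) \<partial>lebesgue))" for x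
      proof -
        have "T J x = (\<integral>\<^sup>+y. ennreal (K (x - y)) * ennreal (\<bar>b x - b y\<bar> ^ m * fJ J y) * indicator {y. \<delta> / 8 < norm (x - y) \<and> norm (x - y) \<le> \<delta> * 2 ^ k / 4} y \<partial>lebesgue)"
          unfolding T_def
        proof (rule nn_integral_cong)
          fix y
          have "\<bar>comm_integrand (KJ J) b m (fJ J) x y\<bar> = K (x - y) * (\<bar>b x - b y\<bar> ^ m * fJ J y) * indicator (A J) (x - y)"
            using K0[of "x - y"] fJ0(1)[of J y] by (simp add: comm_integrand_def KJ_def abs_mult power_abs)
          moreover have "x - y \<in> A J \<longleftrightarrow> \<delta> / 8 < norm (x - y) \<and> norm (x - y) \<le> \<delta> * 2 ^ k / 4" unfolding dk by (simp add: A_def \<delta>_def)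
          ultimately show "ennreal \<bar>comm_integrand (KJ J) b m (fJ J) x y\<bar> = ennreal (K (x - y)) * ennreal (\<bar>b x - b y\<bar> ^ m * fJ J y) * indicator {y. \<delta> / 8 < norm (x - y) \<and> norm (x - y) \<le> \<delta> * 2 ^ k / 4} y"
            using K0[of "x - y"] by (auto simp: indicator_def ennreal_mult')
        qed
        also have "\<dots> \<le> (\<Sum>e\<in>UNIV. \<Sum>i\<le>k. ennreal (I i / (\<delta> * 2 ^ i) ^ ?n) * (\<integral>\<^sup>+y\<in>dcell (shift (\<delta> * 2 ^ k) e) \<delta> i x. ennreal (\<bar>b x - b y\<bar> ^ m * fJ J y) \<partial>lebesgue))"
          by (rule kernel_grid_bound[OF \<delta>(1) KB']) measurable
        finally show ?thesis .
      qed
      have "(\<integral>\<^sup>+x. ennreal (w x * g x) * T J x * indicator (B J) x \<partial>lebesgue) \<le> (\<integral>\<^sup>+x. (\<Sum>e\<in>UNIV. \<Phi> e x * indicator (?root e) x) \<partial>lebesgue)"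
      proof (rule nn_integral_mono)
        fix x
        show "ennreal (w x * g x) * T J x * indicator (B J) x \<le> (\<Sum>e\<in>UNIV. \<Phi> e x * indicator (?root e) x)"
        proof (cases "x \<in> B J")
          case True
          have "ennreal (w x * g x) * T J x \<le> ennreal (w x * g x) * (\<Sum>e\<in>UNIV. \<Sum>i\<le>k. ennreal (I i / (\<delta> * 2 ^ i) ^ ?n) * (\<integral>\<^sup>+y\<in>dcell (shift (\<delta> * 2 ^ k) e) \<delta> i x. ennreal (\<bar>b x - b y\<bar> ^ m * fJ J y) \<partial>lebesgue))"
            by (intro mult_left_mono TJ) simp
          also have "\<dots> \<le> (\<Sum>e\<in>UNIV. \<Phi> e x)" unfolding sum_distrib_left[of _ _ "UNIV :: ('n \<Rightarrow> bool) set"] by (intro sum_mono \<Phi>(3))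
          finally show ?thesis using True in_root[OF True] by simp
        qed simp
      qed
      also have "\<dots> = (\<Sum>e\<in>UNIV. \<integral>\<^sup>+x\<in>?root e. \<Phi> e x \<partial>lebesgue)" by (rule nn_integral_sum) measurable
      also have "\<dots> \<le> (\<Sum>e\<in>(UNIV :: ('n \<Rightarrow> bool) set). ennreal (C * (c1 * \<kappa>) * N ^ m))" by (intro sum_mono \<Phi>(2))
      also have "\<dots> = ennreal nE * ennreal (C * (c1 * \<kappa>) * N ^ m)" by (simp add: nE_def ennreal_of_nat_eq_real_of_nat)
      also have "\<dots> = E" unfolding E_def using nE C(1) c1 \<kappa> N(2) by (simp add: mult_ac flip: ennreal_mult)
      finally show ?thesis .
    qed
    have pt: "ennreal (w x) * (\<integral>\<^sup>+y. ennreal \<bar>comm_integrand K b m f x y\<bar> \<partial>lebesgue) * ennreal (g x) \<le> liminf (\<lambda>J. ennreal (w x * g x) * T J x * indicator (B J) x)" for x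
    proof -
      have cm[measurable]: "comm_integrand K b m f x \<in> borel_measurable lebesgue" by (rule comm_integrand_measurable[OF bm Km fm])
      have cmJ[measurable]: "comm_integrand (KJ J) b m (fJ J) x \<in> borel_measurable lebesgue" for J by (rule comm_integrand_measurable[OF bm KJm fJm])
      have "ennreal (w x) * (\<integral>\<^sup>+y. ennreal \<bar>comm_integrand K b m f x y\<bar> \<partial>lebesgue) * ennreal (g x) = (\<integral>\<^sup>+y. ennreal (w x * g x) * ennreal \<bar>comm_integrand K b m f x y\<bar> \<partial>lebesgue)"
        using nn by (simp add: nn_integral_cmult ennreal_mult mult_ac)
      also have "\<dots> \<le> (\<integral>\<^sup>+y. liminf (\<lambda>J. ennreal (w x * g x) * ennreal \<bar>comm_integrand (KJ J) b m (fJ J) x y\<bar>) \<partial>lebesgue)"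
      proof (rule nn_integral_mono_AE)
        have "AE y in lebesgue. y \<noteq> x" using AE_lborel_singleton[of x] by (simp only: AE_completion_iff)
        then show "AE y in lebesgue. ennreal (w x * g x) * ennreal \<bar>comm_integrand K b m f x y\<bar> \<le> liminf (\<lambda>J. ennreal (w x * g x) * ennreal \<bar>comm_integrand (KJ J) b m (fJ J) x y\<bar>)"
        proof eventually_elim
          fix y assume "y \<noteq> x"
          then have d: "0 < norm (x - y)" by simp
          obtain J0 :: nat where J0: "max (f y) (max (4 * norm (x - y)) (1 / (8 * norm (x - y)))) < real J0" using reals_Archimedean2 by blast
          have "\<forall>\<^sub>F J in sequentially. ennreal (w x * g x) * ennreal \<bar>comm_integrand K b m f x y\<bar> \<le> ennreal (w x * g x) * ennreal \<bar>comm_integrand (KJ J) b m (fJ J) x y\<bar>"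
          proof (rule eventually_sequentiallyI[of J0])
            fix J assume "J0 \<le> J"
            then have J: "f y < real J" "4 * norm (x - y) < real J" "1 / (8 * norm (x - y)) < real J" using J0 by auto
            have J2: "real J < 2 ^ J" by (rule of_nat_less_two_power)
            have "1 / (8 * norm (x - y)) < 2 ^ J" "4 * norm (x - y) \<le> 2 ^ J" using less_trans[OF J(3) J2] less_imp_le[OF less_trans[OF J(2) J2]] by blast+
            then have "x - y \<in> A J" using d by (simp add: A_def field_simps)
            moreover have "fJ J y = f y" using J by (simp add: fJ_def)
            ultimately show "ennreal (w x * g x) * ennreal \<bar>comm_integrand K b m f x y\<bar> \<le> ennreal (w x * g x) * ennreal \<bar>comm_integrand (KJ J) b m (fJ J) x y\<bar>"
              by (simp add: comm_integrand_def KJ_def)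
          qed
          then show "ennreal (w x * g x) * ennreal \<bar>comm_integrand K b m f x y\<bar> \<le> liminf (\<lambda>J. ennreal (w x * g x) * ennreal \<bar>comm_integrand (KJ J) b m (fJ J) x y\<bar>)"
            by (rule Liminf_bounded)
        qed
      qed
      also have "\<dots> \<le> liminf (\<lambda>J. \<integral>\<^sup>+y. ennreal (w x * g x) * ennreal \<bar>comm_integrand (KJ J) b m (fJ J) x y\<bar> \<partial>lebesgue)"
        by (rule nn_integral_liminf) measurable
      also have "\<dots> \<le> liminf (\<lambda>J. ennreal (w x * g x) * T J x * indicator (B J) x)"
      proof (rule Liminf_mono)
        obtain J0 :: nat where J0: "3 * norm x < real J0" using reals_Archimedean2 by blast
        show "\<forall>\<^sub>F J in sequentially. (\<integral>\<^sup>+y. ennreal (w x * g x) * ennreal \<bar>comm_integrand (KJ J) b m (fJ J) x y\<bar> \<partial>lebesgue) \<le> ennreal (w x * g x) * T J x * indicator (B J) x"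
        proof (rule eventually_sequentiallyI[of J0])
          fix J assume "J0 \<le> J"
          then have "3 * norm x < real J" using J0 by auto
          also have "\<dots> < 2 ^ J" by (rule of_nat_less_two_power)
          finally have "x \<in> B J" by (simp add: B_def)
          then show "(\<integral>\<^sup>+y. ennreal (w x * g x) * ennreal \<bar>comm_integrand (KJ J) b m (fJ J) x y\<bar> \<partial>lebesgue) \<le> ennreal (w x * g x) * T J x * indicator (B J) x"
            by (simp add: nn_integral_cmult T_def)
        qed
      qed
      finally show ?thesis .
    qed
    have "(\<integral>\<^sup>+x. ennreal (w x) * (\<integral>\<^sup>+y. ennreal \<bar>comm_integrand K b m f x y\<bar> \<partial>lebesgue) * ennreal (g x) \<partial>lebesgue)
      \<le> (\<integral>\<^sup>+x. liminf (\<lambda>J. ennreal (w x * g x) * T J x * indicator (B J) x) \<partial>lebesgue)"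
      by (rule nn_integral_mono) (rule pt)
    also have "\<dots> \<le> liminf (\<lambda>J. \<integral>\<^sup>+x. ennreal (w x * g x) * T J x * indicator (B J) x \<partial>lebesgue)"
      by (rule nn_integral_liminf) measurable
    also have "\<dots> \<le> limsup (\<lambda>J. \<integral>\<^sup>+x. ennreal (w x * g x) * T J x * indicator (B J) x \<partial>lebesgue)"
      by (rule Liminf_le_Limsup) simp
    also have "\<dots> \<le> E" by (rule Limsup_bounded) (auto intro: step always_eventually)
    finally show "(\<integral>\<^sup>+x. ennreal (w x) * (\<integral>\<^sup>+y. ennreal \<bar>comm_integrand K b m f x y\<bar> \<partial>lebesgue) * ennreal (g x) \<partial>lebesgue) \<le> ennreal (nE * (C * c1) * \<kappa> * N ^ m)"
      unfolding E_def .
  qed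
qed

section \<open>The norm inequality\<close>

text \<open>
  The bound with exponent \<open>\<rho>\<close> implies one with exponent \<open>1\<close>,
  so that the infimum is over a nonempty set; it is attained because the inequalities are
  closed. For nonemptiness any constant will do, and integrating \<open>y \<le> e + e powr
  (1 - \<rho>) * y powr \<rho>\<close> gives twice the given one.
\<close>

lemma osc_bound_exponent_one:
  fixes b :: "real ^ 'n \<Rightarrow> real"
  assumes b: "b \<in> L_osc \<rho> a" and \<rho>: "1 \<le> \<rho>" and a0: "\<And>Q. Q \<in> cubes \<Longrightarrow> 0 \<le> a Q"
  shows "osc_bound 1 a b (osc_norm 1 a b)" "0 \<le> osc_norm 1 a b"
proof -
  from b obtain C where bl: "locally_integrable b" and C: "0 \<le> C" "osc_bound \<rho> a b C" by (auto simp: L_osc_def)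
  let ?S = "{C. 0 \<le> C \<and> osc_bound 1 a b C}"
  have int: "(\<lambda>x. \<bar>b x - avg b Q\<bar>) absolutely_integrable_on Q" if "Q \<in> cubes" for Q
  proof -
    from that obtain z l where Q: "Q = cube z l" by (auto simp: cubes_def)
    have "b absolutely_integrable_on Q" using bl compact_cube[of z l] by (simp add: locally_integrable_def Q)
    moreover have "(\<lambda>x. avg b Q) absolutely_integrable_on Q" unfolding Q cube_def by (rule absolutely_integrable_on_const) simp
    ultimately show ?thesis by (intro set_integrable_abs set_integral_diff(1))
  qed
  have avg0: "0 \<le> avg (\<lambda>x. \<bar>b x - avg b Q\<bar>) Q" for Q
    unfolding avg_def set_lebesgue_integral_def
    by (intro divide_nonneg_nonneg Bochner_Integration.integral_nonneg) auto
  have iff: "osc_bound 1 a b C' \<longleftrightarrow> (\<forall>Q\<in>cubes. avg (\<lambda>x. \<bar>b x - avg b Q\<bar>) Q \<le> C' * a Q)" for C'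
    using int avg0 by (simp add: osc_bound_def)
  have ne: "2 * C \<in> ?S"
    unfolding mem_Collect_eq iff
  proof (intro conjI ballI)
    show "0 \<le> 2 * C" using C by simp
    fix Q :: "(real ^ 'n) set" assume Q: "Q \<in> cubes"
    then obtain z l where zl: "Q = cube z l" "0 < l" by (auto simp: cubes_def)
    let ?g = "\<lambda>x. \<bar>b x - avg b Q\<bar>"
    have mQ: "0 < measure lebesgue Q" using measure_cube[OF less_imp_le[OF zl(2)], of z] zl by simp
    have i\<rho>: "set_integrable lebesgue Q (\<lambda>x. ?g x powr \<rho>)" and X: "(avg (\<lambda>x. ?g x powr \<rho>) Q) powr (1 / \<rho>) \<le> C * a Q"
      using C(2) Q by (auto simp: osc_bound_def)
    have X0: "0 \<le> avg (\<lambda>x. ?g x powr \<rho>) Q"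
      unfolding avg_def set_lebesgue_integral_def by (intro divide_nonneg_nonneg Bochner_Integration.integral_nonneg) auto
    show "avg ?g Q \<le> 2 * C * a Q"
    proof (rule field_le_epsilon)
      fix d :: real assume d: "0 < d"
      define e where "e = C * a Q + d / 2"
      have e: "0 < e" using d C(1) a0[OF Q] by (simp add: e_def add_nonneg_pos)
      have Xe: "avg (\<lambda>x. ?g x powr \<rho>) Q \<le> e powr \<rho>"
      proof -
        have "avg (\<lambda>x. ?g x powr \<rho>) Q = ((avg (\<lambda>x. ?g x powr \<rho>) Q) powr (1 / \<rho>)) powr \<rho>" using X0 \<rho> by (simp add: powr_powr)
        also have "\<dots> \<le> e powr \<rho>" using X \<rho> d by (intro powr_mono2) (auto simp: e_def)
        finally show ?thesis .
      qed
      have pt: "?g x \<le> e + e powr (1 - \<rho>) * (?g x powr \<rho>)" for x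
      proof (cases "?g x \<le> e")
        case True then show ?thesis by (simp add: add_increasing2)
      next
        case False
        have "?g x = e powr (1 - \<rho>) * (e powr (\<rho> - 1) * ?g x)" using e by (simp flip: powr_add mult.assoc)
        also have "\<dots> \<le> e powr (1 - \<rho>) * (?g x powr (\<rho> - 1) * ?g x)"
          using False e \<rho> by (intro mult_left_mono mult_right_mono powr_mono2) auto
        also have "?g x powr (\<rho> - 1) * ?g x = ?g x powr \<rho>" using False e by (simp add: powr_diff)
        finally show ?thesis using e by linarith
      qed
      have ic: "set_integrable lebesgue Q (\<lambda>x. e)" unfolding zl cube_def by (rule absolutely_integrable_on_const) simp
      have ip: "set_integrable lebesgue Q (\<lambda>x. e powr (1 - \<rho>) * (?g x powr \<rho>))" using i\<rho> by (rule set_integrable_mult_right)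
      have "(LINT x:Q|lebesgue. ?g x) \<le> (LINT x:Q|lebesgue. e + e powr (1 - \<rho>) * (?g x powr \<rho>))"
        using int[OF Q] set_integral_add(1)[OF ic ip] pt by (intro set_integral_mono) auto
      also have "\<dots> = (LINT x:Q|lebesgue. e) + e powr (1 - \<rho>) * (LINT x:Q|lebesgue. ?g x powr \<rho>)"
        by (simp add: set_integral_add(2)[OF ic ip])
      also have "(LINT x:Q|lebesgue. e) = e * measure lebesgue Q"
        unfolding set_lebesgue_integral_def by (simp add: mult.commute)
      finally have "(LINT x:Q|lebesgue. ?g x) \<le> e * measure lebesgue Q + e powr (1 - \<rho>) * (LINT x:Q|lebesgue. ?g x powr \<rho>)" .
      from divide_right_mono[OF this, of "measure lebesgue Q"]
      have "avg ?g Q \<le> e + e powr (1 - \<rho>) * avg (\<lambda>x. ?g x powr \<rho>) Q"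
        using mQ by (simp add: avg_def add_divide_distrib)
      also have "\<dots> \<le> e + e powr (1 - \<rho>) * e powr \<rho>" using Xe by (intro add_left_mono mult_left_mono) auto
      also have "\<dots> = 2 * C * a Q + d" using e by (simp add: e_def flip: powr_add)
      finally show "avg ?g Q \<le> 2 * C * a Q + d" .
    qed
  qed
  show N0: "0 \<le> osc_norm 1 a b" unfolding osc_norm_def
  proof (rule cInf_greatest)
    show "?S \<noteq> {}" using ne by blast
  qed simp
  show "osc_bound 1 a b (osc_norm 1 a b)"
    unfolding iff
  proof
    fix Q :: "(real ^ 'n) set" assume Q: "Q \<in> cubes"
    have S: "avg (\<lambda>x. \<bar>b x - avg b Q\<bar>) Q \<le> C' * a Q" if "C' \<in> ?S" for C' using that Q by (simp add: iff)
    show "avg (\<lambda>x. \<bar>b x - avg b Q\<bar>) Q \<le> osc_norm 1 a b * a Q"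
    proof (cases "a Q = 0")
      case True then show ?thesis using S[OF ne] by simp
    next
      case False
      then have aQ: "0 < a Q" using a0[OF Q] by simp
      have "avg (\<lambda>x. \<bar>b x - avg b Q\<bar>) Q / a Q \<le> osc_norm 1 a b" unfolding osc_norm_def
      proof (rule cInf_greatest)
        show "?S \<noteq> {}" using ne by blast
        fix C' assume "C' \<in> ?S"
        from S[OF this] show "avg (\<lambda>x. \<bar>b x - avg b Q\<bar>) Q / a Q \<le> C'" using aQ by (simp add: divide_le_eq)
      qed
      then show ?thesis using aQ by (simp add: divide_le_eq)
    qed
  qed
qed

lemma limit_exponent_mono:
  fixes \<alpha>p \<alpha>q :: "real ^ 'n \<Rightarrow> real"
  assumes P: "lh_exp \<alpha>p cp lop hip \<beta>p" and Q: "lh_exp \<alpha>q cq loq hiq \<beta>q" and le: "\<And>x. \<alpha>q x \<le> \<alpha>p x"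
  shows "\<beta>q \<le> \<beta>p"
proof (rule ccontr)
  interpret P: lh_exp \<alpha>p cp lop hip \<beta>p by fact
  interpret Q: lh_exp \<alpha>q cq loq hiq \<beta>q by fact
  assume "\<not> \<beta>q \<le> \<beta>p"
  then have e: "0 < \<beta>q - \<beta>p" by simp
  define T where "T = (cp + cq) / (\<beta>q - \<beta>p) + 1"
  have T: "0 < T" using e P.c Q.c by (simp add: T_def add_nonneg_pos)
  obtain x :: "real ^ 'n" where x: "norm x = exp T" using vector_choose_size[of "exp T"] by auto
  have "exp T \<le> exp 1 + norm x" using x by simp
  then have ln: "T \<le> ln (exp 1 + norm x)" by (metis exp_gt_zero exp_ln ln_exp ln_mono order_less_le_trans)
  have "\<bar>\<alpha>p x - \<beta>p\<bar> \<le> cp / ln (exp 1 + norm x)" "\<bar>\<alpha>q x - \<beta>q\<bar> \<le> cq / ln (exp 1 + norm x)" by (rule P.inf Q.inf)+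
  then have "\<beta>q - \<beta>p \<le> cp / ln (exp 1 + norm x) + cq / ln (exp 1 + norm x)" using le[of x] by linarith
  also have "\<dots> = (cp + cq) / ln (exp 1 + norm x)" by (simp add: add_divide_distrib)
  also have "\<dots> \<le> (cp + cq) / T" using ln T P.c Q.c by (intro divide_left_mono) auto
  also have "\<dots> < \<beta>q - \<beta>p"
  proof -
    define d where "d = \<beta>q - \<beta>p"
    have "cp + cq < d * T" using e unfolding T_def d_def[symmetric] by (simp add: field_simps)
    then have "cp + cq < (\<beta>q - \<beta>p) * T" unfolding d_def .
    then show ?thesis using T by (simp add: divide_less_eq mult.commute)
  qed
  finally show False by simp
qed

lemma conj_exp_reciprocal:
  assumes "p x = ennreal (1 / \<alpha>)" "0 < \<alpha>" "\<alpha> < 1"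
  shows "conj_exp p x = ennreal (1 / (1 - \<alpha>))"
proof -
  have "p x - 1 = ennreal (1 / \<alpha> - 1)" using assms ennreal_minus[of 1 "1 / \<alpha>"] by simp
  moreover have "0 < 1 / \<alpha> - 1" using assms by (simp add: less_divide_eq)
  ultimately have "conj_exp p x = ennreal ((1 / \<alpha>) / (1 / \<alpha> - 1))"
    using assms by (simp add: conj_exp_def divide_ennreal)
  also have "(1 / \<alpha>) / (1 / \<alpha> - 1) = 1 / (1 - \<alpha>)" using assms by (simp add: field_simps)
  finally show ?thesis .
qed

lemma ennreal_ratio_less:
  assumes "ennreal x / ennreal y < ennreal z" "0 \<le> x" "0 < y"
  shows "x < z * y" "0 < z"
proof -
  have "ennreal (x / y) < ennreal z" using assms by (simp add: divide_ennreal)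
  then have "x / y < z" using assms by (simp add: ennreal_less_iff)
  moreover have "0 \<le> x / y" using assms by simp
  ultimately show "x < z * y" "0 < z" using assms by (simp add: divide_less_eq, linarith)
qed

text \<open>
  The bounds on the reciprocals are \<open>lop = 1 - 1 / (p')\<^sup>-\<close>, \<open>hip =
  1 - 1 / (p')\<^sup>+\<close>, \<open>loq = 1 / q\<^sup>+\<close> and \<open>hiq = 1 /
  q\<^sup>-\<close>. Any \<open>r\<close> between \<open>(p')\<^sup>+\<close> and \<open>R *
  (p')\<^sup>-\<close>, and any \<open>t\<close> between \<open>q\<^sup>+\<close> and
  \<open>S * q\<^sup>-\<close>, will do. Then \<open>1 / r + hip < 1\<close> and \<open>1 /
  t + (1 - loq) < 1\<close>, which leaves room for \<open>1 / \<theta>\<close> above both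
  sums and below \<open>1\<close>; this in turn determines \<open>s\<close> and
  \<open>\<sigma>\<close>.
\<close>

lemma exponent_parameters:
  fixes p q :: "real ^ 'n \<Rightarrow> ennreal"
  assumes p: "p \<in> log_exponents" and q: "q \<in> log_exponents" and p1: "1 < exp_inf p" and pq: "\<forall>x. p x \<le> q x" and q1: "exp_sup q < \<infinity>"
    and R: "ennreal R > exp_sup (conj_exp p) / exp_inf (conj_exp p)" and S: "ennreal S > exp_sup q / exp_inf q"
  obtains cp cq lop hip loq hiq \<beta>p \<beta>q r t s \<sigma> \<theta> where
    "lh_exp (rexp p) cp lop hip \<beta>p" "lh_exp (rexp q) cq loq hiq \<beta>q" "\<And>x. p x = ennreal (1 / rexp p x)" "\<And>x. q x = ennreal (1 / rexp q x)"
    "hip < 1" "hiq < 1" "\<And>x. rexp q x \<le> rexp p x" "\<beta>q \<le> \<beta>p" "0 < R" "0 < S" "r * (1 - lop) < R" "t * hiq < S"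
    "1 < \<theta>" "\<theta> < r" "\<theta> < s" "1 / \<theta> = 1 / r + 1 / s" "\<theta> < t" "\<theta> < \<sigma>" "1 / \<theta> = 1 / t + 1 / \<sigma>" "s * hip < 1" "\<sigma> * (1 - loq) < 1"
proof -
  have px: "exp_inf p \<le> p x" "q x \<le> exp_sup q" "exp_inf q \<le> q x" "exp_inf (conj_exp p) \<le> conj_exp p x" "conj_exp p x \<le> exp_sup (conj_exp p)" for x
    unfolding exp_inf_def exp_sup_def by (auto intro: INF_lower SUP_upper)
  have piq: "exp_inf p \<le> exp_inf q" unfolding exp_inf_def using pq by (intro INF_mono) auto
  have fin: "exp_inf q < \<infinity>" "exp_inf p < \<infinity>" using q1 px[of 0] piq by (auto intro: le_less_trans)
  define pi' where "pi' = enn2real (exp_inf p)"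
  define Qs where "Qs = enn2real (exp_sup q)"
  define Qi where "Qi = enn2real (exp_inf q)"
  have E: "exp_inf p = ennreal pi'" "exp_sup q = ennreal Qs" "exp_inf q = ennreal Qi" using fin q1 by (simp_all add: pi'_def Qs_def Qi_def)
  have "ennreal 1 < ennreal pi'" using p1 unfolding E by simp
  then have pi1: "1 < pi'" by (subst (asm) ennreal_less_iff) auto
  have Qi1: "1 < Qi" using piq pi1 unfolding E by (simp add: ennreal_le_iff2)
  have "exp_inf q \<le> exp_sup q" using px(3)[of 0] px(2)[of 0] by (rule order_trans)
  then have Qs1: "Qi \<le> Qs" "1 < Qs" using Qi1 unfolding E by (auto simp: ennreal_le_iff2)
  have pB: "p x \<le> ennreal Qs" for x using pq px(2)[of x] unfolding E by (meson order_trans)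
  obtain c0 \<beta>0 where P0: "lh_exp (rexp p) c0 (1 / Qs) (1 / pi') \<beta>0" and pr: "\<And>x. p x = ennreal (1 / rexp p x)"
    using lh_exp_of_log_exponents[OF p less_imp_le[OF Qs1(2)] pB less_imp_le[OF pi1]] px(1) unfolding E by metis
  obtain cq \<beta>q where Q: "lh_exp (rexp q) cq (1 / Qs) (1 / Qi) \<beta>q" and qr: "\<And>x. q x = ennreal (1 / rexp q x)"
    using lh_exp_of_log_exponents[OF q less_imp_le[OF Qs1(2)] _ less_imp_le[OF Qi1]] px(2,3) unfolding E by metis
  interpret P0: lh_exp "rexp p" c0 "1 / Qs" "1 / pi'" \<beta>0 by fact
  interpret Q: lh_exp "rexp q" cq "1 / Qs" "1 / Qi" \<beta>q by fact
  have pi_lt: "1 / pi' < 1" and Qi_lt: "1 / Qi < 1" and Qs_lt: "1 / Qs < 1" using pi1 Qi1 Qs1 by simp_all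
  have rp1: "rexp p x < 1" for x using P0.bounds(2)[of x] pi_lt by linarith
  have cj: "conj_exp p x = ennreal (1 / (1 - rexp p x))" for x by (rule conj_exp_reciprocal[OF pr P0.alpha_pos rp1])
  have cb: "1 / (1 - 1 / Qs) \<le> 1 / (1 - rexp p x)" "1 / (1 - rexp p x) \<le> 1 / (1 - 1 / pi')" for x
    using P0.bounds[of x] pi_lt rp1[of x] Qs_lt by (auto intro!: frac_le)
  have "exp_sup (conj_exp p) \<le> ennreal (1 / (1 - 1 / pi'))" unfolding exp_sup_def cj using cb by (intro SUP_least ennreal_leI)
  then have f1: "exp_sup (conj_exp p) < \<infinity>" by (auto intro: le_less_trans)
  have f0: "exp_inf (conj_exp p) < \<infinity>" using px(4,5)[of 0] f1 by (auto intro: le_less_trans)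
  define P1 where "P1 = enn2real (exp_sup (conj_exp p))"
  define Pz where "Pz = enn2real (exp_inf (conj_exp p))"
  have E2: "exp_sup (conj_exp p) = ennreal P1" "exp_inf (conj_exp p) = ennreal Pz" using f0 f1 by (simp_all add: P1_def Pz_def)
  have "ennreal (1 / (1 - 1 / Qs)) \<le> exp_inf (conj_exp p)" unfolding exp_inf_def cj using cb by (intro INF_greatest ennreal_leI)
  then have "1 / (1 - 1 / Qs) \<le> Pz" unfolding E2 using Qs_lt by (simp add: ennreal_le_iff2)
  moreover have "1 < 1 / (1 - 1 / Qs)" using Qs_lt Qs1 by (simp add: less_divide_eq)
  ultimately have Pz1: "1 < Pz" by linarith
  have bd: "Pz \<le> 1 / (1 - rexp p x)" "1 / (1 - rexp p x) \<le> P1" for x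
  proof -
    have n: "0 \<le> 1 / (1 - rexp p x)" using rp1[of x] by simp
    have "ennreal Pz \<le> ennreal (1 / (1 - rexp p x))" "ennreal (1 / (1 - rexp p x)) \<le> ennreal P1" using px(4,5)[of x] unfolding E2 cj .
    moreover have "0 \<le> P1" by (simp add: P1_def)
    ultimately show "Pz \<le> 1 / (1 - rexp p x)" "1 / (1 - rexp p x) \<le> P1" using n by (simp_all only: ennreal_le_iff)
  qed
  have P11: "1 < P1" "Pz \<le> P1" using bd[of 0] Pz1 by linarith+
  have hp: "1 - 1 / Pz \<le> rexp p x" "rexp p x \<le> 1 - 1 / P1" for x
  proof -
    have y: "0 < 1 - rexp p x" using rp1[of x] by simp
    have "Pz * (1 - rexp p x) \<le> 1" using bd(1)[of x] y by (simp add: le_divide_eq)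
    then have "1 - rexp p x \<le> 1 / Pz" using Pz1 by (simp add: le_divide_eq mult.commute)
    then show "1 - 1 / Pz \<le> rexp p x" by linarith
    have "1 \<le> P1 * (1 - rexp p x)" using bd(2)[of x] y by (simp add: divide_le_eq)
    then have "1 / P1 \<le> 1 - rexp p x" using P11 by (simp add: divide_le_eq mult.commute)
    then show "rexp p x \<le> 1 - 1 / P1" by linarith
  qed
  define lop where "lop = 1 - 1 / Pz"
  define hip where "hip = 1 - 1 / P1"
  have lh: "0 < lop" "lop < 1" "0 < hip" "hip < 1" using Pz1 P11 by (simp_all add: lop_def hip_def)
  have ge1: "1 \<le> 1 / lop" "1 \<le> 1 / hip" using lh by (simp_all add: le_divide_eq)
  have u1: "p x \<le> ennreal (1 / lop)" for x unfolding pr[of x]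
    using hp(1)[of x] lh by (intro ennreal_leI frac_le) (auto simp: lop_def)
  have u2: "ennreal (1 / hip) \<le> p x" for x unfolding pr[of x]
    using hp(2)[of x] lh P0.alpha_pos[of x] by (intro ennreal_leI frac_le) (auto simp: hip_def)
  obtain cp \<beta>p where P: "lh_exp (rexp p) cp (1 / (1 / lop)) (1 / (1 / hip)) \<beta>p"
    using lh_exp_of_log_exponents[OF p ge1(1) u1 ge1(2) u2] by metis
  then have P: "lh_exp (rexp p) cp lop hip \<beta>p" by simp
  have le: "rexp q x \<le> rexp p x" for x
  proof -
    have "1 / rexp p x \<le> 1 / rexp q x" using pq[rule_format, of x] unfolding pr[of x] qr[of x] using P0.alpha_pos[of x] Q.alpha_pos[of x] by (simp add: ennreal_le_iff)
    then show ?thesis using P0.alpha_pos[of x] Q.alpha_pos[of x] by (simp add: field_simps)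
  qed
  have RP: "P1 < R * Pz" "0 < R" using ennreal_ratio_less[OF R[unfolded E2]] P11 Pz1 by auto
  have SQ: "Qs < S * Qi" "0 < S" using ennreal_ratio_less[OF S[unfolded E]] Qs1 Qi1 by auto
  obtain r where r: "P1 < r" "r < R * Pz" using dense[OF RP(1)] by blast
  obtain t where t: "Qs < t" "t < S * Qi" using dense[OF SQ(1)] by blast
  have r': "1 / r + hip < 1" using r P11 by (simp add: hip_def frac_less2)
  have t': "1 / t + (1 - 1 / Qs) < 1" using t Qs1 by (simp add: frac_less2)
  obtain i where i: "1 / r + hip < i" "1 / t + (1 - 1 / Qs) < i" "i < 1"
    using dense[of "max (1 / r + hip) (1 / t + (1 - 1 / Qs))" 1] r' t' by auto
  have pos: "0 < 1 / r" "0 < 1 / t" using r t P11 Qs1 by simp_all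
  have i0: "0 < i" "hip < i - 1 / r" "1 - 1 / Qs < i - 1 / t" using i pos lh by linarith+
  have ir: "0 < i - 1 / r" "0 < i - 1 / t" using i0 lh Qs_lt by linarith+
  define \<theta> where "\<theta> = 1 / i"
  define s where "s = 1 / (i - 1 / r)"
  define \<sigma> where "\<sigma> = 1 / (i - 1 / t)"
  have inv: "1 / \<theta> = i" "1 / s = i - 1 / r" "1 / \<sigma> = i - 1 / t" by (simp_all add: \<theta>_def s_def \<sigma>_def)
  have sp: "0 < \<theta>" "0 < s" "0 < \<sigma>" "0 < r" "0 < t" using i0 ir r t P11 Qs1 by (simp_all add: \<theta>_def s_def \<sigma>_def)
  have cmp: "x < y" if "1 / y < 1 / x" "0 < x" "0 < y" for x y :: real using that by (simp add: field_simps)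
  show thesis
  proof (rule that[OF P Q pr qr lh(4) Qi_lt le limit_exponent_mono[OF P Q le] RP(2) SQ(2)])
    show "r * (1 - lop) < R" using r Pz1 by (simp add: lop_def divide_less_eq)
    show "t * (1 / Qi) < S" using t Qi1 by (simp add: divide_less_eq)
    show "1 < \<theta>" using i i0 by (simp add: \<theta>_def)
    show "\<theta> < r" by (rule cmp) (use sp inv ir in auto)
    show "\<theta> < s" by (rule cmp) (use sp inv pos in auto)
    show "\<theta> < t" by (rule cmp) (use sp inv ir in auto)
    show "\<theta> < \<sigma>" by (rule cmp) (use sp inv pos in auto)
    show "1 / \<theta> = 1 / r + 1 / s" "1 / \<theta> = 1 / t + 1 / \<sigma>" using inv by auto
    show "s * hip < 1" using i0 ir by (simp add: s_def divide_less_eq)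
    show "\<sigma> * (1 - 1 / Qs) < 1" using i0 ir by (simp add: \<sigma>_def divide_less_eq)
  qed
qed

text \<open>
  The numbers \<open>e > l0\<close> stand for the admissible constants in the Luxemburg norm
  of \<open>f\<close>, whose infimum \<open>l0\<close> may vanish, as may \<open>D\<close>.
  Both are therefore enlarged slightly, and a passage to the limit gives the claim.
\<close>

lemma (in lh_exp) commutator_norm_le:
  fixes f w b K :: "real ^ 'n \<Rightarrow> real" and D l0 :: real
  assumes hi1: "hi < 1" and bm: "b \<in> borel_measurable lebesgue" and Km: "K \<in> borel_measurable lebesgue" and fm: "f \<in> borel_measurable lebesgue"
    and wm[measurable]: "w \<in> borel_measurable lebesgue" and wpos: "AE x in lebesgue. 0 < w x" and D: "0 \<le> D" and l0: "0 \<le> l0"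
    and dual: "\<And>e g. l0 < e \<Longrightarrow> g \<in> borel_measurable lebesgue \<Longrightarrow> (\<And>x. 0 \<le> g x) \<Longrightarrow>
      (\<integral>\<^sup>+x. ennreal (g x powr (1 / (1 - \<alpha> x))) \<partial>lebesgue) \<le> 1 \<Longrightarrow>
      (\<integral>\<^sup>+x. ennreal \<bar>w x\<bar> * (\<integral>\<^sup>+y. ennreal \<bar>comm_integrand K b m (\<lambda>y. \<bar>f y\<bar> / e) x y\<bar> \<partial>lebesgue) * ennreal (g x) \<partial>lebesgue) \<le> ennreal D"
  shows "AE x in lebesgue. integrable lebesgue (comm_integrand K b m f x)"
    "nrm (\<lambda>x. commutator K b m f x * w x) \<le> ennreal (D * l0)"
proof -
  have cm: "comm_integrand K b m f x \<in> borel_measurable lebesgue" for x by (rule comm_integrand_measurable[OF bm Km fm])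
  have main: "(AE x in lebesgue. integrable lebesgue (comm_integrand K b m f x)) \<and> nrm (\<lambda>x. commutator K b m f x * w x) \<le> ennreal (D' * e)"
    if e: "l0 < e" and D': "D < D'" for e D'
  proof -
    have e0: "0 < e" and D0: "0 < D'" using e D' l0 D by linarith+
    let ?f = "\<lambda>y. \<bar>f y\<bar> / e"
    have fm': "?f \<in> borel_measurable lebesgue" using fm by measurable
    define T where "T x = (\<integral>\<^sup>+y. ennreal \<bar>comm_integrand K b m ?f x y\<bar> \<partial>lebesgue)" for x
    have [measurable]: "T \<in> borel_measurable lebesgue" unfolding T_def by (rule abs_commutator_measurable[OF bm Km fm'])
    define F where "F x = ennreal \<bar>w x\<bar> * T x" for x
    have Fm: "F \<in> borel_measurable lebesgue" unfolding F_def by measurable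
    have dd: "(\<integral>\<^sup>+x. F x * ennreal (g x) \<partial>lebesgue) \<le> ennreal D'"
      if "g \<in> borel_measurable lebesgue" "\<And>x. 0 \<le> g x" "(\<integral>\<^sup>+x. ennreal (g x powr (1 / (1 - \<alpha> x))) \<partial>lebesgue) \<le> 1" for g
    proof -
      have "(\<integral>\<^sup>+x. F x * ennreal (g x) \<partial>lebesgue) \<le> ennreal D" unfolding F_def T_def using dual[OF e that] .
      also have "\<dots> \<le> ennreal D'" using D' by (intro ennreal_leI) simp
      finally show ?thesis .
    qed
    have dual': "AE x in lebesgue. F x < \<infinity>" "(\<integral>\<^sup>+x. ennreal ((enn2real (F x) / D') powr (1 / \<alpha> x)) \<partial>lebesgue) \<le> 1"
      by (rule modular_by_duality[OF hi1 Fm D0]; rule dd; assumption)+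
    have good: "AE x in lebesgue. integrable lebesgue (comm_integrand K b m f x) \<and> \<bar>commutator K b m f x * w x\<bar> \<le> e * enn2real (F x)"
      using dual'(1) wpos
    proof eventually_elim
      fix x assume x: "F x < \<infinity>" "0 < w x"
      have "T x \<noteq> \<infinity>"
      proof
        assume "T x = \<infinity>"
        then have "F x = \<infinity>" using x(2) by (simp add: F_def ennreal_mult_top)
        then show False using x(1) by simp
      qed
      then have Tf: "T x < \<infinity>" by (simp add: less_top)
      have eq: "(\<integral>\<^sup>+y. ennreal (norm (comm_integrand K b m f x y)) \<partial>lebesgue) = ennreal e * T x"
      proof -
        have m1: "(\<lambda>y. ennreal \<bar>comm_integrand K b m ?f x y\<bar>) \<in> borel_measurable lebesgue"
          using comm_integrand_measurable[OF bm Km fm', of m x] by measurable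
        have "(\<integral>\<^sup>+y. ennreal (norm (comm_integrand K b m f x y)) \<partial>lebesgue) = (\<integral>\<^sup>+y. ennreal e * ennreal \<bar>comm_integrand K b m ?f x y\<bar> \<partial>lebesgue)"
        proof (rule nn_integral_cong)
          fix y
          have "norm (comm_integrand K b m f x y) = e * \<bar>comm_integrand K b m ?f x y\<bar>"
            using e0 by (simp add: comm_integrand_def abs_mult power_abs)
          then show "ennreal (norm (comm_integrand K b m f x y)) = ennreal e * ennreal \<bar>comm_integrand K b m ?f x y\<bar>"
            using e0 by (simp only: ennreal_mult' less_imp_le)
        qed
        also have "\<dots> = ennreal e * T x" unfolding T_def by (rule nn_integral_cmult[OF m1])
        finally show ?thesis .
      qed
      have int: "integrable lebesgue (comm_integrand K b m f x)"
        by (rule integrableI_bounded[OF cm]) (unfold eq, use Tf in \<open>simp add: ennreal_mult_less_top\<close>)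
      have "ennreal \<bar>commutator K b m f x\<bar> \<le> ennreal e * T x"
        using integral_norm_bound_ennreal[OF int] unfolding eq by (simp add: commutator_def)
      then have "ennreal \<bar>commutator K b m f x\<bar> * ennreal \<bar>w x\<bar> \<le> (ennreal e * T x) * ennreal \<bar>w x\<bar>" by (rule mult_right_mono) simp
      also have "\<dots> = ennreal e * F x" by (simp add: F_def mult_ac)
      also have "\<dots> = ennreal e * ennreal (enn2real (F x))" using x(1) by (simp add: ennreal_enn2real)
      also have "\<dots> = ennreal (e * enn2real (F x))" using e0 by (simp add: ennreal_mult')
      finally have "ennreal \<bar>commutator K b m f x * w x\<bar> \<le> ennreal (e * enn2real (F x))" by (simp add: abs_mult ennreal_mult')
      then have "\<bar>commutator K b m f x * w x\<bar> \<le> e * enn2real (F x)" using e0 by (subst (asm) ennreal_le_iff) auto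
      then show "integrable lebesgue (comm_integrand K b m f x) \<and> \<bar>commutator K b m f x * w x\<bar> \<le> e * enn2real (F x)" using int by blast
    qed
    have "(\<integral>\<^sup>+x. ennreal ((\<bar>commutator K b m f x * w x\<bar> / (D' * e)) powr (1 / \<alpha> x)) \<partial>lebesgue) \<le> (\<integral>\<^sup>+x. ennreal ((enn2real (F x) / D') powr (1 / \<alpha> x)) \<partial>lebesgue)"
    proof (rule nn_integral_mono_AE)
      show "AE x in lebesgue. ennreal ((\<bar>commutator K b m f x * w x\<bar> / (D' * e)) powr (1 / \<alpha> x)) \<le> ennreal ((enn2real (F x) / D') powr (1 / \<alpha> x))"
        using good
      proof eventually_elim
        fix x assume "integrable lebesgue (comm_integrand K b m f x) \<and> \<bar>commutator K b m f x * w x\<bar> \<le> e * enn2real (F x)"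
        then have "\<bar>commutator K b m f x * w x\<bar> / (D' * e) \<le> (e * enn2real (F x)) / (D' * e)" using e0 D0 by (intro divide_right_mono) auto
        also have "\<dots> = enn2real (F x) / D'" using e0 by simp
        finally show "ennreal ((\<bar>commutator K b m f x * w x\<bar> / (D' * e)) powr (1 / \<alpha> x)) \<le> ennreal ((enn2real (F x) / D') powr (1 / \<alpha> x))"
          using e0 D0 alpha_pos[of x] by (intro ennreal_leI powr_mono2) auto
      qed
    qed
    also have "\<dots> \<le> 1" by (rule dual'(2))
    finally have "nrm (\<lambda>x. commutator K b m f x * w x) \<le> ennreal (D' * e)" by (rule nrm_leI[rotated]) (use e0 D0 in simp)
    then show ?thesis using good by (auto elim: eventually_mono)
  qed
  show "AE x in lebesgue. integrable lebesgue (comm_integrand K b m f x)" using main[of "l0 + 1" "D + 1"] by simp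
  have lim: "((\<lambda>e. ennreal ((D + e) * (l0 + e))) \<longlongrightarrow> ennreal ((D + 0) * (l0 + 0))) (at_right 0)"
    by (intro tendsto_ennrealI tendsto_intros)
  have "nrm (\<lambda>x. commutator K b m f x * w x) \<le> ennreal ((D + 0) * (l0 + 0))"
    by (rule tendsto_lowerbound[OF lim]) (auto intro!: eventually_at_rightI[of 0 1] simp: main)
  then show "nrm (\<lambda>x. commutator K b m f x * w x) \<le> ennreal (D * l0)" by simp
qed

lemma lux_norm_abs:
  "lux_norm p (\<lambda>x. indicator A x * \<bar>g x\<bar>) = lux_norm p (\<lambda>x. indicator A x * g x)"
  by (simp add: lux_norm_def abs_mult)

lemma effective_exists:
  assumes "1 \<le> L" "0 < l"
  obtains A where "effective \<alpha> \<beta> L z l A"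
proof (cases "l \<le> L")
  case True
  have "z \<in> cube z l" using assms by (simp add: cube_def mem_box_cart)
  then show ?thesis using True assms that by (auto simp: effective_def)
next
  case False then show ?thesis using assms that[of \<beta>] by (simp add: effective_def)
qed

theorem theorem1p1:
  fixes p q :: "real ^ 'n \<Rightarrow> ennreal" and K :: "real ^ 'n \<Rightarrow> real"
    and a :: "(real ^ 'n) set \<Rightarrow> real" and \<rho> R S :: real and m :: nat
  assumes "p \<in> log_exponents" and "q \<in> log_exponents"
    and "1 < exp_inf p" and "\<forall>x. p x \<le> q x" and "exp_sup q < \<infinity>"
    and "K \<in> kernel_class"
    and "1 \<le> \<rho>" and "a \<in> T_infty"
    and "ennreal R > exp_sup (conj_exp p) / exp_inf (conj_exp p)"
    and "ennreal S > exp_sup q / exp_inf q"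
  shows "\<exists>C>0. \<forall>b v w. \<forall>\<kappa>>0.
    b \<in> L_osc \<rho> a \<longrightarrow> weight v \<longrightarrow> weight w \<longrightarrow>
    v \<in> Lvar_loc p \<longrightarrow> w \<in> Lvar_loc (\<lambda>x. ennreal S * q x) \<longrightarrow>
    (\<forall>z l. 0 < l \<longrightarrow> (let Q = cube z l; Rp' = (\<lambda>x. ennreal R * conj_exp p x);
                            Sq = (\<lambda>x. ennreal S * q x) in
      ennreal (a Q ^ m) * ennreal (Ktilde K l) *
      (lux_norm q (indicator Q) / lux_norm p (indicator Q)) *
      (lux_norm Rp' (\<lambda>x. indicator Q x * inverse (v x)) / lux_norm Rp' (indicator Q)) *
      (lux_norm Sq (\<lambda>x. indicator Q x * w x) / lux_norm Sq (indicator Q)) \<le> ennreal \<kappa>)) \<longrightarrow>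
    (\<forall>f \<in> Lvar_weighted p v.
      (AE x in lebesgue. integrable lebesgue (comm_integrand K b m f x)) \<and>
      commutator K b m f \<in> Lvar_weighted q w \<and>
      wnorm q w (commutator K b m f) \<le> ennreal (C * \<kappa> * osc_norm 1 a b ^ m) * wnorm p v f)"
proof -
  obtain cp cq lop hip loq hiq \<beta>p \<beta>q r t s \<sigma> \<theta> where
    P: "lh_exp (rexp p) cp lop hip \<beta>p" and Q: "lh_exp (rexp q) cq loq hiq \<beta>q"
    and pr: "\<And>x. p x = ennreal (1 / rexp p x)" and qr: "\<And>x. q x = ennreal (1 / rexp q x)"
    and hip: "hip < 1" and hiq: "hiq < 1" and pq: "\<And>x. rexp q x \<le> rexp p x" "\<beta>q \<le> \<beta>p"
    and RS: "0 < R" "0 < S" and rt: "r * (1 - lop) < R" "t * hiq < S"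
    and \<theta>: "1 < \<theta>" "\<theta> < r" "\<theta> < s" "1 / \<theta> = 1 / r + 1 / s" "\<theta> < t" "\<theta> < \<sigma>" "1 / \<theta> = 1 / t + 1 / \<sigma>"
    and s: "s * hip < 1" "\<sigma> * (1 - loq) < 1"
    by (rule exponent_parameters[OF assms(1-5,9,10)]) blast
  have rt0: "0 < r" "0 < t" using \<theta> by linarith+
  interpret P: lh_exp "rexp p" cp lop hip \<beta>p by fact
  interpret Q: lh_exp "rexp q" cq loq hiq \<beta>q by fact
  interpret QS: lh_exp "\<lambda>x. rexp q x / S" "cq / S" "loq / S" "hiq / S" "\<beta>q / S"
    by (rule Q.scaled_exponent[OF RS(2)])
  have pE: "p = (\<lambda>x. ennreal (1 / rexp p x))" and qE: "q = (\<lambda>x. ennreal (1 / rexp q x))" using pr qr by auto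
  have rp1: "rexp p x < 1" for x using P.bounds(2)[of x] hip by linarith
  have RpE: "(\<lambda>x. ennreal R * conj_exp p x) = (\<lambda>x. ennreal (1 / ((1 - rexp p x) / R)))"
  proof
    fix x
    have "ennreal R * ennreal (1 / (1 - rexp p x)) = ennreal (R * (1 / (1 - rexp p x)))" using RS by (simp only: ennreal_mult' less_imp_le)
    then show "ennreal R * conj_exp p x = ennreal (1 / ((1 - rexp p x) / R))"
      unfolding conj_exp_reciprocal[OF pr P.alpha_pos rp1] by simp
  qed
  have SqE: "(\<lambda>x. ennreal S * q x) = (\<lambda>x. ennreal (1 / (rexp q x / S)))"
  proof
    fix x
    have "ennreal S * ennreal (1 / rexp q x) = ennreal (S * (1 / rexp q x))" using RS by (simp only: ennreal_mult' less_imp_le)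
    then show "ennreal S * q x = ennreal (1 / (rexp q x / S))" unfolding qr[of x] by simp
  qed
  obtain tt where tt: "0 < tt" "\<And>Q Q'. Q \<in> cubes \<Longrightarrow> Q' \<in> cubes \<Longrightarrow> Q' \<subseteq> Q \<Longrightarrow> a Q' \<le> tt * a Q" and a0: "\<And>Q. Q \<in> cubes \<Longrightarrow> 0 \<le> a Q"
    using assms(8) unfolding T_infty_def by auto
  have K0: "0 \<le> K x" for x using assms(6) by (simp add: kernel_class_def)
  have Km: "K \<in> borel_measurable lebesgue" using assms(6) by (intro locally_integrable_measurable) (simp add: kernel_class_def)
  obtain L C where L: "2 \<le> L" and C: "0 < C" and dual:
    "\<And>u w f h g \<kappa> a b N. \<lbrakk>
      u \<in> borel_measurable lebesgue; w \<in> borel_measurable lebesgue; f \<in> borel_measurable lebesgue; h \<in> borel_measurable lebesgue; g \<in> borel_measurable lebesgue;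
      \<And>x. 0 \<le> u x; \<And>x. 0 \<le> w x; \<And>x. 0 \<le> h x; \<And>x. 0 \<le> g x; \<And>x. 0 \<le> f x; AE x in lebesgue. f x = u x * h x;
      (\<integral>\<^sup>+y. ennreal (h y powr (1 / rexp p y)) \<partial>lebesgue) \<le> 1; (\<integral>\<^sup>+y. ennreal (g y powr (1 / (1 - rexp q y))) \<partial>lebesgue) \<le> 1;
      \<And>z l. 0 < l \<Longrightarrow> (\<integral>\<^sup>+y\<in>cube z l. ennreal (w y powr t) \<partial>lebesgue) < \<infinity>;
      locally_integrable b; osc_bound 1 a b N; 0 \<le> N;
      \<And>Q Q'. Q \<in> cubes \<Longrightarrow> Q' \<in> cubes \<Longrightarrow> Q' \<subseteq> Q \<Longrightarrow> a Q' \<le> tt * a Q; \<And>Q. Q \<in> cubes \<Longrightarrow> 0 \<le> a Q; 0 \<le> \<kappa>;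
      \<And>z l Ap Aq. effective (rexp p) \<beta>p L z l Ap \<Longrightarrow> effective (rexp q) \<beta>q L z l Aq \<Longrightarrow> Aq \<le> Ap \<Longrightarrow> 0 < Ktilde K l * a (cube z l) ^ m \<Longrightarrow>
        mean_product_le r t u w z l (Ktilde K l * a (cube z l) ^ m * (l ^ CARD('n)) powr (Aq - Ap)) \<kappa>\<rbrakk> \<Longrightarrow>
     (\<integral>\<^sup>+x. ennreal (w x) * (\<integral>\<^sup>+y. ennreal \<bar>comm_integrand K b m f x y\<bar> \<partial>lebesgue) * ennreal (g x) \<partial>lebesgue) \<le> ennreal (C * \<kappa> * N ^ m)"
    by (rule commutator_dual_bound[OF P Q hip hiq pq assms(6) \<theta> s tt(1), where m = m]) blast
  have L1: "1 \<le> L" using L by simp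
  obtain Cw where Cw: "0 < Cw" "\<And>z l Ap Aq u w A0 \<kappa>.
    \<lbrakk>effective (rexp p) \<beta>p L z l Ap; effective (rexp q) \<beta>q L z l Aq; u \<in> borel_measurable lebesgue; w \<in> borel_measurable lebesgue;
     \<And>x. 0 \<le> u x; \<And>x. 0 \<le> w x; AE x in lebesgue. 0 < w x; 0 < A0; 0 \<le> \<kappa>;
     lux_norm (\<lambda>x. ennreal (1 / (rexp q x / S))) (\<lambda>x. indicator (cube z l) x * w x) < \<infinity>;
     ennreal A0 * (lux_norm (\<lambda>x. ennreal (1 / rexp q x)) (indicator (cube z l)) / lux_norm (\<lambda>x. ennreal (1 / rexp p x)) (indicator (cube z l))) *
     (lux_norm (\<lambda>x. ennreal (1 / ((1 - rexp p x) / R))) (\<lambda>x. indicator (cube z l) x * u x) / lux_norm (\<lambda>x. ennreal (1 / ((1 - rexp p x) / R))) (indicator (cube z l))) *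
     (lux_norm (\<lambda>x. ennreal (1 / (rexp q x / S))) (\<lambda>x. indicator (cube z l) x * w x) / lux_norm (\<lambda>x. ennreal (1 / (rexp q x / S))) (indicator (cube z l))) \<le> ennreal \<kappa>\<rbrakk> \<Longrightarrow>
    mean_product_le r t u w z l (A0 * (l ^ CARD('n)) powr (Aq - Ap)) (Cw * \<kappa>)"
    by (rule weight_condition[OF P Q hip L1 RS rt0(1) rt(1) rt0(2) rt(2)]) blast
  have bound: "(AE x in lebesgue. integrable lebesgue (comm_integrand K b m f x)) \<and>
      commutator K b m f \<in> Lvar_weighted q w \<and>
      wnorm q w (commutator K b m f) \<le> ennreal (C * Cw * \<kappa> * osc_norm 1 a b ^ m) * wnorm p v f"
    if \<kappa>: "0 < \<kappa>" and b: "b \<in> L_osc \<rho> a" and v: "weight v" and w: "weight w" and wloc: "w \<in> Lvar_loc (\<lambda>x. ennreal S * q x)"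
      and cond: "\<And>z l. 0 < l \<Longrightarrow> ennreal (a (cube z l) ^ m) * ennreal (Ktilde K l) *
      (lux_norm q (indicator (cube z l)) / lux_norm p (indicator (cube z l))) *
      (lux_norm (\<lambda>x. ennreal R * conj_exp p x) (\<lambda>x. indicator (cube z l) x * inverse (v x)) / lux_norm (\<lambda>x. ennreal R * conj_exp p x) (indicator (cube z l))) *
      (lux_norm (\<lambda>x. ennreal S * q x) (\<lambda>x. indicator (cube z l) x * w x) / lux_norm (\<lambda>x. ennreal S * q x) (indicator (cube z l))) \<le> ennreal \<kappa>"
      and f: "f \<in> Lvar_weighted p v" for b v w \<kappa> f
  proof -
    define N where "N = osc_norm 1 a b"
    have N: "osc_bound 1 a b N" "0 \<le> N" unfolding N_def using osc_bound_exponent_one[OF b assms(7)] a0 by blast+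
    have bl: "locally_integrable b" using b by (simp add: L_osc_def)
    have bm: "b \<in> borel_measurable lebesgue" by (rule locally_integrable_measurable[OF bl])
    have vm[measurable]: "v \<in> borel_measurable lebesgue" and wm[measurable]: "w \<in> borel_measurable lebesgue"
      using v w by (auto simp: weight_def intro: locally_integrable_measurable)
    have v0: "AE x in lebesgue. 0 < v x" and w0: "AE x in lebesgue. 0 < w x" using v w by (auto simp: weight_def)
    have fm[measurable]: "f \<in> borel_measurable lebesgue" and ffin: "wnorm p v f < \<infinity>"
      using f by (auto simp: Lvar_weighted_def Lvar_def wnorm_def)
    define l0 where "l0 = enn2real (wnorm p v f)"
    have l0: "0 \<le> l0" "wnorm p v f = ennreal l0" using ffin by (auto simp: l0_def)
    define u where "u x = \<bar>inverse (v x)\<bar>" for x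
    define w' where "w' x = \<bar>w x\<bar>" for x
    have um[measurable]: "u \<in> borel_measurable lebesgue" and w'm[measurable]: "w' \<in> borel_measurable lebesgue"
      unfolding u_def w'_def by measurable
    have u0: "0 \<le> u x" and w'0: "0 \<le> w' x" for x by (simp_all add: u_def w'_def)
    have w'pos: "AE x in lebesgue. 0 < w' x" using w0 by eventually_elim (simp add: w'_def)
    have wn: "lux_norm (\<lambda>x. ennreal (1 / (rexp q x / S))) (\<lambda>x. indicator (cube z l) x * w' x) < \<infinity>" for z l
    proof -
      have "(\<lambda>x. w x * indicator (cube z l) x) \<in> Lvar (\<lambda>x. ennreal S * q x)" using wloc compact_cube[of z l] by (simp add: Lvar_loc_def)
      then show ?thesis unfolding SqE w'_def lux_norm_abs by (simp add: Lvar_def mult.commute[of "w _"])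
    qed
    have wfin: "(\<integral>\<^sup>+y\<in>cube z l. ennreal (w' y powr t) \<partial>lebesgue) < \<infinity>" if l: "0 < l" for z l
    proof -
      have t1: "t * (hiq / S) < 1" using rt(2) RS by (simp add: divide_less_eq)
      obtain A where A: "effective (\<lambda>x. rexp q x / S) (\<beta>q / S) L z l A" by (rule effective_exists[OF L1 l])
      define N' where "N' = enn2real (QS.nrm (\<lambda>x. indicator (cube z l) x * w' x))"
      have N': "0 \<le> N'" "QS.nrm (\<lambda>x. indicator (cube z l) x * w' x) \<le> ennreal N'" using wn[of z l] by (auto simp: N'_def)
      obtain C5 where C5: "0 < C5"
        "\<And>z l A u N. \<lbrakk>effective (\<lambda>x. rexp q x / S) (\<beta>q / S) L z l A; u \<in> borel_measurable lebesgue; \<And>y. 0 \<le> u y; 0 \<le> N;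
         QS.nrm (\<lambda>x. indicator (cube z l) x * u x) \<le> ennreal N\<rbrakk> \<Longrightarrow>
         (\<integral>\<^sup>+y\<in>cube z l. ennreal (u y powr t) \<partial>lebesgue) \<le> ennreal ((C5 * N * (l ^ CARD('n)) powr (- A)) powr t * l ^ CARD('n))"
        by (rule QS.average_le_nrm[OF L1 rt0(2) t1]) blast
      from C5(2)[OF A w'm w'0 N'] show ?thesis by (rule le_less_trans) simp
    qed
    have \<kappa>0: "0 \<le> Cw * \<kappa>" using \<kappa> Cw(1) by simp
    have cond': "mean_product_le r t u w' z l (Ktilde K l * a (cube z l) ^ m * (l ^ CARD('n)) powr (Aq - Ap)) (Cw * \<kappa>)"
      if eff: "effective (rexp p) \<beta>p L z l Ap" "effective (rexp q) \<beta>q L z l Aq" and A0: "0 < Ktilde K l * a (cube z l) ^ m" for z l Ap Aq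
    proof (rule Cw(2)[OF eff um w'm u0 w'0 w'pos A0 less_imp_le[OF \<kappa>] wn])
      have l: "0 < l" using eff by (simp add: effective_def)
      have "ennreal (a (cube z l) ^ m) * ennreal (Ktilde K l) = ennreal (Ktilde K l * a (cube z l) ^ m)"
        using a0[OF cube_in_cubes[OF l, of z]] by (simp add: mult.commute[of "Ktilde K l"] ennreal_mult')
      from cond[OF l, of z, unfolded this, unfolded RpE SqE, folded pE qE]
      show "ennreal (Ktilde K l * a (cube z l) ^ m) * (lux_norm (\<lambda>x. ennreal (1 / rexp q x)) (indicator (cube z l)) / lux_norm (\<lambda>x. ennreal (1 / rexp p x)) (indicator (cube z l))) *
     (lux_norm (\<lambda>x. ennreal (1 / ((1 - rexp p x) / R))) (\<lambda>x. indicator (cube z l) x * u x) / lux_norm (\<lambda>x. ennreal (1 / ((1 - rexp p x) / R))) (indicator (cube z l))) *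
     (lux_norm (\<lambda>x. ennreal (1 / (rexp q x / S))) (\<lambda>x. indicator (cube z l) x * w' x) / lux_norm (\<lambda>x. ennreal (1 / (rexp q x / S))) (indicator (cube z l))) \<le> ennreal \<kappa>"
        unfolding u_def w'_def lux_norm_abs pE[symmetric] qE[symmetric] .
    qed
    define D where "D = C * (Cw * \<kappa>) * N ^ m"
    have D: "0 \<le> D" unfolding D_def using C \<kappa>0 N by simp
    have dual': "(\<integral>\<^sup>+x. ennreal \<bar>w x\<bar> * (\<integral>\<^sup>+y. ennreal \<bar>comm_integrand K b m (\<lambda>y. \<bar>f y\<bar> / e) x y\<bar> \<partial>lebesgue) * ennreal (g x) \<partial>lebesgue) \<le> ennreal D"
      if e: "l0 < e" and g: "g \<in> borel_measurable lebesgue" "\<And>x. 0 \<le> g x" "(\<integral>\<^sup>+x. ennreal (g x powr (1 / (1 - rexp q x))) \<partial>lebesgue) \<le> 1" for e g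
    proof -
      have e0: "0 < e" using e l0 by linarith
      define h where "h y = \<bar>f y * v y\<bar> / e" for y
      have hm: "h \<in> borel_measurable lebesgue" unfolding h_def by measurable
      have fm': "(\<lambda>y. \<bar>f y\<bar> / e) \<in> borel_measurable lebesgue" by measurable
      have h0: "0 \<le> h y" "0 \<le> \<bar>f y\<bar> / e" for y using e0 by (auto simp: h_def)
      have "P.nrm (\<lambda>y. f y * v y) < ennreal e" using l0(2) e l0(1) unfolding wnorm_def pE[symmetric] by (simp add: ennreal_less_iff)
      then have hmod: "(\<integral>\<^sup>+y. ennreal (h y powr (1 / rexp p y)) \<partial>lebesgue) \<le> 1" unfolding h_def by (rule P.nrm_lessD(2))
      have fuh: "AE y in lebesgue. \<bar>f y\<bar> / e = u y * h y"
        using v0 by eventually_elim (simp add: u_def h_def abs_mult)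
      show ?thesis unfolding w'_def[symmetric] D_def
        by (rule dual[OF um w'm fm' hm g(1) u0 w'0 h0(1) g(2) h0(2) fuh hmod g(3) wfin bl N tt(2) a0 \<kappa>0 cond'])
    qed
    have res: "AE x in lebesgue. integrable lebesgue (comm_integrand K b m f x)" "Q.nrm (\<lambda>x. commutator K b m f x * w x) \<le> ennreal (D * l0)"
      by (rule Q.commutator_norm_le[OF hiq bm Km fm wm w0 D l0(1)]; rule dual'; assumption)+
    have cm[measurable]: "commutator K b m f \<in> borel_measurable lebesgue" by (rule commutator_measurable[OF bm Km fm])
    have "wnorm q w (commutator K b m f) \<le> ennreal (D * l0)" using res(2) unfolding wnorm_def qE[symmetric] .
    also have "ennreal (D * l0) = ennreal (C * Cw * \<kappa> * osc_norm 1 a b ^ m) * wnorm p v f"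
      unfolding l0(2) using D l0(1) by (simp add: D_def N_def mult.assoc flip: ennreal_mult)
    finally have fin: "wnorm q w (commutator K b m f) \<le> ennreal (C * Cw * \<kappa> * osc_norm 1 a b ^ m) * wnorm p v f" .
    have "lux_norm q (\<lambda>x. commutator K b m f x * w x) < \<infinity>" using res(2) unfolding qE[symmetric] by (rule le_less_trans) simp
    then have "commutator K b m f \<in> Lvar_weighted q w" unfolding Lvar_weighted_def Lvar_def by simp
    with res(1) fin show ?thesis by blast
  qed
  have "0 < C * Cw" using C Cw(1) by simp
  then show ?thesis using bound unfolding Let_def by blast
qed

end
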